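(* Let $r>0$, let $W$ be a standard Wiener process, and let $\eta_{T,r}$ be the taut string accompanying $W$ in the strip of width $r$ on $[0,T]$. Then, almost surely, $$\lim_{T\to\infty}\frac1T\inf_h\int_0^T h'(t)^2\,dt=\lim_{T\to\infty}\frac1T\int_0^T\eta'_{T,r}(t)^2\,dt=\frac{\pi^2}{6r^2},$$ where the infimum is taken over all $h\in\mathrm{AC}[0,T]$ with $h(0)=0$, $h(T)=W_T$ and $\max_{t\in[0,T]}|h(t)-W_t|\le\frac r2$.
   Context: $\mathrm{AC}[0,T]$ is the class of absolutely continuous functions on $[0,T]$ and $\|g\|_T=\sup_{0\le t\le T}|g(t)|$. For $T>0$, $r>0$ the taut string $\eta_{T,r}$ accompanying $W$ in the strip of width $r$ on $[0,T]$ is the (random) function that is the unique minimizer of $\int_0^T\varphi(h'(t))\,dt$ over all $h\in\mathrm{AC}[0,T]$ with $h(0)=0$, $h(T)=W_T$, $\|h-W\|_T\le \frac r2$, for a strictly convex $\varphi$, e.g. $\varphi(u)=u^2$. It is a known fact that the same function $\eta_{T,r}$ is a minimizer for every convex $\varphi:\mathbb{R}\to\mathbb{R}$ (and the unique one when $\varphi$ is strictly convex). *)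

theory Defs
  imports "HOL-Probability.Probability"
begin

text \<open>Only the values of \<open>W\<close> at times \<open>t \<ge> 0\<close> matter.\<close>

locale wiener_process = prob_space M
  for M :: "'a measure" and W :: "real \<Rightarrow> 'a \<Rightarrow> real" +
  assumes W_measurable: "\<And>t. 0 \<le> t \<Longrightarrow> W t \<in> borel_measurable M"
    and W_start: "AE \<omega> in M. W 0 \<omega> = 0"
    and W_increment: "\<And>s t. 0 \<le> s \<Longrightarrow> s < t \<Longrightarrow>
      distributed M lborel (\<lambda>\<omega>. W t \<omega> - W s \<omega>) (\<lambda>x. ennreal (normal_density 0 (sqrt (t - s)) x))"
    and W_indep: "\<And>(n::nat) \<tau>. 0 \<le> \<tau> 0 \<Longrightarrow> (\<forall>i<n. \<tau> i < \<tau> (Suc i)) \<Longrightarrow>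
      indep_vars (\<lambda>_. borel) (\<lambda>i \<omega>. W (\<tau> (Suc i)) \<omega> - W (\<tau> i) \<omega>) {..<n}"
    and W_continuous: "AE \<omega> in M. continuous_on {0..} (\<lambda>t. W t \<omega>)"

definition AC :: "real \<Rightarrow> (real \<Rightarrow> real) set" where
  "AC T = {h. \<forall>\<epsilon>>0. \<exists>\<delta>>0. \<forall>(n::nat) a b.
      (\<forall>i<n. 0 \<le> a i \<and> a i \<le> b i \<and> b i \<le> T) \<longrightarrow>
      disjoint_family_on (\<lambda>i. {a i<..<b i}) {..<n} \<longrightarrow>
      (\<Sum>i<n. b i - a i) < \<delta> \<longrightarrow> (\<Sum>i<n. \<bar>h (b i) - h (a i)\<bar>) < \<epsilon>}"

text \<open>
  The energy takes values in the extended nonnegative reals, so that an absolutely continuous \<open>h\<close>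
  with non-square-integrable derivative has infinite energy (a Bochner integral would give 0).
  Such an \<open>h\<close> is differentiable almost everywhere; the arbitrary value of \<^const>\<open>deriv\<close> elsewhere
  is irrelevant.
\<close>

definition energy :: "real \<Rightarrow> (real \<Rightarrow> real) \<Rightarrow> ennreal" where
  "energy T h = (\<integral>\<^sup>+ t\<in>{0..T}. ennreal ((deriv h t)\<^sup>2) \<partial>lborel)"

definition strip :: "real \<Rightarrow> real \<Rightarrow> (real \<Rightarrow> real) \<Rightarrow> (real \<Rightarrow> real) set" where
  "strip T r w = {h \<in> AC T. h 0 = 0 \<and> h T = w T \<and> (\<forall>t\<in>{0..T}. \<bar>h t - w t\<bar> \<le> r / 2)}"

text \<open>
  The taut string is defined by the strictly convex function \<open>\<phi>(u) = u\<^sup>2\<close>. Functions on \<open>[0,T]\<close> are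
  represented by functions on the reals, so a minimizer is unique only after its values outside
  \<open>[0,T]\<close> have been fixed; this is what \<^const>\<open>extensional\<close> is for.
\<close>

definition taut_string :: "real \<Rightarrow> real \<Rightarrow> (real \<Rightarrow> real) \<Rightarrow> real \<Rightarrow> real" where
  "taut_string T r w =
     (THE h. h \<in> extensional {0..T} \<and> is_arg_min (energy T) (\<lambda>g. g \<in> strip T r w) h)"

end

theory Submission
  imports Defs
begin

text \<open>
  Why the constant is \<open>\<kappa>(r) = pi\<^sup>2 / (6 r\<^sup>2)\<close>. Sample a path \<open>w\<close> with mesh \<open>\<delta>\<close> and ask for the least
  energy \<open>\<Sum> (\<Delta>y)\<^sup>2 / \<delta>\<close> of a sequence \<open>y\<close> with \<open>\<bar>y - w\<bar> \<le> r/2\<close> whose two ends are free. A square is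
  a superposition of excesses over slopes, \<open>s\<^sup>2 / \<delta> = \<integral> 2 ((s - c \<delta>)\<^sup>+ + (- s - c \<delta>)\<^sup>+) dc\<close> over
  \<open>c \<ge> 0\<close> (\<open>square_layers\<close>). For a single \<open>c\<close> the least value of \<open>\<Sum> (\<Delta>y - c \<delta>)\<^sup>+\<close> is reached by a lazy
  path, which moves with slope \<open>c\<close>, is held back by the upper edge of the tube at no cost and is
  lifted by the lower edge (\<open>lazy_path\<close>, \<open>climb_le\<close>); its distance to the upper edge is the walk of
  the increments of \<open>w\<close> with drift \<open>- c\<close>, reflected in \<open>[0, r]\<close>. The minimizer of the energy is taut,
  and therefore minimizes the costs of all the \<open>c\<close> at once (\<open>tube_min_climb\<close>). So the least
  energy is an explicit functional of the increments, \<open>free_energy\<close>.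

  If \<open>w\<close> is a Wiener process, the increments are independent Gaussians, and the convex function
  \<open>(exp (2 c x) - 1) / (2 c) - x\<close> of the reflected walk shows that it is lifted at the rate
  \<open>c / (exp (2 c r) - 1)\<close> per unit of time, up to an error that vanishes with the mesh
  (\<open>climb_expectation_upper\<close>, \<open>climb_expectation_lower\<close>). As
  \<open>\<integral> c / (exp (2 c r) - 1) dc = pi\<^sup>2 / (24 r\<^sup>2)\<close> and the upward and downward costs each count twice,
  the expected free energy per unit of time is at most \<open>\<kappa>(r)\<close>, with equality in the limit of fine meshes and
  long blocks (\<open>free_energy_expectation_upper\<close>, \<open>free_energy_expectation_lower\<close>).

  Lower bound: cut \<open>[0, T]\<close> into blocks of length \<open>L\<close>. On each block every admissible \<open>h\<close>, sampled
  on a grid, costs at least the free energy of the block (\<open>level_energy_sum_le\<close>). The free energies of different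
  blocks are independent and identically distributed, so the strong law gives the average.

  Upper bound: on each block start from the cheapest free path, in a slightly narrower tube, and use
  a unit of time at either end to bend it to \<open>w\<close> itself (\<open>pin_both\<close>), so that consecutive
  blocks join. The two bends cost an amount independent of \<open>L\<close>. Interpolating linearly on a fine
  enough grid stays in the strip (\<open>strip_path_grid\<close>); since the mesh needed depends on the path, the costs are
  bounded by suprema over all dyadic meshes, which have the same expectation bounds. The last,
  incomplete block costs \<open>o(T)\<close>. Letting \<open>L \<rightarrow> \<infinity>\<close>, then the width
  of the tube to \<open>r\<close>, gives \<open>\<kappa>(r)\<close> again.

  Taut string: by the parallelogram identity a minimizing sequence converges uniformly and the
  minimizer is unique (\<open>energy_taut_string\<close>), so both quotients of the theorem agree as soon as the strip
  contains a function of finite energy. That uses the fundamental theorem of calculus for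
  absolutely continuous functions, which rests on the differentiability of monotone functions.
\<close>

section \<open>Monotone functions are differentiable almost everywhere\<close>

text \<open>
  The intervals contain \<open>x\<close> instead of ending there, so that they form a Vitali cover.
\<close>

definition steep :: "(real \<Rightarrow> real) \<Rightarrow> real \<Rightarrow> real \<Rightarrow> bool" where
  "steep f q x \<longleftrightarrow> (\<forall>d>0. \<exists>u v. u \<le> x \<and> x \<le> v \<and> u < v \<and> v - u < d \<and> q * (v - u) < f v - f u)"

definition flat :: "(real \<Rightarrow> real) \<Rightarrow> real \<Rightarrow> real \<Rightarrow> bool" where
  "flat f p x \<longleftrightarrow> (\<forall>d>0. \<exists>u v. u \<le> x \<and> x \<le> v \<and> u < v \<and> v - u < d \<and> f v - f u < p * (v - u))"

lemma mono_sum_disjoint_intervals: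
  fixes f :: "real \<Rightarrow> real" and C :: "(real \<times> real) set"
  assumes "mono f" and "finite C"
    and "\<And>a b. (a, b) \<in> C \<Longrightarrow> u \<le> a \<and> a \<le> b \<and> b \<le> v"
    and "pairwise (\<lambda>i j. disjnt {fst i..snd i} {fst j..snd j}) C" and "u \<le> v"
  shows "(\<Sum>c\<in>C. f (snd c) - f (fst c)) \<le> f v - f u"
  using assms(2-5)
proof (induction C arbitrary: v rule: finite_ranking_induct[where f = "fst :: real \<times> real \<Rightarrow> real"])
  case empty
  then show ?case using \<open>mono f\<close> by (simp add: mono_def)
next
  case (insert x C)
  show ?case
  proof (cases "x \<in> C")
    case True
    then show ?thesis using insert by (simp add: insert_absorb)
  next
    case False
    obtain a b where x: "x = (a, b)" by (cases x)
    have ab: "u \<le> a" "a \<le> b" "b \<le> v" using insert(4)[of a b] x by auto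
    have "(\<Sum>c\<in>C. f (snd c) - f (fst c)) \<le> f a - f u"
    proof (rule insert(3))
      fix a' b' assume c: "(a', b') \<in> C"
      then have le: "a' \<le> a" using insert(2)[of "(a', b')"] x by simp
      have "disjnt {a'..b'} {a..b}"
        using insert(5) c False x by (fastforce simp: pairwise_insert)
      moreover have "u \<le> a'" "a' \<le> b'" using insert(4)[of a' b'] c by auto
      ultimately have "b' < a"
        using le ab by (auto simp: disjnt_iff)
      then show "u \<le> a' \<and> a' \<le> b' \<and> b' \<le> a" using \<open>u \<le> a'\<close> \<open>a' \<le> b'\<close> by auto
    qed (use insert(5) ab in \<open>auto simp: pairwise_insert\<close>)
    moreover have "f b \<le> f v" using ab \<open>mono f\<close> by (simp add: mono_def)
    ultimately show ?thesis using insert(1) False x by simp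
  qed
qed

text \<open>Closed intervals are closed balls of the line, so this is the covering theorem for balls.\<close>

lemma Vitali_intervals:
  fixes S :: "real set" and K :: "(real \<times> real) set"
  assumes K: "\<And>a b. (a, b) \<in> K \<Longrightarrow> a < b"
    and S: "\<And>x d. x \<in> S \<Longrightarrow> 0 < d \<Longrightarrow> \<exists>a b. (a, b) \<in> K \<and> a \<le> x \<and> x \<le> b \<and> b - a < d"
  obtains C where "countable C" "C \<subseteq> K"
    "pairwise (\<lambda>i j. disjnt {fst i..snd i} {fst j..snd j}) C"
    "negligible (S - (\<Union>c\<in>C. {fst c..snd c}))"
proof -
  define ce where "ce = (\<lambda>c::real \<times> real. (fst c + snd c) / 2)"
  define ra where "ra = (\<lambda>c::real \<times> real. (snd c - fst c) / 2)"
  have cb: "cball (ce c) (ra c) = {fst c..snd c}" for c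
    by (simp add: cball_eq_atLeastAtMost ce_def ra_def field_simps)
  have "\<exists>i. i \<in> K \<and> x \<in> cball (ce i) (ra i) \<and> ra i < d" if xS: "x \<in> S" and d: "0 < d" for x d
  proof -
    obtain a b where "(a, b) \<in> K" "a \<le> x" "x \<le> b" "b - a < d" using S[OF xS d] by blast
    moreover have "ra (a, b) < d" using \<open>b - a < d\<close> K[OF \<open>(a, b) \<in> K\<close>] d by (simp add: ra_def)
    ultimately show ?thesis unfolding cb by (intro exI[of _ "(a, b)"]) auto
  qed
  note cov = this
  have pos: "0 < ra i" if "i \<in> K" for i using K[of "fst i" "snd i"] that by (simp add: ra_def)
  show ?thesis
    by (rule Vitali_covering_theorem_cballs[OF pos cov]) (assumption+, rule that, simp_all only: cb)
qed

text \<open>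
  Disjoint intervals of mean slope above \<open>q\<close> have total length at most the total rise divided by
  \<open>q\<close>.
\<close>

lemma steep_cover:
  fixes f :: "real \<Rightarrow> real"
  assumes "mono f" and "q > 0" and S: "\<And>x. x \<in> S \<Longrightarrow> u < x \<and> x < v \<and> steep f q x" and "u \<le> v"
  obtains B where "S \<subseteq> B" "B \<in> lmeasurable" "measure lebesgue B \<le> (f v - f u) / q"
proof -
  define K where "K = {(a, b). a < b \<and> u \<le> a \<and> b \<le> v \<and> q * (b - a) < f b - f a}"
  have cov: "\<exists>a b. (a, b) \<in> K \<and> a \<le> x \<and> x \<le> b \<and> b - a < d" if x: "x \<in> S" and d: "0 < d" for x d
  proof -
    have "0 < min d (min (x - u) (v - x))" using S[OF x] d by simp
    then obtain a b where "a \<le> x \<and> x \<le> b \<and> a < b \<and> b - a < min d (min (x - u) (v - x))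
        \<and> q * (b - a) < f b - f a"
      using S[OF x] unfolding steep_def by blast
    then show ?thesis unfolding K_def by (intro exI[of _ a] exI[of _ b]) auto
  qed
  have Klt: "a < b" if "(a, b) \<in> K" for a b using that by (simp add: K_def)
  obtain C where C: "countable C" "C \<subseteq> K"
    "pairwise (\<lambda>i j. disjnt {fst i..snd i} {fst j..snd j}) C"
    "negligible (S - (\<Union>c\<in>C. {fst c..snd c}))"
    by (rule Vitali_intervals[OF Klt cov])
  have fin: "measure lebesgue (\<Union>c\<in>I. {fst c..snd c}) \<le> (f v - f u) / q" if I: "I \<subseteq> C" "finite I" for I
  proof -
    have Kd: "fst c < snd c \<and> q * (snd c - fst c) < f (snd c) - f (fst c)" if "c \<in> I" for c
      using subsetD[OF C(2) subsetD[OF I(1) that]] by (simp add: K_def case_prod_beta)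
    have "measure lebesgue (\<Union>c\<in>I. {fst c..snd c}) \<le> (\<Sum>c\<in>I. measure lebesgue {fst c..snd c})"
      by (rule measure_UNION_le[OF I(2)]) simp
    also have "\<dots> = (\<Sum>c\<in>I. snd c - fst c)"
      by (rule sum.cong[OF refl]) (simp add: less_imp_le[OF conjunct1[OF Kd]])
    also have "\<dots> \<le> (\<Sum>c\<in>I. (f (snd c) - f (fst c)) / q)"
    proof (rule sum_mono)
      fix c assume "c \<in> I"
      from Kd[OF this] show "snd c - fst c \<le> (f (snd c) - f (fst c)) / q"
        using \<open>q > 0\<close> by (simp add: pos_le_divide_eq mult.commute)
    qed
    also have "\<dots> = (\<Sum>c\<in>I. f (snd c) - f (fst c)) / q" by (simp add: sum_divide_distrib)
    also have "\<dots> \<le> (f v - f u) / q"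
    proof (rule divide_right_mono)
      show "(\<Sum>c\<in>I. f (snd c) - f (fst c)) \<le> f v - f u"
      proof (rule mono_sum_disjoint_intervals[OF \<open>mono f\<close> I(2) _ pairwise_subset[OF C(3) I(1)] \<open>u \<le> v\<close>])
        fix a b assume "(a, b) \<in> I"
        then have "(a, b) \<in> K" using I(1) C(2) by blast
        then show "u \<le> a \<and> a \<le> b \<and> b \<le> v" by (simp add: K_def)
      qed
    qed (use \<open>q > 0\<close> in simp)
    finally show ?thesis .
  qed
  let ?B = "\<Union>c\<in>C. {fst c..snd c}"
  have B: "?B \<in> lmeasurable" "measure lebesgue ?B \<le> (f v - f u) / q"
    using fmeasurable_UN_bound[of C "\<lambda>c. {fst c..snd c}", OF C(1) _ fin]
      measure_UN_bound[of C "\<lambda>c. {fst c..snd c}", OF C(1) _ fin] by auto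
  have N: "S - ?B \<in> lmeasurable" "measure lebesgue (S - ?B) = 0"
    using C(4) by (auto simp: negligible_imp_measurable negligible_imp_measure0)
  show ?thesis
  proof
    show "S \<subseteq> ?B \<union> (S - ?B)" by auto
    show "?B \<union> (S - ?B) \<in> lmeasurable" using B N by (intro fmeasurable.Un)
    have "measure lebesgue (?B \<union> (S - ?B)) \<le> measure lebesgue ?B + measure lebesgue (S - ?B)"
      using B N by (intro measure_Un_le) auto
    then show "measure lebesgue (?B \<union> (S - ?B)) \<le> (f v - f u) / q" using B N by simp
  qed
qed

text \<open>
  The classical two-stage covering. Cover \<open>E\<close> by flat intervals inside an open set \<open>U\<close> of
  nearly the outer measure \<open>m\<close> of \<open>E\<close>: there \<open>f\<close> rises by at most
  \<open>p\<close> times the length. Within each of them the steep points are covered by a set of measure at most the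
  rise divided by \<open>q\<close>. Together \<open>m \<le> p / q * m\<close>, so \<open>m = 0\<close>.
\<close>

lemma negligible_flat_steep_bounded:
  fixes f :: "real \<Rightarrow> real"
  assumes "mono f" and pq: "0 < p" "p < q" and E: "\<And>x. x \<in> E \<Longrightarrow> u < x \<and> x < v \<and> flat f p x \<and> steep f q x"
  shows "negligible E"
proof -
  define Ms where "Ms = {measure lebesgue T | T. T \<in> lmeasurable \<and> E \<subseteq> T}"
  define m where "m = Inf Ms"
  have bdd: "bdd_below Ms" by (rule bdd_belowI[of _ 0]) (auto simp: Ms_def)
  have "measure lebesgue {u<..<v} \<in> Ms"
    unfolding Ms_def mem_Collect_eq using E by (intro exI[of _ "{u<..<v}"] conjI refl subsetI) simp_all
  then have ne: "Ms \<noteq> {}" by auto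
  have m0: "0 \<le> m" unfolding m_def by (rule cInf_greatest[OF ne]) (auto simp: Ms_def)
  \<comment> \<open>Steep points inside disjoint flat intervals: the covering by steep intervals is applied in each of them.\<close>
  have shrink: "m \<le> p / q * measure lebesgue U" if U: "open U" "U \<in> lmeasurable" "E \<subseteq> U" for U
  proof -
    define K where "K = {(a, b). a < b \<and> {a..b} \<subseteq> U \<and> f b - f a < p * (b - a)}"
    have cov: "\<exists>a b. (a, b) \<in> K \<and> a \<le> x \<and> x \<le> b \<and> b - a < d" if x: "x \<in> E" and d: "0 < d" for x d
    proof -
      obtain e where e: "e > 0" "ball x e \<subseteq> U" using U x open_contains_ball by blast
      then obtain a b where ab: "a \<le> x" "x \<le> b" "a < b" "b - a < min d e" "f b - f a < p * (b - a)"
        using E[OF x] d unfolding flat_def by (meson min_less_iff_conj)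
      moreover have "{a..b} \<subseteq> ball x e" using ab by (auto simp: dist_real_def)
      ultimately show ?thesis unfolding K_def using e by (intro exI[of _ a] exI[of _ b]) auto
    qed
    have Klt: "a < b" if "(a, b) \<in> K" for a b using that by (simp add: K_def)
    obtain C where C: "countable C" "C \<subseteq> K"
      "pairwise (\<lambda>i j. disjnt {fst i..snd i} {fst j..snd j}) C"
      "negligible (E - (\<Union>c\<in>C. {fst c..snd c}))"
      by (rule Vitali_intervals[OF Klt cov])
    have "\<exists>B. E \<inter> {fst c<..<snd c} \<subseteq> B \<and> B \<in> lmeasurable
        \<and> measure lebesgue B \<le> p / q * (snd c - fst c)" if c: "c \<in> C" for c
    proof -
      have c': "fst c < snd c" "f (snd c) - f (fst c) < p * (snd c - fst c)"
        using C(2) c by (auto simp: K_def)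
      obtain B where "E \<inter> {fst c<..<snd c} \<subseteq> B" "B \<in> lmeasurable"
          "measure lebesgue B \<le> (f (snd c) - f (fst c)) / q"
      proof (rule steep_cover[OF \<open>mono f\<close>])
        show "0 < q" using pq by simp
        show "fst c \<le> snd c" using c' by simp
        show "fst c < x \<and> x < snd c \<and> steep f q x" if "x \<in> E \<inter> {fst c<..<snd c}" for x
          using that E[of x] by simp
      qed
      moreover have "(f (snd c) - f (fst c)) / q \<le> p / q * (snd c - fst c)"
        using divide_right_mono[of "f (snd c) - f (fst c)" "p * (snd c - fst c)" q] c' pq by simp
      ultimately show ?thesis by (meson order_trans)
    qed
    then obtain B where B: "\<And>c. c \<in> C \<Longrightarrow> E \<inter> {fst c<..<snd c} \<subseteq> B c"
      "\<And>c. c \<in> C \<Longrightarrow> B c \<in> lmeasurable"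
      "\<And>c. c \<in> C \<Longrightarrow> measure lebesgue (B c) \<le> p / q * (snd c - fst c)" by metis
    have fin: "measure lebesgue (\<Union>c\<in>I. B c) \<le> p / q * measure lebesgue U" if I: "I \<subseteq> C" "finite I" for I
    proof -
      have KU: "{fst c..snd c} \<subseteq> U \<and> fst c < snd c" if "c \<in> I" for c
        using subsetD[OF C(2) subsetD[OF I(1) that]] by (simp add: K_def case_prod_beta)
      have "measure lebesgue (\<Union>c\<in>I. B c) \<le> (\<Sum>c\<in>I. measure lebesgue (B c))"
        by (rule measure_UNION_le[OF I(2) fmeasurableD[OF B(2)[OF subsetD[OF I(1)]]]])
      also have "\<dots> \<le> (\<Sum>c\<in>I. p / q * measure lebesgue {fst c..snd c})"
      proof (rule sum_mono)
        fix c assume c: "c \<in> I"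
        have "measure lebesgue {fst c..snd c} = snd c - fst c" using KU[OF c] by simp
        then show "measure lebesgue (B c) \<le> p / q * measure lebesgue {fst c..snd c}"
          using B(3)[OF subsetD[OF I(1) c]] by (simp only:)
      qed
      also have "\<dots> = p / q * (\<Sum>c\<in>I. measure lebesgue {fst c..snd c})"
        by (simp add: sum_distrib_left)
      also have "(\<Sum>c\<in>I. measure lebesgue {fst c..snd c}) = measure lebesgue (\<Union>c\<in>I. {fst c..snd c})"
        by (rule measure_UNION'[symmetric, OF I(2) _ pairwise_subset[OF C(3) I(1)]]) simp
      finally have le: "measure lebesgue (\<Union>c\<in>I. B c) \<le> p / q * measure lebesgue (\<Union>c\<in>I. {fst c..snd c})" .
      have "measure lebesgue (\<Union>c\<in>I. {fst c..snd c}) \<le> measure lebesgue U"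
        using KU I(2) U(2) by (intro measure_mono_fmeasurable UN_least) auto
      then have "p / q * measure lebesgue (\<Union>c\<in>I. {fst c..snd c}) \<le> p / q * measure lebesgue U"
        by (rule mult_left_mono) (use pq in simp)
      with le show ?thesis by linarith
    qed
    let ?B = "\<Union>c\<in>C. B c"
    have Bm: "?B \<in> lmeasurable" by (rule fmeasurable_UN_bound[OF C(1) B(2) fin])
    have Bm2: "measure lebesgue ?B \<le> p / q * measure lebesgue U"
      by (rule measure_UN_bound[OF C(1) B(2) fin])
    let ?N = "(E - (\<Union>c\<in>C. {fst c..snd c})) \<union> (fst ` C \<union> snd ` C)"
    have "countable (fst ` C \<union> snd ` C)" using C(1) by simp
    then have "fst ` C \<union> snd ` C \<in> null_sets lborel" by (rule countable_imp_null_set_lborel)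
    then have "negligible (fst ` C \<union> snd ` C)"
      by (simp add: negligible_iff_null_sets null_sets_completionI)
    then have "negligible ?N" by (rule negligible_Un[OF C(4)])
    note N = negligible_imp_measurable[OF this] negligible_imp_measure0[OF this]
    have "E \<subseteq> ?B \<union> ?N"
    proof
      fix x assume x: "x \<in> E"
      show "x \<in> ?B \<union> ?N"
      proof (cases "x \<in> ?N")
        case False
        then obtain c where c: "c \<in> C" "fst c \<le> x" "x \<le> snd c" using x by auto
        have "x \<noteq> fst c" "x \<noteq> snd c" using False c(1) by auto
        then have "x \<in> E \<inter> {fst c<..<snd c}" using c x by auto
        then show ?thesis using B(1)[OF c(1)] c(1) by blast
      qed auto
    qed
    moreover have "?B \<union> ?N \<in> lmeasurable" by (rule fmeasurable.Un[OF Bm N(1)])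
    ultimately have "m \<le> measure lebesgue (?B \<union> ?N)"
      unfolding m_def using bdd by (intro cInf_lower) (auto simp: Ms_def)
    also have "\<dots> \<le> measure lebesgue ?B + measure lebesgue ?N"
      by (rule measure_Un_le) (rule fmeasurableD[OF Bm], rule fmeasurableD[OF N(1)])
    finally show ?thesis using Bm2 N(2) by linarith
  qed
  have "m \<le> p / q * (m + 2 * e)" if "e > 0" for e
  proof -
    obtain t where "t \<in> Ms" "t < m + e"
      using cInf_lessD[OF ne, of "m + e"] \<open>e > 0\<close> unfolding m_def by auto
    then obtain T where T: "T \<in> lmeasurable" "E \<subseteq> T" "measure lebesgue T < m + e"
      unfolding Ms_def by auto
    obtain U where U: "open U" "T \<subseteq> U" "U - T \<in> lmeasurable" "emeasure lebesgue (U - T) < ennreal e"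
      using sets_lebesgue_outer_open[OF fmeasurableD[OF T(1)] \<open>e > 0\<close>] .
    have "U = T \<union> (U - T)" using U(2) by blast
    then have Um: "U \<in> lmeasurable" using fmeasurable.Un[OF T(1) U(3)] by simp
    have "measure lebesgue U \<le> measure lebesgue T + measure lebesgue (U - T)"
      using measure_Un_le[OF fmeasurableD[OF T(1)] fmeasurableD[OF U(3)]] \<open>U = T \<union> (U - T)\<close> by simp
    moreover have "measure lebesgue (U - T) < e"
      using U(4) \<open>e > 0\<close> by (simp add: emeasure_eq_measure2[OF U(3)] ennreal_less_iff)
    ultimately have Ule: "measure lebesgue U \<le> m + 2 * e" using T(3) by linarith
    have "m \<le> p / q * measure lebesgue U" by (rule shrink[OF U(1) Um subset_trans[OF T(2) U(2)]])
    also have "\<dots> \<le> p / q * (m + 2 * e)"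
      by (rule mult_left_mono[OF Ule]) (use pq in simp)
    finally show ?thesis .
  qed
  note le = this
  have "m = 0"
  proof (rule ccontr)
    assume "m \<noteq> 0"
    then have "m > 0" using m0 by simp
    \<comment> \<open>Small enough for \<open>p * (m + 2 * e) < q * m\<close>.\<close>
    define e where "e = m * (q - p) / (4 * p)"
    have "e > 0" unfolding e_def using \<open>m > 0\<close> pq by simp
    have "q * m \<le> p * (m + 2 * e)" using le[OF \<open>e > 0\<close>] pq by (simp add: field_simps)
    also have "\<dots> = p * m + m * (q - p) / 2" unfolding e_def using pq by (simp add: field_simps)
    finally have "m * (q - p) \<le> 0" by (simp add: field_simps)
    then show False using \<open>m > 0\<close> pq by (simp add: mult_le_0_iff)
  qed
  show ?thesis
  proof (subst negligible_outer, intro allI impI)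
    fix e :: real assume "e > 0"
    then obtain t where "t \<in> Ms" "t < e" using cInf_lessD[OF ne, of e] \<open>m = 0\<close> unfolding m_def by auto
    then show "\<exists>T. E \<subseteq> T \<and> T \<in> lmeasurable \<and> measure lebesgue T < e" unfolding Ms_def by auto
  qed
qed

lemma negligible_steep_all_bounded:
  fixes f :: "real \<Rightarrow> real"
  assumes "mono f" and E: "\<And>x. x \<in> E \<Longrightarrow> u < x \<and> x < v \<and> (\<forall>q>0. steep f q x)"
  shows "negligible E"
proof (cases "u < v")
  case True
  show ?thesis
  proof (subst negligible_outer, intro allI impI)
    fix e :: real assume "e > 0"
    have fuv: "f u \<le> f v" using \<open>mono f\<close> True by (simp add: mono_def)
    define q where "q = (f v - f u + 1) / e"
    have "q > 0" unfolding q_def using \<open>e > 0\<close> fuv by simp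
    obtain B where "E \<subseteq> B" "B \<in> lmeasurable" "measure lebesgue B \<le> (f v - f u) / q"
    proof (rule steep_cover[OF \<open>mono f\<close> \<open>q > 0\<close>])
      show "u \<le> v" using True by simp
      show "u < x \<and> x < v \<and> steep f q x" if "x \<in> E" for x
        using E[OF that] \<open>q > 0\<close> by simp
    qed
    moreover have "(f v - f u) / q < e"
      unfolding q_def using \<open>e > 0\<close> fuv by (simp add: field_simps)
    ultimately show "\<exists>T. E \<subseteq> T \<and> T \<in> lmeasurable \<and> measure lebesgue T < e"
      by (intro exI[of _ B] conjI) (assumption | linarith)+
  qed
next
  case False
  then have "x \<notin> E" for x using E[of x] by linarith
  then have "E = {}" by blast
  then show ?thesis by simp
qed

text \<open>
  The derivative is the infimum \<open>L\<close> of the slopes \<open>q\<close> that \<open>f\<close> does not exceed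
  near \<open>x\<close>: above \<open>L\<close> by definition, and below \<open>L\<close> because otherwise two
  rationals would separate the mean slopes.
\<close>

lemma differentiable_from_quotients:
  fixes f :: "real \<Rightarrow> real"
  assumes "mono f" and n1: "\<not> (\<forall>q>0. steep f q x)"
    and n2: "\<And>p q. p \<in> \<rat> \<Longrightarrow> q \<in> \<rat> \<Longrightarrow> 0 < p \<Longrightarrow> p < q \<Longrightarrow> \<not> (flat f p x \<and> steep f q x)"
  shows "f field_differentiable (at x)"
proof -
  define H where "H = {q. 0 < q \<and> \<not> steep f q x}"
  define L where "L = Inf H"
  have H: "H \<noteq> {}" "bdd_below H" using n1 by (auto simp: H_def intro: bdd_belowI[of _ 0])
  have L0: "0 \<le> L" unfolding L_def using H(1) by (rule cInf_greatest) (auto simp: H_def)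
  have up: "\<exists>d>0. \<forall>u v. u \<le> x \<and> x \<le> v \<and> u < v \<and> v - u < d \<longrightarrow> f v - f u \<le> (L + e) * (v - u)"
    if e: "e > 0" for e
  proof -
    obtain q where q: "q \<in> H" "q < L + e" using cInf_lessD[OF H(1), of "L + e"] e by (auto simp: L_def)
    then obtain d where d: "d > 0" "\<forall>u v. u \<le> x \<and> x \<le> v \<and> u < v \<and> v - u < d \<longrightarrow> f v - f u \<le> q * (v - u)"
      unfolding H_def steep_def mem_Collect_eq by (metis not_less)
    have "q * (v - u) \<le> (L + e) * (v - u)" if "u < v" for u v
      using q that by (intro mult_right_mono) auto
    then have "f v - f u \<le> (L + e) * (v - u)" if "u \<le> x \<and> x \<le> v \<and> u < v \<and> v - u < d" for u v
      using d(2) that order_trans by blast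
    with d(1) show ?thesis by blast
  qed
  have lo: "\<exists>d>0. \<forall>u v. u \<le> x \<and> x \<le> v \<and> u < v \<and> v - u < d \<longrightarrow> (L - e) * (v - u) \<le> f v - f u"
    if e: "e > 0" for e
  proof (cases "L - e \<le> 0")
    case True
    have "(L - e) * (v - u) \<le> f v - f u" if "u < v" for u v
    proof -
      have "(L - e) * (v - u) \<le> 0" using True that by (simp add: mult_le_0_iff)
      moreover have "f u \<le> f v" using \<open>mono f\<close> that by (simp add: mono_def)
      ultimately show ?thesis by simp
    qed
    then show ?thesis by (intro exI[of _ 1]) auto
  next
    case False
    obtain p where p: "p \<in> \<rat>" "L - e < p" "p < L" using e Rats_dense_in_real[of "L - e" L] by auto
    obtain q where q: "q \<in> \<rat>" "p < q" "q < L" using p Rats_dense_in_real[of p L] by auto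
    have "q \<notin> H" using q cInf_lower[OF _ H(2)] unfolding L_def by force
    then have "steep f q x" using False p q by (auto simp: H_def)
    then have "\<not> flat f p x" using n2[OF p(1) q(1)] False p q by auto
    then obtain d where d: "d > 0" "\<forall>u v. u \<le> x \<and> x \<le> v \<and> u < v \<and> v - u < d \<longrightarrow> p * (v - u) \<le> f v - f u"
      unfolding flat_def by (metis not_less)
    have "(L - e) * (v - u) \<le> p * (v - u)" if "u < v" for u v
      using p that by (intro mult_right_mono) auto
    then have "(L - e) * (v - u) \<le> f v - f u" if "u \<le> x \<and> x \<le> v \<and> u < v \<and> v - u < d" for u v
      using d(2) that order_trans by blast
    with d(1) show ?thesis by blast
  qed
  have "(f has_field_derivative L) (at x)"
    unfolding has_field_derivative_def has_derivative_at_alt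
  proof (intro conjI allI impI)
    show "bounded_linear ((*) L)" by (rule bounded_linear_mult_right)
    fix e :: real assume "e > 0"
    obtain d1 where d1: "d1 > 0" "\<And>u v. u \<le> x \<Longrightarrow> x \<le> v \<Longrightarrow> u < v \<Longrightarrow> v - u < d1 \<Longrightarrow> f v - f u \<le> (L + e) * (v - u)"
      using up[OF \<open>e > 0\<close>] by auto
    obtain d2 where d2: "d2 > 0" "\<And>u v. u \<le> x \<Longrightarrow> x \<le> v \<Longrightarrow> u < v \<Longrightarrow> v - u < d2 \<Longrightarrow> (L - e) * (v - u) \<le> f v - f u"
      using lo[OF \<open>e > 0\<close>] by auto
    have "norm (f y - f x - L * (y - x)) \<le> e * norm (y - x)" if y: "norm (y - x) < min d1 d2" for y
    proof (cases "x = y")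
      case False
      show ?thesis
      proof (cases "x < y")
        case True
        then show ?thesis using d1(2)[of x y] d2(2)[of x y] y by (auto simp: abs_le_iff algebra_simps)
      next
        case c: False
        then have "y < x" using False by simp
        then show ?thesis using d1(2)[of y x] d2(2)[of y x] y by (auto simp: abs_le_iff algebra_simps)
      qed
    qed auto
    then show "\<exists>d>0. \<forall>y. norm (y - x) < d \<longrightarrow> norm (f y - f x - L * (y - x)) \<le> e * norm (y - x)"
      using d1(1) d2(1) by (intro exI[of _ "min d1 d2"]) auto
  qed
  then show ?thesis by (auto simp: field_differentiable_def)
qed

theorem mono_differentiable_AE:
  fixes f :: "real \<Rightarrow> real"
  assumes "mono f"
  shows "negligible {x. \<not> f field_differentiable (at x)}"
proof -
  define R where "R = {(p, q). p \<in> \<rat> \<and> q \<in> \<rat> \<and> 0 < p \<and> p < (q::real)}"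
  define B where "B = (\<lambda>n::nat. {- real n<..<real n})"
  let ?A = "\<lambda>n. {x \<in> B n. \<forall>q>0. steep f q x}"
  let ?F = "\<lambda>pq n. {x \<in> B n. flat f (fst pq) x \<and> steep f (snd pq) x}"
  have cR: "countable R"
    by (rule countable_subset[of _ "\<rat> \<times> \<rat>"]) (auto simp: R_def countable_rat)
  have nA: "negligible (?A n)" for n
    by (rule negligible_steep_all_bounded[OF assms, of _ "- real n" "real n"]) (auto simp: B_def)
  have nF: "negligible (?F pq n)" if "pq \<in> R" for pq n
    by (rule negligible_flat_steep_bounded[OF assms, of "fst pq" "snd pq" _ "- real n" "real n"])
      (use that in \<open>auto simp: B_def R_def\<close>)
  have "negligible ((\<Union>n. ?A n) \<union> (\<Union>n. \<Union>pq\<in>R. ?F pq n))"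
    using nA nF cR by (intro negligible_Un negligible_Union_nat negligible_countable_Union) auto
  moreover have "{x. \<not> f field_differentiable (at x)} \<subseteq> (\<Union>n. ?A n) \<union> (\<Union>n. \<Union>pq\<in>R. ?F pq n)"
  proof
    fix x assume "x \<in> {x. \<not> f field_differentiable (at x)}"
    then have nd: "\<not> f field_differentiable (at x)" by simp
    obtain n where "\<bar>x\<bar> < real n" using reals_Archimedean2 by blast
    then have xB: "x \<in> B n" by (auto simp: B_def)
    show "x \<in> (\<Union>n. ?A n) \<union> (\<Union>n. \<Union>pq\<in>R. ?F pq n)"
    proof (rule ccontr)
      assume c: "\<not> ?thesis"
      then have "\<not> (\<forall>q>0. steep f q x)" using xB by blast
      moreover have "\<not> (flat f p x \<and> steep f q x)" if "p \<in> \<rat>" "q \<in> \<rat>" "0 < p" "p < q" for p q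
        using c xB that unfolding R_def by fastforce
      ultimately show False using differentiable_from_quotients[OF assms] nd by blast
    qed
  qed
  ultimately show ?thesis by (rule negligible_subset)
qed

section \<open>Absolutely continuous functions and their energy\<close>

text \<open>Absolute continuity on an arbitrary interval, needed to cut paths into blocks.\<close>

definition AC_on :: "real \<Rightarrow> real \<Rightarrow> (real \<Rightarrow> real) set" where
  "AC_on a b = {h. \<forall>\<epsilon>>0. \<exists>\<delta>>0. \<forall>(n::nat) l u.
      (\<forall>i<n. a \<le> l i \<and> l i \<le> u i \<and> u i \<le> b) \<longrightarrow>
      disjoint_family_on (\<lambda>i. {l i<..<u i}) {..<n} \<longrightarrow>
      (\<Sum>i<n. u i - l i) < \<delta> \<longrightarrow> (\<Sum>i<n. \<bar>h (u i) - h (l i)\<bar>) < \<epsilon>}"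

definition energy_on :: "real \<Rightarrow> real \<Rightarrow> (real \<Rightarrow> real) \<Rightarrow> ennreal" where
  "energy_on a b h = (\<integral>\<^sup>+t\<in>{a..b}. ennreal ((deriv h t)\<^sup>2) \<partial>lborel)"

lemma lebesgue_intervals[measurable]:
  "{a..b::real} \<in> sets lebesgue" "{a<..<b::real} \<in> sets lebesgue" "{a..<b::real} \<in> sets lebesgue"
  by auto

lemma AC_eq_AC_on: "AC T = AC_on 0 T"
  by (simp add: AC_def AC_on_def)

lemma energy_eq_energy_on: "energy T h = energy_on 0 T h"
  by (simp add: energy_def energy_on_def)

lemma AC_onD:
  assumes "h \<in> AC_on a b" "\<epsilon> > 0"
  obtains \<delta> where "\<delta> > 0"
    "\<And>(n::nat) l u. (\<And>i. i < n \<Longrightarrow> a \<le> l i \<and> l i \<le> u i \<and> u i \<le> b) \<Longrightarrow>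
      disjoint_family_on (\<lambda>i. {l i<..<u i}) {..<n} \<Longrightarrow>
      (\<Sum>i<n. u i - l i) < \<delta> \<Longrightarrow> (\<Sum>i<n. \<bar>h (u i) - h (l i)\<bar>) < \<epsilon>"
  using assms unfolding AC_on_def mem_Collect_eq by meson

text \<open>Tagged divisions are indexed by pairs of a tag and an interval, not by numbers.\<close>

lemma AC_on_finite:
  assumes "h \<in> AC_on a b" "\<epsilon> > 0"
  obtains \<delta> where "\<delta> > 0"
    "\<And>P (l::'b \<Rightarrow> real) u. finite P \<Longrightarrow> (\<And>i. i \<in> P \<Longrightarrow> a \<le> l i \<and> l i \<le> u i \<and> u i \<le> b) \<Longrightarrow>
      disjoint_family_on (\<lambda>i. {l i<..<u i}) P \<Longrightarrow>
      (\<Sum>i\<in>P. u i - l i) < \<delta> \<Longrightarrow> (\<Sum>i\<in>P. \<bar>h (u i) - h (l i)\<bar>) < \<epsilon>"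
proof -
  obtain \<delta> where \<delta>: "\<delta> > 0"
    "\<And>(n::nat) l u. (\<And>i. i < n \<Longrightarrow> a \<le> l i \<and> l i \<le> u i \<and> u i \<le> b) \<Longrightarrow>
      disjoint_family_on (\<lambda>i. {l i<..<u i}) {..<n} \<Longrightarrow>
      (\<Sum>i<n. u i - l i) < \<delta> \<Longrightarrow> (\<Sum>i<n. \<bar>h (u i) - h (l i)\<bar>) < \<epsilon>"
    using AC_onD[OF assms] by blast
  show ?thesis
  proof (rule that[OF \<delta>(1)])
    fix P and l u :: "'b \<Rightarrow> real"
    assume P: "finite P" and lu: "\<And>i. i \<in> P \<Longrightarrow> a \<le> l i \<and> l i \<le> u i \<and> u i \<le> b"
      and dj: "disjoint_family_on (\<lambda>i. {l i<..<u i}) P" and s: "(\<Sum>i\<in>P. u i - l i) < \<delta>"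
    obtain e where e: "bij_betw e {0..<card P} P" using ex_bij_betw_nat_finite[OF P] by blast
    then have e': "bij_betw e {..<card P} P" by (simp add: atLeast0LessThan)
    have inP: "e i \<in> P" if "i < card P" for i using e' that by (auto simp: bij_betw_def)
    have "(\<Sum>i<card P. \<bar>h (u (e i)) - h (l (e i))\<bar>) < \<epsilon>"
    proof (rule \<delta>(2))
      show "a \<le> l (e i) \<and> l (e i) \<le> u (e i) \<and> u (e i) \<le> b" if "i < card P" for i
        by (rule lu[OF inP[OF that]])
      show "disjoint_family_on (\<lambda>i. {l (e i)<..<u (e i)}) {..<card P}"
        unfolding disjoint_family_on_def
      proof (intro ballI impI)
        fix m n assume "m \<in> {..<card P}" "n \<in> {..<card P}" "m \<noteq> n"
        then have "e m \<in> P" "e n \<in> P" "e m \<noteq> e n"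
          using e' inP by (auto simp: bij_betw_def inj_on_def)
        then show "{l (e m)<..<u (e m)} \<inter> {l (e n)<..<u (e n)} = {}"
          by (rule disjoint_family_onD[OF dj])
      qed
      show "(\<Sum>i<card P. u (e i) - l (e i)) < \<delta>"
        using s sum.reindex_bij_betw[OF e', of "\<lambda>i. u i - l i"] by simp
    qed
    then show "(\<Sum>i\<in>P. \<bar>h (u i) - h (l i)\<bar>) < \<epsilon>"
      using sum.reindex_bij_betw[OF e', of "\<lambda>i. \<bar>h (u i) - h (l i)\<bar>"] by simp
  qed
qed

lemma AC_on_subset: "h \<in> AC_on a b \<Longrightarrow> a \<le> a' \<Longrightarrow> b' \<le> b \<Longrightarrow> h \<in> AC_on a' b'"
  unfolding AC_on_def mem_Collect_eq by (meson order_trans)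

lemma chain_mono:
  fixes \<tau> :: "nat \<Rightarrow> real"
  assumes "\<And>i. i < n \<Longrightarrow> \<tau> i \<le> \<tau> (Suc i)" "i \<le> j" "j \<le> n"
  shows "\<tau> i \<le> \<tau> j"
  using assms(2,3)
proof (induction j)
  case (Suc j)
  then show ?case using assms(1)[of j] by (cases "i = Suc j") (auto intro: order_trans)
qed simp

lemma chain_disjoint:
  fixes \<tau> :: "nat \<Rightarrow> real"
  assumes "\<And>i. i < n \<Longrightarrow> \<tau> i \<le> \<tau> (Suc i)"
  shows "disjoint_family_on (\<lambda>i. {\<tau> i<..<\<tau> (Suc i)}) {..<n}"
proof -
  have *: "{\<tau> i<..<\<tau> (Suc i)} \<inter> {\<tau> j<..<\<tau> (Suc j)} = {}" if "i < j" "j < n" for i j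
    using chain_mono[of n \<tau> "Suc i" j] assms that by auto
  show ?thesis
    unfolding disjoint_family_on_def
  proof (intro ballI impI)
    fix i j assume "i \<in> {..<n}" "j \<in> {..<n}" "i \<noteq> j"
    then consider "i < j" "j < n" | "j < i" "i < n" by (auto simp: neq_iff)
    then show "{\<tau> i<..<\<tau> (Suc i)} \<inter> {\<tau> j<..<\<tau> (Suc j)} = {}"
      using *[of i j] *[of j i] by cases auto
  qed
qed

text \<open>
  \<open>V\<close> is the variation function, the supremum of the sums over chains from \<open>u\<close>; the bound 1
  makes it finite.
\<close>

lemma AC_on_variation_bound:
  fixes h :: "real \<Rightarrow> real"
  assumes bnd: "\<And>(n::nat) l r. (\<And>i. i < n \<Longrightarrow> u \<le> l i \<and> l i \<le> r i \<and> r i \<le> v) \<Longrightarrow>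
      disjoint_family_on (\<lambda>i. {l i<..<r i}) {..<n} \<Longrightarrow> (\<Sum>i<n. r i - l i) \<le> v - u \<Longrightarrow>
      (\<Sum>i<n. \<bar>h (r i) - h (l i)\<bar>) < 1"
  obtains V where "\<And>x y. u \<le> x \<Longrightarrow> x \<le> y \<Longrightarrow> y \<le> v \<Longrightarrow> \<bar>h y - h x\<bar> \<le> V y - V x"
proof -
  define Vs where "Vs = (\<lambda>x. {(\<Sum>i<n. \<bar>h (\<tau> (Suc i)) - h (\<tau> i)\<bar>) | (n::nat) \<tau>.
      (\<forall>i<n. \<tau> i \<le> \<tau> (Suc i)) \<and> \<tau> 0 = u \<and> \<tau> n = x})"
  define V where "V = (\<lambda>x. Sup (Vs x))"
  have ne: "Vs x \<noteq> {}" if "u \<le> x" for x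
  proof -
    define \<tau> where "\<tau> = (\<lambda>i::nat. if i = 0 then u else x)"
    have "(\<Sum>i<1. \<bar>h (\<tau> (Suc i)) - h (\<tau> i)\<bar>) \<in> Vs x"
      unfolding Vs_def mem_Collect_eq by (intro exI[of _ 1] exI[of _ \<tau>]) (use that in \<open>simp add: \<tau>_def\<close>)
    then show ?thesis by blast
  qed
  have bdd: "bdd_above (Vs x)" if "u \<le> x" "x \<le> v" for x
  proof (rule bdd_aboveI[of _ 1])
    fix s assume "s \<in> Vs x"
    then obtain n :: nat and \<tau> where n: "s = (\<Sum>i<n. \<bar>h (\<tau> (Suc i)) - h (\<tau> i)\<bar>)"
      "\<And>i. i < n \<Longrightarrow> \<tau> i \<le> \<tau> (Suc i)" "\<tau> 0 = u" "\<tau> n = x"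
      unfolding Vs_def by blast
    have "(\<Sum>i<n. \<bar>h (\<tau> (Suc i)) - h (\<tau> i)\<bar>) < 1"
    proof (rule bnd)
      fix i assume i: "i < n"
      have "\<tau> 0 \<le> \<tau> i" "\<tau> (Suc i) \<le> \<tau> n" using i by (auto intro!: chain_mono[where n = n and \<tau> = \<tau>] n(2))
      then show "u \<le> \<tau> i \<and> \<tau> i \<le> \<tau> (Suc i) \<and> \<tau> (Suc i) \<le> v" using n i that by auto
    next
      show "disjoint_family_on (\<lambda>i. {\<tau> i<..<\<tau> (Suc i)}) {..<n}" by (rule chain_disjoint[where n = n and \<tau> = \<tau>]) (rule n(2))
      show "(\<Sum>i<n. \<tau> (Suc i) - \<tau> i) \<le> v - u"
        using that n by (simp add: sum_lessThan_telescope)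
    qed
    then show "s \<le> 1" using n by simp
  qed
  show ?thesis
  proof (rule that)
    fix x y assume xy: "u \<le> x" "x \<le> y" "y \<le> v"
    have "s \<le> V y - \<bar>h y - h x\<bar>" if sV: "s \<in> Vs x" for s
    proof -
      obtain n :: nat and \<tau> where n: "s = (\<Sum>i<n. \<bar>h (\<tau> (Suc i)) - h (\<tau> i)\<bar>)"
        "\<And>i. i < n \<Longrightarrow> \<tau> i \<le> \<tau> (Suc i)" "\<tau> 0 = u" "\<tau> n = x"
        using sV unfolding Vs_def by blast
      define \<tau>' where "\<tau>' = \<tau>(Suc n := y)"
      have "(\<Sum>i<Suc n. \<bar>h (\<tau>' (Suc i)) - h (\<tau>' i)\<bar>) \<in> Vs y"
        unfolding Vs_def mem_Collect_eq
        by (intro exI[of _ "Suc n"] exI[of _ \<tau>']) (use n xy in \<open>auto simp: \<tau>'_def less_Suc_eq\<close>)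
      moreover have "(\<Sum>i<Suc n. \<bar>h (\<tau>' (Suc i)) - h (\<tau>' i)\<bar>) = s + \<bar>h y - h x\<bar>"
        using n by (simp add: \<tau>'_def)
      ultimately have "s + \<bar>h y - h x\<bar> \<le> V y"
        unfolding V_def using bdd[of y] xy by (intro cSup_upper) auto
      then show ?thesis by simp
    qed
    then have "V x \<le> V y - \<bar>h y - h x\<bar>"
      unfolding V_def using ne[OF xy(1)] by (intro cSup_least) auto
    then show "\<bar>h y - h x\<bar> \<le> V y - V x" by simp
  qed
qed

text \<open>
  On an interval of bounded variation \<open>h = V - (V - h)\<close> is a difference of monotone functions.
\<close>

lemma AC_on_differentiable_small:
  fixes h :: "real \<Rightarrow> real"
  assumes bnd: "\<And>(n::nat) l r. (\<And>i. i < n \<Longrightarrow> u \<le> l i \<and> l i \<le> r i \<and> r i \<le> v) \<Longrightarrow>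
      disjoint_family_on (\<lambda>i. {l i<..<r i}) {..<n} \<Longrightarrow> (\<Sum>i<n. r i - l i) \<le> v - u \<Longrightarrow>
      (\<Sum>i<n. \<bar>h (r i) - h (l i)\<bar>) < 1" and uv: "u \<le> v"
  shows "negligible {x \<in> {u<..<v}. \<not> h field_differentiable (at x)}"
proof -
  obtain V where V: "\<And>x y. u \<le> x \<Longrightarrow> x \<le> y \<Longrightarrow> y \<le> v \<Longrightarrow> \<bar>h y - h x\<bar> \<le> V y - V x"
  proof (rule AC_on_variation_bound[of u v h])
    show "(\<Sum>i<n. \<bar>h (r i) - h (l i)\<bar>) < 1"
      if "\<And>i. i < n \<Longrightarrow> u \<le> l i \<and> l i \<le> r i \<and> r i \<le> v"
        "disjoint_family_on (\<lambda>i. {l i<..<r i}) {..<n}" "(\<Sum>i<n. r i - l i) \<le> v - u" for n :: nat and l r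
      by (rule bnd) (use that in auto)
  qed (blast intro: that)
  \<comment> \<open>Extended by constants, both summands are monotone on the whole line.\<close>
  define cl where "cl = (\<lambda>x. max u (min v x))"
  define F where "F = (\<lambda>x. V (cl x))"
  define G where "G = (\<lambda>x. V (cl x) - h (cl x))"
  have cl: "u \<le> cl x" "cl x \<le> v" for x using uv by (auto simp: cl_def)
  have clm: "cl x \<le> cl y" if "x \<le> y" for x y using that by (auto simp: cl_def)
  have step: "\<bar>h (cl y) - h (cl x)\<bar> \<le> V (cl y) - V (cl x)" if "x \<le> y" for x y
    by (rule V[OF cl(1) clm[OF that] cl(2)])
  have "mono F"
  proof (rule monoI)
    fix x y :: real assume "x \<le> y" then show "F x \<le> F y" using step[of x y] by (simp add: F_def)
  qed
  moreover have "mono G"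
  proof (rule monoI)
    fix x y :: real assume "x \<le> y" then show "G x \<le> G y" using step[of x y] by (simp add: G_def abs_le_iff)
  qed
  ultimately have "negligible ({x. \<not> F field_differentiable (at x)} \<union> {x. \<not> G field_differentiable (at x)})"
    by (intro negligible_Un mono_differentiable_AE)
  moreover have "{x \<in> {u<..<v}. \<not> h field_differentiable (at x)}
      \<subseteq> {x. \<not> F field_differentiable (at x)} \<union> {x. \<not> G field_differentiable (at x)}"
  proof (rule subsetI, rule ccontr)
    fix x assume x: "x \<in> {x \<in> {u<..<v}. \<not> h field_differentiable (at x)}"
      and n: "x \<notin> {x. \<not> F field_differentiable (at x)} \<union> {x. \<not> G field_differentiable (at x)}"
    then have "(\<lambda>x. F x - G x) field_differentiable (at x)"
      by (intro field_differentiable_diff) auto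
    then obtain D where "((\<lambda>x. F x - G x) has_field_derivative D) (at x)"
      by (auto simp: field_differentiable_def)
    then have "(h has_field_derivative D) (at x)"
      by (rule has_field_derivative_transform_within_open[where S = "{u<..<v}"])
        (use x in \<open>auto simp: F_def G_def cl_def\<close>)
    then show False using x by (auto simp: field_differentiable_def)
  qed
  ultimately show ?thesis by (rule negligible_subset)
qed

text \<open>
  Countably many rational intervals, each shorter than the \<open>\<delta>\<close> belonging to \<open>\<epsilon> =
  1\<close>, cover \<open>(a, b)\<close>.
\<close>

lemma AC_on_differentiable_AE:
  assumes h: "h \<in> AC_on a b"
  shows "negligible {x \<in> {a<..<b}. \<not> h field_differentiable (at x)}"
proof -
  obtain \<delta> where \<delta>: "\<delta> > 0"
    "\<And>(n::nat) l u. (\<And>i. i < n \<Longrightarrow> a \<le> l i \<and> l i \<le> u i \<and> u i \<le> b) \<Longrightarrow>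
      disjoint_family_on (\<lambda>i. {l i<..<u i}) {..<n} \<Longrightarrow>
      (\<Sum>i<n. u i - l i) < \<delta> \<Longrightarrow> (\<Sum>i<n. \<bar>h (u i) - h (l i)\<bar>) < 1"
    using AC_onD[OF h zero_less_one] by blast
  define I where "I = {(u, v). u \<in> \<rat> \<and> v \<in> \<rat> \<and> a \<le> u \<and> u \<le> v \<and> v \<le> b \<and> v - u < \<delta>}"
  let ?N = "\<lambda>p. {x \<in> {fst p<..<snd p}. \<not> h field_differentiable (at x)}"
  have "countable I"
    by (rule countable_subset[of _ "\<rat> \<times> \<rat>"]) (auto simp: I_def countable_rat)
  moreover have "negligible (?N p)" if "p \<in> I" for p
  proof (rule AC_on_differentiable_small)
    show "fst p \<le> snd p" using that by (auto simp: I_def)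
    fix n :: nat and l r
    assume lr: "\<And>i. i < n \<Longrightarrow> fst p \<le> l i \<and> l i \<le> r i \<and> r i \<le> snd p"
      and dj: "disjoint_family_on (\<lambda>i. {l i<..<r i}) {..<n}" and s: "(\<Sum>i<n. r i - l i) \<le> snd p - fst p"
    have p: "a \<le> fst p" "snd p \<le> b" "snd p - fst p < \<delta>" using that by (auto simp: I_def)
    show "(\<Sum>i<n. \<bar>h (r i) - h (l i)\<bar>) < 1"
    proof (rule \<delta>(2)[OF _ dj])
      show "a \<le> l i \<and> l i \<le> r i \<and> r i \<le> b" if "i < n" for i using lr[OF that] p by linarith
      show "(\<Sum>i<n. r i - l i) < \<delta>" using s p by linarith
    qed
  qed
  ultimately have "negligible (\<Union>p\<in>I. ?N p)" by (intro negligible_countable_Union) auto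
  moreover have "{x \<in> {a<..<b}. \<not> h field_differentiable (at x)} \<subseteq> (\<Union>p\<in>I. ?N p)"
  proof
    fix x assume x: "x \<in> {x \<in> {a<..<b}. \<not> h field_differentiable (at x)}"
    have "max a (x - \<delta> / 2) < x" using x \<delta>(1) by simp
    then obtain u where u: "u \<in> \<rat>" "max a (x - \<delta> / 2) < u" "u < x" using Rats_dense_in_real by blast
    have "x < min b (x + \<delta> / 2)" using x \<delta>(1) by simp
    then obtain v where v: "v \<in> \<rat>" "x < v" "v < min b (x + \<delta> / 2)" using Rats_dense_in_real by blast
    have "(u, v) \<in> I" using u v by (simp add: I_def)
    moreover have "x \<in> ?N (u, v)" using x u v by simp
    ultimately show "x \<in> (\<Union>p\<in>I. ?N p)" by blast
  qed
  ultimately show ?thesis by (rule negligible_subset)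
qed

text \<open>
  Difference quotients over intervals around \<open>x\<close>, not only those with \<open>x\<close> as an end, approach
  the derivative.
\<close>

lemma straddle:
  fixes h :: "real \<Rightarrow> real"
  assumes "(h has_field_derivative D) (at x)" "\<epsilon> > 0"
  obtains d where "d > 0" "\<And>u v. u \<le> x \<Longrightarrow> x \<le> v \<Longrightarrow> x - u < d \<Longrightarrow> v - x < d \<Longrightarrow>
     \<bar>h v - h u - D * (v - u)\<bar> \<le> \<epsilon> * (v - u)"
proof -
  have "(h has_derivative (*) D) (at x)" using assms(1) by (simp add: has_field_derivative_def)
  then obtain d where d: "d > 0" "\<And>y. norm (y - x) < d \<Longrightarrow> norm (h y - h x - D * (y - x)) \<le> \<epsilon> * norm (y - x)"
    using assms(2) unfolding has_derivative_at_alt by blast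
  show ?thesis
  proof (rule that[OF d(1)])
    fix u v assume uv: "u \<le> x" "x \<le> v" "x - u < d" "v - x < d"
    have 1: "\<bar>h v - h x - D * (v - x)\<bar> \<le> \<epsilon> * (v - x)" using d(2)[of v] uv by simp
    have 2: "\<bar>h u - h x - D * (u - x)\<bar> \<le> \<epsilon> * (x - u)" using d(2)[of u] uv by simp
    have "h v - h u - D * (v - u) = (h v - h x - D * (v - x)) - (h u - h x - D * (u - x))"
      by (simp add: algebra_simps)
    also have "\<bar>\<dots>\<bar> \<le> \<epsilon> * (v - x) + \<epsilon> * (x - u)" using 1 2 by linarith
    also have "\<dots> = \<epsilon> * (v - u)" by (simp add: algebra_simps)
    finally show "\<bar>h v - h u - D * (v - u)\<bar> \<le> \<epsilon> * (v - u)" .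
  qed
qed

text \<open>
  A gauge argument: off the null set the increments are close to derivative times length, and the intervals tagged in
  the null set lie in an open set of small measure, where absolute continuity bounds the sum of the increments.
\<close>

lemma AC_on_FTC:
  assumes h: "h \<in> AC_on a b" and ab: "a \<le> b"
  shows "(deriv h has_integral (h b - h a)) {a..b}"
proof -
  define N where "N = {x \<in> {a<..<b}. \<not> h field_differentiable (at x)} \<union> {a, b}"
  \<comment> \<open>The value 0 on \<open>N\<close> removes the tags in \<open>N\<close> from the Riemann sums.\<close>
  define g where "g = (\<lambda>x. if x \<in> N then 0 else deriv h x)"
  have N: "negligible N"
    unfolding N_def by (intro negligible_Un AC_on_differentiable_AE[OF h]) simp
  have der: "(h has_field_derivative deriv h x) (at x)" if "x \<in> {a..b}" "x \<notin> N" for x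
    using that by (auto simp: N_def field_differentiable_derivI)
  have "(g has_integral (h b - h a)) {a..b}"
    unfolding has_integral_real
  proof (intro allI impI)
    fix e :: real assume "e > 0"
    define \<epsilon> where "\<epsilon> = e / (2 * (b - a + 1))"
    have \<epsilon>: "\<epsilon> > 0" "\<epsilon> * (b - a) \<le> e / 2"
    proof -
      show "\<epsilon> > 0" using \<open>e > 0\<close> ab by (simp add: \<epsilon>_def)
      have "\<epsilon> * (b - a) \<le> \<epsilon> * (b - a + 1)" using \<open>\<epsilon> > 0\<close> by simp
      also have "\<dots> = e / 2" using ab by (simp add: \<epsilon>_def field_simps)
      finally show "\<epsilon> * (b - a) \<le> e / 2" .
    qed
    obtain \<delta> where \<delta>: "\<delta> > 0"
      "\<And>P (l::real \<times> real set \<Rightarrow> real) u. finite P \<Longrightarrow> (\<And>i. i \<in> P \<Longrightarrow> a \<le> l i \<and> l i \<le> u i \<and> u i \<le> b) \<Longrightarrow>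
        disjoint_family_on (\<lambda>i. {l i<..<u i}) P \<Longrightarrow>
        (\<Sum>i\<in>P. u i - l i) < \<delta> \<Longrightarrow> (\<Sum>i\<in>P. \<bar>h (u i) - h (l i)\<bar>) < e / 2"
      using AC_on_finite[OF h half_gt_zero[OF \<open>e > 0\<close>], where 'b = "real \<times> real set"] by blast
    obtain N' where N': "N \<subseteq> N'" "N' \<in> lmeasurable" "measure lebesgue N' < \<delta> / 2"
      using N \<delta>(1) unfolding negligible_outer by (meson half_gt_zero)
    obtain U where U: "open U" "N' \<subseteq> U" "U - N' \<in> lmeasurable" "emeasure lebesgue (U - N') < ennreal (\<delta> / 2)"
      using sets_lebesgue_outer_open[OF fmeasurableD[OF N'(2)], of "\<delta> / 2"] \<delta>(1) by auto
    have UU: "U = N' \<union> (U - N')" using U(2) by blast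
    have Um: "U \<in> lmeasurable" using fmeasurable.Un[OF N'(2) U(3)] UU by simp
    have "measure lebesgue U \<le> measure lebesgue N' + measure lebesgue (U - N')"
      using measure_Un_le[OF fmeasurableD[OF N'(2)] fmeasurableD[OF U(3)]] UU by simp
    moreover have "measure lebesgue (U - N') < \<delta> / 2"
      using U(4) \<delta>(1) by (simp add: emeasure_eq_measure2[OF U(3)] ennreal_less_iff)
    ultimately have Ul: "measure lebesgue U < \<delta>" using N'(3) by linarith
    have "\<exists>d>0. (x \<in> N \<longrightarrow> ball x d \<subseteq> U) \<and> (x \<in> {a..b} - N \<longrightarrow> (\<forall>u v. u \<le> x \<and> x \<le> v \<and> x - u < d \<and> v - x < d \<longrightarrow>
       \<bar>h v - h u - deriv h x * (v - u)\<bar> \<le> \<epsilon> * (v - u)))" for x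
    proof (cases "x \<in> N")
      case True
      then obtain d where "d > 0" "ball x d \<subseteq> U" using N'(1) U(1,2) open_contains_ball by blast
      then show ?thesis using True by (intro exI[of _ d]) simp
    next
      case False
      show ?thesis
      proof (cases "x \<in> {a..b}")
        case True
        obtain d where "d > 0" "\<And>u v. u \<le> x \<Longrightarrow> x \<le> v \<Longrightarrow> x - u < d \<Longrightarrow> v - x < d \<Longrightarrow>
          \<bar>h v - h u - deriv h x * (v - u)\<bar> \<le> \<epsilon> * (v - u)"
          using straddle[OF der[OF True False] \<epsilon>(1)] by blast
        then show ?thesis using False by (intro exI[of _ d]) simp
      next
        case F: False
        then show ?thesis using False by (intro exI[of _ 1]) auto
      qed
    qed
    from choice[OF allI[OF this]] obtain dd where dd0: "\<forall>x. dd x > 0 \<and> (x \<in> N \<longrightarrow> ball x (dd x) \<subseteq> U)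
      \<and> (x \<in> {a..b} - N \<longrightarrow> (\<forall>u v. u \<le> x \<and> x \<le> v \<and> x - u < dd x \<and> v - x < dd x \<longrightarrow>
       \<bar>h v - h u - deriv h x * (v - u)\<bar> \<le> \<epsilon> * (v - u)))" ..
    have dd: "dd x > 0" "x \<in> N \<Longrightarrow> ball x (dd x) \<subseteq> U"
      "x \<in> {a..b} - N \<Longrightarrow> u \<le> x \<Longrightarrow> x \<le> v \<Longrightarrow> x - u < dd x \<Longrightarrow> v - x < dd x \<Longrightarrow>
       \<bar>h v - h u - deriv h x * (v - u)\<bar> \<le> \<epsilon> * (v - u)" for x u v
      using spec[OF dd0, of x] by simp_all
    define \<gamma> where "\<gamma> = (\<lambda>x. ball x (dd x))"
    have G1: "gauge \<gamma>" unfolding \<gamma>_def using dd(1) by (simp add: gauge_def)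
    have G2: "norm ((\<Sum>(x, k)\<in>p. measure lborel k *\<^sub>R g x) - (h b - h a)) < e"
      if p: "p tagged_division_of {a..b}" "\<gamma> fine p" for p
    proof -
      note pD = tagged_division_ofD[OF p(1)]
      have K: "snd c = {Inf (snd c)..Sup (snd c)} \<and> Inf (snd c) \<le> fst c \<and> fst c \<le> Sup (snd c)
          \<and> a \<le> Inf (snd c) \<and> Sup (snd c) \<le> b \<and> snd c \<subseteq> ball (fst c) (dd (fst c)) \<and> fst c \<in> {a..b}" if "c \<in> p" for c
      proof -
        obtain x k where c: "c = (x, k)" by (cases c)
        have xk: "(x, k) \<in> p" using that c by simp
        obtain l m where k: "k = cbox l m" using pD(4)[OF xk] by blast
        then have k': "k = {l..m}" by simp
        have x: "x \<in> {l..m}" using pD(2)[OF xk] k' by simp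
        then have lm: "l \<le> m" by simp
        have sub: "{l..m} \<subseteq> {a..b}" using pD(3)[OF xk] k' by simp
        have IS: "Inf k = l" "Sup k = m" using lm k' by auto
        have "k \<subseteq> \<gamma> x" using p(2) xk by (auto simp: fine_def)
        then have kb: "k \<subseteq> ball x (dd x)" by (simp add: \<gamma>_def)
        have ab': "a \<le> l \<and> m \<le> b" using sub lm by simp
        have x': "l \<le> x" "x \<le> m" "a \<le> x" "x \<le> b" using x ab' by auto
        have "k = {Inf k..Sup k}" unfolding IS by (rule k')
        then show ?thesis unfolding c fst_conv snd_conv using kb ab' x' IS by simp
      qed
      have Kle: "Inf (snd c) \<le> Sup (snd c) \<and> a \<le> Inf (snd c) \<and> Sup (snd c) \<le> b" if "c \<in> p" for c
        using K[OF that] by (blast intro: order_trans)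
      have KE: "{Inf (snd c)..Sup (snd c)} = snd c" if "c \<in> p" for c
        using K[OF that] by (elim conjE) (rule sym)
      have KS: "{Inf (snd c)..Sup (snd c)} \<subseteq> ball (fst c) (dd (fst c))" if "c \<in> p" for c
        unfolding KE[OF that] using K[OF that] by blast
      define \<phi> where "\<phi> = (\<lambda>c::real \<times> real set. h (Sup (snd c)) - h (Inf (snd c)))"
      define len where "len = (\<lambda>c::real \<times> real set. Sup (snd c) - Inf (snd c))"
      have cont: "measure lborel (snd c) = len c" if "c \<in> p" for c
        using measure_lborel_Icc[of "Inf (snd c)" "Sup (snd c)"] Kle[OF that] KE[OF that] by (simp add: len_def)
      have len0: "0 \<le> len c" if "c \<in> p" for c using Kle[OF that] by (simp add: len_def)
      have tele: "(\<Sum>c\<in>p. \<phi> c) = h b - h a"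
        using additive_tagged_division_1[OF ab p(1), of h] by (simp add: \<phi>_def case_prod_beta)
      have sumlen: "(\<Sum>c\<in>p. len c) = b - a"
        using additive_tagged_division_1[OF ab p(1), of "\<lambda>x. x"] by (simp add: len_def case_prod_beta)
      define P where "P = {c \<in> p. fst c \<in> N}"
      have fp: "finite p" "finite P" using pD(1) by (auto simp: P_def)
      have dj: "disjoint_family_on (\<lambda>c. {Inf (snd c)<..<Sup (snd c)}) P"
        unfolding disjoint_family_on_def
      proof (intro ballI impI)
        fix c c' assume c: "c \<in> P" "c' \<in> P" "c \<noteq> c'"
        then have cp: "c \<in> p" "c' \<in> p" by (auto simp: P_def)
        have "interior (snd c) \<inter> interior (snd c') = {}"
          using pD(5)[of "fst c" "snd c" "fst c'" "snd c'"] cp c(3) by simp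
        moreover have "interior (snd c) = {Inf (snd c)<..<Sup (snd c)}"
          using interior_atLeastAtMost_real[of "Inf (snd c)" "Sup (snd c)"] KE[OF cp(1)] by (simp only:)
        moreover have "interior (snd c') = {Inf (snd c')<..<Sup (snd c')}"
          using interior_atLeastAtMost_real[of "Inf (snd c')" "Sup (snd c')"] KE[OF cp(2)] by (simp only:)
        ultimately show "{Inf (snd c)<..<Sup (snd c)} \<inter> {Inf (snd c')<..<Sup (snd c')} = {}" by simp
      qed
      have "(\<Sum>c\<in>P. Sup (snd c) - Inf (snd c)) = (\<Sum>c\<in>P. measure lebesgue {Inf (snd c)<..<Sup (snd c)})"
      proof (rule sum.cong[OF refl])
        fix c assume "c \<in> P"
        then have "c \<in> p" by (simp add: P_def)
        from Kle[OF this] show "Sup (snd c) - Inf (snd c) = measure lebesgue {Inf (snd c)<..<Sup (snd c)}"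
          by simp
      qed
      also have "\<dots> = measure lebesgue (\<Union>c\<in>P. {Inf (snd c)<..<Sup (snd c)})"
      proof (rule measure_UNION'[symmetric, OF fp(2)])
        show "pairwise (\<lambda>i j. disjnt {Inf (snd i)<..<Sup (snd i)} {Inf (snd j)<..<Sup (snd j)}) P"
          using dj by (simp add: pairwise_def disjoint_family_on_def disjnt_def)
      qed simp
      also have "\<dots> \<le> measure lebesgue U"
      proof (rule measure_mono_fmeasurable[OF _ _ Um])
        show "(\<Union>c\<in>P. {Inf (snd c)<..<Sup (snd c)}) \<subseteq> U"
        proof (rule UN_least)
          fix c assume c: "c \<in> P"
          then have "c \<in> p" "fst c \<in> N" by (auto simp: P_def)
          have "{Inf (snd c)<..<Sup (snd c)} \<subseteq> {Inf (snd c)..Sup (snd c)}"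
            by (rule greaterThanLessThan_subseteq_atLeastAtMost_iff[THEN iffD2]) simp
          also note KS[OF \<open>c \<in> p\<close>]
          also note dd(2)[OF \<open>fst c \<in> N\<close>]
          finally show "{Inf (snd c)<..<Sup (snd c)} \<subseteq> U" .
        qed
        show "(\<Union>c\<in>P. {Inf (snd c)<..<Sup (snd c)}) \<in> sets lebesgue"
          using fp(2) by (intro sets.finite_UN) auto
      qed
      finally have "(\<Sum>c\<in>P. Sup (snd c) - Inf (snd c)) < \<delta>" using Ul by linarith
      then have small: "(\<Sum>c\<in>P. \<bar>\<phi> c\<bar>) < e / 2"
        unfolding \<phi>_def
      proof (intro \<delta>(2)[OF fp(2) _ dj])
        fix c assume "c \<in> P"
        then have "c \<in> p" by (simp add: P_def)
        from Kle[OF this] show "a \<le> Inf (snd c) \<and> Inf (snd c) \<le> Sup (snd c) \<and> Sup (snd c) \<le> b" by blast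
      qed
      have reg: "\<bar>measure lborel (snd c) * g (fst c) - \<phi> c\<bar> \<le> \<epsilon> * len c" if c: "c \<in> p - P" for c
      proof -
        have cp: "c \<in> p" and nN: "fst c \<notin> N" using c by (auto simp: P_def)
        have Kc: "Inf (snd c) \<le> fst c" "fst c \<le> Sup (snd c)" "fst c \<in> {a..b}" using K[OF cp] by blast+
        have "Inf (snd c) \<in> {Inf (snd c)..Sup (snd c)}" "Sup (snd c) \<in> {Inf (snd c)..Sup (snd c)}"
          using Kle[OF cp] by simp_all
        then have "Inf (snd c) \<in> ball (fst c) (dd (fst c))" "Sup (snd c) \<in> ball (fst c) (dd (fst c))"
          using KS[OF cp] by blast+
        then have "fst c - Inf (snd c) < dd (fst c)" "Sup (snd c) - fst c < dd (fst c)"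
          by (simp_all add: dist_real_def abs_less_iff)
        then have "\<bar>h (Sup (snd c)) - h (Inf (snd c)) - deriv h (fst c) * (Sup (snd c) - Inf (snd c))\<bar>
            \<le> \<epsilon> * (Sup (snd c) - Inf (snd c))"
          using dd(3)[of "fst c" "Inf (snd c)" "Sup (snd c)"] Kc nN by simp
        then have "\<bar>\<phi> c - deriv h (fst c) * len c\<bar> \<le> \<epsilon> * len c"
          by (simp only: \<phi>_def len_def)
        moreover have "measure lborel (snd c) * g (fst c) - \<phi> c = - (\<phi> c - deriv h (fst c) * len c)"
          using nN cont[OF cp] by (simp add: g_def)
        ultimately show ?thesis by (simp only: abs_minus_cancel)
      qed
      have "(\<Sum>(x, k)\<in>p. measure lborel k *\<^sub>R g x) - (h b - h a) = (\<Sum>c\<in>p. measure lborel (snd c) * g (fst c) - \<phi> c)"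
        using tele by (simp add: case_prod_beta sum_subtractf)
      also have "\<dots> = (\<Sum>c\<in>p - P. measure lborel (snd c) * g (fst c) - \<phi> c) + (\<Sum>c\<in>P. measure lborel (snd c) * g (fst c) - \<phi> c)"
        using fp by (intro sum.subset_diff) (auto simp: P_def)
      also have "(\<Sum>c\<in>P. measure lborel (snd c) * g (fst c) - \<phi> c) = (\<Sum>c\<in>P. - \<phi> c)"
        by (intro sum.cong) (auto simp: P_def g_def)
      finally have eq: "(\<Sum>(x, k)\<in>p. measure lborel k *\<^sub>R g x) - (h b - h a)
          = (\<Sum>c\<in>p - P. measure lborel (snd c) * g (fst c) - \<phi> c) + (\<Sum>c\<in>P. - \<phi> c)" .
      have A: "\<bar>\<Sum>c\<in>P. - \<phi> c\<bar> \<le> (\<Sum>c\<in>P. \<bar>\<phi> c\<bar>)" by (rule order_trans[OF sum_abs]) (simp only: abs_minus_cancel order_refl)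
      have "\<bar>\<Sum>c\<in>p - P. measure lborel (snd c) * g (fst c) - \<phi> c\<bar> \<le> (\<Sum>c\<in>p - P. \<epsilon> * len c)"
        by (rule order_trans[OF sum_abs sum_mono[OF reg]])
      also have "(\<Sum>c\<in>p - P. \<epsilon> * len c) \<le> (\<Sum>c\<in>p. \<epsilon> * len c)"
        using fp len0 \<epsilon>(1) by (intro sum_mono2) auto
      also have "\<dots> = \<epsilon> * (b - a)" by (simp only: sum_distrib_left[symmetric] sumlen)
      finally have B: "\<bar>\<Sum>c\<in>p - P. measure lborel (snd c) * g (fst c) - \<phi> c\<bar> \<le> \<epsilon> * (b - a)" .
      show ?thesis
        unfolding eq real_norm_def using A B small \<epsilon>(2) by linarith
    qed
    show "\<exists>\<gamma>. gauge \<gamma> \<and> (\<forall>\<D>. \<D> tagged_division_of {a..b} \<and> \<gamma> fine \<D> \<longrightarrow>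
        norm ((\<Sum>(x, k)\<in>\<D>. measure lborel k *\<^sub>R g x) - (h b - h a)) < e)"
    proof (intro exI[of _ \<gamma>] conjI allI impI G1)
      fix p assume "p tagged_division_of {a..b} \<and> \<gamma> fine p"
      then show "norm ((\<Sum>(x, k)\<in>p. measure lborel k *\<^sub>R g x) - (h b - h a)) < e"
        by (elim conjE) (rule G2)
    qed
  qed
  note hg = this
  show ?thesis
    by (rule has_integral_spike[OF N _ hg]) (simp add: g_def)
qed

lemma AC_on_deriv_measurable:
  assumes "h \<in> AC_on a b"
  shows "(\<lambda>x. deriv h x * indicator {a..b} x) \<in> borel_measurable lebesgue"
proof (cases "a \<le> b")
  case True
  show ?thesis by (rule has_integral_implies_lebesgue_measurable_real[OF AC_on_FTC[OF assms True]])
qed simp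

lemma energy_on_lebesgue: "energy_on a b h = (\<integral>\<^sup>+t. ennreal ((deriv h t * indicator {a..b} t)\<^sup>2) \<partial>lebesgue)"
  unfolding energy_on_def nn_integral_completion by (intro nn_integral_cong) (simp add: indicator_def)

text \<open>The affine function has the least energy for given end values.\<close>

lemma energy_on_ge:
  assumes h: "h \<in> AC_on a b" and ab: "a < b"
  shows "ennreal ((h b - h a)\<^sup>2 / (b - a)) \<le> energy_on a b h"
proof (cases "energy_on a b h = \<infinity>")
  case False
  define F where "F = (\<lambda>x. deriv h x * indicator {a..b} x)"
  define D where "D = h b - h a"
  define l where "l = D / (b - a)"
  have Fm[measurable]: "F \<in> borel_measurable lebesgue" unfolding F_def by (rule AC_on_deriv_measurable[OF h])
  have E: "energy_on a b h = (\<integral>\<^sup>+t. ennreal ((F t)\<^sup>2) \<partial>lebesgue)" unfolding energy_on_lebesgue F_def ..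
  have I2: "integrable lebesgue (\<lambda>t. (F t)\<^sup>2)"
    by (rule integrableI_nonneg) (use False E in \<open>auto simp: top.not_eq_extremum\<close>)
  have Ii: "integrable lebesgue (\<lambda>t. indicator {a..b} t :: real)"
    by (rule integrable_real_indicator) (auto simp: emeasure_lborel_Icc_eq)
  have I1: "integrable lebesgue F"
  proof (rule Bochner_Integration.integrable_bound)
    show "integrable lebesgue (\<lambda>t. indicator {a..b} t + (F t)\<^sup>2)" using Ii I2 by simp
    show "AE t in lebesgue. norm (F t) \<le> norm (indicator {a..b} t + (F t)\<^sup>2)"
    proof (rule AE_I2)
      fix t
      have "\<bar>y\<bar> \<le> 1 + y\<^sup>2" for y :: real
      proof -
        have "0 \<le> (\<bar>y\<bar> - 1)\<^sup>2" by simp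
        then show ?thesis by (simp add: power2_eq_square algebra_simps)
      qed
      from this[of "F t"] show "norm (F t) \<le> norm (indicator {a..b} t + (F t)\<^sup>2)"
        by (cases "t \<in> {a..b}") (auto simp: F_def)
    qed
  qed simp
  have "(F has_integral D) UNIV"
  proof -
    have "((\<lambda>x. if x \<in> {a..b} then deriv h x else 0) has_integral D) UNIV"
      using AC_on_FTC[OF h less_imp_le[OF ab]] has_integral_restrict_UNIV[of "{a..b}" "deriv h"] by (simp add: D_def)
    moreover have "(\<lambda>x. if x \<in> {a..b} then deriv h x else 0) = F" by (auto simp: F_def)
    ultimately show ?thesis by simp
  qed
  then have IF: "integral\<^sup>L lebesgue F = D"
    using has_integral_integral_lebesgue[OF I1] has_integral_unique by blast
  \<comment> \<open>The square lies above its tangent at the mean slope \<open>l\<close>.\<close>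
  have "(\<integral>t. 2 * l * F t - l\<^sup>2 * indicator {a..b} t \<partial>lebesgue) \<le> (\<integral>t. (F t)\<^sup>2 \<partial>lebesgue)"
  proof (rule integral_mono)
    show "integrable lebesgue (\<lambda>t. 2 * l * F t - l\<^sup>2 * indicator {a..b} t)" using I1 Ii by simp
    show "integrable lebesgue (\<lambda>t. (F t)\<^sup>2)" by (rule I2)
    show "2 * l * F t - l\<^sup>2 * indicator {a..b} t \<le> (F t)\<^sup>2" for t
    proof (cases "t \<in> {a..b}")
      case True
      have "0 \<le> (F t - l)\<^sup>2" by simp
      then show ?thesis using True by (simp add: power2_eq_square algebra_simps)
    qed (simp add: F_def)
  qed
  also have "(\<integral>t. 2 * l * F t - l\<^sup>2 * indicator {a..b} t \<partial>lebesgue) = 2 * l * D - l\<^sup>2 * (b - a)"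
    using I1 Ii ab by (simp add: IF)
  also have "\<dots> = D\<^sup>2 / (b - a)"
  proof -
    have "l * (b - a) = D" using ab by (simp add: l_def)
    then have "l\<^sup>2 * (b - a) = l * D" by (simp add: power2_eq_square mult.assoc)
    moreover have "D\<^sup>2 / (b - a) = l * D" by (simp add: l_def power2_eq_square)
    ultimately show ?thesis by simp
  qed
  finally have "ennreal (D\<^sup>2 / (b - a)) \<le> ennreal (\<integral>t. (F t)\<^sup>2 \<partial>lebesgue)" by (rule ennreal_leI)
  also have "\<dots> = energy_on a b h"
    unfolding E by (rule nn_integral_eq_integral[symmetric, OF I2]) simp
  finally show ?thesis by (simp add: D_def)
qed simp

lemma energy_on_split:
  assumes h: "h \<in> AC_on a c" and "a \<le> b" "b \<le> c"
  shows "energy_on a c h = energy_on a b h + energy_on b c h"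
proof -
  define F where "F = (\<lambda>x. deriv h x * indicator {a..c} x)"
  have Fm[measurable]: "F \<in> borel_measurable lebesgue" unfolding F_def by (rule AC_on_deriv_measurable[OF h])
  have sub: "energy_on x y h = (\<integral>\<^sup>+t. ennreal ((F t)\<^sup>2) * indicator {x..y} t \<partial>lebesgue)" if "a \<le> x" "y \<le> c" for x y
    unfolding energy_on_lebesgue using that
    by (intro nn_integral_cong) (auto simp: F_def indicator_def)
  have nb: "AE t in lebesgue. t \<noteq> b"
    using AE_lborel_singleton[of b] by (rule AE_completion)
  have "energy_on a c h = (\<integral>\<^sup>+t. ennreal ((F t)\<^sup>2) * indicator {a..b} t + ennreal ((F t)\<^sup>2) * indicator {b..c} t \<partial>lebesgue)"
    unfolding sub[OF order_refl order_refl]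
    by (rule nn_integral_cong_AE) (use nb in eventually_elim, use assms in \<open>auto simp: indicator_def\<close>)
  also have "\<dots> = energy_on a b h + energy_on b c h"
  proof (subst nn_integral_add)
    show "(\<integral>\<^sup>+ t\<in>{a..b}. ennreal ((F t)\<^sup>2) \<partial>lebesgue) + (\<integral>\<^sup>+ t\<in>{b..c}. ennreal ((F t)\<^sup>2) \<partial>lebesgue)
      = energy_on a b h + energy_on b c h"
      using assms by (simp add: sub)
  qed measurable
  finally show ?thesis .
qed

lemma energy_on_mono:
  assumes "a \<le> a'" "b' \<le> b"
  shows "energy_on a' b' h \<le> energy_on a b h"
  unfolding energy_on_def using assms by (intro nn_integral_mono) (auto simp: indicator_def)

lemma energy_on_grid_ge:
  assumes h: "h \<in> AC_on s (s + real n * \<delta>)" and "\<delta> > 0"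
  shows "ennreal ((\<Sum>i<n. (h (s + real (Suc i) * \<delta>) - h (s + real i * \<delta>))\<^sup>2) / \<delta>) \<le> energy_on s (s + real n * \<delta>) h"
  using h
proof (induction n)
  case (Suc n)
  have le: "s \<le> s + real n * \<delta>" "s + real n * \<delta> < s + real (Suc n) * \<delta>" using assms(2) by (auto simp: algebra_simps)
  have h1: "h \<in> AC_on s (s + real n * \<delta>)" "h \<in> AC_on (s + real n * \<delta>) (s + real (Suc n) * \<delta>)"
    using AC_on_subset[OF Suc.prems] le by auto
  have len: "s + real (Suc n) * \<delta> - (s + real n * \<delta>) = \<delta>" by (simp add: algebra_simps)
  have "ennreal ((\<Sum>i<Suc n. (h (s + real (Suc i) * \<delta>) - h (s + real i * \<delta>))\<^sup>2) / \<delta>)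
    = ennreal ((\<Sum>i<n. (h (s + real (Suc i) * \<delta>) - h (s + real i * \<delta>))\<^sup>2) / \<delta>)
      + ennreal ((h (s + real (Suc n) * \<delta>) - h (s + real n * \<delta>))\<^sup>2 / \<delta>)"
    using assms(2) by (subst ennreal_plus[symmetric]) (auto simp: add_divide_distrib sum_nonneg)
  also have "\<dots> \<le> energy_on s (s + real n * \<delta>) h + energy_on (s + real n * \<delta>) (s + real (Suc n) * \<delta>) h"
    using Suc.IH[OF h1(1)] energy_on_ge[OF h1(2) le(2)] unfolding len by (rule add_mono)
  also have "\<dots> = energy_on s (s + real (Suc n) * \<delta>) h"
    by (rule energy_on_split[symmetric, OF Suc.prems]) (use le in auto)
  finally show ?case .
qed simp

section \<open>The taut string attains the infimum\<close>

lemma AE_lebesgue_negligible: "negligible N \<Longrightarrow> AE x in lebesgue. x \<notin> N"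
  by (simp add: negligible_iff_null_sets AE_not_in)

text \<open>
  The squared difference quotients over finer and finer grids converge almost everywhere to the squared derivative, so
  this is Fatou's lemma. It makes the energy lower semicontinuous under pointwise limits.
\<close>

lemma energy_on_le_grid:
  fixes h :: "real \<Rightarrow> real"
  assumes h: "h \<in> AC_on 0 T" and T: "0 < T"
    and grid: "\<And>n::nat. 0 < n \<Longrightarrow>
      (\<Sum>i<n. (h (real (Suc i) * (T / real n)) - h (real i * (T / real n)))\<^sup>2) / (T / real n) \<le> M"
  shows "energy_on 0 T h \<le> ennreal M"
proof -
  define \<delta> where "\<delta> = (\<lambda>m. T / real (Suc m))"
  define c where "c = (\<lambda>m i. (h (real (Suc i) * \<delta> m) - h (real i * \<delta> m)) / \<delta> m)"
  define u where "u = (\<lambda>m t. \<Sum>i<Suc m. ennreal ((c m i)\<^sup>2) * indicator {real i * \<delta> m..<real (Suc i) * \<delta> m} t)"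
  have \<delta>0: "0 < \<delta> m" for m using T by (simp add: \<delta>_def)
  have um[measurable]: "u m \<in> borel_measurable lebesgue" for m
    unfolding u_def by measurable
  have int: "(\<integral>\<^sup>+t. u m t \<partial>lebesgue) \<le> ennreal M" for m
  proof -
    have "(\<integral>\<^sup>+t. u m t \<partial>lebesgue)
        = (\<Sum>i<Suc m. \<integral>\<^sup>+t. ennreal ((c m i)\<^sup>2) * indicator {real i * \<delta> m..<real (Suc i) * \<delta> m} t \<partial>lebesgue)"
      unfolding u_def
      by (rule nn_integral_sum) measurable
    also have "\<dots> = (\<Sum>i<Suc m. ennreal ((c m i)\<^sup>2) * ennreal (\<delta> m))"
    proof (rule sum.cong[OF refl])
      fix i
      have "real i * \<delta> m \<le> real (Suc i) * \<delta> m" using \<delta>0[of m] by simp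
      moreover have "real (Suc i) * \<delta> m - real i * \<delta> m = \<delta> m" by (simp add: algebra_simps)
      ultimately have "emeasure lborel {real i * \<delta> m..<real (Suc i) * \<delta> m} = ennreal (\<delta> m)"
        using emeasure_lborel_Ico by metis
      then show "(\<integral>\<^sup>+t. ennreal ((c m i)\<^sup>2) * indicator {real i * \<delta> m..<real (Suc i) * \<delta> m} t \<partial>lebesgue)
          = ennreal ((c m i)\<^sup>2) * ennreal (\<delta> m)"
        unfolding nn_integral_completion by (subst nn_integral_cmult_indicator) simp_all
    qed
    also have "\<dots> = ennreal (\<Sum>i<Suc m. (c m i)\<^sup>2 * \<delta> m)"
      using \<delta>0[of m] by (subst sum_ennreal[symmetric]) (auto simp: ennreal_mult less_imp_le intro!: sum.cong)
    also have "(\<Sum>i<Suc m. (c m i)\<^sup>2 * \<delta> m)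
       = (\<Sum>i<Suc m. (h (real (Suc i) * \<delta> m) - h (real i * \<delta> m))\<^sup>2) / \<delta> m"
      unfolding sum_divide_distrib
      by (rule sum.cong[OF refl]) (use \<delta>0[of m] in \<open>simp add: c_def power_divide power2_eq_square\<close>)
    also have "ennreal \<dots> \<le> ennreal M"
      using grid[of "Suc m"] by (intro ennreal_leI) (simp only: \<delta>_def zero_less_Suc)
    finally show ?thesis .
  qed
  have "energy_on 0 T h \<le> (\<integral>\<^sup>+t. liminf (\<lambda>m. u m t) \<partial>lebesgue)"
    unfolding energy_on_lebesgue
  proof (rule nn_integral_mono_AE)
    have "AE t in lebesgue. t \<notin> {x \<in> {0<..<T}. \<not> h field_differentiable (at x)} \<union> {0, T}"
      by (intro AE_lebesgue_negligible negligible_Un AC_on_differentiable_AE[OF h]) simp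
    then show "AE t in lebesgue. ennreal ((deriv h t * indicator {0..T} t)\<^sup>2) \<le> liminf (\<lambda>m. u m t)"
    proof eventually_elim
      case (elim t)
      show ?case
      proof (cases "t \<in> {0..T}")
        case True
        then have t: "0 < t" "t < T" using elim by auto
        have der: "(h has_field_derivative deriv h t) (at t)"
          using elim t by (auto simp: field_differentiable_derivI)
        define i where "i = (\<lambda>m. nat \<lfloor>t / \<delta> m\<rfloor>)"
        have i: "real (i m) * \<delta> m \<le> t" "t < real (Suc (i m)) * \<delta> m" "i m < Suc m" for m
        proof -
          have n: "0 \<le> t / \<delta> m" using t \<delta>0[of m] by simp
          have ri: "real (i m) = of_int \<lfloor>t / \<delta> m\<rfloor>" using n by (simp add: i_def)
          have "real (i m) \<le> t / \<delta> m" unfolding ri by (rule of_int_floor_le)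
          then show 1: "real (i m) * \<delta> m \<le> t" using \<delta>0[of m] by (simp add: pos_le_divide_eq)
          have "t / \<delta> m < real (i m) + 1" unfolding ri by (rule floor_correct[THEN conjunct2, simplified])
          then show "t < real (Suc (i m)) * \<delta> m" using \<delta>0[of m] by (simp add: pos_divide_less_eq add.commute)
          have "real (i m) * \<delta> m < real (Suc m) * \<delta> m" using 1 t(2) T by (simp add: \<delta>_def)
          then show "i m < Suc m" using \<delta>0[of m] by simp
        qed
        have ge: "ennreal ((c m (i m))\<^sup>2) \<le> u m t" for m
        proof -
          have "ennreal ((c m (i m))\<^sup>2) = ennreal ((c m (i m))\<^sup>2) * indicator {real (i m) * \<delta> m..<real (Suc (i m)) * \<delta> m} t"
            using i[of m] by simp
          also have "\<dots> \<le> u m t" unfolding u_def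
            by (rule member_le_sum) (use i(3)[of m] in auto)
          finally show ?thesis .
        qed
        have "(\<lambda>m. c m (i m)) \<longlonglongrightarrow> deriv h t"
        proof (rule LIMSEQ_I)
          fix e :: real assume "e > 0"
          obtain d where d: "d > 0" "\<And>u v. u \<le> t \<Longrightarrow> t \<le> v \<Longrightarrow> t - u < d \<Longrightarrow> v - t < d \<Longrightarrow>
             \<bar>h v - h u - deriv h t * (v - u)\<bar> \<le> e / 2 * (v - u)"
            using straddle[OF der half_gt_zero[OF \<open>e > 0\<close>]] by blast
          have "\<delta> \<longlonglongrightarrow> 0" unfolding \<delta>_def by (rule LIMSEQ_Suc[OF lim_const_over_n])
          then have "eventually (\<lambda>m. \<delta> m < d) sequentially" using d(1) by (rule order_tendstoD)
          then obtain m0 where m0: "\<And>m. m \<ge> m0 \<Longrightarrow> \<delta> m < d" by (auto simp: eventually_sequentially)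
          show "\<exists>no. \<forall>n\<ge>no. norm (c n (i n) - deriv h t) < e"
          proof (intro exI[of _ m0] allI impI)
            fix m assume m: "m0 \<le> m"
            have len: "real (Suc (i m)) * \<delta> m - real (i m) * \<delta> m = \<delta> m" by (simp add: algebra_simps)
            have "\<bar>h (real (Suc (i m)) * \<delta> m) - h (real (i m) * \<delta> m) - deriv h t * \<delta> m\<bar> \<le> e / 2 * \<delta> m"
              using d(2)[of "real (i m) * \<delta> m" "real (Suc (i m)) * \<delta> m", unfolded len] i[of m] len m0[OF m] by linarith
            moreover have "h (real (Suc (i m)) * \<delta> m) - h (real (i m) * \<delta> m) = c m (i m) * \<delta> m"
              using \<delta>0[of m] by (simp add: c_def)
            ultimately have "\<bar>(c m (i m) - deriv h t) * \<delta> m\<bar> \<le> e / 2 * \<delta> m" by (simp add: algebra_simps)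
            then have "\<bar>c m (i m) - deriv h t\<bar> * \<delta> m \<le> e / 2 * \<delta> m" using \<delta>0[of m] by (simp add: abs_mult)
            then have "\<bar>c m (i m) - deriv h t\<bar> \<le> e / 2" using \<delta>0[of m] by simp
            then show "norm (c m (i m) - deriv h t) < e" using \<open>e > 0\<close> by simp
          qed
        qed
        then have "(\<lambda>m. ennreal ((c m (i m))\<^sup>2)) \<longlonglongrightarrow> ennreal ((deriv h t)\<^sup>2)"
          by (intro tendsto_ennrealI tendsto_power)
        then have "liminf (\<lambda>m. ennreal ((c m (i m))\<^sup>2)) = ennreal ((deriv h t)\<^sup>2)"
          by (intro lim_imp_Liminf) auto
        moreover have "liminf (\<lambda>m. ennreal ((c m (i m))\<^sup>2)) \<le> liminf (\<lambda>m. u m t)"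
          by (intro Liminf_mono always_eventually allI ge)
        ultimately show ?thesis using True by simp
      qed simp
    qed
  qed
  also have "\<dots> \<le> liminf (\<lambda>m. \<integral>\<^sup>+t. u m t \<partial>lebesgue)" by (rule nn_integral_liminf) measurable
  also have "\<dots> \<le> ennreal M"
  proof -
    have "liminf (\<lambda>m. \<integral>\<^sup>+t. u m t \<partial>lebesgue) \<le> liminf (\<lambda>m. ennreal M)"
      by (intro Liminf_mono always_eventually allI int)
    then show ?thesis by (simp add: Liminf_const)
  qed
  finally show ?thesis .
qed

lemma AC_on_half_sum:
  assumes f: "f \<in> AC_on a b" and g: "g \<in> AC_on a b" and s: "\<bar>s\<bar> = 1"
  shows "(\<lambda>x. (f x + s * g x) / 2) \<in> AC_on a b"
  unfolding AC_on_def mem_Collect_eq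
proof (intro allI impI)
  fix e :: real assume "e > 0"
  obtain d1 where d1: "d1 > 0"
    "\<And>(n::nat) l u. (\<And>i. i < n \<Longrightarrow> a \<le> l i \<and> l i \<le> u i \<and> u i \<le> b) \<Longrightarrow>
      disjoint_family_on (\<lambda>i. {l i<..<u i}) {..<n} \<Longrightarrow>
      (\<Sum>i<n. u i - l i) < d1 \<Longrightarrow> (\<Sum>i<n. \<bar>f (u i) - f (l i)\<bar>) < e"
    using AC_onD[OF f \<open>e > 0\<close>] by blast
  obtain d2 where d2: "d2 > 0"
    "\<And>(n::nat) l u. (\<And>i. i < n \<Longrightarrow> a \<le> l i \<and> l i \<le> u i \<and> u i \<le> b) \<Longrightarrow>
      disjoint_family_on (\<lambda>i. {l i<..<u i}) {..<n} \<Longrightarrow>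
      (\<Sum>i<n. u i - l i) < d2 \<Longrightarrow> (\<Sum>i<n. \<bar>g (u i) - g (l i)\<bar>) < e"
    using AC_onD[OF g \<open>e > 0\<close>] by blast
  show "\<exists>\<delta>>0. \<forall>(n::nat) l u. (\<forall>i<n. a \<le> l i \<and> l i \<le> u i \<and> u i \<le> b) \<longrightarrow>
      disjoint_family_on (\<lambda>i. {l i<..<u i}) {..<n} \<longrightarrow> (\<Sum>i<n. u i - l i) < \<delta> \<longrightarrow>
      (\<Sum>i<n. \<bar>(f (u i) + s * g (u i)) / 2 - (f (l i) + s * g (l i)) / 2\<bar>) < e"
  proof (intro exI[of _ "min d1 d2"] conjI allI impI)
    fix n :: nat and l u
    assume lu: "\<forall>i<n. a \<le> l i \<and> l i \<le> u i \<and> u i \<le> b"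
      and dj: "disjoint_family_on (\<lambda>i. {l i<..<u i}) {..<n}" and sm: "(\<Sum>i<n. u i - l i) < min d1 d2"
    have 1: "(\<Sum>i<n. \<bar>f (u i) - f (l i)\<bar>) < e" by (rule d1(2)[OF _ dj]) (use lu sm in auto)
    have 2: "(\<Sum>i<n. \<bar>g (u i) - g (l i)\<bar>) < e" by (rule d2(2)[OF _ dj]) (use lu sm in auto)
    have "(\<Sum>i<n. \<bar>(f (u i) + s * g (u i)) / 2 - (f (l i) + s * g (l i)) / 2\<bar>)
        \<le> (\<Sum>i<n. (\<bar>f (u i) - f (l i)\<bar> + \<bar>g (u i) - g (l i)\<bar>) / 2)"
    proof (rule sum_mono)
      fix i
      have "(f (u i) + s * g (u i)) / 2 - (f (l i) + s * g (l i)) / 2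
         = (f (u i) - f (l i)) / 2 + s * (g (u i) - g (l i)) / 2" by (simp add: field_simps)
      also have "\<bar>\<dots>\<bar> \<le> \<bar>(f (u i) - f (l i)) / 2\<bar> + \<bar>s * (g (u i) - g (l i)) / 2\<bar>" by (rule abs_triangle_ineq)
      also have "\<dots> = (\<bar>f (u i) - f (l i)\<bar> + \<bar>g (u i) - g (l i)\<bar>) / 2" using s by (simp add: abs_mult add_divide_distrib)
      finally show "\<bar>(f (u i) + s * g (u i)) / 2 - (f (l i) + s * g (l i)) / 2\<bar>
         \<le> (\<bar>f (u i) - f (l i)\<bar> + \<bar>g (u i) - g (l i)\<bar>) / 2" .
    qed
    also have "\<dots> = ((\<Sum>i<n. \<bar>f (u i) - f (l i)\<bar>) + (\<Sum>i<n. \<bar>g (u i) - g (l i)\<bar>)) / 2"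
      by (simp only: sum_divide_distrib[symmetric] sum.distrib)
    also have "\<dots> < e" using add_strict_mono[OF 1 2] by simp
    finally show "(\<Sum>i<n. \<bar>(f (u i) + s * g (u i)) / 2 - (f (l i) + s * g (l i)) / 2\<bar>) < e" .
  qed (use d1(1) d2(1) in simp)
qed

lemma energy_parallelogram:
  assumes f: "f \<in> AC_on a b" and g: "g \<in> AC_on a b"
  shows "2 * (energy_on a b (\<lambda>x. (f x + (-1) * g x) / 2) + energy_on a b (\<lambda>x. (f x + 1 * g x) / 2))
     = energy_on a b f + energy_on a b g"
proof -
  define F where "F = (\<lambda>x. deriv f x * indicator {a..b} x)"
  define G where "G = (\<lambda>x. deriv g x * indicator {a..b} x)"
  have [measurable]: "F \<in> borel_measurable lebesgue" "G \<in> borel_measurable lebesgue"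
    unfolding F_def G_def by (intro AC_on_deriv_measurable f g)+
  let ?N = "({x \<in> {a<..<b}. \<not> f field_differentiable (at x)} \<union> {x \<in> {a<..<b}. \<not> g field_differentiable (at x)}) \<union> {a, b}"
  have AE: "AE x in lebesgue. x \<notin> ?N"
    by (intro AE_lebesgue_negligible negligible_Un AC_on_differentiable_AE f g) simp
  have E: "energy_on a b (\<lambda>x. (f x + s * g x) / 2) = (\<integral>\<^sup>+x. ennreal (((F x + s * G x) / 2)\<^sup>2) \<partial>lebesgue)" for s
    unfolding energy_on_lebesgue
  proof (rule nn_integral_cong_AE)
    show "AE x in lebesgue. ennreal ((deriv (\<lambda>x. (f x + s * g x) / 2) x * indicator {a..b} x)\<^sup>2)
        = ennreal (((F x + s * G x) / 2)\<^sup>2)"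
      using AE
    proof eventually_elim
      case (elim x)
      show ?case
      proof (cases "x \<in> {a..b}")
        case True
        then have "f field_differentiable (at x)" "g field_differentiable (at x)" using elim by auto
        then have "(f has_field_derivative deriv f x) (at x)" "(g has_field_derivative deriv g x) (at x)"
          by (auto simp: field_differentiable_derivI)
        then have "((\<lambda>x. (f x + s * g x) / 2) has_field_derivative (deriv f x + s * deriv g x) / 2) (at x)"
          by (auto intro!: derivative_eq_intros)
        then have d: "deriv (\<lambda>x. (f x + s * g x) / 2) x = (deriv f x + s * deriv g x) / 2" by (rule DERIV_imp_deriv)
        show ?thesis unfolding d F_def G_def using True by simp
      qed (simp add: F_def G_def)
    qed
  qed
  have "2 * (energy_on a b (\<lambda>x. (f x + (-1) * g x) / 2) + energy_on a b (\<lambda>x. (f x + 1 * g x) / 2))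
    = (\<integral>\<^sup>+x. 2 * (ennreal (((F x + (-1) * G x) / 2)\<^sup>2) + ennreal (((F x + 1 * G x) / 2)\<^sup>2)) \<partial>lebesgue)"
    unfolding E by (simp add: nn_integral_cmult nn_integral_add)
  also have "\<dots> = (\<integral>\<^sup>+x. ennreal ((F x)\<^sup>2) + ennreal ((G x)\<^sup>2) \<partial>lebesgue)"
  proof (rule nn_integral_cong)
    fix x
    have "2 * (ennreal p + ennreal q) = ennreal (2 * (p + q))" if "0 \<le> p" "0 \<le> q" for p q
      using ennreal_mult'[of 2 "p + q"] ennreal_plus[OF that] by simp
    then have "2 * (ennreal (((F x + (-1) * G x) / 2)\<^sup>2) + ennreal (((F x + 1 * G x) / 2)\<^sup>2))
      = ennreal (2 * (((F x + (-1) * G x) / 2)\<^sup>2 + ((F x + 1 * G x) / 2)\<^sup>2))" by simp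
    also have "2 * (((F x + (-1) * G x) / 2)\<^sup>2 + ((F x + 1 * G x) / 2)\<^sup>2) = (F x)\<^sup>2 + (G x)\<^sup>2"
      by (simp add: power2_eq_square field_simps)
    finally show "2 * (ennreal (((F x + (-1) * G x) / 2)\<^sup>2) + ennreal (((F x + 1 * G x) / 2)\<^sup>2))
      = ennreal ((F x)\<^sup>2) + ennreal ((G x)\<^sup>2)" by (simp add: ennreal_plus)
  qed
  also have "\<dots> = energy_on a b f + energy_on a b g"
  proof -
    have "energy_on a b f = (\<integral>\<^sup>+x. ennreal ((F x)\<^sup>2) \<partial>lebesgue)" "energy_on a b g = (\<integral>\<^sup>+x. ennreal ((G x)\<^sup>2) \<partial>lebesgue)"
      by (simp_all only: energy_on_lebesgue F_def G_def)
    then show ?thesis by (simp add: nn_integral_add)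
  qed
  finally show ?thesis .
qed

lemma energy_on_disjoint_le:
  assumes h: "h \<in> AC_on a b" and "finite P"
    and lu: "\<And>i. i \<in> P \<Longrightarrow> a \<le> l i \<and> l i \<le> u i \<and> u i \<le> b"
    and dj: "disjoint_family_on (\<lambda>i. {l i<..<u i}) P"
  shows "(\<Sum>i\<in>P. energy_on (l i) (u i) h) \<le> energy_on a b h"
proof -
  define F where "F = (\<lambda>x. deriv h x * indicator {a..b} x)"
  have [measurable]: "F \<in> borel_measurable lebesgue" unfolding F_def by (rule AC_on_deriv_measurable[OF h])
  have E: "energy_on (l i) (u i) h = (\<integral>\<^sup>+t. ennreal ((F t)\<^sup>2) * indicator {l i<..<u i} t \<partial>lebesgue)" if "i \<in> P" for i
    unfolding energy_on_lebesgue
  proof (rule nn_integral_cong_AE)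
    have "AE t in lebesgue. t \<notin> {l i, u i}" by (rule AE_lebesgue_negligible) simp
    then show "AE t in lebesgue. ennreal ((deriv h t * indicator {l i..u i} t)\<^sup>2) = ennreal ((F t)\<^sup>2) * indicator {l i<..<u i} t"
    proof eventually_elim
      case (elim t)
      then show ?case using lu[OF that] by (auto simp: F_def indicator_def)
    qed
  qed
  have "(\<Sum>i\<in>P. energy_on (l i) (u i) h) = (\<integral>\<^sup>+t. (\<Sum>i\<in>P. ennreal ((F t)\<^sup>2) * indicator {l i<..<u i} t) \<partial>lebesgue)"
    by (subst nn_integral_sum) (auto simp: E intro!: sum.cong)
  also have "\<dots> \<le> (\<integral>\<^sup>+t. ennreal ((F t)\<^sup>2) \<partial>lebesgue)"
  proof (rule nn_integral_mono)
    fix t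
    have "(\<Sum>i\<in>P. indicator {l i<..<u i} t) = (indicator (\<Union>i\<in>P. {l i<..<u i}) t :: ennreal)"
      by (rule indicator_UN_disjoint[symmetric, OF \<open>finite P\<close> dj])
    then have "(\<Sum>i\<in>P. ennreal ((F t)\<^sup>2) * indicator {l i<..<u i} t) = ennreal ((F t)\<^sup>2) * indicator (\<Union>i\<in>P. {l i<..<u i}) t"
      by (simp add: sum_distrib_left[symmetric])
    also have "\<dots> \<le> ennreal ((F t)\<^sup>2)" by (simp add: indicator_def)
    finally show "(\<Sum>i\<in>P. ennreal ((F t)\<^sup>2) * indicator {l i<..<u i} t) \<le> ennreal ((F t)\<^sup>2)" .
  qed
  also have "\<dots> = energy_on a b h" unfolding energy_on_lebesgue F_def ..
  finally show ?thesis .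
qed

text \<open>
  From \<open>y \<le> k / 2 * l + y\<^sup>2 / (2 k l)\<close>, for any \<open>k\<close>. The bound depends on
  \<open>h\<close> only through its energy, so it makes limits of functions of bounded energy absolutely continuous.
\<close>

lemma energy_bounded_variation:
  assumes h: "h \<in> AC_on a b" and E: "energy_on a b h \<le> ennreal M" and "0 \<le> M" "0 < k" and "finite P"
    and lu: "\<And>i. i \<in> P \<Longrightarrow> a \<le> l i \<and> l i \<le> u i \<and> u i \<le> b"
    and dj: "disjoint_family_on (\<lambda>i. {l i<..<u i}) P"
  shows "(\<Sum>i\<in>P. \<bar>h (u i) - h (l i)\<bar>) \<le> k / 2 * (\<Sum>i\<in>P. u i - l i) + M / (2 * k)"
proof -
  have "ennreal (\<Sum>i\<in>P. (h (u i) - h (l i))\<^sup>2 / (u i - l i)) = (\<Sum>i\<in>P. ennreal ((h (u i) - h (l i))\<^sup>2 / (u i - l i)))"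
    using lu by (intro sum_ennreal[symmetric]) (simp add: divide_nonneg_nonneg)
  also have "\<dots> \<le> (\<Sum>i\<in>P. energy_on (l i) (u i) h)"
  proof (rule sum_mono)
    fix i assume i: "i \<in> P"
    show "ennreal ((h (u i) - h (l i))\<^sup>2 / (u i - l i)) \<le> energy_on (l i) (u i) h"
    proof (cases "l i < u i")
      case True
      then show ?thesis using lu[OF i] by (intro energy_on_ge AC_on_subset[OF h]) auto
    next
      case False
      then have "l i = u i" using lu[OF i] by simp
      then show ?thesis by simp
    qed
  qed
  also have "\<dots> \<le> energy_on a b h" by (rule energy_on_disjoint_le[OF h \<open>finite P\<close> lu dj])
  also note E
  finally have Q: "(\<Sum>i\<in>P. (h (u i) - h (l i))\<^sup>2 / (u i - l i)) \<le> M"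
    using \<open>0 \<le> M\<close> by (simp add: ennreal_le_iff)
  have "(\<Sum>i\<in>P. \<bar>h (u i) - h (l i)\<bar>) \<le> (\<Sum>i\<in>P. k / 2 * (u i - l i) + (h (u i) - h (l i))\<^sup>2 / (u i - l i) / (2 * k))"
  proof (rule sum_mono)
    fix i assume i: "i \<in> P"
    show "\<bar>h (u i) - h (l i)\<bar> \<le> k / 2 * (u i - l i) + (h (u i) - h (l i))\<^sup>2 / (u i - l i) / (2 * k)"
    proof (cases "l i < u i")
      case True
      define L where "L = u i - l i"
      define y where "y = \<bar>h (u i) - h (l i)\<bar>"
      have L: "L > 0" using True by (simp add: L_def)
      have "0 \<le> (k * L - y)\<^sup>2" by simp
      then have "2 * k * L * y \<le> k\<^sup>2 * L\<^sup>2 + y\<^sup>2" by (simp add: power2_eq_square algebra_simps)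
      then have "2 * k * L * y / (2 * k * L) \<le> (k\<^sup>2 * L\<^sup>2 + y\<^sup>2) / (2 * k * L)"
        using L \<open>0 < k\<close> by (intro divide_right_mono) auto
      then have "y \<le> k / 2 * L + y\<^sup>2 / L / (2 * k)"
        using L \<open>0 < k\<close> by (simp add: add_divide_distrib power2_eq_square mult_ac)
      then show ?thesis by (simp add: y_def L_def)
    next
      case False
      then have "l i = u i" using lu[OF i] by simp
      then show ?thesis by simp
    qed
  qed
  also have "\<dots> = k / 2 * (\<Sum>i\<in>P. u i - l i) + (\<Sum>i\<in>P. (h (u i) - h (l i))\<^sup>2 / (u i - l i)) / (2 * k)"
    by (simp only: sum.distrib sum_distrib_left sum_divide_distrib)
  also have "\<dots> \<le> k / 2 * (\<Sum>i\<in>P. u i - l i) + M / (2 * k)"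
    using Q \<open>0 < k\<close> by (intro add_left_mono divide_right_mono) auto
  finally show ?thesis .
qed

lemma strip_midpoint:
  assumes "f \<in> strip T r w" "g \<in> strip T r w"
  shows "(\<lambda>x. (f x + 1 * g x) / 2) \<in> strip T r w"
  unfolding strip_def mem_Collect_eq
proof (intro conjI ballI)
  show "(\<lambda>x. (f x + 1 * g x) / 2) \<in> AC T"
    unfolding AC_eq_AC_on by (rule AC_on_half_sum) (use assms in \<open>auto simp: strip_def AC_eq_AC_on\<close>)
  show "(f 0 + 1 * g 0) / 2 = 0" "(f T + 1 * g T) / 2 = w T" using assms by (auto simp: strip_def)
  fix t assume "t \<in> {0..T}"
  then have "\<bar>f t - w t\<bar> \<le> r / 2" "\<bar>g t - w t\<bar> \<le> r / 2" using assms by (auto simp: strip_def)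
  moreover have mid: "(f t + 1 * g t) / 2 - w t = ((f t - w t) + (g t - w t)) / 2" by (simp add: field_simps)
  have "\<bar>(f t + 1 * g t) / 2 - w t\<bar> \<le> (\<bar>f t - w t\<bar> + \<bar>g t - w t\<bar>) / 2"
    unfolding mid using abs_triangle_ineq[of "f t - w t" "g t - w t"] by (simp only: abs_divide) simp
  ultimately show "\<bar>(f t + 1 * g t) / 2 - w t\<bar> \<le> r / 2" by argo
qed

text \<open>
  The midpoint has at least the energy \<open>\<mu>\<close>, so by the parallelogram identity half the difference has
  energy at most \<open>e\<close>; it vanishes at \<open>0\<close>, hence is uniformly small. With \<open>e = 0\<close>
  this is uniqueness.
\<close>

lemma strip_near_minimizers:
  assumes T: "0 < T" and f: "f \<in> strip T r w" and g: "g \<in> strip T r w"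
    and m: "\<And>h. h \<in> strip T r w \<Longrightarrow> ennreal \<mu> \<le> energy T h" and "0 \<le> \<mu>" "0 \<le> e"
    and Ef: "energy T f \<le> ennreal (\<mu> + e)" and Eg: "energy T g \<le> ennreal (\<mu> + e)" and t: "t \<in> {0..T}"
  shows "\<bar>f t - g t\<bar> \<le> 2 * sqrt (T * e)"
proof -
  define d where "d = (\<lambda>x. (f x + (-1) * g x) / 2)"
  have AC: "f \<in> AC_on 0 T" "g \<in> AC_on 0 T" using f g by (auto simp: strip_def AC_eq_AC_on)
  have dAC: "d \<in> AC_on 0 T" unfolding d_def by (rule AC_on_half_sum[OF AC]) simp
  have "2 * (energy_on 0 T d + ennreal \<mu>) \<le> 2 * (energy_on 0 T d + energy_on 0 T (\<lambda>x. (f x + 1 * g x) / 2))"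
    using m[OF strip_midpoint[OF f g]] unfolding energy_eq_energy_on by (intro mult_left_mono add_left_mono) auto
  also have "\<dots> = energy_on 0 T f + energy_on 0 T g" unfolding d_def by (rule energy_parallelogram[OF AC])
  also have "\<dots> \<le> ennreal (\<mu> + e) + ennreal (\<mu> + e)"
    using Ef Eg unfolding energy_eq_energy_on by (rule add_mono)
  also have "\<dots> = 2 * ennreal (\<mu> + e)" by (simp add: mult_2)
  finally have "energy_on 0 T d + ennreal \<mu> \<le> ennreal (\<mu> + e)"
    by (subst (asm) ennreal_mult_le_mult_iff) auto
  then have "energy_on 0 T d + ennreal \<mu> \<le> ennreal e + ennreal \<mu>"
    using \<open>0 \<le> \<mu>\<close> \<open>0 \<le> e\<close> by (simp add: ennreal_plus add.commute)
  then have Ed: "energy_on 0 T d \<le> ennreal e"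
    unfolding add.commute[of _ "ennreal \<mu>"] by (simp add: ennreal_add_left_cancel_le)
  show ?thesis
  proof (cases "t = 0")
    case True
    then show ?thesis using f g T \<open>0 \<le> e\<close> by (simp add: strip_def)
  next
    case False
    then have t': "0 < t" "t \<le> T" using t by auto
    have "ennreal ((d t - d 0)\<^sup>2 / (t - 0)) \<le> energy_on 0 t d"
      by (rule energy_on_ge[OF AC_on_subset[OF dAC]]) (use t' in auto)
    also have "\<dots> \<le> energy_on 0 T d" by (rule energy_on_mono) (use t' in auto)
    also note Ed
    finally have "(d t - d 0)\<^sup>2 / (t - 0) \<le> e" using \<open>0 \<le> e\<close> by (simp add: ennreal_le_iff)
    moreover have "d 0 = 0" using f g by (simp add: d_def strip_def)
    ultimately have "(d t)\<^sup>2 \<le> e * t" using t' by (simp add: pos_divide_le_eq)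
    also have "\<dots> \<le> T * e" using mult_left_mono[OF t'(2) \<open>0 \<le> e\<close>] by (simp add: mult.commute)
    finally have "\<bar>d t\<bar> \<le> sqrt (T * e)" by (rule real_le_rsqrt[of "\<bar>d t\<bar>", simplified])
    moreover have "\<bar>f t - g t\<bar> = 2 * \<bar>d t\<bar>" by (simp add: d_def)
    ultimately show ?thesis by simp
  qed
qed

theorem energy_taut_string:
  assumes T: "0 < T" and fin: "h0 \<in> strip T r w" "energy T h0 < \<infinity>"
  shows "energy T (taut_string T r w) = (INF h\<in>strip T r w. energy T h)"
proof -
  define S where "S = strip T r w"
  have "(INF h\<in>S. energy T h) \<le> energy T h0" using fin(1) by (intro INF_lower) (simp add: S_def)
  from le_less_trans[OF this fin(2)] have "(INF h\<in>S. energy T h) \<noteq> \<infinity>" by (rule less_imp_neq)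
  then obtain \<mu> where \<mu>: "0 \<le> \<mu>" "(INF h\<in>S. energy T h) = ennreal \<mu>"
    by (cases "INF h\<in>S. energy T h") auto
  have m: "ennreal \<mu> \<le> energy T h" if "h \<in> strip T r w" for h
    unfolding \<mu>(2)[symmetric] using that by (intro INF_lower) (simp add: S_def)
  have "\<exists>h\<in>S. energy T h \<le> ennreal (\<mu> + 1 / real (Suc n))" for n
  proof -
    have "(INF h\<in>S. energy T h) < ennreal (\<mu> + 1 / real (Suc n))"
      unfolding \<mu>(2) using \<mu>(1) by (intro ennreal_lessI) (auto simp: add_nonneg_pos)
    then obtain h where "h \<in> S" "energy T h < ennreal (\<mu> + 1 / real (Suc n))" unfolding INF_less_iff by blast
    then show ?thesis by (intro bexI[of _ h]) (simp_all only: less_imp_le)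
  qed
  from choice[OF allI[OF this[unfolded Bex_def]]] obtain H
    where H0: "\<forall>n. H n \<in> S \<and> energy T (H n) \<le> ennreal (\<mu> + 1 / real (Suc n))" ..
  have H: "H n \<in> S" "energy T (H n) \<le> ennreal (\<mu> + 1 / real (Suc n))" for n
    using spec[OF H0, of n] by (simp_all only:)
  have HS: "H n \<in> strip T r w" for n using H(1) by (simp add: S_def)
  have HE: "energy T (H k) \<le> ennreal (\<mu> + 1 / real (Suc n))" if "n \<le> k" for n k
  proof -
    have "1 / real (Suc k) \<le> 1 / real (Suc n)" using that by (simp add: frac_le)
    then have "ennreal (\<mu> + 1 / real (Suc k)) \<le> ennreal (\<mu> + 1 / real (Suc n))"
      by (intro ennreal_leI add_left_mono)
    with H(2)[of k] show ?thesis by (rule order_trans)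
  qed
  have conv: "convergent (\<lambda>n. H n t)" if t: "t \<in> {0..T}" for t
  proof (rule Cauchy_convergent, rule metric_CauchyI)
    fix e :: real assume "e > 0"
    have "(\<lambda>n. 2 * sqrt (T * (1 / real (Suc n)))) \<longlonglongrightarrow> 2 * sqrt (T * 0)"
      by (intro tendsto_intros LIMSEQ_Suc[OF lim_const_over_n])
    then have "eventually (\<lambda>n. 2 * sqrt (T * (1 / real (Suc n))) < e) sequentially"
      using \<open>e > 0\<close> by (intro order_tendstoD) auto
    then obtain n where n: "2 * sqrt (T * (1 / real (Suc n))) < e" by (auto simp: eventually_sequentially)
    show "\<exists>M. \<forall>m\<ge>M. \<forall>k\<ge>M. dist (H m t) (H k t) < e"
    proof (intro exI[of _ n] allI impI)
      fix j k assume "n \<le> j" "n \<le> k"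
      then have "\<bar>H j t - H k t\<bar> \<le> 2 * sqrt (T * (1 / real (Suc n)))"
        by (intro strip_near_minimizers[OF T HS HS m \<mu>(1) _ HE HE t]) auto
      then show "dist (H j t) (H k t) < e" using n by (simp add: dist_real_def)
    qed
  qed
  define h where "h = restrict (\<lambda>t. lim (\<lambda>n. H n t)) {0..T}"
  have lim: "(\<lambda>n. H n t) \<longlonglongrightarrow> h t" if "t \<in> {0..T}" for t
    using conv[OF that] that by (simp add: h_def convergent_LIMSEQ_iff)
  have HAC: "H n \<in> AC_on 0 T" for n using HS[of n] by (simp add: strip_def AC_eq_AC_on)
  have hAC: "h \<in> AC_on 0 T"
    unfolding AC_on_def mem_Collect_eq
  proof (intro allI impI)
    fix e :: real assume e: "e > 0"
    define M where "M = \<mu> + 1"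
    have M: "M > 0" using \<mu>(1) by (simp add: M_def)
    \<comment> \<open>Makes \<open>M / (2 * k) = e / 2\<close>, which leaves room for the term with the total length.\<close>
    define k where "k = M / e"
    have k: "k > 0" using M e by (simp add: k_def)
    show "\<exists>\<delta>>0. \<forall>(n::nat) l u. (\<forall>i<n. 0 \<le> l i \<and> l i \<le> u i \<and> u i \<le> T) \<longrightarrow>
      disjoint_family_on (\<lambda>i. {l i<..<u i}) {..<n} \<longrightarrow> (\<Sum>i<n. u i - l i) < \<delta> \<longrightarrow>
      (\<Sum>i<n. \<bar>h (u i) - h (l i)\<bar>) < e"
    proof (intro exI[of _ "e / (2 * k)"] conjI allI impI)
      show "0 < e / (2 * k)" using e k by simp
      fix n :: nat and l u
      assume lu: "\<forall>i<n. 0 \<le> l i \<and> l i \<le> u i \<and> u i \<le> T"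
        and dj: "disjoint_family_on (\<lambda>i. {l i<..<u i}) {..<n}" and sm: "(\<Sum>i<n. u i - l i) < e / (2 * k)"
      have b: "(\<Sum>i<n. \<bar>H j (u i) - H j (l i)\<bar>) \<le> 3 / 4 * e" for j
      proof -
        have "energy_on 0 T (H j) \<le> ennreal M"
          using HE[of 0 j] by (simp add: energy_eq_energy_on M_def)
        then have 1: "(\<Sum>i\<in>{..<n}. \<bar>H j (u i) - H j (l i)\<bar>) \<le> k / 2 * (\<Sum>i\<in>{..<n}. u i - l i) + M / (2 * k)"
          using lu M by (intro energy_bounded_variation[OF HAC _ _ k _ _ dj]) auto
        have "k / 2 * (\<Sum>i\<in>{..<n}. u i - l i) \<le> k / 2 * (e / (2 * k))"
          using sm k by (intro mult_left_mono) auto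
        moreover have "k / 2 * (e / (2 * k)) = e / 4" using k by simp
        ultimately have 2: "k / 2 * (\<Sum>i\<in>{..<n}. u i - l i) \<le> e / 4" by (simp only:)
        have "M / (2 * k) = e / 2" using M e by (simp add: k_def)
        then show ?thesis using 1 2 by linarith
      qed
      have "(\<lambda>j. \<Sum>i<n. \<bar>H j (u i) - H j (l i)\<bar>) \<longlonglongrightarrow> (\<Sum>i<n. \<bar>h (u i) - h (l i)\<bar>)"
      proof (intro tendsto_sum tendsto_rabs tendsto_diff lim)
        fix i assume "i \<in> {..<n}"
        with lu have "0 \<le> l i" "l i \<le> u i" "u i \<le> T" by auto
        then show "u i \<in> {0..T}" "l i \<in> {0..T}" by auto
      qed
      then have "(\<Sum>i<n. \<bar>h (u i) - h (l i)\<bar>) \<le> 3 / 4 * e"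
        by (rule LIMSEQ_le_const2) (use b in auto)
      then show "(\<Sum>i<n. \<bar>h (u i) - h (l i)\<bar>) < e" using e by simp
    qed
  qed
  have hS: "h \<in> strip T r w"
    unfolding strip_def mem_Collect_eq
  proof (intro conjI ballI)
    show "h \<in> AC T" using hAC by (simp add: AC_eq_AC_on)
    show "h 0 = 0" using lim[of 0] HS T by (auto simp: strip_def LIMSEQ_const_iff)
    show "h T = w T" using lim[of T] HS T by (auto simp: strip_def LIMSEQ_const_iff)
    fix t assume t: "t \<in> {0..T}"
    have "(\<lambda>n. \<bar>H n t - w t\<bar>) \<longlonglongrightarrow> \<bar>h t - w t\<bar>" by (intro tendsto_intros lim t)
    then show "\<bar>h t - w t\<bar> \<le> r / 2"
      by (rule LIMSEQ_le_const2) (use HS t in \<open>auto simp: strip_def\<close>)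
  qed
  have "energy_on 0 T h \<le> ennreal \<mu>"
  proof (rule energy_on_le_grid[OF hAC T])
    fix n :: nat assume n: "0 < n"
    define \<delta> where "\<delta> = T / real n"
    have \<delta>: "\<delta> > 0" "real n * \<delta> = T" using T n by (auto simp: \<delta>_def)
    have q: "(\<Sum>i<n. (H j (real (Suc i) * \<delta>) - H j (real i * \<delta>))\<^sup>2) / \<delta> \<le> \<mu> + 1 / real (Suc j)" for j
    proof -
      have "ennreal ((\<Sum>i<n. (H j (0 + real (Suc i) * \<delta>) - H j (0 + real i * \<delta>))\<^sup>2) / \<delta>)
          \<le> energy_on 0 (0 + real n * \<delta>) (H j)"
        by (rule energy_on_grid_ge) (use HAC \<delta> in auto)
      also have "\<dots> \<le> ennreal (\<mu> + 1 / real (Suc j))" using H(2)[of j] \<delta>(2) by (simp add: energy_eq_energy_on)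
      finally have le: "ennreal ((\<Sum>i<n. (H j (0 + real (Suc i) * \<delta>) - H j (0 + real i * \<delta>))\<^sup>2) / \<delta>)
          \<le> ennreal (\<mu> + 1 / real (Suc j))" .
      have "0 \<le> \<mu> + 1 / real (Suc j)" using \<mu>(1) by simp
      from ennreal_le_iff[OF this, THEN iffD1, OF le] show ?thesis by simp
    qed
    have in0: "real i * \<delta> \<in> {0..T}" if "i \<le> n" for i
    proof -
      have "real i * \<delta> \<le> real n * \<delta>" using that \<delta>(1) by (intro mult_right_mono) auto
      then show ?thesis using \<delta> by simp
    qed
    have "(\<lambda>j. (\<Sum>i<n. (H j (real (Suc i) * \<delta>) - H j (real i * \<delta>))\<^sup>2) / \<delta>)
      \<longlonglongrightarrow> (\<Sum>i<n. (h (real (Suc i) * \<delta>) - h (real i * \<delta>))\<^sup>2) / \<delta>"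
      using \<delta>(1) by (intro tendsto_divide tendsto_sum tendsto_power tendsto_diff tendsto_const lim in0) auto
    moreover have "(\<lambda>j. \<mu> + 1 / real (Suc j)) \<longlonglongrightarrow> \<mu> + 0"
      by (intro tendsto_intros LIMSEQ_Suc[OF lim_const_over_n])
    ultimately have "(\<Sum>i<n. (h (real (Suc i) * \<delta>) - h (real i * \<delta>))\<^sup>2) / \<delta> \<le> \<mu> + 0"
      by (rule LIMSEQ_le) (use q in blast)
    then show "(\<Sum>i<n. (h (real (Suc i) * (T / real n)) - h (real i * (T / real n)))\<^sup>2) / (T / real n) \<le> \<mu>"
      by (simp add: \<delta>_def)
  qed
  then have hE: "energy T h = ennreal \<mu>" using m[OF hS] by (simp add: energy_eq_energy_on)
  have hext: "h \<in> extensional {0..T}" by (simp add: h_def)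
  have "taut_string T r w = h"
    unfolding taut_string_def
  proof (rule the_equality)
    show "h \<in> extensional {0..T} \<and> is_arg_min (energy T) (\<lambda>g. g \<in> strip T r w) h"
      using hext hS hE m by (auto simp: is_arg_min_def not_less)
    fix g assume g: "g \<in> extensional {0..T} \<and> is_arg_min (energy T) (\<lambda>g. g \<in> strip T r w) g"
    then have gS: "g \<in> strip T r w" and gE: "energy T g \<le> ennreal \<mu>"
      using hS hE by (auto simp: is_arg_min_def not_less)
    show "g = h"
    proof (rule extensionalityI)
      show "g \<in> extensional {0..T}" "h \<in> extensional {0..T}" using g hext by auto
      fix t assume t: "t \<in> {0..T}"
      have "\<bar>g t - h t\<bar> \<le> 2 * sqrt (T * 0)"
        by (rule strip_near_minimizers[OF T gS hS m \<mu>(1) order_refl _ _ t]) (use gE hE in auto)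
      then show "g t = h t" by simp
    qed
  qed
  then show ?thesis using hE \<mu>(2) by (simp add: S_def)
qed

section \<open>The cheapest path with free ends in a discrete tube\<close>

definition clamp :: "real \<Rightarrow> real \<Rightarrow> real" where
  "clamp r z = max 0 (min r z)"

text \<open>
  The distance to the upper edge of the tube of a path that starts there and moves by \<open>a\<close> per step, except
  that the edges push it; \<open>d\<close> are the increments of the centre of the tube.
\<close>

primrec gap :: "real \<Rightarrow> real \<Rightarrow> (nat \<Rightarrow> real) \<Rightarrow> nat \<Rightarrow> real" where
  "gap a r d 0 = 0"
| "gap a r d (Suc k) = clamp r (gap a r d k + d k - a)"

text \<open>The total lift by the lower edge, beyond the \<open>a\<close> per step that is free.\<close>

definition climb :: "real \<Rightarrow> real \<Rightarrow> (nat \<Rightarrow> real) \<Rightarrow> nat \<Rightarrow> real" where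
  "climb a r d n = (\<Sum>k<n. max 0 (gap a r d k + d k - a - r))"

definition steps :: "(nat \<Rightarrow> real) \<Rightarrow> nat \<Rightarrow> real" where
  "steps w k = w (Suc k) - w k"

definition qenergy :: "real \<Rightarrow> nat \<Rightarrow> (nat \<Rightarrow> real) \<Rightarrow> real" where
  "qenergy \<delta> n x = (\<Sum>k<n. (x (Suc k) - x k)\<^sup>2) / \<delta>"

definition tube :: "real \<Rightarrow> (nat \<Rightarrow> real) \<Rightarrow> nat \<Rightarrow> (nat \<Rightarrow> real) set" where
  "tube r w n = {x. \<forall>k\<le>n. \<bar>x k - w k\<bar> \<le> r / 2}"

text \<open>
  The least energy of a path with free ends in the tube, written in a form that depends on the increments of its centre
  only and is accessible to expectations; see \<open>free_energy_le\<close> and \<open>free_energy_attained\<close>.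
\<close>

definition free_energy :: "real \<Rightarrow> real \<Rightarrow> nat \<Rightarrow> (nat \<Rightarrow> real) \<Rightarrow> ennreal" where
  "free_energy \<delta> r n d =
     (\<integral>\<^sup>+c\<in>{0..}. ennreal (2 * (climb (c * \<delta>) r d n + climb (c * \<delta>) r (\<lambda>k. - d k) n)) \<partial>lborel)"

definition tube_min :: "real \<Rightarrow> (nat \<Rightarrow> real) \<Rightarrow> nat \<Rightarrow> (nat \<Rightarrow> real) \<Rightarrow> bool" where
  "tube_min r w n x \<longleftrightarrow> x \<in> tube r w n \<and> (\<forall>y\<in>tube r w n. qenergy 1 n x \<le> qenergy 1 n y)"

lemma clamp_range: "0 \<le> r \<Longrightarrow> 0 \<le> clamp r z \<and> clamp r z \<le> r"
  by (auto simp: clamp_def)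

lemma gap_range: "0 \<le> r \<Longrightarrow> 0 \<le> gap a r d k \<and> gap a r d k \<le> r"
  by (induction k) (auto simp: clamp_range)

lemma climb_nonneg: "0 \<le> climb a r d n"
  by (auto simp: climb_def intro: sum_nonneg)

text \<open>
  The path described by \<open>gap\<close> rises by more than \<open>a\<close> only when it is lifted.
\<close>

lemma lazy_path:
  fixes w :: "nat \<Rightarrow> real" and a :: real
  assumes "0 \<le> r"
  defines "y \<equiv> \<lambda>k. w k + r / 2 - gap a r (steps w) k"
  shows "y \<in> tube r w n" and "(\<Sum>k<n. max 0 (y (Suc k) - y k - a)) = climb a r (steps w) n"
proof -
  show "y \<in> tube r w n"
    unfolding tube_def y_def using gap_range[OF assms(1), of a "steps w"] by (auto simp: abs_le_iff field_simps)
  have "max 0 (y (Suc k) - y k - a) = max 0 (gap a r (steps w) k + steps w k - a - r)" for k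
    using assms(1) by (simp add: y_def clamp_def steps_def max_def min_def)
  then show "(\<Sum>k<n. max 0 (y (Suc k) - y k - a)) = climb a r (steps w) n"
    by (simp add: climb_def)
qed

text \<open>
  Whoever is above the lazy path has paid for it: the height above the lazy path never exceeds the excess cost. Being
  held back by the upper edge is no disadvantage, since no path in the tube is higher.
\<close>

lemma climb_le:
  fixes w :: "nat \<Rightarrow> real"
  assumes "0 \<le> r" and y: "y \<in> tube r w n"
  shows "climb a r (steps w) n \<le> (\<Sum>k<n. max 0 (y (Suc k) - y k - a))"
proof -
  define p where "p = (\<lambda>k. w k + r / 2 - gap a r (steps w) k)"
  have "max 0 (y k - p k) \<le> (\<Sum>k<k. max 0 (y (Suc k) - y k - a)) - climb a r (steps w) k" if "k \<le> n" for k
    using that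
  proof (induction k)
    case 0
    have "\<bar>y 0 - w 0\<bar> \<le> r / 2" using y by (simp add: tube_def)
    then have "y 0 \<le> p 0" unfolding p_def gap.simps by linarith
    then show ?case by (simp add: climb_def)
  next
    case (Suc k)
    define z where "z = gap a r (steps w) k + steps w k - a"
    define e where "e = (\<Sum>k<k. max 0 (y (Suc k) - y k - a)) - climb a r (steps w) k"
    have e: "max 0 (y k - p k) \<le> e" using Suc by (simp add: e_def)
    have e': "(\<Sum>k<Suc k. max 0 (y (Suc k) - y k - a)) - climb a r (steps w) (Suc k)
        = e + max 0 (y (Suc k) - y k - a) - max 0 (z - r)"
      by (simp add: e_def climb_def z_def)
    have p': "p (Suc k) = w (Suc k) + r / 2 - clamp r z" by (simp add: p_def z_def)
    have yk: "\<bar>y (Suc k) - w (Suc k)\<bar> \<le> r / 2" using y Suc.prems by (simp add: tube_def)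
    have pk: "p k = w k + r / 2 - z + (w (Suc k) - w k) - a" by (simp add: p_def z_def steps_def)
    show ?case unfolding e' p' using e yk assms(1) unfolding pk clamp_def
      by (auto simp: max_def min_def abs_le_iff split: if_splits)
  qed
  from this[of n] show ?thesis by simp
qed

lemma tube_min_exists:
  assumes "0 \<le> r"
  obtains x where "tube_min r w n x"
proof -
  \<comment> \<open>All coordinates are confined, also those beyond \<open>n\<close>, to obtain a compact product.\<close>
  define S where "S = Pi\<^sub>E UNIV (\<lambda>k::nat. cball (w k) (r / 2))"
  have "compactin (product_topology (\<lambda>i. euclidean) UNIV) S"
    unfolding S_def by (subst compactin_PiE) auto
  then have "compact S" by (simp add: euclidean_product_topology)
  have "S \<noteq> {}" unfolding S_def using assms by (auto simp: PiE_eq_empty_iff)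
  have "continuous_on S (qenergy 1 n)"
    unfolding qenergy_def
    by (intro continuous_intros continuous_on_subset[OF continuous_on_product_coordinates]) auto
  then obtain x where x: "x \<in> S" "\<And>y. y \<in> S \<Longrightarrow> qenergy 1 n x \<le> qenergy 1 n y"
    using continuous_attains_inf[OF \<open>compact S\<close> \<open>S \<noteq> {}\<close>] by blast
  have "tube_min r w n x"
    unfolding tube_min_def
  proof (intro conjI ballI)
    show "x \<in> tube r w n" using x(1) by (auto simp: S_def tube_def dist_real_def abs_minus_commute)
    fix y assume y: "y \<in> tube r w n"
    define y' where "y' = (\<lambda>k. if k \<le> n then y k else w k)"
    have "y' \<in> S" using y assms by (auto simp: S_def y'_def tube_def dist_real_def abs_minus_commute)
    moreover have "qenergy 1 n y' = qenergy 1 n y"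
      unfolding qenergy_def y'_def by (intro arg_cong2[where f="(/)"] sum.cong) auto
    ultimately show "qenergy 1 n x \<le> qenergy 1 n y" using x(2) by metis
  qed
  then show ?thesis by (rule that)
qed

lemma summation_by_parts:
  fixes a e :: "nat \<Rightarrow> real"
  shows "(\<Sum>k<n. a (Suc k) * (e (Suc k) - e k))
    = (\<Sum>k\<le>n. (a k - a (Suc k)) * e k) - a 0 * e 0 + a (Suc n) * e n"
  by (induction n) (auto simp: algebra_simps)

text \<open>Zero beyond both ends: the natural boundary condition for free ends.\<close>

definition slope :: "nat \<Rightarrow> (nat \<Rightarrow> real) \<Rightarrow> nat \<Rightarrow> real" where
  "slope n x k = (if k = 0 \<or> n < k then 0 else x k - x (k - 1))"

text \<open>
  The first-order condition in one coordinate: a minimizer bends only where it touches an edge, and towards that edge.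
\<close>

lemma tube_min_coordinate:
  assumes x: "tube_min r w n x" and y: "y \<in> tube r w n" and i: "i \<le> n"
  shows "0 \<le> (slope n x i - slope n x (Suc i)) * (y i - x i)"
proof -
  define v where "v = (\<lambda>k. if k = i then y i - x i else 0)"
  \<comment> \<open>Half the derivative of the energy in the direction \<open>v\<close>.\<close>
  define Bv where "Bv = (\<Sum>k<n. slope n x (Suc k) * (v (Suc k) - v k))"
  have Bv: "Bv = (slope n x i - slope n x (Suc i)) * (y i - x i)"
    unfolding Bv_def summation_by_parts using i
    by (simp add: slope_def[of _ _ 0] slope_def[of n x "Suc n"] v_def if_distrib sum.delta cong: if_cong)
  have ineq: "0 \<le> 2 * \<theta> * Bv + \<theta>\<^sup>2 * qenergy 1 n v" if \<theta>: "0 < \<theta>" "\<theta> \<le> 1" for \<theta>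
  proof -
    have "(\<lambda>k. x k + \<theta> * v k) \<in> tube r w n"
      unfolding tube_def
    proof (intro CollectI allI impI)
      fix k assume "k \<le> n"
      have "\<bar>x i + \<theta> * (y i - x i) - w i\<bar> = \<bar>(1 - \<theta>) * (x i - w i) + \<theta> * (y i - w i)\<bar>"
        by (simp add: algebra_simps)
      also have "\<dots> \<le> (1 - \<theta>) * \<bar>x i - w i\<bar> + \<theta> * \<bar>y i - w i\<bar>"
        using \<theta> by (intro order_trans[OF abs_triangle_ineq]) (simp add: abs_mult)
      also have "\<dots> \<le> (1 - \<theta>) * (r / 2) + \<theta> * (r / 2)"
        using x y i \<theta> by (intro add_mono mult_left_mono) (auto simp: tube_min_def tube_def)
      also have "\<dots> = r / 2" by (simp only: distrib_right[symmetric]) simp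
      finally have "\<bar>x i + \<theta> * (y i - x i) - w i\<bar> \<le> r / 2" .
      then show "\<bar>x k + \<theta> * v k - w k\<bar> \<le> r / 2"
        using x \<open>k \<le> n\<close> by (auto simp: v_def tube_min_def tube_def)
    qed
    then have "qenergy 1 n x \<le> qenergy 1 n (\<lambda>k. x k + \<theta> * v k)"
      using x by (auto simp: tube_min_def)
    also have "\<dots> = (\<Sum>k<n. (x (Suc k) - x k)\<^sup>2 + 2 * \<theta> * (slope n x (Suc k) * (v (Suc k) - v k))
        + \<theta>\<^sup>2 * (v (Suc k) - v k)\<^sup>2)"
      unfolding qenergy_def by (auto simp: slope_def power2_eq_square algebra_simps intro!: sum.cong)
    also have "\<dots> = qenergy 1 n x + 2 * \<theta> * Bv + \<theta>\<^sup>2 * qenergy 1 n v"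
      unfolding qenergy_def Bv_def by (simp add: sum.distrib sum_distrib_left)
    finally show ?thesis by simp
  qed
  have "0 \<le> Bv"
  proof (rule ccontr)
    assume "\<not> 0 \<le> Bv"
    then have Bn: "Bv < 0" by simp
    define q where "q = qenergy 1 n v"
    have q0: "0 \<le> q" by (simp add: q_def qenergy_def sum_nonneg)
    define \<theta> where "\<theta> = min 1 (- Bv / (q + 1))"
    have \<theta>: "0 < \<theta>" "\<theta> \<le> 1" "\<theta> * (q + 1) \<le> - Bv"
      using Bn q0 by (auto simp: \<theta>_def min_def field_simps divide_simps)
    have "0 \<le> \<theta> * (2 * Bv + \<theta> * q)"
      using ineq[OF \<theta>(1,2)] by (simp add: q_def power2_eq_square algebra_simps)
    then have "0 \<le> 2 * Bv + \<theta> * q" using \<theta>(1) by (simp add: zero_le_mult_iff)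
    then show False using \<theta> Bn by (simp add: algebra_simps)
  qed
  then show ?thesis using Bv by simp
qed

text \<open>
  The sign condition of \<open>tube_min_coordinate\<close> is preserved when slopes are replaced by a monotone function
  of them. For the subgradient of \<open>s \<mapsto> (s - a)\<^sup>+\<close> this is the first-order condition for the
  excess over \<open>a\<close>, which by convexity is sufficient for a minimum.
\<close>

lemma tube_min_climb:
  assumes x: "tube_min r w n x" and y: "y \<in> tube r w n" and a: "0 \<le> a"
  shows "(\<Sum>k<n. max 0 (x (Suc k) - x k - a)) \<le> (\<Sum>k<n. max 0 (y (Suc k) - y k - a))"
proof -
  define \<psi> :: "real \<Rightarrow> real" where "\<psi> = (\<lambda>s. if a < s then 1 else 0)"
  define e where "e = (\<lambda>k. y k - x k)"
  have "0 \<le> (\<psi> (slope n x k) - \<psi> (slope n x (Suc k))) * e k" if k: "k \<le> n" for k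
  proof -
    have "0 \<le> (slope n x k - slope n x (Suc k)) * e k"
      using tube_min_coordinate[OF x y k] by (simp add: e_def)
    then show ?thesis
      by (auto simp: \<psi>_def zero_le_mult_iff)
  qed
  then have "0 \<le> (\<Sum>k\<le>n. (\<psi> (slope n x k) - \<psi> (slope n x (Suc k))) * e k)"
    by (intro sum_nonneg) auto
  also have "\<dots> = (\<Sum>k<n. \<psi> (slope n x (Suc k)) * (e (Suc k) - e k))"
    using summation_by_parts[of "\<lambda>k. \<psi> (slope n x k)" e n] a by (simp add: slope_def \<psi>_def)
  finally have "(\<Sum>k<n. max 0 (x (Suc k) - x k - a))
      \<le> (\<Sum>k<n. max 0 (x (Suc k) - x k - a)) + (\<Sum>k<n. \<psi> (slope n x (Suc k)) * (e (Suc k) - e k))"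
    by simp
  also have "\<dots> = (\<Sum>k<n. max 0 (x (Suc k) - x k - a) + \<psi> (slope n x (Suc k)) * (e (Suc k) - e k))"
    by (simp add: sum.distrib)
  also have "\<dots> \<le> (\<Sum>k<n. max 0 (y (Suc k) - y k - a))"
    by (rule sum_mono) (auto simp: \<psi>_def slope_def e_def)
  finally show ?thesis .
qed

lemma tube_uminus: "x \<in> tube r w n \<longleftrightarrow> (\<lambda>k. - x k) \<in> tube r (\<lambda>k. - w k) n"
  by (simp add: tube_def) (metis abs_minus_commute minus_diff_minus)

lemma tube_min_uminus:
  assumes "tube_min r w n x"
  shows "tube_min r (\<lambda>k. - w k) n (\<lambda>k. - x k)"
proof -
  have q: "qenergy 1 n (\<lambda>k. - x k) = qenergy 1 n x" for x
    by (simp add: qenergy_def power2_commute)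
  show ?thesis
    unfolding tube_min_def
  proof (intro conjI ballI)
    show "(\<lambda>k. - x k) \<in> tube r (\<lambda>k. - w k) n" using assms by (simp add: tube_min_def flip: tube_uminus)
    fix y assume "y \<in> tube r (\<lambda>k. - w k) n"
    then have "(\<lambda>k. - y k) \<in> tube r w n" using tube_uminus[of y r "\<lambda>k. - w k"] by simp
    then show "qenergy 1 n (\<lambda>k. - x k) \<le> qenergy 1 n y" using assms q by (metis tube_min_def)
  qed
qed

lemma steps_uminus: "steps (\<lambda>k. - w k) = (\<lambda>k. - steps w k)"
  by (auto simp: steps_def)

text \<open>
  The formula \<open>t\<^sup>2 = \<integral> 2 (t - c) dc\<close> over \<open>0 \<le> c \<le> t\<close>, with both signs
  of the slope.
\<close>

lemma square_layers:
  assumes "\<delta> > 0"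
  shows "(\<integral>\<^sup>+c\<in>{0..}. ennreal (2 * (max 0 (s - c * \<delta>) + max 0 (- s - c * \<delta>))) \<partial>lborel) = ennreal (s\<^sup>2 / \<delta>)"
proof -
  define t where "t = \<bar>s\<bar>"
  have eq: "ennreal (2 * (max 0 (s - c * \<delta>) + max 0 (- s - c * \<delta>))) * indicator {0..} c
     = ennreal (2 * (t - c * \<delta>)) * indicator {0..t / \<delta>} c" for c
  proof (cases "0 \<le> c \<and> c * \<delta> \<le> t")
    case True
    have "max 0 (s - c * \<delta>) + max 0 (- s - c * \<delta>) = t - c * \<delta>"
    proof -
      have "0 \<le> c * \<delta>" using True assms by simp
      then show ?thesis using True unfolding t_def by linarith
    qed
    moreover have "c \<in> {0..t / \<delta>}" using True assms by (simp add: field_simps)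
    ultimately show ?thesis using True by simp
  next
    case False
    have "max 0 (s - c * \<delta>) + max 0 (- s - c * \<delta>) = 0" if "0 \<le> c"
      using False that unfolding t_def by (auto simp: max_def)
    moreover have "c \<notin> {0..t / \<delta>}" using False assms by (auto simp: field_simps)
    ultimately show ?thesis by (auto simp: indicator_def)
  qed
  have "(\<integral>\<^sup>+c. ennreal (2 * (t - c * \<delta>)) * indicator {0..t / \<delta>} c \<partial>lborel)
    = ennreal ((2 * t * (t / \<delta>) - (t / \<delta>)\<^sup>2 * \<delta>) - (2 * t * 0 - 0\<^sup>2 * \<delta>))"
    using assms by (intro nn_integral_FTC_Icc[where F = "\<lambda>c. 2 * t * c - c\<^sup>2 * \<delta>"])
      (auto intro!: derivative_eq_intros simp: t_def field_simps)
  also have "\<dots> = ennreal (s\<^sup>2 / \<delta>)"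
  proof -
    have "2 * t * (t / \<delta>) - (t / \<delta>)\<^sup>2 * \<delta> = t\<^sup>2 / \<delta>"
      using assms by (simp add: power2_eq_square field_simps)
    then show ?thesis by (simp add: t_def)
  qed
  finally show ?thesis unfolding eq .
qed

lemma qenergy_layers:
  assumes "\<delta> > 0"
  shows "ennreal (qenergy \<delta> n x) = (\<integral>\<^sup>+c\<in>{0..}. ennreal (2 * ((\<Sum>k<n. max 0 (x (Suc k) - x k - c * \<delta>))
     + (\<Sum>k<n. max 0 (- (x (Suc k) - x k) - c * \<delta>)))) \<partial>lborel)"
proof -
  define f where "f = (\<lambda>k c. 2 * (max 0 (x (Suc k) - x k - c * \<delta>) + max 0 (- (x (Suc k) - x k) - c * \<delta>)))"
  have "ennreal (qenergy \<delta> n x) = (\<Sum>k<n. ennreal ((x (Suc k) - x k)\<^sup>2 / \<delta>))"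
    using assms by (simp add: qenergy_def sum_divide_distrib sum_ennreal)
  also have "\<dots> = (\<Sum>k<n. \<integral>\<^sup>+c. ennreal (f k c) * indicator {0..} c \<partial>lborel)"
    unfolding f_def square_layers[OF assms] ..
  also have "\<dots> = (\<integral>\<^sup>+c. (\<Sum>k<n. ennreal (f k c) * indicator {0..} c) \<partial>lborel)"
    by (rule nn_integral_sum[symmetric]) (auto simp: f_def)
  also have "\<dots> = (\<integral>\<^sup>+c\<in>{0..}. ennreal (\<Sum>k<n. f k c) \<partial>lborel)"
    by (intro nn_integral_cong) (simp add: sum_ennreal f_def del: ennreal_plus flip: sum_distrib_right)
  also have "(\<lambda>c. \<Sum>k<n. f k c) = (\<lambda>c. 2 * ((\<Sum>k<n. max 0 (x (Suc k) - x k - c * \<delta>))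
     + (\<Sum>k<n. max 0 (- (x (Suc k) - x k) - c * \<delta>))))"
    by (simp add: f_def sum.distrib sum_distrib_left)
  finally show ?thesis .
qed

theorem free_energy_le:
  assumes "\<delta> > 0" "0 \<le> r" and y: "y \<in> tube r w n"
  shows "free_energy \<delta> r n (steps w) \<le> ennreal (qenergy \<delta> n y)"
proof -
  have "climb a r (\<lambda>k. - steps w k) n \<le> (\<Sum>k<n. max 0 (- (y (Suc k) - y k) - a))" for a
    using climb_le[OF assms(2), of "\<lambda>k. - y k" "\<lambda>k. - w k" n a] y tube_uminus[of y]
    by (simp add: steps_uminus)
  then show ?thesis
    unfolding qenergy_layers[OF assms(1)] free_energy_def
    using climb_le[OF assms(2) y] by (intro nn_integral_mono mult_right_mono ennreal_leI mult_left_mono add_mono) auto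
qed

text \<open>
  The minimizer costs no more than the lazy path, for every \<open>c\<close> and both directions, so the infima over the
  layers add up.
\<close>

theorem free_energy_attained:
  assumes "\<delta> > 0" "0 \<le> r"
  obtains x where "x \<in> tube r w n" "ennreal (qenergy \<delta> n x) = free_energy \<delta> r n (steps w)"
proof -
  obtain x where x: "tube_min r w n x" using tube_min_exists[OF assms(2)] .
  then have xt: "x \<in> tube r w n" by (simp add: tube_min_def)
  have "(\<Sum>k<n. max 0 (x (Suc k) - x k - a)) \<le> climb a r (steps w) n" if "0 \<le> a" for a
    using tube_min_climb[OF x lazy_path(1)[OF assms(2)] that, of a] lazy_path(2)[OF assms(2), of w a n] by simp
  moreover have "(\<Sum>k<n. max 0 (- (x (Suc k) - x k) - a)) \<le> climb a r (\<lambda>k. - steps w k) n" if "0 \<le> a" for a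
    using tube_min_climb[OF tube_min_uminus[OF x] lazy_path(1)[OF assms(2)] that, of a]
      lazy_path(2)[OF assms(2), of "\<lambda>k. - w k" a n] by (simp add: steps_uminus)
  ultimately have "ennreal (qenergy \<delta> n x) \<le> free_energy \<delta> r n (steps w)"
    unfolding qenergy_layers[OF assms(1)] free_energy_def using assms(1)
    by (intro nn_integral_mono) (auto simp: indicator_def intro!: ennreal_leI add_mono)
  then show ?thesis using free_energy_le[OF assms xt] xt that by (meson antisym)
qed

text \<open>
  Every second point of a path on the finer grid is a path on the coarser one, of no larger energy.
\<close>

lemma free_energy_refine:
  assumes "\<delta> > 0" "0 \<le> r"
  shows "free_energy \<delta> r n (steps (\<lambda>k. w (2 * k))) \<le> free_energy (\<delta> / 2) r (2 * n) (steps w)"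
proof -
  obtain x where x: "x \<in> tube r w (2 * n)" "ennreal (qenergy (\<delta> / 2) (2 * n) x) = free_energy (\<delta> / 2) r (2 * n) (steps w)"
    using free_energy_attained[of "\<delta> / 2" r] assms by (metis half_gt_zero)
  have "(\<lambda>k. x (2 * k)) \<in> tube r (\<lambda>k. w (2 * k)) n" using x(1) by (auto simp: tube_def)
  then have "free_energy \<delta> r n (steps (\<lambda>k. w (2 * k))) \<le> ennreal (qenergy \<delta> n (\<lambda>k. x (2 * k)))"
    by (rule free_energy_le[OF assms])
  also have "qenergy \<delta> n (\<lambda>k. x (2 * k)) \<le> qenergy (\<delta> / 2) (2 * n) x"
  proof -
    have "(\<Sum>k<n. (x (2 * Suc k) - x (2 * k))\<^sup>2) \<le> 2 * (\<Sum>k<2 * n. (x (Suc k) - x k)\<^sup>2)" for n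
    proof (induction n)
      case (Suc n)
      have "(x (Suc (Suc (2 * n))) - x (2 * n))\<^sup>2
          \<le> 2 * (x (Suc (2 * n)) - x (2 * n))\<^sup>2 + 2 * (x (Suc (Suc (2 * n))) - x (Suc (2 * n)))\<^sup>2"
        using sum_squares_bound[of "x (Suc (2 * n)) - x (2 * n)" "x (Suc (Suc (2 * n))) - x (Suc (2 * n))"]
        by (simp add: power2_eq_square algebra_simps)
      then show ?case using Suc by simp
    qed simp
    from divide_right_mono[OF this[of n], of \<delta>] show ?thesis
      using assms(1) by (simp add: qenergy_def field_simps)
  qed
  finally show ?thesis using x(2) by (simp add: ennreal_leI)
qed

section \<open>The expected climb of a Gaussian walk: upper bound\<close>

definition gstep :: "real \<Rightarrow> real measure" where
  "gstep \<delta> = density lborel (\<lambda>x. ennreal (normal_density 0 (sqrt \<delta>) x))"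

definition gwalk :: "real \<Rightarrow> nat \<Rightarrow> (nat \<Rightarrow> real) measure" where
  "gwalk \<delta> n = Pi\<^sub>M {..<n} (\<lambda>_. gstep \<delta>)"

lemma sets_gstep[simp, measurable_cong]: "sets (gstep \<delta>) = sets borel"
  by (simp add: gstep_def)

lemma space_gstep[simp]: "space (gstep \<delta>) = UNIV"
  by (simp add: gstep_def)

lemma prob_space_gstep: "\<delta> > 0 \<Longrightarrow> prob_space (gstep \<delta>)"
  unfolding gstep_def by (rule prob_space_normal_density) simp

lemma gstep_exp:
  assumes "\<delta> > 0"
  shows "has_bochner_integral (gstep \<delta>) (\<lambda>x. exp (s * x)) (exp (s\<^sup>2 * \<delta> / 2))"
proof -
  have eq: "normal_density 0 (sqrt \<delta>) x * exp (s * x) = exp (s\<^sup>2 * \<delta> / 2) * normal_density (s * \<delta>) (sqrt \<delta>) x" for x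
  proof -
    have "- (x\<^sup>2 / (2 * \<delta>)) + s * x = s\<^sup>2 * \<delta> / 2 + - ((x - s * \<delta>)\<^sup>2 / (2 * \<delta>))"
      using assms by (simp add: field_simps power2_eq_square)
    then have "exp (- (x\<^sup>2 / (2 * \<delta>))) * exp (s * x) = exp (s\<^sup>2 * \<delta> / 2) * exp (- ((x - s * \<delta>)\<^sup>2 / (2 * \<delta>)))"
      by (simp only: exp_add[symmetric])
    then show ?thesis using assms by (simp add: normal_density_def)
  qed
  have "has_bochner_integral lborel (\<lambda>x. exp (s\<^sup>2 * \<delta> / 2) * normal_density (s * \<delta>) (sqrt \<delta>) x) (exp (s\<^sup>2 * \<delta> / 2) * 1)"
    using assms by (intro has_bochner_integral_mult_right)
      (simp add: has_bochner_integral_iff)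
  then have "has_bochner_integral lborel (\<lambda>x. normal_density 0 (sqrt \<delta>) x *\<^sub>R exp (s * x)) (exp (s\<^sup>2 * \<delta> / 2))"
    by (simp add: eq)
  then show ?thesis
    unfolding gstep_def by (intro has_bochner_integral_density) auto
qed

lemma gstep_moments:
  assumes "\<delta> > 0"
  shows "has_bochner_integral (gstep \<delta>) (\<lambda>x. x) 0"
    and "has_bochner_integral (gstep \<delta>) (\<lambda>x. x\<^sup>2) \<delta>"
    and "has_bochner_integral (gstep \<delta>) (\<lambda>x. k) (k::real)"
proof -
  have "has_bochner_integral lborel (\<lambda>x. normal_density 0 (sqrt \<delta>) x *\<^sub>R x) 0"
    using normal_moment_nz_1[of "sqrt \<delta>" 0] assms by simp
  then show "has_bochner_integral (gstep \<delta>) (\<lambda>x. x) 0"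
    unfolding gstep_def by (intro has_bochner_integral_density) auto
  have "has_bochner_integral lborel (\<lambda>x. normal_density 0 (sqrt \<delta>) x *\<^sub>R x\<^sup>2) \<delta>"
    using normal_moment_even[of "sqrt \<delta>" 0 1] assms by (simp add: fact_numeral)
  then show "has_bochner_integral (gstep \<delta>) (\<lambda>x. x\<^sup>2) \<delta>"
    unfolding gstep_def by (intro has_bochner_integral_density) auto
  interpret prob_space "gstep \<delta>" by (rule prob_space_gstep[OF assms])
  show "has_bochner_integral (gstep \<delta>) (\<lambda>x. k) k"
    using prob_space by (simp add: has_bochner_integral_iff)
qed

text \<open>
  For a Brownian motion with drift \<open>- c\<close> this function grows by \<open>c\<close> per unit of time in
  expectation, and its derivative vanishes at \<open>0\<close>, so that reflection there does not count; at
  \<open>r\<close> the derivative is \<open>exp (2 c r) - 1\<close>, which is what a unit of lift is worth.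
\<close>

definition potential :: "real \<Rightarrow> real \<Rightarrow> real" where
  "potential c x = (exp (2 * c * x) - 1) / (2 * c) - x"

lemma potential_nonneg: "c > 0 \<Longrightarrow> 0 \<le> potential c x"
  using exp_ge_add_one_self[of "2 * c * x"] by (simp add: potential_def field_simps)

lemma potential_0[simp]: "potential c 0 = 0"
  by (simp add: potential_def)

text \<open>
  Convexity: above \<open>r\<close> the function lies above its tangent at \<open>r\<close>, below \<open>0\<close> it
  lies above its minimum.
\<close>

lemma potential_clamp_le:
  assumes "c > 0" "0 \<le> r"
  shows "(exp (2 * c * r) - 1) * max 0 (z - r) + potential c (clamp r z) \<le> potential c z"
proof -
  consider "z < 0" | "0 \<le> z" "z \<le> r" | "r < z" by linarith
  then show ?thesis
  proof cases
    case 1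
    then show ?thesis using potential_nonneg[OF assms(1), of z] assms by (simp add: clamp_def)
  next
    case 2
    then show ?thesis by (simp add: clamp_def)
  next
    case 3
    have "exp (2 * c * r) * (2 * c * (z - r)) \<le> exp (2 * c * r) * (exp (2 * c * (z - r)) - 1)"
    proof (rule mult_left_mono)
      show "2 * c * (z - r) \<le> exp (2 * c * (z - r)) - 1"
        using exp_ge_add_one_self[of "2 * c * (z - r)"] by linarith
    qed simp
    also have "\<dots> = exp (2 * c * z) - exp (2 * c * r)"
      by (simp add: algebra_simps flip: exp_add)
    finally have "exp (2 * c * r) * (z - r) \<le> (exp (2 * c * z) - exp (2 * c * r)) / (2 * c)"
      using assms by (simp add: field_simps)
    then show ?thesis using 3 assms by (simp add: clamp_def potential_def algebra_simps diff_divide_distrib)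
  qed
qed

text \<open>
  The exponential has mean \<open>exp (2 c R)\<close> exactly, because the drift \<open>- c \<delta>\<close> balances
  the variance \<open>\<delta>\<close>; no error term arises from the mesh.
\<close>

lemma gstep_potential:
  assumes "\<delta> > 0" "c > 0" "s\<^sup>2 = 1"
  shows "has_bochner_integral (gstep \<delta>) (\<lambda>x. potential c (R + s * x - c * \<delta>)) (potential c R + c * \<delta>)"
proof -
  have "has_bochner_integral (gstep \<delta>)
     (\<lambda>x. exp (2 * c * (R - c * \<delta>)) / (2 * c) * exp ((2 * c * s) * x) - (1 / (2 * c) + (R - c * \<delta>)) - s * x)
     (exp (2 * c * (R - c * \<delta>)) / (2 * c) * exp ((2 * c * s)\<^sup>2 * \<delta> / 2) - (1 / (2 * c) + (R - c * \<delta>)) - s * 0)"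
    by (intro has_bochner_integral_diff has_bochner_integral_mult_right gstep_exp gstep_moments assms)
  moreover have "exp (2 * c * (R - c * \<delta>)) * exp ((2 * c * s)\<^sup>2 * \<delta> / 2) = exp (2 * c * R)"
    using assms(3) by (simp add: power_mult_distrib power2_eq_square algebra_simps flip: exp_add)
  moreover have "exp (2 * c * (R - c * \<delta>)) * exp ((2 * c * s) * x) = exp (2 * c * (R + s * x - c * \<delta>))" for x
    by (simp add: algebra_simps flip: exp_add)
  ultimately show ?thesis
    by (simp add: potential_def diff_divide_distrib algebra_simps)
qed

lemma gap_cong: "(\<And>i. i < k \<Longrightarrow> d i = d' i) \<Longrightarrow> gap a r d k = gap a r d' k"
  by (induction k) auto

lemma climb_cong: "(\<And>i. i < n \<Longrightarrow> d i = d' i) \<Longrightarrow> climb a r d n = climb a r d' n"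
  unfolding climb_def by (intro sum.cong refl arg_cong2[where f = max]) (auto cong: gap_cong)

lemma gap_measurable:
  assumes "A \<in> borel_measurable N" and "\<And>i. i < n \<Longrightarrow> (\<lambda>\<omega>. d \<omega> i) \<in> borel_measurable N" and "k \<le> n"
  shows "(\<lambda>\<omega>. gap (A \<omega>) r (d \<omega>) k) \<in> borel_measurable N"
  using assms(3)
proof (induction k)
  case (Suc k)
  have [measurable]: "(\<lambda>\<omega>. gap (A \<omega>) r (d \<omega>) k) \<in> borel_measurable N" "(\<lambda>\<omega>. d \<omega> k) \<in> borel_measurable N"
    "A \<in> borel_measurable N"
    using Suc assms by auto
  show ?case by (simp add: clamp_def)
qed simp

lemma climb_measurable:
  assumes "A \<in> borel_measurable N" and "\<And>i. i < n \<Longrightarrow> (\<lambda>\<omega>. d \<omega> i) \<in> borel_measurable N"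
  shows "(\<lambda>\<omega>. climb (A \<omega>) r (d \<omega>) n) \<in> borel_measurable N"
proof -
  have "(\<lambda>\<omega>. gap (A \<omega>) r (d \<omega>) k) \<in> borel_measurable N" if "k < n" for k
    by (rule gap_measurable[OF assms]) (use that in auto)
  then show ?thesis
    unfolding climb_def using assms
    by (intro borel_measurable_sum borel_measurable_max borel_measurable_diff borel_measurable_add
        borel_measurable_const) auto
qed

lemma climb_Suc_upd:
  "climb a r (\<lambda>i. s * (x(n := y)) i) (Suc n)
    = climb a r (\<lambda>i. s * x i) n + max 0 (gap a r (\<lambda>i. s * x i) n + s * y - a - r)"
  "gap a r (\<lambda>i. s * (x(n := y)) i) (Suc n) = clamp r (gap a r (\<lambda>i. s * x i) n + s * y - a)"
proof -
  have "climb a r (\<lambda>i. s * (x(n := y)) i) n = climb a r (\<lambda>i. s * x i) n"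
    and g: "gap a r (\<lambda>i. s * (x(n := y)) i) n = gap a r (\<lambda>i. s * x i) n"
    by (auto intro: climb_cong gap_cong)
  then show "climb a r (\<lambda>i. s * (x(n := y)) i) (Suc n)
    = climb a r (\<lambda>i. s * x i) n + max 0 (gap a r (\<lambda>i. s * x i) n + s * y - a - r)"
    by (simp add: climb_def)
  show "gap a r (\<lambda>i. s * (x(n := y)) i) (Suc n) = clamp r (gap a r (\<lambda>i. s * x i) n + s * y - a)"
    by (simp only: gap.simps g fun_upd_same)
qed

text \<open>
  Fubini for the last step, the form in which expectations are computed by induction along the walk.
\<close>

lemma gwalk_Suc:
  assumes "\<delta> > 0" "f \<in> borel_measurable (gwalk \<delta> (Suc n))"
  shows "(\<integral>\<^sup>+x. f x \<partial>gwalk \<delta> (Suc n)) = (\<integral>\<^sup>+x. (\<integral>\<^sup>+y. f (x(n := y)) \<partial>gstep \<delta>) \<partial>gwalk \<delta> n)"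
proof -
  interpret prob_space "gstep \<delta>" by (rule prob_space_gstep[OF assms(1)])
  interpret product_sigma_finite "\<lambda>_::nat. gstep \<delta>" by standard
  have e: "{..<Suc n} = insert n {..<n}" by auto
  show ?thesis
    using assms(2) unfolding gwalk_def e by (intro product_nn_integral_insert) auto
qed

lemma gwalk_coordinate: "i < n \<Longrightarrow> (\<lambda>x. x i) \<in> borel_measurable (gwalk \<delta> n)"
  unfolding gwalk_def
  by (subst measurable_cong_sets[OF refl sets_gstep[symmetric]]) (auto intro: measurable_component_singleton)

lemma prob_space_gwalk: "\<delta> > 0 \<Longrightarrow> prob_space (gwalk \<delta> n)"
  unfolding gwalk_def by (intro prob_space_PiM prob_space_gstep)

lemma gwalk_climb_measurable:
  "(\<lambda>x. climb a r (\<lambda>i. s * x i) n) \<in> borel_measurable (gwalk \<delta> n)"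
  "(\<lambda>x. gap a r (\<lambda>i. s * x i) n) \<in> borel_measurable (gwalk \<delta> n)"
proof -
  have m: "(\<lambda>x. s * x i) \<in> borel_measurable (gwalk \<delta> n)" if "i < n" for i
    using gwalk_coordinate[OF that, of \<delta>] by simp
  show "(\<lambda>x. climb a r (\<lambda>i. s * x i) n) \<in> borel_measurable (gwalk \<delta> n)"
    by (rule climb_measurable[OF borel_measurable_const m])
  show "(\<lambda>x. gap a r (\<lambda>i. s * x i) n) \<in> borel_measurable (gwalk \<delta> n)"
    by (rule gap_measurable[OF borel_measurable_const m order_refl])
qed

text \<open>
  Lift, weighted by its worth, plus potential grows by at most \<open>c \<delta>\<close> in each step.
\<close>

lemma climb_potential_expectation:
  assumes "\<delta> > 0" "c > 0" "0 \<le> r" "s\<^sup>2 = 1"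
  shows "(\<integral>\<^sup>+x. ennreal ((exp (2 * c * r) - 1) * climb (c * \<delta>) r (\<lambda>i. s * x i) n
      + potential c (gap (c * \<delta>) r (\<lambda>i. s * x i) n)) \<partial>gwalk \<delta> n) \<le> ennreal (real n * (c * \<delta>))"
proof (induction n)
  case 0
  show ?case by (simp add: climb_def)
next
  case (Suc n)
  define K where "K = exp (2 * c * r) - 1"
  have K: "0 \<le> K" using assms by (simp add: K_def)
  interpret P: prob_space "gwalk \<delta> n" by (rule prob_space_gwalk[OF assms(1)])
  define f where "f = (\<lambda>n x. K * climb (c * \<delta>) r (\<lambda>i. s * x i) n + potential c (gap (c * \<delta>) r (\<lambda>i. s * x i) n))"
  have fm[measurable]: "f n \<in> borel_measurable (gwalk \<delta> n)" for n
  proof -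
    note [measurable] = gwalk_climb_measurable[of "c * \<delta>" r s n \<delta>]
    show ?thesis unfolding f_def potential_def by measurable
  qed
  have f0: "0 \<le> f n x" for n x
    using K climb_nonneg potential_nonneg[OF assms(2)] by (simp add: f_def)
  have step: "(\<integral>\<^sup>+y. ennreal (f (Suc n) (x(n := y))) \<partial>gstep \<delta>) \<le> ennreal (f n x) + ennreal (c * \<delta>)" for x
  proof -
    define R where "R = gap (c * \<delta>) r (\<lambda>i. s * x i) n"
    define C where "C = K * climb (c * \<delta>) r (\<lambda>i. s * x i) n"
    have C: "0 \<le> C" using K climb_nonneg by (simp add: C_def)
    have I: "has_bochner_integral (gstep \<delta>) (\<lambda>y. C + potential c (R + s * y - c * \<delta>)) (C + (potential c R + c * \<delta>))"
      by (intro has_bochner_integral_add gstep_moments gstep_potential assms)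
    have "f (Suc n) (x(n := y)) \<le> C + potential c (R + s * y - c * \<delta>)" for y
      using potential_clamp_le[OF assms(2,3), of "R + s * y - c * \<delta>"]
      unfolding f_def climb_Suc_upd by (simp add: C_def R_def K_def algebra_simps)
    then have "(\<integral>\<^sup>+y. ennreal (f (Suc n) (x(n := y))) \<partial>gstep \<delta>)
        \<le> (\<integral>\<^sup>+y. ennreal (C + potential c (R + s * y - c * \<delta>)) \<partial>gstep \<delta>)"
      by (intro nn_integral_mono ennreal_leI)
    also have "\<dots> = ennreal (C + (potential c R + c * \<delta>))"
      using I C potential_nonneg[OF assms(2)]
      by (subst nn_integral_eq_integral) (auto simp: has_bochner_integral_iff)
    also have "\<dots> = ennreal (f n x) + ennreal (c * \<delta>)"
      using f0[of n x] assms by (simp add: f_def C_def R_def add.assoc flip: ennreal_plus)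
    finally show ?thesis .
  qed
  have "(\<integral>\<^sup>+x. ennreal (f (Suc n) x) \<partial>gwalk \<delta> (Suc n)) \<le> (\<integral>\<^sup>+x. ennreal (f n x) + ennreal (c * \<delta>) \<partial>gwalk \<delta> n)"
    by (subst gwalk_Suc[OF assms(1)]) (auto intro!: nn_integral_mono step)
  also have "\<dots> = (\<integral>\<^sup>+x. ennreal (f n x) \<partial>gwalk \<delta> n) + ennreal (c * \<delta>)"
    by (subst nn_integral_add) (auto simp: P.emeasure_space_1)
  also have "\<dots> \<le> ennreal (real n * (c * \<delta>)) + ennreal (c * \<delta>)"
    using Suc by (intro add_right_mono) (simp add: f_def K_def)
  also have "\<dots> = ennreal (real (Suc n) * (c * \<delta>))"
    using assms by (simp add: algebra_simps flip: ennreal_plus)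
  finally show ?case by (simp add: f_def K_def)
qed

lemma climb_expectation_upper:
  assumes "\<delta> > 0" "c > 0" "r > 0" "s\<^sup>2 = 1"
  shows "(\<integral>\<^sup>+x. ennreal (climb (c * \<delta>) r (\<lambda>i. s * x i) n) \<partial>gwalk \<delta> n)
    \<le> ennreal (real n * \<delta> * (c / (exp (2 * c * r) - 1)))"
proof -
  define K where "K = exp (2 * c * r) - 1"
  have K: "0 < K" using assms by (simp add: K_def)
  have [measurable]: "(\<lambda>x. climb (c * \<delta>) r (\<lambda>i. s * x i) n) \<in> borel_measurable (gwalk \<delta> n)"
    by (rule gwalk_climb_measurable)
  have "(\<integral>\<^sup>+x. ennreal (climb (c * \<delta>) r (\<lambda>i. s * x i) n) \<partial>gwalk \<delta> n)
      \<le> (\<integral>\<^sup>+x. ennreal (1 / K) * ennreal (K * climb (c * \<delta>) r (\<lambda>i. s * x i) n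
      + potential c (gap (c * \<delta>) r (\<lambda>i. s * x i) n)) \<partial>gwalk \<delta> n)"
  proof (rule nn_integral_mono)
    fix x
    have "climb (c * \<delta>) r (\<lambda>i. s * x i) n \<le> 1 / K * (K * climb (c * \<delta>) r (\<lambda>i. s * x i) n
      + potential c (gap (c * \<delta>) r (\<lambda>i. s * x i) n))"
      using K potential_nonneg[OF assms(2), of "gap (c * \<delta>) r (\<lambda>i. s * x i) n"]
      by (simp add: distrib_left)
    then show "ennreal (climb (c * \<delta>) r (\<lambda>i. s * x i) n) \<le> ennreal (1 / K) *
      ennreal (K * climb (c * \<delta>) r (\<lambda>i. s * x i) n + potential c (gap (c * \<delta>) r (\<lambda>i. s * x i) n))"
      using K by (simp only: ennreal_mult'[symmetric] ennreal_leI zero_le_divide_1_iff less_imp_le)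
  qed
  also have "\<dots> = ennreal (1 / K) * (\<integral>\<^sup>+x. ennreal (K * climb (c * \<delta>) r (\<lambda>i. s * x i) n
      + potential c (gap (c * \<delta>) r (\<lambda>i. s * x i) n)) \<partial>gwalk \<delta> n)"
  proof (rule nn_integral_cmult)
    note [measurable] = gwalk_climb_measurable[of "c * \<delta>" r s n \<delta>]
    show "(\<lambda>x. ennreal (K * climb (c * \<delta>) r (\<lambda>i. s * x i) n + potential c (gap (c * \<delta>) r (\<lambda>i. s * x i) n)))
        \<in> borel_measurable (gwalk \<delta> n)"
      unfolding potential_def by measurable
  qed
  also have "\<dots> \<le> ennreal (1 / K) * ennreal (real n * (c * \<delta>))"
    using climb_potential_expectation[OF assms(1,2) less_imp_le[OF assms(3)] assms(4), of n]
    by (intro mult_left_mono) (auto simp: K_def)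
  also have "\<dots> = ennreal (real n * \<delta> * (c / K))"
    using K assms by (simp add: field_simps flip: ennreal_mult')
  finally show ?thesis by (simp add: K_def)
qed

section \<open>The expected climb of a Gaussian walk: lower bound\<close>

lemma ennreal_integral_le_nn_integral:
  fixes h :: "'a \<Rightarrow> real"
  assumes "integrable M h"
  shows "ennreal (\<integral>x. h x \<partial>M) \<le> (\<integral>\<^sup>+x. ennreal (h x) \<partial>M)"
proof -
  have "ennreal (\<integral>x. h x \<partial>M) \<le> ennreal (\<integral>x. max 0 (h x) \<partial>M)"
    using assms by (intro ennreal_leI integral_mono) auto
  also have "\<dots> = (\<integral>\<^sup>+x. ennreal (max 0 (h x)) \<partial>M)"
    using assms by (intro nn_integral_eq_integral[symmetric]) auto
  also have "\<dots> = (\<integral>\<^sup>+x. ennreal (h x) \<partial>M)"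
    by (intro nn_integral_cong) (simp add: max_def ennreal_neg)
  finally show ?thesis .
qed

lemma exp_remainder_le:
  fixes u :: real
  assumes "0 \<le> u"
  shows "exp u - 1 - u \<le> u\<^sup>2 * exp u" and "exp (- u) - 1 + u \<le> u\<^sup>2"
proof -
  have a: "exp u - 1 \<le> u * exp u"
  proof -
    have "exp u * (1 - u) \<le> exp u * exp (- u)"
      using exp_ge_add_one_self[of "- u"] by (intro mult_left_mono) auto
    also have "\<dots> = 1" by (simp flip: exp_add)
    finally show ?thesis by (simp add: algebra_simps)
  qed
  have "exp u - 1 - u \<le> u * (exp u - 1)" using a by (simp add: algebra_simps)
  also have "\<dots> \<le> u * (u * exp u)" by (rule mult_left_mono[OF a assms])
  finally show "exp u - 1 - u \<le> u\<^sup>2 * exp u" by (simp add: power2_eq_square mult.assoc)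
  have e: "1 - u \<le> exp (- u)" using exp_ge_add_one_self[of "- u"] by simp
  have "exp (- u) * (1 + u) \<le> exp (- u) * exp u"
    using exp_ge_add_one_self[of u] by (intro mult_left_mono) auto
  then have "exp (- u) * (1 + u) \<le> 1" by (simp flip: exp_add)
  then have "exp (- u) - 1 + u \<le> u * (1 - exp (- u))" by (simp add: algebra_simps)
  also have "\<dots> \<le> u * u" using e by (intro mult_left_mono[OF _ assms]) simp
  finally show "exp (- u) - 1 + u \<le> u\<^sup>2" by (simp add: power2_eq_square)
qed

text \<open>
  The loss in \<open>potential_clamp_le\<close> is quadratic in the overshoot \<open>q\<close>, while clamping decreases
  the squared distance to the middle of the interval by an amount linear in \<open>q\<close>.
\<close>

lemma potential_clamp_error:
  fixes r c z :: real
  assumes "c > 0" "r > 0"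
  defines "q \<equiv> \<bar>z - clamp r z\<bar>"
  shows "potential c z \<le> (exp (2 * c * r) - 1) * max 0 (z - r) + potential c (clamp r z)
     + 2 * c * exp (2 * c * r) * (q\<^sup>2 * exp (2 * c * q))"
    and "r * q \<le> (z - r / 2)\<^sup>2 - (clamp r z - r / 2)\<^sup>2"
proof -
  consider "z < 0" | "0 \<le> z" "z \<le> r" | "r < z" by linarith
  then have "potential c z \<le> (exp (2 * c * r) - 1) * max 0 (z - r) + potential c (clamp r z)
     + 2 * c * exp (2 * c * r) * (q\<^sup>2 * exp (2 * c * q)) \<and> r * q \<le> (z - r / 2)\<^sup>2 - (clamp r z - r / 2)\<^sup>2"
  proof cases
    case 1
    then have q: "q = - z" "clamp r z = 0" using assms by (auto simp: q_def clamp_def)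
    have q0: "0 \<le> 2 * c * q" using assms(1) q(1) 1 by (intro mult_nonneg_nonneg) auto
    have "exp (- (2 * c * q)) - 1 + 2 * c * q \<le> (2 * c * q)\<^sup>2"
      by (rule exp_remainder_le(2)[OF q0])
    then have "(exp (- (2 * c * q)) - 1 + 2 * c * q) / (2 * c) \<le> (2 * c * q)\<^sup>2 / (2 * c)"
      using assms(1) by (intro divide_right_mono) auto
    then have "potential c z \<le> 2 * c * q\<^sup>2"
      using assms(1) q by (simp add: potential_def power2_eq_square field_simps)
    also have "2 * c * q\<^sup>2 \<le> 2 * c * exp (2 * c * r) * (q\<^sup>2 * exp (2 * c * q))"
    proof -
      have "1 * 1 \<le> exp (2 * c * r) * exp (2 * c * q)"
        by (rule mult_mono) (use assms(1,2) in simp, simp only: one_le_exp_iff q0, simp_all)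
      then have "2 * c * q\<^sup>2 * 1 \<le> 2 * c * q\<^sup>2 * (exp (2 * c * r) * exp (2 * c * q))"
        using assms(1) by (intro mult_left_mono) auto
      then show ?thesis by (simp add: mult_ac)
    qed
    finally have "potential c z \<le> 2 * c * exp (2 * c * r) * (q\<^sup>2 * exp (2 * c * q))" .
    moreover have "r * q \<le> (z - r / 2)\<^sup>2 - (clamp r z - r / 2)\<^sup>2"
      using q by (simp add: power2_eq_square algebra_simps)
    ultimately show ?thesis using q 1 assms by simp
  next
    case 2
    then show ?thesis using assms by (simp add: clamp_def q_def)
  next
    case 3
    then have q: "q = z - r" "clamp r z = r" "0 \<le> q" using assms by (auto simp: q_def clamp_def)
    have "(exp (2 * c * q) - 1 - 2 * c * q) / (2 * c) \<le> ((2 * c * q)\<^sup>2 * exp (2 * c * q)) / (2 * c)"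
      using exp_remainder_le(1)[of "2 * c * q"] assms(1) q by (intro divide_right_mono) auto
    also have "\<dots> = 2 * c * (q\<^sup>2 * exp (2 * c * q))" using assms(1) by (simp add: power2_eq_square)
    finally have "exp (2 * c * r) * ((exp (2 * c * q) - 1 - 2 * c * q) / (2 * c))
        \<le> exp (2 * c * r) * (2 * c * (q\<^sup>2 * exp (2 * c * q)))"
      by (intro mult_left_mono) auto
    moreover have z: "z = r + q" using q(1) by simp
    have "exp (2 * c * z) = exp (2 * c * r) * exp (2 * c * q)"
      unfolding z by (simp add: distrib_left exp_add)
    moreover have "E1 * ((E2 - 1 - 2 * c * q) / (2 * c))
        = ((E1 * E2 - 1) / (2 * c) - (r + q)) - ((E1 - 1) / (2 * c) - r) - (E1 - 1) * q" for E1 E2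
      using assms(1) by (simp add: field_simps)
    ultimately have e: "potential c z - potential c r - (exp (2 * c * r) - 1) * q
        \<le> exp (2 * c * r) * (2 * c * (q\<^sup>2 * exp (2 * c * q)))"
      unfolding potential_def using z by simp
    moreover have "r * q \<le> (z - r / 2)\<^sup>2 - (r - r / 2)\<^sup>2"
    proof -
      have "(z - r / 2)\<^sup>2 - (r - r / 2)\<^sup>2 = r * q + q\<^sup>2" unfolding z by (simp add: power2_eq_square field_simps)
      then show ?thesis by simp
    qed
    ultimately show ?thesis using q 3 e by (simp add: mult_ac)
  qed
  then show "potential c z \<le> (exp (2 * c * r) - 1) * max 0 (z - r) + potential c (clamp r z)
     + 2 * c * exp (2 * c * r) * (q\<^sup>2 * exp (2 * c * q))"
    and "r * q \<le> (z - r / 2)\<^sup>2 - (clamp r z - r / 2)\<^sup>2" by auto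
qed

text \<open>
  Subtracting a small multiple \<open>\<epsilon>\<close> of the squared distance to the middle reverses
  \<open>potential_clamp_le\<close> for small overshoots. Large ones require a large step from \<open>R\<close>, which
  is charged to the last term.
\<close>

lemma potential_clamp_ge:
  fixes r c \<epsilon> :: real
  assumes "c > 0" "r > 0" "\<epsilon> > 0"
  obtains C where "C \<ge> 0" "\<And>R z. 0 \<le> R \<Longrightarrow> R \<le> r \<Longrightarrow>
     potential c z - \<epsilon> * (z - r / 2)\<^sup>2 \<le> (exp (2 * c * r) - 1) * max 0 (z - r)
       + potential c (clamp r z) - \<epsilon> * (clamp r z - r / 2)\<^sup>2 + C * (\<bar>z - R\<bar> ^ 4 * exp (2 * c * \<bar>z - R\<bar>))"
proof -
  define A where "A = 2 * c * exp (2 * c * r)"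
  \<comment> \<open>Overshoots up to \<open>q0\<close> count as small.\<close>
  define q0 where "q0 = min 1 (\<epsilon> * r / (A * exp (2 * c)))"
  have A: "A > 0" using assms by (simp add: A_def)
  have q0: "0 < q0" "q0 \<le> 1" "A * exp (2 * c) * q0 \<le> \<epsilon> * r"
    using assms A by (auto simp: q0_def min_def field_simps)
  define C where "C = A / q0\<^sup>2"
  have C: "C \<ge> 0" using A by (simp add: C_def)
  show ?thesis
  proof (rule that[OF C])
    fix R z :: real assume R: "0 \<le> R" "R \<le> r"
    define q where "q = \<bar>z - clamp r z\<bar>"
    have qR: "0 \<le> q" "q \<le> \<bar>z - R\<bar>" using R assms by (auto simp: q_def clamp_def)
    have "A * (q\<^sup>2 * exp (2 * c * q)) \<le> \<epsilon> * (r * q) + C * (\<bar>z - R\<bar> ^ 4 * exp (2 * c * \<bar>z - R\<bar>))"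
    proof (cases "q \<le> q0")
      case True
      have "2 * c * q \<le> 2 * c" using True q0 assms by (simp add: mult_left_le)
      then have "q\<^sup>2 * exp (2 * c * q) \<le> (q0 * q) * exp (2 * c)"
        using True qR q0 by (intro mult_mono) (auto simp: power2_eq_square mult_right_mono)
      then have "A * (q\<^sup>2 * exp (2 * c * q)) \<le> A * ((q0 * q) * exp (2 * c))"
        using A by (intro mult_left_mono) auto
      also have "\<dots> = (A * exp (2 * c) * q0) * q" by simp
      also have "\<dots> \<le> \<epsilon> * r * q" using q0(3) qR(1) by (rule mult_right_mono)
      finally have "A * (q\<^sup>2 * exp (2 * c * q)) \<le> \<epsilon> * (r * q)" by simp
      moreover have "0 \<le> C * (\<bar>z - R\<bar> ^ 4 * exp (2 * c * \<bar>z - R\<bar>))" using C by simp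
      ultimately show ?thesis by linarith
    next
      case False
      have "1 \<le> q\<^sup>2 / q0\<^sup>2" using False q0 by (simp add: power_mono)
      then have "q\<^sup>2 * 1 \<le> q\<^sup>2 * (q\<^sup>2 / q0\<^sup>2)" by (intro mult_left_mono) auto
      also have "\<dots> = q ^ 4 / q0\<^sup>2" by (simp add: power2_eq_square power4_eq_xxxx)
      also have "\<dots> \<le> \<bar>z - R\<bar> ^ 4 / q0\<^sup>2" using qR by (intro divide_right_mono power_mono) auto
      finally have "q\<^sup>2 \<le> \<bar>z - R\<bar> ^ 4 / q0\<^sup>2" by simp
      then have "q\<^sup>2 * exp (2 * c * q) \<le> \<bar>z - R\<bar> ^ 4 / q0\<^sup>2 * exp (2 * c * \<bar>z - R\<bar>)"
        using qR assms by (intro mult_mono) auto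
      then have "A * (q\<^sup>2 * exp (2 * c * q)) \<le> A * (\<bar>z - R\<bar> ^ 4 / q0\<^sup>2 * exp (2 * c * \<bar>z - R\<bar>))"
        using A by (intro mult_left_mono) auto
      also have "\<dots> = C * (\<bar>z - R\<bar> ^ 4 * exp (2 * c * \<bar>z - R\<bar>))" by (simp add: C_def)
      finally show ?thesis using assms qR by (simp add: add_increasing)
    qed
    moreover have "\<epsilon> * (r * q) \<le> \<epsilon> * ((z - r / 2)\<^sup>2 - (clamp r z - r / 2)\<^sup>2)"
      using potential_clamp_error(2)[OF assms(1,2), of z] assms(3) unfolding q_def by (intro mult_left_mono) auto
    ultimately show "potential c z - \<epsilon> * (z - r / 2)\<^sup>2 \<le> (exp (2 * c * r) - 1) * max 0 (z - r)
       + potential c (clamp r z) - \<epsilon> * (clamp r z - r / 2)\<^sup>2 + C * (\<bar>z - R\<bar> ^ 4 * exp (2 * c * \<bar>z - R\<bar>))"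
      using potential_clamp_error(1)[OF assms(1,2), of z] unfolding q_def[symmetric] A_def[symmetric]
      by (simp add: algebra_simps)
  qed
qed

text \<open>
  Under a Gaussian of variance \<open>\<delta>\<close> the right-hand side has expectation of order
  \<open>\<delta>\<^sup>2\<close>, negligible against the length \<open>\<delta>\<close> of a step; the left-hand side
  is the large-step term of \<open>potential_clamp_ge\<close>.
\<close>

lemma fourth_power_exp_le:
  fixes u \<delta> c :: real
  assumes "\<delta> > 0"
  defines "\<theta> \<equiv> 2 * c + 1 / sqrt \<delta>"
  shows "\<bar>u\<bar> ^ 4 * exp (2 * c * \<bar>u\<bar>) \<le> 256 * \<delta>\<^sup>2 * (exp (\<theta> * u) + exp (- \<theta> * u))"
proof -
  define x where "x = \<bar>u\<bar> / sqrt \<delta>"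
  have x: "0 \<le> x" using assms by (simp add: x_def)
  \<comment> \<open>The constant is \<open>4 ^ 4 = 256\<close>.\<close>
  have "x / 4 \<le> exp (x / 4)" using exp_ge_add_one_self[of "x / 4"] by linarith
  then have "(x / 4) ^ 4 \<le> exp (x / 4) ^ 4" using x by (intro power_mono) auto
  also have "\<dots> = exp x" by (simp flip: exp_of_nat_mult)
  finally have "x ^ 4 \<le> 256 * exp x" by (simp add: power_divide)
  moreover have "x ^ 4 = \<bar>u\<bar> ^ 4 / \<delta>\<^sup>2"
    using assms by (simp add: x_def power_divide power4_eq_xxxx power2_eq_square flip: real_sqrt_mult)
  ultimately have "\<bar>u\<bar> ^ 4 \<le> 256 * \<delta>\<^sup>2 * exp x" using assms by (simp add: field_simps)
  then have "\<bar>u\<bar> ^ 4 * exp (2 * c * \<bar>u\<bar>) \<le> 256 * \<delta>\<^sup>2 * exp x * exp (2 * c * \<bar>u\<bar>)"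
    by (intro mult_right_mono) auto
  also have "\<dots> = 256 * \<delta>\<^sup>2 * exp (\<theta> * \<bar>u\<bar>)"
    by (simp add: \<theta>_def x_def algebra_simps flip: exp_add)
  also have "\<dots> \<le> 256 * \<delta>\<^sup>2 * (exp (\<theta> * u) + exp (- \<theta> * u))"
    by (intro mult_left_mono) (auto simp: abs_if)
  finally show ?thesis .
qed

text \<open>
  The function \<open>h\<close> is a minorant of the corrected potential after one step plus the worth of the lift, and
  has an explicit Gaussian expectation. The correction costs at most \<open>\<eta> / 2\<close> per unit of time, the
  large steps another \<open>\<eta> / 2\<close>.
\<close>

lemma climb_expectation_lower_step:
  fixes c r \<eta> :: real
  assumes "c > 0" "r > 0" "\<eta> > 0"
  obtains \<epsilon> \<delta>0 where "0 < \<epsilon>" "\<epsilon> \<le> 1" "\<delta>0 > 0"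
    "\<And>\<delta> s R. 0 < \<delta> \<Longrightarrow> \<delta> < \<delta>0 \<Longrightarrow> s\<^sup>2 = 1 \<Longrightarrow> 0 \<le> R \<Longrightarrow> R \<le> r \<Longrightarrow>
      \<exists>h I. has_bochner_integral (gstep \<delta>) h I
        \<and> potential c R - \<epsilon> * (R - r / 2)\<^sup>2 + (c - \<eta>) * \<delta> \<le> I
        \<and> (\<forall>y. h y \<le> (exp (2 * c * r) - 1) * max 0 (R + s * y - c * \<delta> - r)
             + potential c (clamp r (R + s * y - c * \<delta>)) - \<epsilon> * (clamp r (R + s * y - c * \<delta>) - r / 2)\<^sup>2)"
proof -
  \<comment> \<open>In one step the expected squared distance to the middle grows by at most \<open>(1 + c\<^sup>2 + r * c) * \<delta>\<close>.\<close>
  define \<epsilon> where "\<epsilon> = min 1 (\<eta> / (2 * (1 + c\<^sup>2 + r * c)))"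
  have pos: "0 < 1 + c\<^sup>2 + r * c" using assms by (simp add: add_pos_nonneg)
  have half: "a / (2 * X) * X = a / 2" if "X > 0" for a X :: real using that by simp
  have \<epsilon>: "0 < \<epsilon>" "\<epsilon> \<le> 1" "\<epsilon> * (1 + c\<^sup>2 + r * c) \<le> \<eta> / 2"
  proof -
    show "0 < \<epsilon>" "\<epsilon> \<le> 1" using pos assms by (auto simp: \<epsilon>_def)
    have "\<epsilon> * (1 + c\<^sup>2 + r * c) \<le> \<eta> / (2 * (1 + c\<^sup>2 + r * c)) * (1 + c\<^sup>2 + r * c)"
      using pos by (intro mult_right_mono) (auto simp: \<epsilon>_def)
    also have "\<dots> = \<eta> / 2" by (rule half[OF pos])
    finally show "\<epsilon> * (1 + c\<^sup>2 + r * c) \<le> \<eta> / 2" .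
  qed
  obtain C where C: "C \<ge> 0" "\<And>R z. 0 \<le> R \<Longrightarrow> R \<le> r \<Longrightarrow>
     potential c z - \<epsilon> * (z - r / 2)\<^sup>2 \<le> (exp (2 * c * r) - 1) * max 0 (z - r)
       + potential c (clamp r z) - \<epsilon> * (clamp r z - r / 2)\<^sup>2 + C * (\<bar>z - R\<bar> ^ 4 * exp (2 * c * \<bar>z - R\<bar>))"
    using potential_clamp_ge[OF assms(1,2) \<epsilon>(1)] by blast
  \<comment> \<open>A bound for the exponential moments in \<open>IG\<close> for all \<open>\<delta> \<le> 1\<close>.\<close>
  define E where "E = exp (c * (2 * c + 1) + (2 * c + 1)\<^sup>2 / 2)"
  define \<delta>0 where "\<delta>0 = min 1 (\<eta> / (2 * (C * 512 * E + 1)))"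
  have E: "E > 0" by (simp add: E_def)
  have CE: "0 < C * 512 * E + 1" using C(1) E by (simp add: add_nonneg_pos)
  have d0: "\<delta>0 > 0" using assms CE by (simp add: \<delta>0_def)
  show ?thesis
  proof (rule that[OF \<epsilon>(1,2) d0])
    fix \<delta> s R :: real
    assume \<delta>: "0 < \<delta>" "\<delta> < \<delta>0" and s: "s\<^sup>2 = 1" and R: "0 \<le> R" "R \<le> r"
    have d1: "\<delta> \<le> 1" "C * 512 * E * \<delta> \<le> \<eta> / 2"
    proof -
      show "\<delta> \<le> 1" using \<delta> by (simp add: \<delta>0_def)
      have "(C * 512 * E + 1) * \<delta> \<le> (C * 512 * E + 1) * (\<eta> / (2 * (C * 512 * E + 1)))"
        using \<delta> CE by (intro mult_left_mono) (auto simp: \<delta>0_def)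
      also have "\<dots> = \<eta> / 2" using half[OF CE] by (simp only: mult.commute)
      finally show "C * 512 * E * \<delta> \<le> \<eta> / 2" using \<delta>(1) by (simp add: algebra_simps)
    qed
    define \<theta> where "\<theta> = 2 * c + 1 / sqrt \<delta>"
    define G where "G = (\<lambda>y. 256 * \<delta>\<^sup>2 * (exp (\<theta> * (s * y - c * \<delta>)) + exp (- \<theta> * (s * y - c * \<delta>))))"
    define IG where "IG = 256 * \<delta>\<^sup>2 * (exp (- \<theta> * (c * \<delta>)) * exp ((\<theta> * s)\<^sup>2 * \<delta> / 2)
        + exp (\<theta> * (c * \<delta>)) * exp ((- \<theta> * s)\<^sup>2 * \<delta> / 2))"
    have "has_bochner_integral (gstep \<delta>) (\<lambda>y. 256 * \<delta>\<^sup>2 * (exp (- \<theta> * (c * \<delta>)) * exp ((\<theta> * s) * y)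
        + exp (\<theta> * (c * \<delta>)) * exp ((- \<theta> * s) * y))) IG"
      unfolding IG_def
      by (intro has_bochner_integral_mult_right has_bochner_integral_add gstep_exp \<delta>(1))
    moreover have "(\<lambda>y. 256 * \<delta>\<^sup>2 * (exp (- \<theta> * (c * \<delta>)) * exp ((\<theta> * s) * y)
        + exp (\<theta> * (c * \<delta>)) * exp ((- \<theta> * s) * y))) = G"
      by (simp add: G_def algebra_simps flip: exp_add)
    ultimately have HG: "has_bochner_integral (gstep \<delta>) G IG" by simp
    have IGle: "IG \<le> 512 * E * \<delta>\<^sup>2"
    proof -
      have sq: "sqrt \<delta> * sqrt \<delta> = \<delta>" "0 < sqrt \<delta>" "sqrt \<delta> \<le> 1" using \<delta>(1) d1 by auto
      have t0: "0 \<le> \<theta>" using assms \<delta>(1) by (simp add: \<theta>_def)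
      have td: "\<theta> * \<delta> = 2 * c * \<delta> + sqrt \<delta>"
        using \<delta>(1) by (simp add: \<theta>_def algebra_simps real_div_sqrt)
      have "\<theta> * \<delta> \<le> 2 * c + 1" unfolding td using d1 sq assms by (intro add_mono) (auto simp: mult_left_le)
      then have a: "\<theta> * (c * \<delta>) \<le> c * (2 * c + 1)"
        using mult_left_mono[of "\<theta> * \<delta>" "2 * c + 1" c] assms by (simp add: mult_ac)
      have "\<theta> * sqrt \<delta> = 2 * c * sqrt \<delta> + 1" using sq by (simp add: \<theta>_def algebra_simps)
      also have "\<dots> \<le> 2 * c + 1" using sq assms by (simp add: mult_left_le)
      finally have "(\<theta> * sqrt \<delta>)\<^sup>2 \<le> (2 * c + 1)\<^sup>2" using t0 sq by (intro power_mono) auto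
      then have b: "\<theta>\<^sup>2 * \<delta> \<le> (2 * c + 1)\<^sup>2" using sq by (simp add: power2_eq_square mult_ac)
      have e1: "exp (\<theta> * (c * \<delta>)) * exp ((- \<theta> * s)\<^sup>2 * \<delta> / 2) \<le> E"
        unfolding E_def using a b s by (simp add: power_mult_distrib flip: exp_add)
      have "- \<theta> * (c * \<delta>) \<le> \<theta> * (c * \<delta>)" using t0 assms \<delta>(1) by simp
      then have "exp (- \<theta> * (c * \<delta>)) * exp ((\<theta> * s)\<^sup>2 * \<delta> / 2) \<le> exp (\<theta> * (c * \<delta>)) * exp ((- \<theta> * s)\<^sup>2 * \<delta> / 2)"
        by (intro mult_mono) (auto simp: power_mult_distrib)
      with e1 have "exp (- \<theta> * (c * \<delta>)) * exp ((\<theta> * s)\<^sup>2 * \<delta> / 2)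
         + exp (\<theta> * (c * \<delta>)) * exp ((- \<theta> * s)\<^sup>2 * \<delta> / 2) \<le> 2 * E" by linarith
      then have "256 * \<delta>\<^sup>2 * (exp (- \<theta> * (c * \<delta>)) * exp ((\<theta> * s)\<^sup>2 * \<delta> / 2)
         + exp (\<theta> * (c * \<delta>)) * exp ((- \<theta> * s)\<^sup>2 * \<delta> / 2)) \<le> 256 * \<delta>\<^sup>2 * (2 * E)"
        by (intro mult_left_mono) auto
      then show ?thesis by (simp add: IG_def)
    qed
    define h where "h = (\<lambda>y. potential c (R + s * y - c * \<delta>)
        - \<epsilon> * ((R - r / 2 - c * \<delta>)\<^sup>2 + 2 * (R - r / 2 - c * \<delta>) * s * y + y\<^sup>2) - C * G y)"
    define I where "I = potential c R + c * \<delta>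
        - \<epsilon> * ((R - r / 2 - c * \<delta>)\<^sup>2 + 2 * (R - r / 2 - c * \<delta>) * s * 0 + \<delta>) - C * IG"
    have H: "has_bochner_integral (gstep \<delta>) h I"
      unfolding h_def I_def
      by (intro has_bochner_integral_diff has_bochner_integral_add has_bochner_integral_mult_right
          gstep_potential gstep_moments HG \<delta>(1) assms s)
    have hI: "potential c R - \<epsilon> * (R - r / 2)\<^sup>2 + (c - \<eta>) * \<delta> \<le> I"
    proof -
      have "(R - r / 2 - c * \<delta>)\<^sup>2 = (R - r / 2)\<^sup>2 - 2 * (R - r / 2) * (c * \<delta>) + c\<^sup>2 * \<delta>\<^sup>2"
        by (simp add: power2_eq_square algebra_simps)
      moreover have "- 2 * (R - r / 2) * (c * \<delta>) \<le> r * (c * \<delta>)"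
        using R assms \<delta>(1) by (intro mult_right_mono) auto
      moreover have "c\<^sup>2 * \<delta>\<^sup>2 \<le> c\<^sup>2 * \<delta>" using d1 \<delta>(1) by (intro mult_left_mono) (auto simp: power2_eq_square mult_left_le)
      ultimately have "(R - r / 2 - c * \<delta>)\<^sup>2 + \<delta> \<le> (R - r / 2)\<^sup>2 + (1 + c\<^sup>2 + r * c) * \<delta>"
        by (simp add: algebra_simps)
      then have "\<epsilon> * ((R - r / 2 - c * \<delta>)\<^sup>2 + \<delta>) \<le> \<epsilon> * ((R - r / 2)\<^sup>2 + (1 + c\<^sup>2 + r * c) * \<delta>)"
        using \<epsilon> by (intro mult_left_mono) auto
      also have "\<dots> = \<epsilon> * (R - r / 2)\<^sup>2 + \<epsilon> * (1 + c\<^sup>2 + r * c) * \<delta>" by (simp add: algebra_simps)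
      also have "\<dots> \<le> \<epsilon> * (R - r / 2)\<^sup>2 + \<eta> / 2 * \<delta>"
        using \<epsilon>(3) \<delta>(1) by (intro add_left_mono mult_right_mono) auto
      finally have 1: "\<epsilon> * ((R - r / 2 - c * \<delta>)\<^sup>2 + \<delta>) \<le> \<epsilon> * (R - r / 2)\<^sup>2 + \<eta> / 2 * \<delta>" .
      have "C * IG \<le> C * (512 * E * \<delta>\<^sup>2)" using IGle C(1) by (rule mult_left_mono)
      also have "\<dots> = C * 512 * E * \<delta> * \<delta>" by (simp add: power2_eq_square)
      also have "\<dots> \<le> \<eta> / 2 * \<delta>" using d1(2) \<delta>(1) by (intro mult_right_mono) auto
      finally have 2: "C * IG \<le> \<eta> / 2 * \<delta>" .
      show ?thesis using 1 2 unfolding I_def by (simp add: algebra_simps)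
    qed
    have hle: "h y \<le> (exp (2 * c * r) - 1) * max 0 (R + s * y - c * \<delta> - r)
             + potential c (clamp r (R + s * y - c * \<delta>)) - \<epsilon> * (clamp r (R + s * y - c * \<delta>) - r / 2)\<^sup>2" for y
    proof -
      define z where "z = R + s * y - c * \<delta>"
      have zR: "z - R = s * y - c * \<delta>" by (simp add: z_def)
      have "\<bar>z - R\<bar> ^ 4 * exp (2 * c * \<bar>z - R\<bar>) \<le> G y"
        using fourth_power_exp_le[OF \<delta>(1), of "z - R" c] unfolding G_def \<theta>_def zR .
      then have "C * (\<bar>z - R\<bar> ^ 4 * exp (2 * c * \<bar>z - R\<bar>)) \<le> C * G y" using C(1) by (rule mult_left_mono)
      moreover have e: "(z - r / 2)\<^sup>2 = (R - r / 2 - c * \<delta>)\<^sup>2 + 2 * (R - r / 2 - c * \<delta>) * s * y + y\<^sup>2"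
      proof -
        have "(z - r / 2)\<^sup>2 = (R - r / 2 - c * \<delta>)\<^sup>2 + 2 * (R - r / 2 - c * \<delta>) * s * y + s\<^sup>2 * y\<^sup>2"
          by (simp add: z_def power2_eq_square algebra_simps)
        then show ?thesis using s by simp
      qed
      ultimately show ?thesis using C(2)[OF R, of z, unfolded e] unfolding h_def z_def[symmetric] by linarith
    qed
    show "\<exists>h I. has_bochner_integral (gstep \<delta>) h I
        \<and> potential c R - \<epsilon> * (R - r / 2)\<^sup>2 + (c - \<eta>) * \<delta> \<le> I
        \<and> (\<forall>y. h y \<le> (exp (2 * c * r) - 1) * max 0 (R + s * y - c * \<delta> - r)
             + potential c (clamp r (R + s * y - c * \<delta>)) - \<epsilon> * (clamp r (R + s * y - c * \<delta>) - r / 2)\<^sup>2)"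
      using H hI hle by blast
  qed
qed

text \<open>
  The last term bounds the potential and the correction, which range over a bounded set; it is independent of the number
  of steps.
\<close>

lemma climb_expectation_lower:
  fixes c r \<eta> :: real
  assumes "c > 0" "r > 0" "\<eta> > 0" "\<eta> \<le> c"
  obtains \<delta>0 where "\<delta>0 > 0"
    "\<And>\<delta> s n. 0 < \<delta> \<Longrightarrow> \<delta> < \<delta>0 \<Longrightarrow> s\<^sup>2 = 1 \<Longrightarrow>
      ennreal (real n * \<delta> * (c - \<eta>)) \<le> ennreal (exp (2 * c * r) - 1)
         * (\<integral>\<^sup>+x. ennreal (climb (c * \<delta>) r (\<lambda>i. s * x i) n) \<partial>gwalk \<delta> n)
         + ennreal ((exp (2 * c * r) - 1) / (2 * c) + r\<^sup>2 / 4)"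
proof -
  obtain \<epsilon> \<delta>0 where \<epsilon>: "0 < \<epsilon>" "\<epsilon> \<le> 1" and d0: "\<delta>0 > 0" and step:
    "\<And>\<delta> s R. 0 < \<delta> \<Longrightarrow> \<delta> < \<delta>0 \<Longrightarrow> s\<^sup>2 = 1 \<Longrightarrow> 0 \<le> R \<Longrightarrow> R \<le> r \<Longrightarrow>
      \<exists>h I. has_bochner_integral (gstep \<delta>) h I
        \<and> potential c R - \<epsilon> * (R - r / 2)\<^sup>2 + (c - \<eta>) * \<delta> \<le> I
        \<and> (\<forall>y. h y \<le> (exp (2 * c * r) - 1) * max 0 (R + s * y - c * \<delta> - r)
             + potential c (clamp r (R + s * y - c * \<delta>)) - \<epsilon> * (clamp r (R + s * y - c * \<delta>) - r / 2)\<^sup>2)"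
    using climb_expectation_lower_step[OF assms(1-3)] by metis
  define K where "K = exp (2 * c * r) - 1"
  have K: "0 < K" using assms by (simp add: K_def)
  show ?thesis
  proof (rule that[OF d0])
    fix \<delta> s :: real and n :: nat
    assume \<delta>: "0 < \<delta>" "\<delta> < \<delta>0" and s: "s\<^sup>2 = 1"
    define f where "f = (\<lambda>n x. K * climb (c * \<delta>) r (\<lambda>i. s * x i) n + potential c (gap (c * \<delta>) r (\<lambda>i. s * x i) n)
       - \<epsilon> * (gap (c * \<delta>) r (\<lambda>i. s * x i) n - r / 2)\<^sup>2 + r\<^sup>2 / 4)"
    have fm[measurable]: "f n \<in> borel_measurable (gwalk \<delta> n)" for n
    proof -
      note [measurable] = gwalk_climb_measurable[of "c * \<delta>" r s n \<delta>]
      show ?thesis unfolding f_def potential_def by measurable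
    qed
    have gr: "0 \<le> gap (c * \<delta>) r d k" "gap (c * \<delta>) r d k \<le> r" for d k
      using gap_range[of r "c * \<delta>" d k] assms by auto
    have psi: "\<epsilon> * (R - r / 2)\<^sup>2 \<le> r\<^sup>2 / 4" if "0 \<le> R" "R \<le> r" for R
    proof -
      have "\<bar>R - r / 2\<bar> \<le> r / 2" using that by linarith
      then have "\<bar>R - r / 2\<bar>\<^sup>2 \<le> (r / 2)\<^sup>2" by (intro power_mono) auto
      then have "(R - r / 2)\<^sup>2 \<le> r\<^sup>2 / 4" by (simp add: power_divide)
      moreover have "\<epsilon> * (R - r / 2)\<^sup>2 \<le> 1 * (R - r / 2)\<^sup>2" using \<epsilon> by (intro mult_right_mono) auto
      ultimately show ?thesis by linarith
    qed
    have f0: "0 \<le> f n x" for n x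
      using psi[OF gr] K climb_nonneg[of "c * \<delta>" r "\<lambda>i. s * x i" n] potential_nonneg[OF assms(1)]
      unfolding f_def by (smt (verit) mult_nonneg_nonneg)
    have one: "ennreal (f n x) + ennreal ((c - \<eta>) * \<delta>) \<le> (\<integral>\<^sup>+y. ennreal (f (Suc n) (x(n := y))) \<partial>gstep \<delta>)" for n x
    proof -
      define R where "R = gap (c * \<delta>) r (\<lambda>i. s * x i) n"
      define C where "C = K * climb (c * \<delta>) r (\<lambda>i. s * x i) n + r\<^sup>2 / 4"
      obtain h I where h: "has_bochner_integral (gstep \<delta>) h I"
        "potential c R - \<epsilon> * (R - r / 2)\<^sup>2 + (c - \<eta>) * \<delta> \<le> I"
        "\<And>y. h y \<le> K * max 0 (R + s * y - c * \<delta> - r)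
             + potential c (clamp r (R + s * y - c * \<delta>)) - \<epsilon> * (clamp r (R + s * y - c * \<delta>) - r / 2)\<^sup>2"
        using step[OF \<delta> s, of R] gr unfolding R_def K_def by blast
      have hb: "has_bochner_integral (gstep \<delta>) (\<lambda>y. C + h y) (C + I)"
        by (intro has_bochner_integral_add gstep_moments \<delta>(1) h(1))
      have "ennreal (f n x) + ennreal ((c - \<eta>) * \<delta>) = ennreal (f n x + (c - \<eta>) * \<delta>)"
        using f0 assms \<delta>(1) by (intro ennreal_plus[symmetric]) auto
      also have "\<dots> \<le> ennreal (C + I)"
        using h(2) by (intro ennreal_leI) (simp add: f_def C_def R_def)
      also have "\<dots> \<le> (\<integral>\<^sup>+y. ennreal (C + h y) \<partial>gstep \<delta>)"
        using ennreal_integral_le_nn_integral[of "gstep \<delta>" "\<lambda>y. C + h y"] hb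
        by (simp add: has_bochner_integral_iff)
      also have "\<dots> \<le> (\<integral>\<^sup>+y. ennreal (f (Suc n) (x(n := y))) \<partial>gstep \<delta>)"
      proof (intro nn_integral_mono ennreal_leI)
        fix y
        show "C + h y \<le> f (Suc n) (x(n := y))"
          using h(3)[of y] unfolding f_def climb_Suc_upd C_def R_def by (simp add: distrib_left)
      qed
      finally show ?thesis .
    qed
    have "ennreal (real n * ((c - \<eta>) * \<delta>)) \<le> (\<integral>\<^sup>+x. ennreal (f n x) \<partial>gwalk \<delta> n)" for n
    proof (induction n)
      case (Suc n)
      interpret P: prob_space "gwalk \<delta> n" by (rule prob_space_gwalk[OF \<delta>(1)])
      have "ennreal (real (Suc n) * ((c - \<eta>) * \<delta>)) = ennreal (real n * ((c - \<eta>) * \<delta>)) + ennreal ((c - \<eta>) * \<delta>)"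
      proof -
        have p: "0 \<le> (c - \<eta>) * \<delta>" using assms \<delta>(1) by simp
        have "real (Suc n) * ((c - \<eta>) * \<delta>) = real n * ((c - \<eta>) * \<delta>) + (c - \<eta>) * \<delta>"
          by (simp add: algebra_simps)
        then show ?thesis by (simp only: ennreal_plus[OF mult_nonneg_nonneg[OF of_nat_0_le_iff p] p])
      qed
      also have "\<dots> \<le> (\<integral>\<^sup>+x. ennreal (f n x) \<partial>gwalk \<delta> n) + ennreal ((c - \<eta>) * \<delta>)"
        by (rule add_right_mono[OF Suc])
      also have "\<dots> = (\<integral>\<^sup>+x. ennreal (f n x) + ennreal ((c - \<eta>) * \<delta>) \<partial>gwalk \<delta> n)"
        by (subst nn_integral_add) (auto simp: P.emeasure_space_1)
      also have "\<dots> \<le> (\<integral>\<^sup>+x. (\<integral>\<^sup>+y. ennreal (f (Suc n) (x(n := y))) \<partial>gstep \<delta>) \<partial>gwalk \<delta> n)"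
        by (intro nn_integral_mono one)
      also have "\<dots> = (\<integral>\<^sup>+x. ennreal (f (Suc n) x) \<partial>gwalk \<delta> (Suc n))"
        by (rule gwalk_Suc[OF \<delta>(1), symmetric]) measurable
      finally show ?case .
    qed simp
    then have "ennreal (real n * \<delta> * (c - \<eta>)) \<le> (\<integral>\<^sup>+x. ennreal (f n x) \<partial>gwalk \<delta> n)"
      by (metis mult.assoc mult.commute)
    also have "\<dots> \<le> (\<integral>\<^sup>+x. ennreal K * ennreal (climb (c * \<delta>) r (\<lambda>i. s * x i) n) + ennreal (K / (2 * c) + r\<^sup>2 / 4) \<partial>gwalk \<delta> n)"
    proof (rule nn_integral_mono)
      fix x
      define R where "R = gap (c * \<delta>) r (\<lambda>i. s * x i) n"
      have R: "0 \<le> R" "R \<le> r" using gr by (auto simp: R_def)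
      have "exp (2 * c * R) \<le> exp (2 * c * r)" using R assms by simp
      then have "(exp (2 * c * R) - 1) / (2 * c) \<le> K / (2 * c)"
        using assms by (intro divide_right_mono) (auto simp: K_def)
      then have "potential c R \<le> K / (2 * c)" using R by (simp add: potential_def)
      moreover have "0 \<le> \<epsilon> * (R - r / 2)\<^sup>2" using \<epsilon> by simp
      ultimately have "f n x \<le> K * climb (c * \<delta>) r (\<lambda>i. s * x i) n + (K / (2 * c) + r\<^sup>2 / 4)"
        unfolding f_def R_def[symmetric] by linarith
      then have "ennreal (f n x) \<le> ennreal (K * climb (c * \<delta>) r (\<lambda>i. s * x i) n + (K / (2 * c) + r\<^sup>2 / 4))"
        by (rule ennreal_leI)
      also have "\<dots> = ennreal K * ennreal (climb (c * \<delta>) r (\<lambda>i. s * x i) n) + ennreal (K / (2 * c) + r\<^sup>2 / 4)"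
        using K assms climb_nonneg by (subst ennreal_plus) (auto simp: ennreal_mult)
      finally show "ennreal (f n x) \<le> ennreal K * ennreal (climb (c * \<delta>) r (\<lambda>i. s * x i) n) + ennreal (K / (2 * c) + r\<^sup>2 / 4)" .
    qed
    also have "\<dots> = ennreal K * (\<integral>\<^sup>+x. ennreal (climb (c * \<delta>) r (\<lambda>i. s * x i) n) \<partial>gwalk \<delta> n) + ennreal (K / (2 * c) + r\<^sup>2 / 4)"
    proof -
      interpret P: prob_space "gwalk \<delta> n" by (rule prob_space_gwalk[OF \<delta>(1)])
      note [measurable] = gwalk_climb_measurable[of "c * \<delta>" r s n \<delta>]
      show ?thesis by (subst nn_integral_add) (auto simp: P.emeasure_space_1 nn_integral_cmult)
    qed
    finally show "ennreal (real n * \<delta> * (c - \<eta>)) \<le> ennreal (exp (2 * c * r) - 1)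
         * (\<integral>\<^sup>+x. ennreal (climb (c * \<delta>) r (\<lambda>i. s * x i) n) \<partial>gwalk \<delta> n)
         + ennreal ((exp (2 * c * r) - 1) / (2 * c) + r\<^sup>2 / 4)"
      by (simp add: K_def)
  qed
qed

section \<open>The expected free energy of a Gaussian walk\<close>

lemma ennreal_four:
  assumes "0 \<le> v"
  shows "2 * (ennreal v + ennreal v) = ennreal (4 * v)"
proof -
  have "ennreal v + ennreal v = ennreal (v + v)" by (rule ennreal_plus[symmetric, OF assms assms])
  moreover have "2 * ennreal (v + v) = ennreal (2 * (v + v))"
    using ennreal_mult'[of 2 "v + v"] by simp
  ultimately show ?thesis by simp
qed

lemma integral_exp_linear:
  fixes l :: real
  assumes "l > 0"
  shows "(\<integral>\<^sup>+c\<in>{0..}. ennreal (c * exp (- l * c)) \<partial>lborel) = ennreal (1 / l\<^sup>2)"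
proof -
  define F where "F = (\<lambda>c. - (1 / l\<^sup>2) * ((l * c) ^ 1 / exp (l * c) + (l * c) ^ 0 / exp (l * c)))"
  have "filterlim (\<lambda>c. l * c) at_top at_top"
    by (rule filterlim_tendsto_pos_mult_at_top[OF tendsto_const assms filterlim_ident])
  then have "((\<lambda>c. (l * c) ^ k / exp (l * c)) \<longlongrightarrow> 0) at_top" for k
    by (rule filterlim_compose[OF tendsto_power_div_exp_0])
  then have "(F \<longlongrightarrow> - (1 / l\<^sup>2) * (0 + 0)) at_top"
    unfolding F_def by (intro tendsto_intros)
  then have lim: "(F \<longlongrightarrow> 0) at_top" by simp
  have F: "F c = - (1 / l\<^sup>2) * ((l * c + 1) * exp (- l * c))" for c
    by (simp add: F_def exp_minus field_simps)
  have "(F has_real_derivative c * exp (- l * c)) (at c)" for c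
    unfolding F[abs_def] using assms
    by (auto intro!: derivative_eq_intros simp: field_simps power2_eq_square)
  then have "(\<integral>\<^sup>+c. ennreal (c * exp (- l * c)) * indicator {0..} c \<partial>lborel) = ennreal (0 - F 0)"
    by (intro nn_integral_FTC_atLeast lim) auto
  then show ?thesis by (simp add: F)
qed

text \<open>
  Expanding into a geometric series turns the integral into \<open>\<Sum> 1 / (2 k r)\<^sup>2\<close> over \<open>k
  \<ge> 1\<close>.
\<close>

lemma integral_planck:
  fixes r :: real
  assumes "r > 0"
  shows "(\<integral>\<^sup>+c\<in>{0..}. ennreal (c / (exp (2 * c * r) - 1)) \<partial>lborel) = ennreal (pi\<^sup>2 / (24 * r\<^sup>2))"
proof -
  have eq: "ennreal (c / (exp (2 * c * r) - 1)) = (\<Sum>k. ennreal (c * exp (- (2 * real (Suc k) * r) * c)))" if c: "0 \<le> c" for c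
  proof (cases "c = 0")
    case False
    define x where "x = exp (- (2 * c * r))"
    have x: "0 < x" "x < 1" using c False assms by (auto simp: x_def)
    have ex: "exp (- (2 * real (Suc k) * r) * c) = x * x ^ k" for k
      by (simp add: x_def algebra_simps flip: exp_of_nat_mult exp_add)
    have "(\<lambda>k. c * x * x ^ k) sums (c * x * (1 / (1 - x)))"
      using x by (intro sums_mult geometric_sums) auto
    moreover have "c * x * (1 / (1 - x)) = c / (exp (2 * c * r) - 1)"
    proof -
      have "exp (2 * c * r) = 1 / x" by (simp add: x_def exp_minus field_simps)
      then have "exp (2 * c * r) - 1 = (1 - x) / x" using x by (simp only: diff_divide_distrib) simp
      then show ?thesis by simp
    qed
    ultimately have "(\<lambda>k. c * x * x ^ k) sums (c / (exp (2 * c * r) - 1))" by simp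
    then have "(\<Sum>k. ennreal (c * x * x ^ k)) = ennreal (c / (exp (2 * c * r) - 1))"
      using x c by (intro suminf_ennreal_eq) auto
    then show ?thesis unfolding ex by (simp add: mult.assoc)
  qed simp
  have "(\<integral>\<^sup>+c\<in>{0..}. ennreal (c / (exp (2 * c * r) - 1)) \<partial>lborel)
     = (\<integral>\<^sup>+c. (\<Sum>k. ennreal (c * exp (- (2 * real (Suc k) * r) * c)) * indicator {0..} c) \<partial>lborel)"
    by (intro nn_integral_cong) (auto simp: indicator_def eq simp del: of_nat_Suc)
  also have "\<dots> = (\<Sum>k. \<integral>\<^sup>+c\<in>{0..}. ennreal (c * exp (- (2 * real (Suc k) * r) * c)) \<partial>lborel)"
    by (rule nn_integral_suminf) measurable
  also have "\<dots> = (\<Sum>k. ennreal (1 / (2 * real (Suc k) * r)\<^sup>2))"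
    using assms by (subst integral_exp_linear) auto
  also have "\<dots> = ennreal (pi\<^sup>2 / (24 * r\<^sup>2))"
  proof (rule suminf_ennreal_eq)
    have "(\<lambda>k. 1 / (4 * r\<^sup>2) * (1 / (real k + 1)\<^sup>2)) sums (1 / (4 * r\<^sup>2) * (pi\<^sup>2 / 6))"
      by (rule sums_mult) (use inverse_squares_sums in \<open>simp add: add.commute\<close>)
    moreover have "1 / (4 * r\<^sup>2) * (1 / (real k + 1)\<^sup>2) = 1 / (2 * real (Suc k) * r)\<^sup>2" for k
    proof -
      have "(2 * real (Suc k) * r)\<^sup>2 = 4 * r\<^sup>2 * (real k + 1)\<^sup>2" by (simp add: power2_eq_square algebra_simps)
      then show ?thesis by simp
    qed
    ultimately show "(\<lambda>k. 1 / (2 * real (Suc k) * r)\<^sup>2) sums (pi\<^sup>2 / (24 * r\<^sup>2))"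
      by (simp add: field_simps)
  qed auto
  finally show ?thesis .
qed

lemma climb_pair_measurable:
  assumes d: "\<And>i. i < n \<Longrightarrow> (\<lambda>\<omega>. d \<omega> i) \<in> borel_measurable N"
  shows "(\<lambda>(\<omega>, c). climb (c * \<delta>) r (\<lambda>i. s * d \<omega> i) n) \<in> borel_measurable (N \<Otimes>\<^sub>M lborel)"
proof -
  have "(\<lambda>p. climb (snd p * \<delta>) r ((\<lambda>p i. s * d (fst p) i) p) n) \<in> borel_measurable (N \<Otimes>\<^sub>M lborel)"
  proof (rule climb_measurable)
    fix i assume "i < n"
    note [measurable] = d[OF this]
    show "(\<lambda>p. s * d (fst p) i) \<in> borel_measurable (N \<Otimes>\<^sub>M lborel)" by measurable
  qed measurable
  then show ?thesis by (simp add: case_prod_beta')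
qed

lemma free_energy_integrand_measurable:
  assumes d: "\<And>i. i < n \<Longrightarrow> (\<lambda>\<omega>. d \<omega> i) \<in> borel_measurable N"
  shows "(\<lambda>(\<omega>, c). ennreal (2 * (climb (c * \<delta>) r (d \<omega>) n + climb (c * \<delta>) r (\<lambda>k. - d \<omega> k) n)) * indicator {0..} c)
    \<in> borel_measurable (N \<Otimes>\<^sub>M lborel)"
proof -
  note [measurable] = climb_pair_measurable[OF d, where s = 1 and \<delta> = \<delta> and r = r, simplified]
    climb_pair_measurable[OF d, where s = "-1" and \<delta> = \<delta> and r = r, simplified]
  show ?thesis by measurable
qed

lemma free_energy_measurable:
  assumes d: "\<And>i. i < n \<Longrightarrow> (\<lambda>\<omega>. d \<omega> i) \<in> borel_measurable N"
  shows "(\<lambda>\<omega>. free_energy \<delta> r n (d \<omega>)) \<in> borel_measurable N"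
  unfolding free_energy_def
  by (rule lborel.borel_measurable_nn_integral[OF free_energy_integrand_measurable[OF d]])

text \<open>Fubini; the sign \<open>s = - 1\<close> gives the downward climb.\<close>

lemma free_energy_gwalk:
  fixes \<delta> r :: real and n :: nat
  assumes "\<delta> > 0"
  defines "U \<equiv> \<lambda>s c. \<integral>\<^sup>+x. ennreal (climb (c * \<delta>) r (\<lambda>i. s * x i) n) \<partial>gwalk \<delta> n"
  shows "(\<integral>\<^sup>+x. free_energy \<delta> r n x \<partial>gwalk \<delta> n) = (\<integral>\<^sup>+c\<in>{0..}. 2 * (U 1 c + U (-1) c) \<partial>lborel)"
    and "(\<lambda>c. U s c) \<in> borel_measurable lborel"
proof -
  interpret Q: prob_space "gwalk \<delta> n" by (rule prob_space_gwalk[OF assms(1)])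
  interpret pair_sigma_finite "gwalk \<delta> n" lborel by standard
  have m: "(\<lambda>x. x i) \<in> borel_measurable (gwalk \<delta> n)" if "i < n" for i
    by (rule gwalk_coordinate[OF that])
  define f where "f = (\<lambda>x c. ennreal (2 * (climb (c * \<delta>) r x n + climb (c * \<delta>) r (\<lambda>k. - x k) n)) * indicator {0..} c)"
  have fm: "case_prod f \<in> borel_measurable (gwalk \<delta> n \<Otimes>\<^sub>M lborel)"
    using free_energy_integrand_measurable[of n "\<lambda>x. x", OF m] by (simp add: f_def)
  have "(\<integral>\<^sup>+x. free_energy \<delta> r n x \<partial>gwalk \<delta> n) = (\<integral>\<^sup>+x. (\<integral>\<^sup>+c. f x c \<partial>lborel) \<partial>gwalk \<delta> n)"
    by (simp add: free_energy_def f_def)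
  also have "\<dots> = (\<integral>\<^sup>+c. (\<integral>\<^sup>+x. f x c \<partial>gwalk \<delta> n) \<partial>lborel)"
    by (rule Fubini'[OF fm, symmetric])
  also have "(\<lambda>c. \<integral>\<^sup>+x. f x c \<partial>gwalk \<delta> n) = (\<lambda>c. 2 * (U 1 c + U (-1) c) * indicator {0..} c)"
  proof
    fix c
    note [measurable] = gwalk_climb_measurable(1)[of "c * \<delta>" r 1 n \<delta>, simplified]
      gwalk_climb_measurable(1)[of "c * \<delta>" r "-1" n \<delta>, simplified]
    have "(\<integral>\<^sup>+x. f x c \<partial>gwalk \<delta> n) = (\<integral>\<^sup>+x. (2 * (ennreal (climb (c * \<delta>) r x n)
        + ennreal (climb (c * \<delta>) r (\<lambda>k. - x k) n))) * indicator {0..} c \<partial>gwalk \<delta> n)"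
      unfolding f_def using climb_nonneg by (intro nn_integral_cong) (simp add: ennreal_mult distrib_left)
    also have "\<dots> = 2 * (U 1 c + U (-1) c) * indicator {0..} c"
      by (simp add: U_def nn_integral_multc nn_integral_cmult nn_integral_add)
    finally show "(\<integral>\<^sup>+x. f x c \<partial>gwalk \<delta> n) = 2 * (U 1 c + U (-1) c) * indicator {0..} c" .
  qed
  finally show "(\<integral>\<^sup>+x. free_energy \<delta> r n x \<partial>gwalk \<delta> n) = (\<integral>\<^sup>+c\<in>{0..}. 2 * (U 1 c + U (-1) c) \<partial>lborel)" .
  have "(\<lambda>(c, x). ennreal (climb (c * \<delta>) r (\<lambda>i. s * x i) n)) \<in> borel_measurable (lborel \<Otimes>\<^sub>M gwalk \<delta> n)"
  proof -
    have "(\<lambda>p. climb (fst p * \<delta>) r ((\<lambda>p i. s * snd p i) p) n) \<in> borel_measurable (lborel \<Otimes>\<^sub>M gwalk \<delta> n)"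
    proof (rule climb_measurable)
      fix i assume "i < n"
      note [measurable] = m[OF this]
      show "(\<lambda>p. s * snd p i) \<in> borel_measurable (lborel \<Otimes>\<^sub>M gwalk \<delta> n)" by measurable
    qed measurable
    then show ?thesis by (simp add: case_prod_beta')
  qed
  then show "(\<lambda>c. U s c) \<in> borel_measurable lborel"
    unfolding U_def
    by (rule Q.borel_measurable_nn_integral)
qed

text \<open>
  Twice the upward and twice the downward climb rate gives \<open>4 * pi\<^sup>2 / (24 r\<^sup>2)\<close>.
\<close>

theorem free_energy_expectation_upper:
  assumes "\<delta> > 0" "r > 0"
  shows "(\<integral>\<^sup>+x. free_energy \<delta> r n x \<partial>gwalk \<delta> n) \<le> ennreal (real n * \<delta> * (pi\<^sup>2 / (6 * r\<^sup>2)))"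
proof -
  have "(\<integral>\<^sup>+x. free_energy \<delta> r n x \<partial>gwalk \<delta> n)
     \<le> (\<integral>\<^sup>+c. ennreal (4 * (real n * \<delta>)) * (ennreal (c / (exp (2 * c * r) - 1)) * indicator {0..} c) \<partial>lborel)"
    unfolding free_energy_gwalk[OF assms(1)]
  proof (rule nn_integral_mono_AE)
    have "AE c in lborel. c \<noteq> (0::real)" by (rule AE_lborel_singleton)
    then show "AE c in lborel. 2 * ((\<integral>\<^sup>+x. ennreal (climb (c * \<delta>) r (\<lambda>i. 1 * x i) n) \<partial>gwalk \<delta> n)
        + (\<integral>\<^sup>+x. ennreal (climb (c * \<delta>) r (\<lambda>i. -1 * x i) n) \<partial>gwalk \<delta> n)) * indicator {0..} c
       \<le> ennreal (4 * (real n * \<delta>)) * (ennreal (c / (exp (2 * c * r) - 1)) * indicator {0..} c)"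
    proof eventually_elim
      case (elim c)
      show ?case
      proof (cases "0 \<le> c")
        case True
        then have c: "c > 0" using elim by simp
        define v where "v = real n * \<delta> * (c / (exp (2 * c * r) - 1))"
        have v: "0 \<le> v" using c assms by (simp add: v_def)
        have "2 * ((\<integral>\<^sup>+x. ennreal (climb (c * \<delta>) r (\<lambda>i. 1 * x i) n) \<partial>gwalk \<delta> n)
          + (\<integral>\<^sup>+x. ennreal (climb (c * \<delta>) r (\<lambda>i. -1 * x i) n) \<partial>gwalk \<delta> n)) \<le> 2 * (ennreal v + ennreal v)"
          unfolding v_def by (intro mult_left_mono add_mono climb_expectation_upper assms c) auto
        also have "\<dots> = ennreal (4 * v)" by (rule ennreal_four[OF v])
        also have "\<dots> = ennreal (4 * (real n * \<delta>)) * ennreal (c / (exp (2 * c * r) - 1))"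
          using assms c by (simp add: v_def flip: ennreal_mult')
        finally show ?thesis using True by simp
      qed simp
    qed
  qed
  also have "\<dots> = ennreal (4 * (real n * \<delta>)) * ennreal (pi\<^sup>2 / (24 * r\<^sup>2))"
    by (subst nn_integral_cmult) (simp_all add: integral_planck[OF assms(2)])
  also have "\<dots> = ennreal (real n * \<delta> * (pi\<^sup>2 / (6 * r\<^sup>2)))"
    using assms by (simp flip: ennreal_mult')
  finally show ?thesis .
qed

text \<open>
  For fixed \<open>c\<close> the climb rate is nearly reached for a fine mesh and a long block, but not uniformly in
  \<open>c\<close>. Fatou's lemma is therefore applied twice, first for the mesh and then for the length of the block.
\<close>

theorem free_energy_expectation_lower:
  fixes \<theta> r :: real
  assumes r: "r > 0" and \<theta>: "0 \<le> \<theta>" "\<theta> < pi\<^sup>2 / (6 * r\<^sup>2)"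
  obtains L j :: nat where "2 \<le> L"
    "ennreal (\<theta> * real L) < (\<integral>\<^sup>+x. free_energy (1 / 2 ^ j) r (L * 2 ^ j) x \<partial>gwalk (1 / 2 ^ j) (L * 2 ^ j))"
proof -
  define K where "K = (\<lambda>c. exp (2 * c * r) - 1)"
  define D where "D = (\<lambda>c. K c / (2 * c) + r\<^sup>2 / 4)"
  define g where "g = (\<lambda>L c. 4 * ((c - (c + D c) / real L) / K c))"
  define E where "E = (\<lambda>L j. \<integral>\<^sup>+x. free_energy (1 / 2 ^ j) r (L * 2 ^ j) x \<partial>gwalk (1 / 2 ^ j) (L * 2 ^ j))"
  have [measurable]: "K \<in> borel_measurable borel" "D \<in> borel_measurable borel" "g L \<in> borel_measurable borel" for L
    unfolding K_def D_def g_def by measurable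
  \<comment> \<open>The mesh tends to zero while \<open>L\<close> is fixed; \<open>D c\<close> is the boundary term of \<open>climb_expectation_lower\<close>, and \<open>\<eta> = c / L\<close> there.\<close>
  have first: "(\<integral>\<^sup>+c\<in>{0<..}. ennreal (real L * g L c) \<partial>lborel) \<le> liminf (E L)" if L: "2 \<le> L" for L
  proof -
    define U where "U = (\<lambda>s j c. \<integral>\<^sup>+x. ennreal (climb (c * (1 / 2 ^ j)) r (\<lambda>i. s * x i) (L * 2 ^ j)) \<partial>gwalk (1 / 2 ^ j) (L * 2 ^ j))"
    define u where "u = (\<lambda>j c. 2 * (U 1 j c + U (-1) j c) * indicator {0..} c)"
    have [measurable]: "U s j \<in> borel_measurable lborel" for s j
      using free_energy_gwalk(2)[where \<delta> = "1 / 2 ^ j" and r = r and s = s and n = "L * 2 ^ j"] by (simp add: U_def)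
    have um[measurable]: "u j \<in> borel_measurable lborel" for j unfolding u_def by measurable
    have E: "E L j = (\<integral>\<^sup>+c. u j c \<partial>lborel)" for j
      unfolding E_def u_def U_def by (rule free_energy_gwalk(1)) simp
    have "(\<integral>\<^sup>+c\<in>{0<..}. ennreal (real L * g L c) \<partial>lborel) \<le> (\<integral>\<^sup>+c. liminf (\<lambda>j. u j c) \<partial>lborel)"
    proof (rule nn_integral_mono)
      fix c :: real
      show "ennreal (real L * g L c) * indicator {0<..} c \<le> liminf (\<lambda>j. u j c)"
      proof (cases "0 < c")
        case True
        have K: "0 < K c" using True r by (simp add: K_def)
        have D: "0 \<le> D c" using K True by (simp add: D_def)
        have cL: "0 < c / real L" "c / real L \<le> c" using True L by (auto simp: field_simps)
        obtain \<delta>0 where \<delta>0: "\<delta>0 > 0"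
          "\<And>\<delta> s n. 0 < \<delta> \<Longrightarrow> \<delta> < \<delta>0 \<Longrightarrow> s\<^sup>2 = 1 \<Longrightarrow>
            ennreal (real n * \<delta> * (c - c / real L)) \<le> ennreal (exp (2 * c * r) - 1)
            * (\<integral>\<^sup>+x. ennreal (climb (c * \<delta>) r (\<lambda>i. s * x i) n) \<partial>gwalk \<delta> n)
            + ennreal ((exp (2 * c * r) - 1) / (2 * c) + r\<^sup>2 / 4)"
          using climb_expectation_lower[OF True r cL] by blast
        have "(\<lambda>j. (1 / 2) ^ j) \<longlonglongrightarrow> (0::real)" by (intro LIMSEQ_realpow_zero) auto
        then have "eventually (\<lambda>j. (1 / 2) ^ j < \<delta>0) sequentially"
          using \<delta>0(1) by (rule order_tendstoD)
        then have "eventually (\<lambda>j. ennreal (real L * g L c) \<le> u j c) sequentially"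
        proof eventually_elim
          case (elim j)
          then have j: "1 / 2 ^ j < \<delta>0" by (simp add: power_divide)
          have b: "ennreal (real L * ((c - (c + D c) / real L) / K c)) \<le> U s j c" if "s\<^sup>2 = 1" for s
          proof -
            have "real (L * 2 ^ j) * (1 / 2 ^ j) = real L" by simp
            then have "ennreal (real L * (c - c / real L)) \<le> ennreal (K c) * U s j c + ennreal (D c)"
              using \<delta>0(2)[of "1 / 2 ^ j" s "L * 2 ^ j"] j that unfolding U_def K_def D_def by simp
            moreover have "real L * (c - c / real L) = L * c - c" using L by (simp add: field_simps)
            ultimately have le: "ennreal (L * c - c) \<le> ennreal (K c) * U s j c + ennreal (D c)" by simp
            show ?thesis
            proof (cases "U s j c")
              case (real w)
              then have "ennreal (L * c - c) \<le> ennreal (K c * w + D c)"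
                using le K D by (simp add: ennreal_mult)
              moreover have "0 \<le> K c * w + D c" using real K D by simp
              ultimately have "L * c - c \<le> K c * w + D c" by (simp add: ennreal_le_iff)
              then have "(L * c - c - D c) / K c \<le> w" using K by (simp add: pos_divide_le_eq mult.commute)
              have "real L * (c - (c + D c) / real L) = L * c - c - D c"
                using L by (simp add: field_simps)
              then have "real L * ((c - (c + D c) / real L) / K c) = (L * c - c - D c) / K c"
                by (simp only: times_divide_eq_right)
              with \<open>(L * c - c - D c) / K c \<le> w\<close> have "real L * ((c - (c + D c) / real L) / K c) \<le> w" by (simp only:)
              then show ?thesis using real by (simp only: ennreal_leI)
            qed simp
          qed
          have "ennreal (real L * g L c) = 2 * (ennreal (real L * ((c - (c + D c) / real L) / K c)) + ennreal (real L * ((c - (c + D c) / real L) / K c)))"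
          proof -
            have "ennreal (4 * v) = 2 * (ennreal v + ennreal v)" for v
            proof (cases "0 \<le> v")
              case True then show ?thesis by (rule ennreal_four[symmetric])
            qed (simp add: ennreal_neg)
            moreover have "real L * g L c = 4 * (real L * ((c - (c + D c) / real L) / K c))" by (simp add: g_def)
            ultimately show ?thesis by metis
          qed
          also have "\<dots> \<le> 2 * (U 1 j c + U (-1) j c)"
            by (intro mult_left_mono add_mono b) auto
          finally show ?case using True by (simp add: u_def)
        qed
        then show ?thesis using True by (simp add: Liminf_bounded)
      qed simp
    qed
    also have "\<dots> \<le> liminf (\<lambda>j. \<integral>\<^sup>+c. u j c \<partial>lborel)"
      by (rule nn_integral_liminf) measurable
    finally show ?thesis unfolding E[abs_def, symmetric] using E by simp
  qed
  have "ennreal (pi\<^sup>2 / (6 * r\<^sup>2)) = ennreal 4 * ennreal (pi\<^sup>2 / (24 * r\<^sup>2))" by (subst ennreal_mult[symmetric]) auto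
  also have "\<dots> = (\<integral>\<^sup>+c. ennreal 4 * (ennreal (c / (exp (2 * c * r) - 1)) * indicator {0..} c) \<partial>lborel)"
    by (subst nn_integral_cmult) (simp_all add: integral_planck[OF r])
  also have "\<dots> \<le> (\<integral>\<^sup>+c. liminf (\<lambda>L. ennreal (g L c) * indicator {0<..} c) \<partial>lborel)"
  proof (rule nn_integral_mono)
    fix c :: real
    show "ennreal 4 * (ennreal (c / (exp (2 * c * r) - 1)) * indicator {0..} c) \<le> liminf (\<lambda>L. ennreal (g L c) * indicator {0<..} c)"
    proof (cases "0 < c")
      case True
      have "(\<lambda>L. g L c) \<longlonglongrightarrow> 4 * ((c - 0) / K c)"
        unfolding g_def using True r
        by (intro tendsto_intros lim_const_over_n) (auto simp: K_def)
      then have "(\<lambda>L. ennreal (g L c)) \<longlonglongrightarrow> ennreal (4 * (c / K c))"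
        by (intro tendsto_ennrealI) simp
      then have "liminf (\<lambda>L. ennreal (g L c)) = ennreal (4 * (c / K c))"
        by (intro lim_imp_Liminf) auto
      moreover have "ennreal 4 * ennreal (c / K c) = ennreal (4 * (c / K c))"
        by (rule ennreal_mult'[symmetric]) simp
      moreover have "exp (2 * c * r) - 1 = K c" by (simp add: K_def)
      moreover have "indicator {0..} c = (1::ennreal)" "indicator {0<..} c = (1::ennreal)" using True by auto
      ultimately show ?thesis by (simp only: mult_1_right order_refl)
    next
      case False
      then show ?thesis by (cases "c = 0") auto
    qed
  qed
  also have "\<dots> \<le> liminf (\<lambda>L. \<integral>\<^sup>+c. ennreal (g L c) * indicator {0<..} c \<partial>lborel)"
    by (rule nn_integral_liminf) measurable
  finally have "ennreal \<theta> < liminf (\<lambda>L. \<integral>\<^sup>+c. ennreal (g L c) * indicator {0<..} c \<partial>lborel)"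
    by (intro less_le_trans[OF ennreal_lessI]) (use \<theta> in auto)
  then have "eventually (\<lambda>L. ennreal \<theta> < (\<integral>\<^sup>+c. ennreal (g L c) * indicator {0<..} c \<partial>lborel)) sequentially"
    by (rule less_LiminfD)
  then obtain L0 where "\<And>L. L \<ge> L0 \<Longrightarrow> ennreal \<theta> < (\<integral>\<^sup>+c. ennreal (g L c) * indicator {0<..} c \<partial>lborel)"
    by (auto simp: eventually_sequentially)
  then obtain L where L: "2 \<le> L" "ennreal \<theta> < (\<integral>\<^sup>+c. ennreal (g L c) * indicator {0<..} c \<partial>lborel)"
    by (metis max.cobounded1 max.cobounded2)
  have "ennreal (\<theta> * real L) = ennreal (real L) * ennreal \<theta>"
    using \<theta> by (simp add: mult.commute flip: ennreal_mult)
  also have "\<dots> < ennreal (real L) * (\<integral>\<^sup>+c. ennreal (g L c) * indicator {0<..} c \<partial>lborel)"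
    using L by (intro ennreal_mult_strict_left_mono) auto
  also have "\<dots> = (\<integral>\<^sup>+c. ennreal (real L * g L c) * indicator {0<..} c \<partial>lborel)"
    by (subst nn_integral_cmult[symmetric]) (auto simp: ennreal_mult' mult.assoc intro!: nn_integral_cong)
  also have "\<dots> \<le> liminf (E L)" by (rule first[OF L(1)])
  finally have "eventually (\<lambda>j. ennreal (\<theta> * real L) < E L j) sequentially" by (rule less_LiminfD)
  then obtain j where "ennreal (\<theta> * real L) < E L j" by (auto simp: eventually_sequentially)
  then show ?thesis using that L(1) by (simp add: E_def)
qed

section \<open>Paths inside the strip\<close>

lemma lipschitz_AC_on:
  assumes "C-lipschitz_on {a..b} h"
  shows "h \<in> AC_on a b"
  unfolding AC_on_def mem_Collect_eq
proof (intro allI impI)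
  fix e :: real assume "e > 0"
  have C: "0 \<le> C" by (rule lipschitz_on_nonneg[OF assms])
  show "\<exists>\<delta>>0. \<forall>(n::nat) l u. (\<forall>i<n. a \<le> l i \<and> l i \<le> u i \<and> u i \<le> b) \<longrightarrow>
      disjoint_family_on (\<lambda>i. {l i<..<u i}) {..<n} \<longrightarrow> (\<Sum>i<n. u i - l i) < \<delta> \<longrightarrow>
      (\<Sum>i<n. \<bar>h (u i) - h (l i)\<bar>) < e"
  proof (intro exI[of _ "e / (C + 1)"] conjI allI impI)
    show "0 < e / (C + 1)" using C \<open>e > 0\<close> by simp
    fix n :: nat and l u
    assume lu: "\<forall>i<n. a \<le> l i \<and> l i \<le> u i \<and> u i \<le> b" and s: "(\<Sum>i<n. u i - l i) < e / (C + 1)"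
    have "(\<Sum>i<n. \<bar>h (u i) - h (l i)\<bar>) \<le> (\<Sum>i<n. C * (u i - l i))"
    proof (rule sum_mono)
      fix i assume "i \<in> {..<n}"
      then have "a \<le> l i" "l i \<le> u i" "u i \<le> b" using lu by auto
      then show "\<bar>h (u i) - h (l i)\<bar> \<le> C * (u i - l i)"
        using lipschitz_onD[OF assms, of "u i" "l i"] by (simp add: dist_real_def)
    qed
    also have "\<dots> = C * (\<Sum>i<n. u i - l i)" by (simp add: sum_distrib_left)
    also have "\<dots> \<le> C * (e / (C + 1))" using s C by (intro mult_left_mono) auto
    also have "\<dots> < e" using C \<open>e > 0\<close> by (simp add: field_simps)
    finally show "(\<Sum>i<n. \<bar>h (u i) - h (l i)\<bar>) < e" .
  qed
qed

lemma energy_on_cong: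
  assumes "\<And>t. a < t \<Longrightarrow> t < b \<Longrightarrow> f t = g t"
  shows "energy_on a b f = energy_on a b g"
  unfolding energy_on_lebesgue
proof (rule nn_integral_cong_AE)
  have "AE t in lebesgue. t \<notin> {a, b}" by (rule AE_lebesgue_negligible) simp
  then show "AE t in lebesgue. ennreal ((deriv f t * indicator {a..b} t)\<^sup>2) = ennreal ((deriv g t * indicator {a..b} t)\<^sup>2)"
  proof eventually_elim
    case (elim t)
    show ?case
    proof (cases "t \<in> {a<..<b}")
      case True
      have "eventually (\<lambda>x. x \<in> {a<..<b}) (nhds t)" by (rule eventually_nhds_in_open[OF _ True]) simp
      then have "eventually (\<lambda>x. f x = g x) (nhds t)" by eventually_elim (use assms in auto)
      then have "deriv f t = deriv g t" by (rule deriv_cong_ev) simp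
      then show ?thesis by simp
    next
      case False
      then have "t \<notin> {a..b}" using elim by auto
      then show ?thesis by simp
    qed
  qed
qed

text \<open>
  The paths constructed below are piecewise linear; the Lipschitz condition is the form of regularity that is easiest to
  glue.
\<close>

definition strip_path :: "(real \<Rightarrow> real) \<Rightarrow> real \<Rightarrow> real \<Rightarrow> real \<Rightarrow> real \<Rightarrow> real \<Rightarrow> real \<Rightarrow> bool" where
  "strip_path w \<rho> a b u v e \<longleftrightarrow> (\<exists>h C. C-lipschitz_on {a..b} h \<and> h a = u \<and> h b = v
     \<and> (\<forall>t\<in>{a..b}. \<bar>h t - w t\<bar> \<le> \<rho>) \<and> energy_on a b h \<le> ennreal e)"

lemma strip_path_mono: "strip_path w \<rho> a b u v e \<Longrightarrow> e \<le> e' \<Longrightarrow> strip_path w \<rho> a b u v e'"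
proof -
  assume p: "strip_path w \<rho> a b u v e" and e: "e \<le> e'"
  obtain h C where h: "C-lipschitz_on {a..b} h" "h a = u" "h b = v" "\<forall>t\<in>{a..b}. \<bar>h t - w t\<bar> \<le> \<rho>" "energy_on a b h \<le> ennreal e"
    using p unfolding strip_path_def by blast
  have "energy_on a b h \<le> ennreal e'" using order_trans[OF h(5) ennreal_leI[OF e]] .
  then show ?thesis unfolding strip_path_def using h by blast
qed

lemma strip_path_join:
  assumes 1: "strip_path w \<rho> a b u v e1" and 2: "strip_path w \<rho> b c v z e2" and ab: "a \<le> b" "b \<le> c" and e: "0 \<le> e1" "0 \<le> e2"
  shows "strip_path w \<rho> a c u z (e1 + e2)"
proof -
  obtain f C where f: "C-lipschitz_on {a..b} f" "f a = u" "f b = v" "\<forall>t\<in>{a..b}. \<bar>f t - w t\<bar> \<le> \<rho>" "energy_on a b f \<le> ennreal e1"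
    using 1 unfolding strip_path_def by blast
  obtain g D where g: "D-lipschitz_on {b..c} g" "g b = v" "g c = z" "\<forall>t\<in>{b..c}. \<bar>g t - w t\<bar> \<le> \<rho>" "energy_on b c g \<le> ennreal e2"
    using 2 unfolding strip_path_def by blast
  define h where "h = (\<lambda>x. if x \<le> b then f x else g x)"
  have fg: "f b = g b" using f(3) g(2) by simp
  have lip: "(max C D)-lipschitz_on {a..c} h" unfolding h_def by (rule lipschitz_on_concat_max[OF f(1) g(1) fg])
  have "energy_on a c h = energy_on a b h + energy_on b c h"
    by (rule energy_on_split[OF lipschitz_AC_on[OF lip] ab])
  also have "energy_on a b h = energy_on a b f" by (rule energy_on_cong) (simp add: h_def)
  also have "energy_on b c h = energy_on b c g" by (rule energy_on_cong) (simp add: h_def)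
  also have "energy_on a b f + energy_on b c g \<le> ennreal e1 + ennreal e2" using f(5) g(5) by (rule add_mono)
  also have "\<dots> = ennreal (e1 + e2)" using e by (rule ennreal_plus[symmetric])
  finally have E: "energy_on a c h \<le> ennreal (e1 + e2)" .
  have "h a = u" using ab f(2) by (simp add: h_def)
  moreover have "h c = z"
  proof (cases "c \<le> b")
    case True
    then have "c = b" using ab by simp
    then show ?thesis using g(3) fg by (simp add: h_def)
  qed (simp add: h_def g(3))
  moreover have "\<bar>h t - w t\<bar> \<le> \<rho>" if "t \<in> {a..c}" for t
    using f(4) g(4) that by (auto simp: h_def)
  ultimately show ?thesis unfolding strip_path_def using lip E by blast
qed

lemma energy_on_affine: "a \<le> b \<Longrightarrow> energy_on a b (\<lambda>t. u + k * (t - a)) = ennreal (k\<^sup>2 * (b - a))"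
proof -
  assume ab: "a \<le> b"
  have "deriv (\<lambda>t. u + k * (t - a)) t = k" for t
    by (rule DERIV_imp_deriv) (auto intro!: derivative_eq_intros)
  then have "energy_on a b (\<lambda>t. u + k * (t - a)) = (\<integral>\<^sup>+t. ennreal (k\<^sup>2) * indicator {a..b} t \<partial>lborel)"
    by (simp add: energy_on_def)
  also have "\<dots> = ennreal (k\<^sup>2) * ennreal (b - a)" using ab by (subst nn_integral_cmult_indicator) auto
  also have "\<dots> = ennreal (k\<^sup>2 * (b - a))" using ab by (simp add: ennreal_mult)
  finally show ?thesis .
qed

lemma lipschitz_affine: "\<bar>k\<bar>-lipschitz_on S (\<lambda>t::real. u + k * (t - a))"
  by (rule lipschitz_onI) (auto simp: dist_real_def abs_mult simp flip: right_diff_distrib)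

text \<open>
  Both ends are near all values of \<open>w\<close> on the interval, hence so are their convex combinations.
\<close>

lemma strip_path_segment:
  assumes ab: "a < b" and u: "\<And>t. t \<in> {a..b} \<Longrightarrow> \<bar>u - w t\<bar> \<le> \<rho>" and v: "\<And>t. t \<in> {a..b} \<Longrightarrow> \<bar>v - w t\<bar> \<le> \<rho>"
  shows "strip_path w \<rho> a b u v ((v - u)\<^sup>2 / (b - a))"
proof -
  define k where "k = (v - u) / (b - a)"
  define h where "h = (\<lambda>t. u + k * (t - a))"
  have "\<bar>h t - w t\<bar> \<le> \<rho>" if t: "t \<in> {a..b}" for t
  proof -
    define \<theta> where "\<theta> = (t - a) / (b - a)"
    have \<theta>: "0 \<le> \<theta>" "\<theta> \<le> 1" using t ab by (auto simp: \<theta>_def)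
    have "h t - w t = (1 - \<theta>) * (u - w t) + \<theta> * (v - w t)"
    proof -
      have "k * (t - a) = \<theta> * (v - u)" by (simp add: k_def \<theta>_def)
      then show ?thesis by (simp add: h_def algebra_simps)
    qed
    also have "\<bar>\<dots>\<bar> \<le> (1 - \<theta>) * \<bar>u - w t\<bar> + \<theta> * \<bar>v - w t\<bar>"
      using \<theta> by (intro order_trans[OF abs_triangle_ineq]) (simp add: abs_mult)
    also have "\<dots> \<le> (1 - \<theta>) * \<rho> + \<theta> * \<rho>" using \<theta> u[OF t] v[OF t] by (intro add_mono mult_left_mono) auto
    finally show ?thesis by (simp add: algebra_simps)
  qed
  moreover have "\<bar>k\<bar>-lipschitz_on {a..b} h" unfolding h_def by (rule lipschitz_affine)
  moreover have "h a = u" "h b = v" using ab by (auto simp: h_def k_def)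
  moreover have "energy_on a b h \<le> ennreal ((v - u)\<^sup>2 / (b - a))"
  proof -
    have "k\<^sup>2 * (b - a) = (v - u)\<^sup>2 / (b - a)" using ab by (simp add: k_def power_divide power2_eq_square)
    then show ?thesis using energy_on_affine[of a b u k] ab by (simp add: h_def)
  qed
  ultimately show ?thesis unfolding strip_path_def by blast
qed

text \<open>
  Linear interpolation leaves the tube of width \<open>r'\<close> by at most the oscillation of \<open>w\<close> over
  one step of the grid.
\<close>

lemma strip_path_grid:
  assumes "\<delta> > 0" and osc: "\<And>t t'. t \<in> {s..s + real n * \<delta>} \<Longrightarrow> t' \<in> {s..s + real n * \<delta>} \<Longrightarrow> \<bar>t - t'\<bar> \<le> \<delta> \<Longrightarrow> \<bar>w t - w t'\<bar> \<le> \<omega>"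
    and x: "x \<in> tube r' (\<lambda>k. w (s + real k * \<delta>)) n" and r: "r' / 2 + \<omega> \<le> \<rho>" and \<omega>: "0 \<le> \<omega>"
  shows "strip_path w \<rho> s (s + real n * \<delta>) (x 0) (x n) (qenergy \<delta> n x)"
  using osc x
proof (induction n)
  case 0
  have "\<bar>x 0 - w s\<bar> \<le> \<rho>" using 0(2) r \<omega> by (auto simp: tube_def)
  moreover have "energy_on s s (\<lambda>t. x 0) = 0"
    using energy_on_affine[of s s "x 0" 0] by simp
  ultimately show ?case
    unfolding strip_path_def
    by (intro exI[of _ "\<lambda>t. x 0"] exI[of _ 0]) (auto simp: qenergy_def intro: lipschitz_intros)
next
  case (Suc n)
  have le: "s \<le> s + real n * \<delta>" "s + real n * \<delta> < s + real (Suc n) * \<delta>" using assms(1) by (auto simp: algebra_simps)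
  have len: "s + real (Suc n) * \<delta> - (s + real n * \<delta>) = \<delta>" by (simp add: algebra_simps)
  have 1: "strip_path w \<rho> s (s + real n * \<delta>) (x 0) (x n) (qenergy \<delta> n x)"
  proof (rule Suc.IH)
    show "\<bar>w t - w t'\<bar> \<le> \<omega>" if "t \<in> {s..s + real n * \<delta>}" "t' \<in> {s..s + real n * \<delta>}" "\<bar>t - t'\<bar> \<le> \<delta>" for t t'
      by (rule Suc.prems(1)) (use that le in auto)
    show "x \<in> tube r' (\<lambda>k. w (s + real k * \<delta>)) n" using Suc.prems(2) by (auto simp: tube_def)
  qed
  have near: "\<bar>x k - w t\<bar> \<le> \<rho>" if t: "t \<in> {s + real n * \<delta>..s + real (Suc n) * \<delta>}" and k: "k = n \<or> k = Suc n" for k t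
  proof -
    have "\<bar>x k - w (s + real k * \<delta>)\<bar> \<le> r' / 2" using Suc.prems(2) k by (auto simp: tube_def)
    moreover have "\<bar>w (s + real k * \<delta>) - w t\<bar> \<le> \<omega>"
    proof (rule Suc.prems(1))
      show "s + real k * \<delta> \<in> {s..s + real (Suc n) * \<delta>}" "t \<in> {s..s + real (Suc n) * \<delta>}"
        using t k le by auto
      show "\<bar>s + real k * \<delta> - t\<bar> \<le> \<delta>" using t k len by (auto simp: abs_le_iff)
    qed
    ultimately show ?thesis using r by linarith
  qed
  have "strip_path w \<rho> (s + real n * \<delta>) (s + real (Suc n) * \<delta>) (x n) (x (Suc n))
      ((x (Suc n) - x n)\<^sup>2 / (s + real (Suc n) * \<delta> - (s + real n * \<delta>)))"
    by (rule strip_path_segment[OF le(2)]) (use near in blast)+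
  then have 2: "strip_path w \<rho> (s + real n * \<delta>) (s + real (Suc n) * \<delta>) (x n) (x (Suc n)) ((x (Suc n) - x n)\<^sup>2 / \<delta>)"
    unfolding len .
  have q: "qenergy \<delta> (Suc n) x = qenergy \<delta> n x + (x (Suc n) - x n)\<^sup>2 / \<delta>"
    by (simp add: qenergy_def add_divide_distrib)
  show ?case unfolding q
    by (rule strip_path_join[OF 1 2 le(1) less_imp_le[OF le(2)]]) (use assms(1) in \<open>auto simp: qenergy_def sum_nonneg\<close>)
qed

text \<open>
  Interpolate between \<open>x\<close> and a copy of \<open>q\<close> shifted to start at \<open>w 0\<close>. As
  \<open>q\<close> lies in a tube of half the width, its shifted copy stays in the tube of \<open>x\<close>. The factor
  \<open>1 + \<eta>\<close> separates the energies of \<open>x\<close> and \<open>q\<close> from the cost of passing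
  from one to the other.
\<close>

lemma pin_left:
  fixes x q w :: "nat \<Rightarrow> real"
  assumes x: "x \<in> tube r w n" and q: "q \<in> tube (r / 2) w m" and m: "0 < m" "m \<le> n" and \<delta>: "\<delta> > 0" and \<eta>: "\<eta> > 0"
  obtains y where "y \<in> tube r w n" "y 0 = w 0" "\<And>i. m \<le> i \<Longrightarrow> y i = x i"
    "qenergy \<delta> n y \<le> (1 + \<eta>) * (qenergy \<delta> n x + qenergy \<delta> m q) + (1 + 1 / \<eta>) * r\<^sup>2 / (real m * \<delta>)"
proof -
  define \<theta> where "\<theta> = (\<lambda>i. if i \<le> m then 1 - real i / real m else 0)"
  define p where "p = (\<lambda>i. q i + (w 0 - q 0))"
  define y where "y = (\<lambda>i. (1 - \<theta> i) * x i + \<theta> i * p i)"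
  have \<theta>: "0 \<le> \<theta> i" "\<theta> i \<le> 1" for i using m by (auto simp: \<theta>_def field_simps)
  have \<theta>m: "\<theta> i = 0" if "m \<le> i" for i using that m by (auto simp: \<theta>_def)
  have \<theta>d: "\<theta> (Suc i) - \<theta> i = - (1 / real m)" if "i < m" for i using that m by (simp add: \<theta>_def field_simps)
  have pw: "\<bar>p i - w i\<bar> \<le> r / 2" if "i \<le> m" for i
  proof -
    have "\<bar>q i - w i\<bar> \<le> r / 2 / 2" "\<bar>q 0 - w 0\<bar> \<le> r / 2 / 2" using q that by (auto simp: tube_def)
    then show ?thesis unfolding p_def by linarith
  qed
  have xw: "\<bar>x i - w i\<bar> \<le> r / 2" if "i \<le> n" for i using x that by (auto simp: tube_def)
  show ?thesis
  proof (rule that)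
    show "y \<in> tube r w n"
      unfolding tube_def
    proof (intro CollectI allI impI)
      fix i assume i: "i \<le> n"
      show "\<bar>y i - w i\<bar> \<le> r / 2"
      proof (cases "i \<le> m")
        case True
        have "y i - w i = (1 - \<theta> i) * (x i - w i) + \<theta> i * (p i - w i)" by (simp add: y_def algebra_simps)
        also have "\<bar>\<dots>\<bar> \<le> (1 - \<theta> i) * \<bar>x i - w i\<bar> + \<theta> i * \<bar>p i - w i\<bar>"
          using \<theta>[of i] by (intro order_trans[OF abs_triangle_ineq]) (simp add: abs_mult)
        also have "\<dots> \<le> (1 - \<theta> i) * (r / 2) + \<theta> i * (r / 2)"
          using \<theta>[of i] xw[OF i] pw[OF True] by (intro add_mono mult_left_mono) auto
        also have "\<dots> = r / 2" by (simp only: distrib_right[symmetric]) simp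
        finally show ?thesis .
      next
        case False
        then show ?thesis using xw[OF i] \<theta>m[of i] by (simp add: y_def)
      qed
    qed
    show "y 0 = w 0" by (simp add: y_def \<theta>_def p_def)
    show "y i = x i" if "m \<le> i" for i using \<theta>m[OF that] by (simp add: y_def)
    have step: "(y (Suc i) - y i)\<^sup>2 \<le> (1 + \<eta>) * ((x (Suc i) - x i)\<^sup>2 + (if i < m then (q (Suc i) - q i)\<^sup>2 else 0))
       + (if i < m then (1 + 1 / \<eta>) * (r / real m)\<^sup>2 else 0)" if i: "i < n" for i
    proof (cases "i < m")
      case False
      have "(x (Suc i) - x i)\<^sup>2 \<le> (1 + \<eta>) * (x (Suc i) - x i)\<^sup>2" using \<eta> by (simp add: algebra_simps)
      then show ?thesis using False \<theta>m[of i] \<theta>m[of "Suc i"] by (simp add: y_def)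
    next
      case True
      define A where "A = (1 - \<theta> (Suc i)) * (x (Suc i) - x i) + \<theta> (Suc i) * (q (Suc i) - q i)"
      define Bt where "Bt = (\<theta> (Suc i) - \<theta> i) * (p i - x i)"
      have yd: "y (Suc i) - y i = A + Bt" by (simp add: y_def A_def Bt_def p_def algebra_simps)
      \<comment> \<open>Convexity of the square, with the weights then estimated by 1.\<close>
      have conv: "((1 - t) * a + t * b)\<^sup>2 \<le> a\<^sup>2 + b\<^sup>2" if "0 \<le> t" "t \<le> 1" for t a b :: real
      proof -
        have "(1 - t) * a\<^sup>2 + t * b\<^sup>2 - ((1 - t) * a + t * b)\<^sup>2 = t * (1 - t) * (a - b)\<^sup>2"
          by (simp add: power2_eq_square algebra_simps)
        moreover have "0 \<le> t * (1 - t) * (a - b)\<^sup>2" using that by simp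
        moreover have "(1 - t) * a\<^sup>2 \<le> 1 * a\<^sup>2" "t * b\<^sup>2 \<le> 1 * b\<^sup>2" by (intro mult_right_mono; use that in simp)+
        ultimately show ?thesis by linarith
      qed
      have A2: "A\<^sup>2 \<le> (x (Suc i) - x i)\<^sup>2 + (q (Suc i) - q i)\<^sup>2" unfolding A_def by (rule conv[OF \<theta>])
      have "\<bar>p i - x i\<bar> \<le> r" using pw[of i] xw[of i] True i m by linarith
      then have "\<bar>Bt\<bar> \<le> (1 / real m) * r" unfolding Bt_def \<theta>d[OF True] abs_mult
        by (intro mult_mono) auto
      then have "\<bar>Bt\<bar>\<^sup>2 \<le> (r / real m)\<^sup>2" by (intro power_mono) auto
      then have B2: "Bt\<^sup>2 \<le> (r / real m)\<^sup>2" by simp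
      have "(A + Bt)\<^sup>2 \<le> (1 + \<eta>) * A\<^sup>2 + (1 + 1 / \<eta>) * Bt\<^sup>2"
      proof -
        have "0 \<le> (\<eta> * A - Bt)\<^sup>2 / \<eta>" using \<eta> by simp
        also have "(\<eta> * A - Bt)\<^sup>2 / \<eta> = \<eta> * A\<^sup>2 - 2 * A * Bt + Bt\<^sup>2 / \<eta>"
          using \<eta> by (simp add: power2_eq_square field_simps)
        finally show ?thesis by (simp add: power2_eq_square algebra_simps)
      qed
      also have "\<dots> \<le> (1 + \<eta>) * ((x (Suc i) - x i)\<^sup>2 + (q (Suc i) - q i)\<^sup>2) + (1 + 1 / \<eta>) * (r / real m)\<^sup>2"
        using A2 B2 \<eta> by (intro add_mono mult_left_mono) auto
      finally show ?thesis using True yd by simp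
    qed
    have sm: "(\<Sum>i<n. if i < m then f i else 0) = (\<Sum>i<m. f i)" for f :: "nat \<Rightarrow> real"
    proof -
      have "(\<Sum>i<n. if i < m then f i else 0) = (\<Sum>i\<in>{..<n} \<inter> {i. i < m}. f i)" by (simp add: sum.inter_restrict)
      also have "{..<n} \<inter> {i. i < m} = {..<m}" using m by auto
      finally show ?thesis .
    qed
    have "(\<Sum>i<n. (y (Suc i) - y i)\<^sup>2) \<le> (\<Sum>i<n. (1 + \<eta>) * ((x (Suc i) - x i)\<^sup>2 + (if i < m then (q (Suc i) - q i)\<^sup>2 else 0))
       + (if i < m then (1 + 1 / \<eta>) * (r / real m)\<^sup>2 else 0))"
      by (rule sum_mono) (use step in simp)
    also have "\<dots> = (1 + \<eta>) * ((\<Sum>i<n. (x (Suc i) - x i)\<^sup>2) + (\<Sum>i<m. (q (Suc i) - q i)\<^sup>2)) + real m * ((1 + 1 / \<eta>) * (r / real m)\<^sup>2)"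
      by (simp only: sum.distrib sum_distrib_left[symmetric] sm sum_constant card_lessThan of_nat_id mult.left_commute)
    also have "real m * ((1 + 1 / \<eta>) * (r / real m)\<^sup>2) = (1 + 1 / \<eta>) * r\<^sup>2 / real m"
      using m by (simp add: power2_eq_square)
    finally have "(\<Sum>i<n. (y (Suc i) - y i)\<^sup>2) / \<delta> \<le> ((1 + \<eta>) * ((\<Sum>i<n. (x (Suc i) - x i)\<^sup>2) + (\<Sum>i<m. (q (Suc i) - q i)\<^sup>2))
        + (1 + 1 / \<eta>) * r\<^sup>2 / real m) / \<delta>"
      using \<delta> by (intro divide_right_mono) auto
    moreover have "((1 + \<eta>) * (a + b) + c / real m) / \<delta> = (1 + \<eta>) * (a / \<delta> + b / \<delta>) + c / (real m * \<delta>)" for a b c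
      by (simp add: add_divide_distrib distrib_left)
    ultimately show "qenergy \<delta> n y \<le> (1 + \<eta>) * (qenergy \<delta> n x + qenergy \<delta> m q) + (1 + 1 / \<eta>) * r\<^sup>2 / (real m * \<delta>)"
      unfolding qenergy_def by simp
  qed
qed

lemma qenergy_rev: "qenergy \<delta> n (\<lambda>i. x (n - i)) = qenergy \<delta> n x"
proof -
  have "(\<Sum>k<n. (x (n - Suc k) - x (n - k))\<^sup>2) = (\<Sum>k<n. (x (Suc (n - Suc k)) - x (n - Suc k))\<^sup>2)"
    by (rule sum.cong[OF refl]) (simp add: Suc_diff_Suc power2_commute)
  also have "\<dots> = (\<Sum>k<n. (x (Suc k) - x k)\<^sup>2)" by (rule sum.nat_diff_reindex[of "\<lambda>k. (x (Suc k) - x k)\<^sup>2"])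
  finally show ?thesis by (simp add: qenergy_def)
qed

lemma tube_rev: "x \<in> tube r w n \<Longrightarrow> (\<lambda>i. x (n - i)) \<in> tube r (\<lambda>i. w (n - i)) n"
  by (auto simp: tube_def)

text \<open>Pinning on the left, applied twice: the second time to the reversed path.\<close>

lemma pin_both:
  fixes x q q' w :: "nat \<Rightarrow> real"
  assumes x: "x \<in> tube r w n" and q: "q \<in> tube (r / 2) w m" and q': "q' \<in> tube (r / 2) (\<lambda>i. w (n - m + i)) m"
    and m: "0 < m" "m \<le> n" and \<delta>: "\<delta> > 0" and \<eta>: "\<eta> > 0"
  obtains y where "y \<in> tube r w n" "y 0 = w 0" "y n = w n"
    "qenergy \<delta> n y \<le> (1 + \<eta>)\<^sup>2 * (qenergy \<delta> n x + qenergy \<delta> m q + qenergy \<delta> m q') + (2 + \<eta>) * ((1 + 1 / \<eta>) * r\<^sup>2 / (real m * \<delta>))"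
proof -
  define c where "c = (1 + 1 / \<eta>) * r\<^sup>2 / (real m * \<delta>)"
  obtain y where y: "y \<in> tube r w n" "y 0 = w 0" "\<And>i. m \<le> i \<Longrightarrow> y i = x i"
    "qenergy \<delta> n y \<le> (1 + \<eta>) * (qenergy \<delta> n x + qenergy \<delta> m q) + c"
    using pin_left[OF x q m \<delta> \<eta>] unfolding c_def by blast
  have "(\<lambda>i. q' (m - i)) \<in> tube (r / 2) (\<lambda>i. w (n - i)) m"
    unfolding tube_def
  proof (intro CollectI allI impI)
    fix i assume "i \<le> m"
    then have "n - m + (m - i) = n - i" using m by simp
    then show "\<bar>q' (m - i) - w (n - i)\<bar> \<le> r / 2 / 2" using q' by (auto simp: tube_def dest!: spec[of _ "m - i"])
  qed
  from pin_left[OF tube_rev[OF y(1)] this m \<delta> \<eta>] obtain z where z: "z \<in> tube r (\<lambda>i. w (n - i)) n" "z 0 = w (n - 0)"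
    "\<And>i. m \<le> i \<Longrightarrow> z i = y (n - i)"
    "qenergy \<delta> n z \<le> (1 + \<eta>) * (qenergy \<delta> n (\<lambda>i. y (n - i)) + qenergy \<delta> m (\<lambda>i. q' (m - i))) + c"
    unfolding c_def by blast
  define v where "v = (\<lambda>i. z (n - i))"
  show ?thesis
  proof (rule that)
    show "v \<in> tube r w n" using z(1) unfolding v_def tube_def 
    proof (intro CollectI allI impI)
      fix i assume "i \<le> n"
      then have "n - i \<le> n" "n - (n - i) = i" by auto
      moreover assume "z \<in> {x. \<forall>k\<le>n. \<bar>x k - w (n - k)\<bar> \<le> r / 2}"
      ultimately show "\<bar>z (n - i) - w i\<bar> \<le> r / 2" by (auto dest!: spec[of _ "n - i"])
    qed
    show "v 0 = w 0" using z(3)[OF m(2)] y(2) by (simp add: v_def)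
    show "v n = w n" using z(2) by (simp add: v_def)
    have "qenergy \<delta> n v = qenergy \<delta> n z" unfolding v_def by (rule qenergy_rev)
    also have "\<dots> \<le> (1 + \<eta>) * (qenergy \<delta> n y + qenergy \<delta> m q') + c" using z(4) by (simp only: qenergy_rev)
    also have "\<dots> \<le> (1 + \<eta>) * (((1 + \<eta>) * (qenergy \<delta> n x + qenergy \<delta> m q) + c) + (1 + \<eta>) * qenergy \<delta> m q') + c"
    proof -
      have "0 \<le> qenergy \<delta> m q'" using \<delta> by (simp add: qenergy_def sum_nonneg)
      then have "qenergy \<delta> m q' \<le> (1 + \<eta>) * qenergy \<delta> m q'" using \<eta> by (simp add: algebra_simps)
      then show ?thesis using y(4) \<eta> by (intro add_right_mono mult_left_mono add_mono) auto
    qed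
    also have "\<dots> = (1 + \<eta>)\<^sup>2 * (qenergy \<delta> n x + qenergy \<delta> m q + qenergy \<delta> m q') + (2 + \<eta>) * c"
      by (simp add: power2_eq_square algebra_simps)
    finally show "qenergy \<delta> n v \<le> (1 + \<eta>)\<^sup>2 * (qenergy \<delta> n x + qenergy \<delta> m q + qenergy \<delta> m q')
        + (2 + \<eta>) * ((1 + 1 / \<eta>) * r\<^sup>2 / (real m * \<delta>))" by (simp only: c_def)
  qed
qed

text \<open>
  The free energy of the block of length \<open>l\<close> beginning at time \<open>s\<close>, on the dyadic grid of
  level \<open>N\<close>.
\<close>

definition level_energy :: "real \<Rightarrow> nat \<Rightarrow> nat \<Rightarrow> real \<Rightarrow> (real \<Rightarrow> real) \<Rightarrow> ennreal" where
  "level_energy r l N s w = free_energy (1 / 2 ^ N) r (l * 2 ^ N) (steps (\<lambda>i. w (s + real i * (1 / 2 ^ N))))"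

text \<open>
  \<open>A\<close> bounds the free energy of the block, \<open>B\<close> and \<open>C\<close> those of its first and
  last unit of time, where the ends are pinned. The bounds are demanded for all levels because the level is chosen to
  suit the modulus of continuity of \<open>w\<close>.
\<close>

lemma strip_path_block:
  assumes w: "continuous_on {s..s + real L} w" and r: "0 < r'" "r' < r" and \<eta>: "0 < \<eta>" and L: "1 \<le> L"
    and A: "0 \<le> A" "\<And>N. level_energy r' L N s w \<le> ennreal A"
    and B: "0 \<le> B" "\<And>N. level_energy (r' / 2) 1 N s w \<le> ennreal B"
    and C: "0 \<le> C" "\<And>N. level_energy (r' / 2) 1 N (s + real (L - 1)) w \<le> ennreal C"
  shows "strip_path w (r / 2) s (s + real L) (w s) (w (s + real L))
    ((1 + \<eta>)\<^sup>2 * (A + B + C) + (2 + \<eta>) * ((1 + 1 / \<eta>) * r'\<^sup>2))"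
proof -
  define \<omega> where "\<omega> = (r - r') / 2"
  have \<omega>: "0 < \<omega>" using r by (simp add: \<omega>_def)
  have "uniformly_continuous_on {s..s + real L} w" by (rule compact_uniformly_continuous[OF w]) simp
  then obtain d where d: "d > 0" "\<And>t t'. t \<in> {s..s + real L} \<Longrightarrow> t' \<in> {s..s + real L} \<Longrightarrow> dist t' t < d \<Longrightarrow> dist (w t') (w t) < \<omega>"
    using \<omega> by (rule uniformly_continuous_onE) blast
  obtain N where N: "(1 / 2) ^ N < d" using real_arch_pow_inv[of d "1/2"] d(1) by auto
  define \<delta> :: real where "\<delta> = 1 / 2 ^ N"
  define m :: nat where "m = 2 ^ N"
  define n where "n = L * m"
  have \<delta>: "0 < \<delta>" "\<delta> < d" "real m * \<delta> = 1" "real n * \<delta> = real L"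
    using N by (auto simp: \<delta>_def m_def n_def power_divide)
  have m: "0 < m" "m \<le> n" using L by (auto simp: m_def n_def)
  define W where "W = (\<lambda>i. w (s + real i * \<delta>))"
  obtain x where x: "x \<in> tube r' W n" "ennreal (qenergy \<delta> n x) = free_energy \<delta> r' n (steps W)"
    using free_energy_attained[OF \<delta>(1) less_imp_le[OF r(1)]] by blast
  obtain q where q: "q \<in> tube (r' / 2) W m" "ennreal (qenergy \<delta> m q) = free_energy \<delta> (r' / 2) m (steps W)"
    using free_energy_attained[OF \<delta>(1), of "r' / 2" W m] r by auto
  obtain q' where q': "q' \<in> tube (r' / 2) (\<lambda>i. W (n - m + i)) m"
    "ennreal (qenergy \<delta> m q') = free_energy \<delta> (r' / 2) m (steps (\<lambda>i. W (n - m + i)))"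
    using free_energy_attained[OF \<delta>(1), of "r' / 2" "\<lambda>i. W (n - m + i)" m] r by auto
  have shift: "(\<lambda>i. W (n - m + i)) = (\<lambda>i. w (s + real (L - 1) + real i * \<delta>))"
  proof
    fix i
    have "n - m = (L - 1) * m" by (simp add: n_def diff_mult_distrib)
    then have e: "real (n - m + i) = real (L - 1) * real m + real i" by simp
    have "real (n - m + i) * \<delta> = real (L - 1) * (real m * \<delta>) + real i * \<delta>"
      unfolding e distrib_right mult.assoc ..
    then show "W (n - m + i) = w (s + real (L - 1) + real i * \<delta>)" using \<delta>(3) by (simp add: W_def add.assoc)
  qed
  have qx: "qenergy \<delta> n x \<le> A"
  proof -
    have "ennreal (qenergy \<delta> n x) \<le> ennreal A" unfolding x(2) using A(2)[of N]
      by (simp only: level_energy_def n_def m_def \<delta>_def W_def)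
    then show ?thesis using A(1) by (simp add: ennreal_le_iff)
  qed
  have qq: "qenergy \<delta> m q \<le> B"
  proof -
    have "ennreal (qenergy \<delta> m q) \<le> ennreal B" unfolding q(2) using B(2)[of N]
      by (simp only: level_energy_def m_def \<delta>_def W_def mult_1)
    then show ?thesis using B(1) by (simp add: ennreal_le_iff)
  qed
  have qq': "qenergy \<delta> m q' \<le> C"
  proof -
    have "ennreal (qenergy \<delta> m q') \<le> ennreal C" unfolding q'(2) shift using C(2)[of N]
      by (simp only: level_energy_def m_def \<delta>_def mult_1)
    then show ?thesis using C(1) by (simp add: ennreal_le_iff)
  qed
  obtain y where y: "y \<in> tube r' W n" "y 0 = W 0" "y n = W n"
    "qenergy \<delta> n y \<le> (1 + \<eta>)\<^sup>2 * (qenergy \<delta> n x + qenergy \<delta> m q + qenergy \<delta> m q') + (2 + \<eta>) * ((1 + 1 / \<eta>) * r'\<^sup>2 / (real m * \<delta>))"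
    by (rule pin_both[OF x(1) q(1) q'(1) m \<delta>(1) \<eta>])
  have "strip_path w (r / 2) s (s + real n * \<delta>) (y 0) (y n) (qenergy \<delta> n y)"
  proof (rule strip_path_grid[OF \<delta>(1)])
    show "y \<in> tube r' (\<lambda>k. w (s + real k * \<delta>)) n" using y(1) by (simp add: W_def)
    show "r' / 2 + \<omega> \<le> r / 2" by (simp add: \<omega>_def field_simps)
    show "0 \<le> \<omega>" using \<omega> by simp
    fix t t' assume "t \<in> {s..s + real n * \<delta>}" "t' \<in> {s..s + real n * \<delta>}" "\<bar>t - t'\<bar> \<le> \<delta>"
    then show "\<bar>w t - w t'\<bar> \<le> \<omega>" using d(2)[of t' t] \<delta> by (simp add: dist_real_def)
  qed
  then have p: "strip_path w (r / 2) s (s + real L) (w s) (w (s + real L)) (qenergy \<delta> n y)"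
    using y(2,3) \<delta>(4) by (simp add: W_def)
  have "qenergy \<delta> n y \<le> (1 + \<eta>)\<^sup>2 * (qenergy \<delta> n x + qenergy \<delta> m q + qenergy \<delta> m q') + (2 + \<eta>) * ((1 + 1 / \<eta>) * r'\<^sup>2)"
    using y(4) \<delta>(3) by simp
  also have "\<dots> \<le> (1 + \<eta>)\<^sup>2 * (A + B + C) + (2 + \<eta>) * ((1 + 1 / \<eta>) * r'\<^sup>2)"
    using qx qq qq' by (intro add_right_mono mult_left_mono add_mono) auto
  finally show ?thesis by (rule strip_path_mono[OF p])
qed

lemma energy_on_double:
  assumes "h \<in> AC_on a b"
  shows "energy_on a b (\<lambda>t. 2 * h t) = 4 * energy_on a b h" and "(\<lambda>t. 2 * h t) \<in> AC_on a b"
proof -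
  have "AE x in lebesgue. x \<notin> {x \<in> {a<..<b}. \<not> h field_differentiable (at x)} \<union> {a, b}"
    by (intro AE_lebesgue_negligible negligible_Un AC_on_differentiable_AE assms) simp
  note AE = this
  note [measurable] = AC_on_deriv_measurable[OF assms]
  have "energy_on a b (\<lambda>t. 2 * h t) = (\<integral>\<^sup>+t. 4 * ennreal ((deriv h t * indicator {a..b} t)\<^sup>2) \<partial>lebesgue)"
    unfolding energy_on_lebesgue
  proof (rule nn_integral_cong_AE)
    show "AE t in lebesgue. ennreal ((deriv (\<lambda>t. 2 * h t) t * indicator {a..b} t)\<^sup>2) = 4 * ennreal ((deriv h t * indicator {a..b} t)\<^sup>2)"
      using AE
    proof eventually_elim
      case (elim t)
      show ?case
      proof (cases "t \<in> {a..b}")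
        case True
        then have "(h has_field_derivative deriv h t) (at t)" using elim by (auto simp: field_differentiable_derivI)
        then have "((\<lambda>t. 2 * h t) has_field_derivative 2 * deriv h t) (at t)" by (rule DERIV_cmult)
        then have d: "deriv (\<lambda>t. 2 * h t) t = 2 * deriv h t" by (rule DERIV_imp_deriv)
        have "ennreal (4 * (deriv h t)\<^sup>2) = ennreal 4 * ennreal ((deriv h t)\<^sup>2)" by (rule ennreal_mult') simp
        then show ?thesis unfolding d using True by (simp add: power_mult_distrib)
      qed simp
    qed
  qed
  then show "energy_on a b (\<lambda>t. 2 * h t) = 4 * energy_on a b h"
    unfolding energy_on_lebesgue by (simp add: nn_integral_cmult)
  show "(\<lambda>t. 2 * h t) \<in> AC_on a b"
    unfolding AC_on_def mem_Collect_eq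
  proof (intro allI impI)
    fix e :: real assume "e > 0"
    obtain d where d: "d > 0"
      "\<And>(n::nat) l u. (\<And>i. i < n \<Longrightarrow> a \<le> l i \<and> l i \<le> u i \<and> u i \<le> b) \<Longrightarrow>
        disjoint_family_on (\<lambda>i. {l i<..<u i}) {..<n} \<Longrightarrow>
        (\<Sum>i<n. u i - l i) < d \<Longrightarrow> (\<Sum>i<n. \<bar>h (u i) - h (l i)\<bar>) < e / 2"
      using AC_onD[OF assms half_gt_zero[OF \<open>e > 0\<close>]] by blast
    show "\<exists>\<delta>>0. \<forall>(n::nat) l u. (\<forall>i<n. a \<le> l i \<and> l i \<le> u i \<and> u i \<le> b) \<longrightarrow>
        disjoint_family_on (\<lambda>i. {l i<..<u i}) {..<n} \<longrightarrow> (\<Sum>i<n. u i - l i) < \<delta> \<longrightarrow>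
        (\<Sum>i<n. \<bar>2 * h (u i) - 2 * h (l i)\<bar>) < e"
    proof (intro exI[of _ d] conjI allI impI d(1))
      fix n :: nat and l u
      assume lu: "\<forall>i<n. a \<le> l i \<and> l i \<le> u i \<and> u i \<le> b"
        and dj: "disjoint_family_on (\<lambda>i. {l i<..<u i}) {..<n}" and sm: "(\<Sum>i<n. u i - l i) < d"
      have "(\<Sum>i<n. \<bar>h (u i) - h (l i)\<bar>) < e / 2" by (rule d(2)[OF _ dj sm]) (use lu in auto)
      moreover have double: "\<bar>2 * x - 2 * y\<bar> = 2 * \<bar>x - y\<bar>" for x y :: real
        by (simp only: right_diff_distrib[symmetric] abs_mult abs_numeral)
      moreover have "(\<Sum>i<n. \<bar>2 * h (u i) - 2 * h (l i)\<bar>) = 2 * (\<Sum>i<n. \<bar>h (u i) - h (l i)\<bar>)"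
        by (simp only: double sum_distrib_left)
      ultimately show "(\<Sum>i<n. \<bar>2 * h (u i) - 2 * h (l i)\<bar>) < e" by simp
    qed
  qed
qed

text \<open>
  A path that is not pinned at \<open>T\<close> is corrected by a linear function to end at \<open>w T\<close>; for that
  the path needs half of the width as a reserve. Doubling the energies is harmless, since this happens on the last
  stretch only.
\<close>

lemma strip_path_truncate:
  assumes p: "strip_path w (r / 4) a b (w a) v e" and T: "a < T" "T \<le> b" and r: "0 \<le> r" and e: "0 \<le> e"
  shows "strip_path w (r / 2) a T (w a) (w T) (2 * e + r\<^sup>2 / (8 * (T - a)))"
proof -
  obtain h C where h: "C-lipschitz_on {a..b} h" "h a = w a" "\<forall>t\<in>{a..b}. \<bar>h t - w t\<bar> \<le> r / 4" "energy_on a b h \<le> ennreal e"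
    using p unfolding strip_path_def by blast
  define k where "k = (w T - h T) / (T - a)"
  define g where "g = (\<lambda>t. 0 + k * (t - a))"
  define f where "f = (\<lambda>t. h t + g t)"
  have hT: "C-lipschitz_on {a..T} h" by (rule lipschitz_on_subset[OF h(1)]) (use T in auto)
  have gl: "\<bar>k\<bar>-lipschitz_on {a..T} g" unfolding g_def by (rule lipschitz_affine)
  have fl: "(C + \<bar>k\<bar>)-lipschitz_on {a..T} f" unfolding f_def by (rule lipschitz_on_add[OF hT gl])
  have AC: "h \<in> AC_on a T" "g \<in> AC_on a T" using lipschitz_AC_on[OF hT] lipschitz_AC_on[OF gl] by auto
  have hw: "\<bar>h T - w T\<bar> \<le> r / 4" using h(3) T by simp
  have Eh: "energy_on a T h \<le> ennreal e" using energy_on_mono[of a a T b h] T h(4) by auto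
  have Eg: "energy_on a T g \<le> ennreal (r\<^sup>2 / (16 * (T - a)))"
  proof -
    have "k\<^sup>2 * (T - a) = (w T - h T)\<^sup>2 / (T - a)" using T by (simp add: k_def power_divide power2_eq_square)
    also have "\<dots> = \<bar>h T - w T\<bar>\<^sup>2 / (T - a)" by (simp add: power2_commute)
    also have "\<dots> \<le> (r / 4)\<^sup>2 / (T - a)" using hw T by (intro divide_right_mono power_mono) auto
    also have "\<dots> = r\<^sup>2 / (16 * (T - a))" by (simp add: power_divide)
    finally show ?thesis unfolding g_def using T by (subst energy_on_affine) (auto intro: ennreal_leI)
  qed
  have "energy_on a T f = energy_on a T (\<lambda>x. (2 * h x + 1 * (2 * g x)) / 2)"
    by (rule energy_on_cong) (simp add: f_def)
  then have "2 * energy_on a T f \<le> 2 * (energy_on a T (\<lambda>x. (2 * h x + (-1) * (2 * g x)) / 2) + energy_on a T (\<lambda>x. (2 * h x + 1 * (2 * g x)) / 2))"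
    by (intro mult_left_mono) auto
  also have "\<dots> = energy_on a T (\<lambda>x. 2 * h x) + energy_on a T (\<lambda>x. 2 * g x)"
    by (rule energy_parallelogram) (intro energy_on_double(2) AC)+
  also have "\<dots> = 4 * energy_on a T h + 4 * energy_on a T g" using energy_on_double(1)[OF AC(1)] energy_on_double(1)[OF AC(2)] by simp
  also have "\<dots> \<le> 4 * ennreal e + 4 * ennreal (r\<^sup>2 / (16 * (T - a)))"
    using Eh Eg by (intro add_mono mult_left_mono) auto
  also have "\<dots> = 2 * ennreal (2 * e + r\<^sup>2 / (8 * (T - a)))"
  proof -
    define z where "z = r\<^sup>2 / (16 * (T - a))"
    have z: "0 \<le> z" "r\<^sup>2 / (8 * (T - a)) = 2 * z" using T by (auto simp: z_def field_simps)
    have "4 * ennreal e + 4 * ennreal z = ennreal (4 * e) + ennreal (4 * z)"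
      using ennreal_mult'[of 4 e] ennreal_mult'[of 4 z] by simp
    also have "\<dots> = ennreal (4 * e + 4 * z)" using e z by (intro ennreal_plus[symmetric]) auto
    also have "\<dots> = 2 * ennreal (2 * e + 2 * z)" using ennreal_mult'[of 2 "2 * e + 2 * z"] by (simp add: algebra_simps)
    finally show ?thesis unfolding z(2) z_def[symmetric] .
  qed
  finally have E: "energy_on a T f \<le> ennreal (2 * e + r\<^sup>2 / (8 * (T - a)))"
    by (subst (asm) ennreal_mult_le_mult_iff) auto
  have fa: "f a = w a" "f T = w T" using h(2) T by (auto simp: f_def g_def k_def)
  have "\<bar>f t - w t\<bar> \<le> r / 2" if t: "t \<in> {a..T}" for t
  proof -
    have "\<bar>g t\<bar> \<le> r / 4"
    proof -
      have "\<bar>g t\<bar> = \<bar>h T - w T\<bar> * ((t - a) / (T - a))"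
        using t T by (simp add: g_def k_def abs_mult abs_divide abs_minus_commute)
      also have "\<dots> \<le> \<bar>h T - w T\<bar> * 1" using t T by (intro mult_left_mono) auto
      finally show ?thesis using hw by simp
    qed
    moreover have "\<bar>h t - w t\<bar> \<le> r / 4" using h(3) t T by simp
    ultimately show ?thesis unfolding f_def by linarith
  qed
  then show ?thesis unfolding strip_path_def using fl fa E by blast
qed

lemma strip_path_blocks:
  assumes p: "\<And>k. strip_path w \<rho> (real (k * L)) (real (Suc k * L)) (w (real (k * L))) (w (real (Suc k * L))) (e k)"
    and e: "\<And>k. 0 \<le> e k" and z: "\<bar>0::real\<bar> \<le> \<rho>"
  shows "strip_path w \<rho> 0 (real (m * L)) (w 0) (w (real (m * L))) (\<Sum>k<m. e k)"
proof (induction m)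
  case 0
  have "energy_on 0 0 (\<lambda>t. w 0) = 0" using energy_on_affine[of 0 0 "w 0" 0] by simp
  then show ?case
    unfolding strip_path_def using z
    by (intro exI[of _ "\<lambda>t. w 0"] exI[of _ 0]) (auto intro: lipschitz_intros)
next
  case (Suc m)
  have "strip_path w \<rho> 0 (real (Suc m * L)) (w 0) (w (real (Suc m * L))) ((\<Sum>k<m. e k) + e m)"
    by (rule strip_path_join[OF Suc p]) (use e in \<open>auto intro: sum_nonneg\<close>)
  then show ?case by simp
qed

text \<open>
  All but the last complete block are passed by the cheap paths. From there to \<open>T\<close> the path runs on the
  paths of the narrower strip, through the last complete block as well, so that there is at least a time
  \<open>L\<close> for the linear correction.
\<close>

lemma strip_path_total:
  assumes L: "1 \<le> L" and r: "0 < r" and w0: "w 0 = 0" and T: "real L \<le> T"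
    and p: "\<And>k. strip_path w (r / 2) (real (k * L)) (real (Suc k * L)) (w (real (k * L))) (w (real (Suc k * L))) (e k)"
    and p': "\<And>k. strip_path w (r / 4) (real (k * L)) (real (Suc k * L)) (w (real (k * L))) (w (real (Suc k * L))) (e' k)"
    and e: "\<And>k. 0 \<le> e k" "\<And>k. 0 \<le> e' k"
  defines "m \<equiv> nat \<lfloor>T / real L\<rfloor>"
  shows "\<exists>h\<in>strip T r w. energy T h \<le> ennreal ((\<Sum>k<m. e k) + 2 * (e' (m - 1) + e' m) + r\<^sup>2)"
proof -
  have L0: "0 < real L" using L by simp
  have TL: "1 \<le> T / real L" using T L0 by simp
  have mr: "real m = of_int \<lfloor>T / real L\<rfloor>" using TL by (simp add: m_def)
  have m1: "1 \<le> m" using TL by (simp add: m_def le_nat_iff)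
  have "real m \<le> T / real L" unfolding mr by (rule of_int_floor_le)
  then have mT: "real m * real L \<le> T" using L0 by (simp add: pos_le_divide_eq)
  have "T / real L < real m + 1" unfolding mr by (rule floor_correct[THEN conjunct2, simplified])
  then have Tm: "T < (real m + 1) * real L" using L0 by (simp add: pos_divide_less_eq)
  obtain j where j: "m = Suc j" using m1 by (cases m) auto
  have P1: "strip_path w (r / 2) 0 (real (j * L)) (w 0) (w (real (j * L))) (\<Sum>k<j. e k)"
    by (rule strip_path_blocks[where w = w and e = e and L = L, OF p e(1)]) (use r in simp)
  have P2: "strip_path w (r / 4) (real (j * L)) (real (Suc (Suc j) * L)) (w (real (j * L))) (w (real (Suc (Suc j) * L))) (e' j + e' (Suc j))"
    by (rule strip_path_join[OF p'[of j] p'[of "Suc j"]]) (use e in auto)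
  have aT: "real (j * L) < T" "T \<le> real (Suc (Suc j) * L)" "real L \<le> T - real (j * L)"
    using mT Tm L0 by (auto simp: j algebra_simps)
  have P3: "strip_path w (r / 2) (real (j * L)) T (w (real (j * L))) (w T) (2 * (e' j + e' (Suc j)) + r\<^sup>2 / (8 * (T - real (j * L))))"
    by (rule strip_path_truncate[OF P2 aT(1,2)]) (use r e in auto)
  have "strip_path w (r / 2) 0 T (w 0) (w T) ((\<Sum>k<j. e k) + (2 * (e' j + e' (Suc j)) + r\<^sup>2 / (8 * (T - real (j * L)))))"
    by (rule strip_path_join[OF P1 P3]) (use e aT L0 in \<open>auto intro!: sum_nonneg add_nonneg_nonneg divide_nonneg_nonneg simp del: of_nat_mult\<close>)
  moreover have "(\<Sum>k<j. e k) + (2 * (e' j + e' (Suc j)) + r\<^sup>2 / (8 * (T - real (j * L))))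
      \<le> (\<Sum>k<m. e k) + 2 * (e' (m - 1) + e' m) + r\<^sup>2"
  proof -
    have "1 \<le> 8 * (T - real (j * L))" using aT(3) L by simp
    then have "r\<^sup>2 / (8 * (T - real (j * L))) \<le> r\<^sup>2 / 1" by (intro divide_left_mono) auto
    moreover have "(\<Sum>k<m. e k) = (\<Sum>k<j. e k) + e j" "m - 1 = j" unfolding j by simp_all
    ultimately show ?thesis using e(1)[of j] j by simp
  qed
  ultimately have "strip_path w (r / 2) 0 T (w 0) (w T) ((\<Sum>k<m. e k) + 2 * (e' (m - 1) + e' m) + r\<^sup>2)" by (rule strip_path_mono)
  then obtain h C where h: "C-lipschitz_on {0..T} h" "h 0 = w 0" "h T = w T" "\<forall>t\<in>{0..T}. \<bar>h t - w t\<bar> \<le> r / 2"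
    "energy_on 0 T h \<le> ennreal ((\<Sum>k<m. e k) + 2 * (e' (m - 1) + e' m) + r\<^sup>2)"
    unfolding strip_path_def by blast
  then have "h \<in> strip T r w" using lipschitz_AC_on[OF h(1)] w0 by (simp add: strip_def AC_eq_AC_on)
  then show ?thesis using h(5) by (auto simp: energy_eq_energy_on)
qed

section \<open>A strong law for pairwise uncorrelated truncations\<close>

lemma cesaro_mean:
  fixes a :: "nat \<Rightarrow> real"
  assumes "a \<longlonglongrightarrow> L"
  shows "(\<lambda>n. (\<Sum>k<n. a k) / real n) \<longlonglongrightarrow> L"
proof (rule LIMSEQ_I)
  fix e :: real assume "e > 0"
  then obtain N where N: "\<And>k. k \<ge> N \<Longrightarrow> \<bar>a k - L\<bar> < e / 2"
    using LIMSEQ_D[OF assms, of "e / 2"] by auto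
  define C where "C = (\<Sum>k<N. \<bar>a k - L\<bar>)"
  have C: "0 \<le> C" by (simp add: C_def sum_nonneg)
  obtain N2 :: nat where N2: "2 * C / e < real N2" using reals_Archimedean2 by blast
  show "\<exists>no. \<forall>n\<ge>no. norm ((\<Sum>k<n. a k) / real n - L) < e"
  proof (intro exI[of _ "Suc (N + N2)"] allI impI)
    fix n assume n: "Suc (N + N2) \<le> n"
    have n0: "0 < real n" using n by simp
    have "(\<Sum>k<n. a k) / real n - L = (\<Sum>k<n. a k - L) / real n"
      using n0 by (simp add: sum_subtractf field_simps)
    also have "\<bar>\<dots>\<bar> \<le> (\<Sum>k<n. \<bar>a k - L\<bar>) / real n"
      using n0 by (simp add: abs_divide divide_right_mono sum_abs)
    also have "\<dots> \<le> (C + real n * (e / 2)) / real n"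
    proof (rule divide_right_mono)
      have "(\<Sum>k<n. \<bar>a k - L\<bar>) = C + (\<Sum>k\<in>{N..<n}. \<bar>a k - L\<bar>)"
      proof -
        have "{..<n} = {..<N} \<union> {N..<n}" using n by auto
        moreover have "{..<N} \<inter> {N..<n} = {}" by auto
        ultimately show ?thesis unfolding C_def by (simp add: sum.union_disjoint)
      qed
      also have "(\<Sum>k\<in>{N..<n}. \<bar>a k - L\<bar>) \<le> (\<Sum>k\<in>{N..<n}. e / 2)"
        by (rule sum_mono) (use N in \<open>auto intro: less_imp_le\<close>)
      also have "\<dots> \<le> real n * (e / 2)" using \<open>e > 0\<close> by (simp add: mult_right_mono)
      finally show "(\<Sum>k<n. \<bar>a k - L\<bar>) \<le> C + real n * (e / 2)" by simp
    qed simp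
    also have "\<dots> = C / real n + e / 2" using n0 by (simp add: field_simps)
    also have "C / real n < e / 2"
    proof -
      have "2 * C / e < real n" using N2 n by linarith
      then show ?thesis using \<open>e > 0\<close> n0 by (simp add: field_simps)
    qed
    finally show "norm ((\<Sum>k<n. a k) / real n - L) < e" by simp
  qed
qed

text \<open>
  Terms with \<open>\<alpha>\<^sup>j \<le> x\<close> form an increasing, the others a decreasing geometric series, both
  dominated by their value near \<open>x\<close>.
\<close>

lemma truncated_squares_sum:
  fixes \<alpha> x :: real
  assumes \<alpha>: "1 < \<alpha>" and x: "0 \<le> x"
  shows "(\<Sum>j. ennreal ((min x (\<alpha> ^ j))\<^sup>2 / \<alpha> ^ j)) \<le> ennreal (2 * \<alpha> / (\<alpha> - 1) * x)"
proof (cases "x = 0")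
  case True
  then show ?thesis using \<alpha> by (simp add: min_def)
next
  case False
  then have x0: "0 < x" using x by simp
  define J where "J = (LEAST j. x < \<alpha> ^ j)"
  have ex: "\<exists>j. x < \<alpha> ^ j" using real_arch_pow[OF \<alpha>] .
  have J: "x < \<alpha> ^ J" unfolding J_def by (rule LeastI_ex[OF ex])
  have lJ: "\<alpha> ^ j \<le> x" if "j < J" for j using not_less_Least[OF that[unfolded J_def]] by simp
  define t where "t = (\<lambda>j. (min x (\<alpha> ^ j))\<^sup>2 / \<alpha> ^ j)"
  have p: "0 < \<alpha> ^ j" for j using \<alpha> by simp
  have t0: "0 \<le> t j" for j using p[of j] by (simp add: t_def)
  have split: "(\<Sum>j<J + n. t j) = (\<Sum>j<J. t j) + (\<Sum>i<n. t (J + i))" for n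
    by (induction n) auto
  have part1: "(\<Sum>j<J. t j) \<le> \<alpha> / (\<alpha> - 1) * x"
  proof (cases J)
    case 0
    then show ?thesis using \<alpha> x by simp
  next
    case (Suc m)
    have "(\<Sum>j<J. t j) = (\<Sum>j<J. \<alpha> ^ j)"
      by (rule sum.cong[OF refl]) (use lJ p in \<open>simp add: t_def min_absorb2 power2_eq_square\<close>)
    also have "\<dots> = (\<alpha> ^ J - 1) / (\<alpha> - 1)" using \<alpha> by (simp add: geometric_sum)
    also have "\<dots> \<le> (\<alpha> * x) / (\<alpha> - 1)"
    proof (rule divide_right_mono)
      have "\<alpha> ^ m \<le> x" by (rule lJ) (simp add: Suc)
      then have "\<alpha> * \<alpha> ^ m \<le> \<alpha> * x" using \<alpha> by (intro mult_left_mono) auto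
      then show "\<alpha> ^ J - 1 \<le> \<alpha> * x" by (simp add: Suc)
    qed (use \<alpha> in simp)
    finally show ?thesis by simp
  qed
  have part2: "(\<Sum>i<n. t (J + i)) \<le> \<alpha> / (\<alpha> - 1) * x" for n
  proof -
    have "(\<Sum>i<n. t (J + i)) \<le> (\<Sum>i<n. x * (1 / \<alpha>) ^ i)"
    proof (rule sum_mono)
      fix i
      have "min x (\<alpha> ^ (J + i)) \<le> x" by simp
      then have "(min x (\<alpha> ^ (J + i)))\<^sup>2 \<le> x\<^sup>2" using x p[of "J + i"] by (intro power_mono) auto
      then have "t (J + i) \<le> x\<^sup>2 / \<alpha> ^ (J + i)" unfolding t_def using p[of "J + i"] by (intro divide_right_mono) auto
      also have "\<dots> = (x / \<alpha> ^ J) * (x * (1 / \<alpha>) ^ i)" by (simp add: power_add power2_eq_square power_divide)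
      also have "\<dots> \<le> 1 * (x * (1 / \<alpha>) ^ i)"
        using J p[of J] x \<alpha> by (intro mult_right_mono) auto
      finally show "t (J + i) \<le> x * (1 / \<alpha>) ^ i" by simp
    qed
    also have "\<dots> = x * (\<Sum>i<n. (1 / \<alpha>) ^ i)" by (simp add: sum_distrib_left)
    also have "\<dots> \<le> x * (1 / (1 - 1 / \<alpha>))"
    proof (rule mult_left_mono[OF _ x])
      have s: "(\<lambda>i. (1 / \<alpha>) ^ i) sums (1 / (1 - 1 / \<alpha>))" using \<alpha> by (intro geometric_sums) simp
      have "(\<Sum>i<n. (1 / \<alpha>) ^ i) \<le> (\<Sum>i. (1 / \<alpha>) ^ i)"
        using s \<alpha> by (intro sum_le_suminf) (auto simp: sums_iff)
      then show "(\<Sum>i<n. (1 / \<alpha>) ^ i) \<le> 1 / (1 - 1 / \<alpha>)" using s by (simp add: sums_iff)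
    qed
    also have "\<dots> = \<alpha> / (\<alpha> - 1) * x" using \<alpha> by (simp add: field_simps)
    finally show ?thesis .
  qed
  have "(\<Sum>j<n. ennreal (t j)) \<le> ennreal (2 * \<alpha> / (\<alpha> - 1) * x)" for n
  proof -
    have "(\<Sum>j<n. t j) \<le> (\<Sum>j<J + n. t j)" using t0 by (intro sum_mono2) auto
    also have "\<dots> \<le> \<alpha> / (\<alpha> - 1) * x + \<alpha> / (\<alpha> - 1) * x" unfolding split by (intro add_mono part1 part2)
    also have "\<dots> = 2 * \<alpha> / (\<alpha> - 1) * x" by (simp only: mult_2 add_divide_distrib distrib_right)
    finally show ?thesis using t0 by (simp add: sum_ennreal ennreal_leI)
  qed
  then show ?thesis unfolding t_def by (intro suminf_le_const) auto
qed

text \<open>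
  Between consecutive times \<open>\<alpha>\<^sup>j\<close> a nondecreasing sum is trapped by its values there, at the
  price of factors \<open>\<alpha>\<close> in the averages.
\<close>

lemma geometric_interpolation:
  fixes S :: "nat \<Rightarrow> real" and \<alpha> :: real
  assumes mono: "\<And>m n. m \<le> n \<Longrightarrow> S m \<le> S n" and S0: "\<And>n. 0 \<le> S n" and \<alpha>: "1 < \<alpha>"
    and lim: "(\<lambda>j. S (nat \<lfloor>\<alpha> ^ j\<rfloor>) / real (nat \<lfloor>\<alpha> ^ j\<rfloor>)) \<longlonglongrightarrow> \<mu>" and e: "0 < e"
  shows "eventually (\<lambda>n. S n / real n \<le> \<alpha> * (\<mu> + e) \<and> (\<mu> - e) / (\<alpha> * \<alpha>) \<le> S n / real n) sequentially"
proof -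
  define k where "k = (\<lambda>j. nat \<lfloor>\<alpha> ^ j\<rfloor>)"
  have p1: "1 \<le> \<alpha> ^ j" for j using \<alpha> by simp
  have kle: "real (k j) \<le> \<alpha> ^ j" and kgt: "\<alpha> ^ j < real (k j) + 1" and k1: "1 \<le> k j" for j
  proof -
    have r: "real (k j) = of_int \<lfloor>\<alpha> ^ j\<rfloor>" using p1[of j] by (simp add: k_def)
    show "real (k j) \<le> \<alpha> ^ j" unfolding r by (rule of_int_floor_le)
    show "\<alpha> ^ j < real (k j) + 1" unfolding r by (rule floor_correct[THEN conjunct2, simplified])
    then show "1 \<le> k j" using p1[of j] by (cases "k j") auto
  qed
  have "eventually (\<lambda>j. \<bar>S (k j) / real (k j) - \<mu>\<bar> < e) sequentially"
    using tendstoD[OF lim e] by (simp add: k_def dist_real_def)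
  then obtain j1 where j1: "\<And>j. j \<ge> j1 \<Longrightarrow> \<bar>S (k j) / real (k j) - \<mu>\<bar> < e" by (auto simp: eventually_sequentially)
  obtain j2 where j2: "\<alpha> / (\<alpha> - 1) < \<alpha> ^ j2" using real_arch_pow[OF \<alpha>] by blast
  obtain n0 :: nat where n0: "\<alpha> ^ (j1 + j2) < real n0" using reals_Archimedean2 by blast
  show ?thesis
    unfolding eventually_sequentially
  proof (intro exI[of _ n0] allI impI)
    fix n assume n: "n0 \<le> n"
    have ex: "\<exists>j. real n < \<alpha> ^ j" using real_arch_pow[OF \<alpha>] .
    define i where "i = (LEAST j. real n < \<alpha> ^ j)"
    have i: "real n < \<alpha> ^ i" unfolding i_def by (rule LeastI_ex[OF ex])
    have li: "\<alpha> ^ j \<le> real n" if "j < i" for j using not_less_Least[OF that[unfolded i_def]] by simp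
    have "\<alpha> ^ (j1 + j2) < \<alpha> ^ i" using n0 n i by linarith
    then have ij: "j1 + j2 < i" using \<alpha> by (simp add: power_strict_increasing_iff)
    then obtain j where j: "i = Suc j" "j1 + j2 \<le> j" by (cases i) auto
    have nj: "\<alpha> ^ j \<le> real n" "real n < \<alpha> ^ Suc j" using li[of j] i j by auto
    have npos: "0 < real n" using nj(1) p1[of j] by linarith
    have kn: "k j \<le> n" using kle[of j] nj(1) by linarith
    have nk: "n \<le> k (Suc j)" using kgt[of "Suc j"] nj(2) by linarith
    have up: "S n \<le> (\<mu> + e) * real (k (Suc j))"
    proof -
      have "S (k (Suc j)) / real (k (Suc j)) \<le> \<mu> + e" using j1[of "Suc j"] j(2) by (simp add: abs_less_iff)
      then have "S (k (Suc j)) \<le> (\<mu> + e) * real (k (Suc j))" using k1[of "Suc j"] by (simp add: pos_divide_le_eq)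
      then show ?thesis using mono[OF nk] by linarith
    qed
    have me: "0 \<le> \<mu> + e"
    proof -
      have "0 \<le> S (k (Suc j)) / real (k (Suc j))" using S0 by simp
      then show ?thesis using j1[of "Suc j"] j(2) by (simp add: abs_less_iff)
    qed
    have "real (k (Suc j)) \<le> \<alpha> * real n"
    proof -
      have "\<alpha> * \<alpha> ^ j \<le> \<alpha> * real n" using nj(1) \<alpha> by (intro mult_left_mono) auto
      then show ?thesis using kle[of "Suc j"] by simp
    qed
    then have "S n \<le> (\<mu> + e) * (\<alpha> * real n)" using up mult_left_mono[OF _ me] order_trans by blast
    then have A: "S n / real n \<le> \<alpha> * (\<mu> + e)" using npos by (simp add: pos_divide_le_eq mult_ac)
    have B: "(\<mu> - e) / (\<alpha> * \<alpha>) \<le> S n / real n"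
    proof (cases "\<mu> - e \<le> 0")
      case True
      then have "(\<mu> - e) / (\<alpha> * \<alpha>) \<le> 0" using \<alpha> by (simp add: divide_nonpos_pos)
      also have "0 \<le> S n / real n" using S0 by simp
      finally show ?thesis .
    next
      case False
      have "\<mu> - e \<le> S (k j) / real (k j)" using j1[of j] j(2) by (simp add: abs_less_iff)
      then have "(\<mu> - e) * real (k j) \<le> S (k j)" using k1[of j] by (simp add: pos_le_divide_eq)
      then have Sl: "(\<mu> - e) * real (k j) \<le> S n" using mono[OF kn] by linarith
      have "\<alpha> / (\<alpha> - 1) \<le> \<alpha> ^ j"
      proof -
        have "\<alpha> ^ j2 \<le> \<alpha> ^ j" by (rule power_increasing) (use j(2) \<alpha> in auto)
        then show ?thesis using j2 by linarith
      qed
      then have "\<alpha> \<le> \<alpha> ^ j * (\<alpha> - 1)" using \<alpha> by (simp add: pos_divide_le_eq)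
      then have "\<alpha> ^ j \<le> \<alpha> * (\<alpha> ^ j - 1)" by (simp add: algebra_simps)
      also have "\<dots> \<le> \<alpha> * real (k j)" using kgt[of j] \<alpha> by (intro mult_left_mono) auto
      finally have "\<alpha> * \<alpha> ^ j \<le> \<alpha> * (\<alpha> * real (k j))" using \<alpha> by (intro mult_left_mono) auto
      then have "real n \<le> \<alpha> * \<alpha> * real (k j)" using nj(2) by simp
      then have "(\<mu> - e) * real n \<le> (\<mu> - e) * (\<alpha> * \<alpha> * real (k j))"
        using False by (intro mult_left_mono) auto
      also have "\<dots> = (\<mu> - e) * real (k j) * (\<alpha> * \<alpha>)" by simp
      also have "\<dots> \<le> S n * (\<alpha> * \<alpha>)" using Sl \<alpha> by (intro mult_right_mono) auto
      finally have "(\<mu> - e) * real n \<le> S n * (\<alpha> * \<alpha>)" .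
      then show ?thesis using npos \<alpha> by (simp add: pos_le_divide_eq pos_divide_le_eq mult_ac)
    qed
    show "S n / real n \<le> \<alpha> * (\<mu> + e) \<and> (\<mu> - e) / (\<alpha> * \<alpha>) \<le> S n / real n" using A B by blast
  qed
qed

lemma geometric_subsequences_suffice:
  fixes S :: "nat \<Rightarrow> real"
  assumes mono: "\<And>m n. m \<le> n \<Longrightarrow> S m \<le> S n" and S0: "\<And>n. 0 \<le> S n"
    and lim: "\<And>q::nat. (\<lambda>j. S (nat \<lfloor>(1 + 1 / real (Suc q)) ^ j\<rfloor>) / real (nat \<lfloor>(1 + 1 / real (Suc q)) ^ j\<rfloor>)) \<longlonglongrightarrow> \<mu>"
  shows "(\<lambda>n. S n / real n) \<longlonglongrightarrow> \<mu>"
proof (rule order_tendstoI)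
  define \<alpha> where "\<alpha> = (\<lambda>q::nat. 1 + 1 / real (Suc q))"
  have \<alpha>: "1 < \<alpha> q" for q by (simp add: \<alpha>_def)
  have al: "\<alpha> \<longlonglongrightarrow> 1 + 0" unfolding \<alpha>_def by (intro tendsto_intros LIMSEQ_Suc[OF lim_const_over_n])
  have ev: "eventually (\<lambda>n. S n / real n \<le> \<alpha> q * (\<mu> + e) \<and> (\<mu> - e) / (\<alpha> q * \<alpha> q) \<le> S n / real n) sequentially"
    if "0 < e" for q e
    by (rule geometric_interpolation[OF mono S0 \<alpha>]) (use lim[of q] that in \<open>auto simp: \<alpha>_def\<close>)
  fix a assume "\<mu> < a"
  define e where "e = (a - \<mu>) / 2"
  have e: "0 < e" "\<mu> + e < a" using \<open>\<mu> < a\<close> by (auto simp: e_def field_simps)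
  have "(\<lambda>q. \<alpha> q * (\<mu> + e)) \<longlonglongrightarrow> (1 + 0) * (\<mu> + e)" by (intro tendsto_intros al)
  then have "eventually (\<lambda>q. \<alpha> q * (\<mu> + e) < a) sequentially" by (rule order_tendstoD) (use e in simp)
  then obtain q where q: "\<alpha> q * (\<mu> + e) < a" by (auto simp: eventually_sequentially)
  show "eventually (\<lambda>n. S n / real n < a) sequentially"
    using ev[OF e(1), of q] by eventually_elim (use q in linarith)
next
  define \<alpha> where "\<alpha> = (\<lambda>q::nat. 1 + 1 / real (Suc q))"
  have \<alpha>: "1 < \<alpha> q" for q by (simp add: \<alpha>_def)
  have al: "\<alpha> \<longlonglongrightarrow> 1 + 0" unfolding \<alpha>_def by (intro tendsto_intros LIMSEQ_Suc[OF lim_const_over_n])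
  have ev: "eventually (\<lambda>n. S n / real n \<le> \<alpha> q * (\<mu> + e) \<and> (\<mu> - e) / (\<alpha> q * \<alpha> q) \<le> S n / real n) sequentially"
    if "0 < e" for q e
    by (rule geometric_interpolation[OF mono S0 \<alpha>]) (use lim[of q] that in \<open>auto simp: \<alpha>_def\<close>)
  fix a assume "a < \<mu>"
  define e where "e = (\<mu> - a) / 2"
  have e: "0 < e" "a < \<mu> - e" using \<open>a < \<mu>\<close> by (auto simp: e_def field_simps)
  have "(\<lambda>q. (\<mu> - e) / (\<alpha> q * \<alpha> q)) \<longlonglongrightarrow> (\<mu> - e) / ((1 + 0) * (1 + 0))" by (intro tendsto_intros al) simp
  then have "eventually (\<lambda>q. a < (\<mu> - e) / (\<alpha> q * \<alpha> q)) sequentially" by (rule order_tendstoD) (use e in simp)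
  then obtain q where q: "a < (\<mu> - e) / (\<alpha> q * \<alpha> q)" by (auto simp: eventually_sequentially)
  show "eventually (\<lambda>n. a < S n / real n) sequentially"
    using ev[OF e(1), of q] by eventually_elim (use q in linarith)
qed

context prob_space
begin

text \<open>
  Etemadi's proof. Truncate the \<open>k\<close>-th variable at \<open>k + 1\<close>; the variances of the averages are
  summable along the times \<open>\<alpha>\<^sup>j\<close>, and monotonicity of the sums fills the gaps. Independence
  enters only through the uncorrelatedness of truncations, a condition that passes to limits.
\<close>

theorem strong_law_nonneg:
  fixes X :: "nat \<Rightarrow> 'a \<Rightarrow> real"
  assumes meas[measurable]: "\<And>k. X k \<in> borel_measurable M" and X0: "\<And>k \<omega>. 0 \<le> X k \<omega>"
    and int: "integrable M (X 0)" and ident: "\<And>k. distr M borel (X k) = distr M borel (X 0)"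
    and uncorr: "\<And>j k a b. j \<noteq> k \<Longrightarrow> 0 \<le> a \<Longrightarrow> 0 \<le> b \<Longrightarrow>
      expectation (\<lambda>\<omega>. min (X j \<omega>) a * min (X k \<omega>) b)
        = expectation (\<lambda>\<omega>. min (X j \<omega>) a) * expectation (\<lambda>\<omega>. min (X k \<omega>) b)"
  shows "AE \<omega> in M. (\<lambda>n. (\<Sum>k<n. X k \<omega>) / real n) \<longlonglongrightarrow> expectation (X 0)"
proof -
  define \<mu> where "\<mu> = expectation (X 0)"
  \<comment> \<open>The truncation at \<open>k + 1\<close>; by the first Borel-Cantelli lemma only finitely many variables are changed.\<close>
  define Y where "Y = (\<lambda>k \<omega>. min (X k \<omega>) (real (Suc k)))"
  define S where "S = (\<lambda>n \<omega>. \<Sum>k<n. Y k \<omega>)"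
  define v where "v = (\<lambda>a. expectation (\<lambda>\<omega>. (min (X 0 \<omega>) a)\<^sup>2))"
  have [measurable]: "Y k \<in> borel_measurable M" for k unfolding Y_def by measurable
  have [measurable]: "S n \<in> borel_measurable M" for n unfolding S_def by measurable
  have Yb: "0 \<le> Y k \<omega>" "Y k \<omega> \<le> real (Suc k)" for k \<omega> using X0 by (auto simp: Y_def)
  have ident_exp: "expectation (\<lambda>\<omega>. f (X k \<omega>)) = expectation (\<lambda>\<omega>. f (X 0 \<omega>))"
    if [measurable]: "f \<in> borel_measurable borel" for f :: "real \<Rightarrow> real" and k
  proof -
    have "expectation (\<lambda>\<omega>. f (X k \<omega>)) = integral\<^sup>L (distr M borel (X k)) f" by (subst integral_distr) auto
    also have "\<dots> = integral\<^sup>L (distr M borel (X 0)) f" unfolding ident[of k] ..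
    also have "\<dots> = expectation (\<lambda>\<omega>. f (X 0 \<omega>))" by (subst integral_distr) auto
    finally show ?thesis .
  qed
  have bint: "integrable M f" if "f \<in> borel_measurable M" "\<And>\<omega>. \<bar>f \<omega>\<bar> \<le> B" for f :: "'a \<Rightarrow> real" and B
    by (rule integrable_const_bound[of _ B]) (use that in auto)
  have Yint: "integrable M (Y k)" for k by (rule bint[of _ "real (Suc k)"]) (use Yb in auto)
  define Z where "Z = (\<lambda>k \<omega>. Y k \<omega> - expectation (Y k))"
  have [measurable]: "Z k \<in> borel_measurable M" for k unfolding Z_def by measurable
  have EY: "0 \<le> expectation (Y k)" "expectation (Y k) \<le> real (Suc k)" for k
  proof -
    show "0 \<le> expectation (Y k)" using Yb by (intro Bochner_Integration.integral_nonneg) auto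
    have "expectation (Y k) \<le> expectation (\<lambda>_. real (Suc k))" using Yb Yint by (intro integral_mono) auto
    then show "expectation (Y k) \<le> real (Suc k)" by (simp add: prob_space)
  qed
  have Zb: "\<bar>Z k \<omega>\<bar> \<le> real (Suc k)" for k \<omega> using Yb[of k \<omega>] EY[of k] by (simp add: Z_def abs_le_iff)
  have ZZint: "integrable M (\<lambda>\<omega>. Z j \<omega> * Z k \<omega>)" for j k
    by (rule bint[of _ "real (Suc j) * real (Suc k)"]) (auto simp: abs_mult simp del: of_nat_Suc intro!: mult_mono Zb)
  have YYint: "integrable M (\<lambda>\<omega>. Y j \<omega> * Y k \<omega>)" for j k
    by (rule bint[of _ "real (Suc j) * real (Suc k)"]) (use Yb in \<open>auto simp: abs_mult simp del: of_nat_Suc intro!: mult_mono\<close>)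
  have ZZ: "expectation (\<lambda>\<omega>. Z j \<omega> * Z k \<omega>) = (if j = k then expectation (\<lambda>\<omega>. (Z k \<omega>)\<^sup>2) else 0)" for j k
  proof (cases "j = k")
    case False
    have "(\<lambda>\<omega>. Z j \<omega> * Z k \<omega>) = (\<lambda>\<omega>. Y j \<omega> * Y k \<omega> - expectation (Y k) * Y j \<omega> - expectation (Y j) * Y k \<omega>
        + expectation (Y j) * expectation (Y k))"
      by (auto simp: Z_def algebra_simps)
    then have "expectation (\<lambda>\<omega>. Z j \<omega> * Z k \<omega>) = expectation (\<lambda>\<omega>. Y j \<omega> * Y k \<omega>) - expectation (Y j) * expectation (Y k)"
      using Yint YYint by (simp add: prob_space)
    also have "\<dots> = 0" unfolding Y_def using uncorr[OF False, of "real (Suc j)" "real (Suc k)"] by simp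
    finally show ?thesis using False by simp
  qed (simp add: power2_eq_square)
  have v_mono: "v a \<le> v b" if "0 \<le> a" "a \<le> b" for a b
    unfolding v_def
  proof (rule integral_mono)
    show "integrable M (\<lambda>\<omega>. (min (X 0 \<omega>) a)\<^sup>2)"
      by (rule bint[of _ "a\<^sup>2"]) (use that X0 in \<open>auto intro!: power_mono\<close>)
    show "integrable M (\<lambda>\<omega>. (min (X 0 \<omega>) b)\<^sup>2)"
      by (rule bint[of _ "b\<^sup>2"]) (use that X0 in \<open>auto intro!: power_mono\<close>)
    show "(min (X 0 \<omega>) a)\<^sup>2 \<le> (min (X 0 \<omega>) b)\<^sup>2" for \<omega>
      using that X0[of 0 \<omega>] by (intro power_mono) auto
  qed
  have v0: "0 \<le> v a" for a unfolding v_def by (intro Bochner_Integration.integral_nonneg) auto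
  have var: "expectation (\<lambda>\<omega>. (\<Sum>k<n. Z k \<omega>)\<^sup>2) \<le> real n * v (real n)" for n
  proof -
    have "expectation (\<lambda>\<omega>. (\<Sum>k<n. Z k \<omega>)\<^sup>2) = (\<Sum>j<n. \<Sum>k<n. expectation (\<lambda>\<omega>. Z j \<omega> * Z k \<omega>))"
      unfolding power2_eq_square sum_product using ZZint by (simp add: Bochner_Integration.integral_sum)
    also have "\<dots> = (\<Sum>j<n. expectation (\<lambda>\<omega>. (Z j \<omega>)\<^sup>2))"
      by (rule sum.cong[OF refl]) (simp add: ZZ)
    also have "\<dots> \<le> (\<Sum>j<n. v (real n))"
    proof (rule sum_mono)
      fix j assume j: "j \<in> {..<n}"
      have "(\<lambda>\<omega>. (Z j \<omega>)\<^sup>2) = (\<lambda>\<omega>. Y j \<omega> * Y j \<omega> - 2 * expectation (Y j) * Y j \<omega> + expectation (Y j) * expectation (Y j))"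
        by (auto simp: Z_def power2_eq_square algebra_simps)
      then have "expectation (\<lambda>\<omega>. (Z j \<omega>)\<^sup>2) = expectation (\<lambda>\<omega>. Y j \<omega> * Y j \<omega>) - expectation (Y j) * expectation (Y j)"
        using Yint YYint by (simp add: prob_space)
      also have "\<dots> \<le> expectation (\<lambda>\<omega>. Y j \<omega> * Y j \<omega>)" by simp
      also have "\<dots> = v (real (Suc j))"
        unfolding v_def Y_def power2_eq_square
        by (rule ident_exp[of "\<lambda>x. min x (real (Suc j)) * min x (real (Suc j))"]) measurable
      also have "\<dots> \<le> v (real n)" using j by (intro v_mono) auto
      finally show "expectation (\<lambda>\<omega>. (Z j \<omega>)\<^sup>2) \<le> v (real n)" .
    qed
    finally show ?thesis by simp
  qed
  have mean: "(\<lambda>n. expectation (S n) / real n) \<longlonglongrightarrow> \<mu>"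
  proof -
    have "(\<lambda>k. expectation (\<lambda>\<omega>. min (X 0 \<omega>) (real (Suc k)))) \<longlonglongrightarrow> \<mu>"
      unfolding \<mu>_def
    proof (rule integral_dominated_convergence[where w = "X 0"])
      show "AE \<omega> in M. (\<lambda>k. min (X 0 \<omega>) (real (Suc k))) \<longlonglongrightarrow> X 0 \<omega>"
      proof (rule AE_I2)
        fix \<omega>
        obtain N :: nat where "X 0 \<omega> < real N" using reals_Archimedean2 by blast
        then have "eventually (\<lambda>k. min (X 0 \<omega>) (real (Suc k)) = X 0 \<omega>) sequentially"
          by (intro eventually_sequentiallyI[of N]) (auto simp: min_def)
        then show "(\<lambda>k. min (X 0 \<omega>) (real (Suc k))) \<longlonglongrightarrow> X 0 \<omega>" by (rule tendsto_eventually)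
      qed
      show "AE \<omega> in M. norm (min (X 0 \<omega>) (real (Suc k))) \<le> X 0 \<omega>" for k
        using X0[of 0] by (auto simp: min_def)
    qed (use int in auto)
    moreover have "expectation (Y k) = expectation (\<lambda>\<omega>. min (X 0 \<omega>) (real (Suc k)))" for k
      unfolding Y_def by (rule ident_exp[of "\<lambda>x. min x (real (Suc k))"]) measurable
    ultimately have "(\<lambda>k. expectation (Y k)) \<longlonglongrightarrow> \<mu>" by simp
    then have "(\<lambda>n. (\<Sum>k<n. expectation (Y k)) / real n) \<longlonglongrightarrow> \<mu>" by (rule cesaro_mean)
    moreover have "expectation (S n) = (\<Sum>k<n. expectation (Y k))" for n
      unfolding S_def using Yint by (simp add: Bochner_Integration.integral_sum)
    ultimately show ?thesis by simp
  qed
  have sub: "AE \<omega> in M. (\<lambda>j. S (nat \<lfloor>(1 + 1 / real (Suc q)) ^ j\<rfloor>) \<omega> / real (nat \<lfloor>(1 + 1 / real (Suc q)) ^ j\<rfloor>)) \<longlonglongrightarrow> \<mu>" for q :: nat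
  proof -
    define \<alpha> where "\<alpha> = 1 + 1 / real (Suc q)"
    have \<alpha>: "1 < \<alpha>" by (simp add: \<alpha>_def)
    define k where "k = (\<lambda>j. nat \<lfloor>\<alpha> ^ j\<rfloor>)"
    have p1: "1 \<le> \<alpha> ^ j" for j using \<alpha> by simp
    have kle: "real (k j) \<le> \<alpha> ^ j" and kgt: "\<alpha> ^ j < real (k j) + 1" and k1: "1 \<le> real (k j)" for j
    proof -
      have r: "real (k j) = of_int \<lfloor>\<alpha> ^ j\<rfloor>" using p1[of j] by (simp add: k_def)
      show "real (k j) \<le> \<alpha> ^ j" unfolding r by (rule of_int_floor_le)
      show 1: "\<alpha> ^ j < real (k j) + 1" unfolding r by (rule floor_correct[THEN conjunct2, simplified])
      show "1 \<le> real (k j)" using 1 p1[of j] by (cases "k j") auto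
    qed
    define W where "W = (\<lambda>j \<omega>. ((\<Sum>i<k j. Z i \<omega>) / real (k j))\<^sup>2)"
    have [measurable]: "W j \<in> borel_measurable M" for j unfolding W_def by measurable
    have W0: "0 \<le> W j \<omega>" for j \<omega> by (simp add: W_def)
    have Wint: "integrable M (W j)" for j
      unfolding W_def power_divide power2_eq_square[of "sum _ _"] sum_product using ZZint by simp
    have EW: "expectation (W j) \<le> 2 * expectation (\<lambda>\<omega>. (min (X 0 \<omega>) (\<alpha> ^ j))\<^sup>2 / \<alpha> ^ j)" for j
    proof -
      have "expectation (W j) = expectation (\<lambda>\<omega>. (\<Sum>i<k j. Z i \<omega>)\<^sup>2) / (real (k j))\<^sup>2"
        unfolding W_def power_divide by simp
      also have "\<dots> \<le> real (k j) * v (real (k j)) / (real (k j))\<^sup>2"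
        by (intro divide_right_mono var) simp
      also have "\<dots> = v (real (k j)) / real (k j)" using k1[of j] by (simp add: power2_eq_square)
      also have "\<dots> \<le> v (\<alpha> ^ j) / real (k j)" using k1[of j] kle[of j] by (intro divide_right_mono v_mono) auto
      also have "\<dots> \<le> v (\<alpha> ^ j) / (\<alpha> ^ j / 2)"
      proof (rule divide_left_mono[OF _ v0])
        show "\<alpha> ^ j / 2 \<le> real (k j)" using k1[of j] kgt[of j] by linarith
        show "0 < real (k j) * (\<alpha> ^ j / 2)" using k1[of j] p1[of j] by (intro mult_pos_pos) linarith+
      qed
      also have "\<dots> = 2 * expectation (\<lambda>\<omega>. (min (X 0 \<omega>) (\<alpha> ^ j))\<^sup>2 / \<alpha> ^ j)" by (simp add: v_def)
      finally show ?thesis .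
    qed
    have "(\<integral>\<^sup>+\<omega>. (\<Sum>j. ennreal (W j \<omega>)) \<partial>M) = (\<Sum>j. \<integral>\<^sup>+\<omega>. ennreal (W j \<omega>) \<partial>M)"
      by (rule nn_integral_suminf) measurable
    also have "\<dots> = (\<Sum>j. ennreal (expectation (W j)))"
      using Wint W0 by (intro suminf_cong nn_integral_eq_integral) auto
    also have "\<dots> \<le> (\<Sum>j. \<integral>\<^sup>+\<omega>. 2 * ennreal ((min (X 0 \<omega>) (\<alpha> ^ j))\<^sup>2 / \<alpha> ^ j) \<partial>M)"
    proof (intro suminf_le)
      fix j
      have i: "integrable M (\<lambda>\<omega>. (min (X 0 \<omega>) (\<alpha> ^ j))\<^sup>2 / \<alpha> ^ j)"
        using X0 p1[of j] by (intro bint[of _ "(\<alpha> ^ j)\<^sup>2 / \<alpha> ^ j"]) (auto intro!: divide_right_mono power_mono)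
      have "ennreal (expectation (W j)) \<le> ennreal (2 * expectation (\<lambda>\<omega>. (min (X 0 \<omega>) (\<alpha> ^ j))\<^sup>2 / \<alpha> ^ j))"
        by (rule ennreal_leI[OF EW])
      also have "\<dots> = 2 * (\<integral>\<^sup>+\<omega>. ennreal ((min (X 0 \<omega>) (\<alpha> ^ j))\<^sup>2 / \<alpha> ^ j) \<partial>M)"
        using i p1[of j] \<alpha> ennreal_mult'[of 2 "expectation (\<lambda>\<omega>. (min (X 0 \<omega>) (\<alpha> ^ j))\<^sup>2 / \<alpha> ^ j)"]
        by (subst nn_integral_eq_integral) auto
      also have "\<dots> = (\<integral>\<^sup>+\<omega>. 2 * ennreal ((min (X 0 \<omega>) (\<alpha> ^ j))\<^sup>2 / \<alpha> ^ j) \<partial>M)"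
        by (subst nn_integral_cmult) auto
      finally show "ennreal (expectation (W j)) \<le> (\<integral>\<^sup>+\<omega>. 2 * ennreal ((min (X 0 \<omega>) (\<alpha> ^ j))\<^sup>2 / \<alpha> ^ j) \<partial>M)" .
    qed auto
    also have "\<dots> = (\<integral>\<^sup>+\<omega>. 2 * (\<Sum>j. ennreal ((min (X 0 \<omega>) (\<alpha> ^ j))\<^sup>2 / \<alpha> ^ j)) \<partial>M)"
      by (subst nn_integral_suminf[symmetric]) (auto simp: ennreal_suminf_cmult)
    also have "\<dots> \<le> (\<integral>\<^sup>+\<omega>. 2 * ennreal (2 * \<alpha> / (\<alpha> - 1) * X 0 \<omega>) \<partial>M)"
      by (intro nn_integral_mono mult_left_mono truncated_squares_sum \<alpha> X0) simp
    also have "\<dots> = (\<integral>\<^sup>+\<omega>. ennreal (2 * (2 * \<alpha> / (\<alpha> - 1) * X 0 \<omega>)) \<partial>M)"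
    proof (rule nn_integral_cong)
      fix \<omega>
      show "2 * ennreal (2 * \<alpha> / (\<alpha> - 1) * X 0 \<omega>) = ennreal (2 * (2 * \<alpha> / (\<alpha> - 1) * X 0 \<omega>))"
        using ennreal_mult'[of 2 "2 * \<alpha> / (\<alpha> - 1) * X 0 \<omega>"] by simp
    qed
    also have "\<dots> < \<infinity>"
      using int X0 \<alpha> by (subst nn_integral_eq_integral) auto
    finally have "AE \<omega> in M. (\<Sum>j. ennreal (W j \<omega>)) \<noteq> \<infinity>"
      by (intro nn_integral_PInf_AE) auto
    then show ?thesis
    proof eventually_elim
      case (elim \<omega>)
      have "summable (\<lambda>j. W j \<omega>)" using elim W0 by (intro summable_suminf_not_top) auto
      then have "(\<lambda>j. sqrt (W j \<omega>)) \<longlonglongrightarrow> sqrt 0" by (intro tendsto_real_sqrt summable_LIMSEQ_zero)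
      then have "(\<lambda>j. \<bar>(\<Sum>i<k j. Z i \<omega>) / real (k j)\<bar>) \<longlonglongrightarrow> 0" by (simp add: W_def)
      then have z: "(\<lambda>j. (\<Sum>i<k j. Z i \<omega>) / real (k j)) \<longlonglongrightarrow> 0" by (rule tendsto_rabs_zero_cancel)
      have kt: "filterlim k at_top sequentially"
        unfolding filterlim_at_top
      proof
        fix Z :: nat
        obtain j0 where j0: "real Z + 1 < \<alpha> ^ j0" using real_arch_pow[OF \<alpha>] by blast
        show "eventually (\<lambda>j. Z \<le> k j) sequentially"
        proof (rule eventually_sequentiallyI[of j0])
          fix j assume "j0 \<le> j"
          then have "\<alpha> ^ j0 \<le> \<alpha> ^ j" by (rule power_increasing) (use \<alpha> in simp)
          then have "real Z < real (k j)" using j0 kgt[of j] by linarith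
          then show "Z \<le> k j" by simp
        qed
      qed
      have m: "(\<lambda>j. expectation (S (k j)) / real (k j)) \<longlonglongrightarrow> \<mu>" by (rule filterlim_compose[OF mean kt])
      have "(\<Sum>i<n. Z i \<omega>) / real n + expectation (S n) / real n = S n \<omega> / real n" for n
      proof -
        have "expectation (S n) = (\<Sum>k<n. expectation (Y k))"
          unfolding S_def using Yint by (simp add: Bochner_Integration.integral_sum)
        then show ?thesis by (simp add: Z_def S_def sum_subtractf add_divide_distrib[symmetric])
      qed
      then have "(\<lambda>j. S (k j) \<omega> / real (k j)) \<longlonglongrightarrow> 0 + \<mu>" using tendsto_add[OF z m] by simp
      then show ?case by (simp add: k_def \<alpha>_def)
    qed
  qed
  have "AE \<omega> in M. \<forall>q. (\<lambda>j. S (nat \<lfloor>(1 + 1 / real (Suc q)) ^ j\<rfloor>) \<omega> / real (nat \<lfloor>(1 + 1 / real (Suc q)) ^ j\<rfloor>)) \<longlonglongrightarrow> \<mu>"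
    unfolding AE_all_countable using sub by blast
  then have main: "AE \<omega> in M. (\<lambda>n. S n \<omega> / real n) \<longlonglongrightarrow> \<mu>"
  proof eventually_elim
    case (elim \<omega>)
    show ?case
    proof (rule geometric_subsequences_suffice)
      show "S m \<omega> \<le> S n \<omega>" if "m \<le> n" for m n unfolding S_def using that Yb by (intro sum_mono2) auto
      show "0 \<le> S n \<omega>" for n unfolding S_def using Yb by (intro sum_nonneg) auto
    qed (use elim in blast)
  qed
  have "AE \<omega> in M. eventually (\<lambda>k. \<omega> \<in> space M - {\<omega> \<in> space M. real (Suc k) < X k \<omega>}) sequentially"
  proof (rule borel_cantelli_AE1)
    show "emeasure M {\<omega> \<in> space M. real (Suc k) < X k \<omega>} < \<infinity>" for k by (simp add: emeasure_eq_measure)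
    have eqm: "emeasure M {\<omega> \<in> space M. real (Suc k) < X k \<omega>} = emeasure M {\<omega> \<in> space M. real (Suc k) < X 0 \<omega>}" for k
    proof -
      have "emeasure M {\<omega> \<in> space M. real (Suc k) < X k \<omega>} = emeasure (distr M borel (X k)) {real (Suc k)<..}"
        by (subst emeasure_distr) (auto intro!: arg_cong[where f = "emeasure M"])
      also have "\<dots> = emeasure (distr M borel (X 0)) {real (Suc k)<..}" unfolding ident[of k] ..
      also have "\<dots> = emeasure M {\<omega> \<in> space M. real (Suc k) < X 0 \<omega>}"
        by (subst emeasure_distr) (auto intro!: arg_cong[where f = "emeasure M"])
      finally show ?thesis .
    qed
    have sets_Collect_X: "{\<omega> \<in> space M. real (Suc k) < X 0 \<omega>} \<in> sets M" for k by measurable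
    have count: "(\<Sum>k<n. indicator {\<omega> \<in> space M. real (Suc k) < X 0 \<omega>} \<omega>) \<le> min (real n) (X 0 \<omega>)" for n \<omega>
    proof (induction n)
      case (Suc n)
      then show ?case by (auto simp: indicator_def min_def split: if_splits)
    qed (simp add: X0)
    have "(\<Sum>k. ennreal (measure M {\<omega> \<in> space M. real (Suc k) < X k \<omega>}))
        = (\<Sum>k. \<integral>\<^sup>+\<omega>. indicator {\<omega> \<in> space M. real (Suc k) < X 0 \<omega>} \<omega> \<partial>M)"
      by (simp only: emeasure_eq_measure[symmetric] eqm nn_integral_indicator sets_Collect_X)
    also have "\<dots> = (\<integral>\<^sup>+\<omega>. (\<Sum>k. indicator {\<omega> \<in> space M. real (Suc k) < X 0 \<omega>} \<omega>) \<partial>M)"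
      by (rule nn_integral_suminf[symmetric]) measurable
    also have "\<dots> \<le> (\<integral>\<^sup>+\<omega>. ennreal (X 0 \<omega>) \<partial>M)"
    proof (rule nn_integral_mono, rule suminf_le_const)
      fix \<omega> n
      have "(\<Sum>k<n. indicator {\<omega> \<in> space M. real (Suc k) < X 0 \<omega>} \<omega>) = ennreal (\<Sum>k<n. indicator {\<omega> \<in> space M. real (Suc k) < X 0 \<omega>} \<omega>)"
        by (subst sum_ennreal[symmetric]) (auto simp: ennreal_indicator)
      also have "\<dots> \<le> ennreal (X 0 \<omega>)" by (intro ennreal_leI order_trans[OF count min.cobounded2])
      finally show "(\<Sum>k<n. indicator {\<omega> \<in> space M. real (Suc k) < X 0 \<omega>} \<omega>) \<le> ennreal (X 0 \<omega>)" .
    qed simp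
    also have "\<dots> < \<infinity>" using int X0 by (subst nn_integral_eq_integral) auto
    finally show "summable (\<lambda>k. measure M {\<omega> \<in> space M. real (Suc k) < X k \<omega>})"
      by (intro summable_suminf_not_top) auto
  qed measurable
  then show ?thesis
    using main AE_space
  proof eventually_elim
    case (elim \<omega>)
    then obtain N where N0: "\<And>k. k \<ge> N \<Longrightarrow> \<not> real (Suc k) < X k \<omega>"
      by (auto simp: eventually_sequentially simp del: of_nat_Suc)
    have N: "Y k \<omega> = X k \<omega>" if "k \<ge> N" for k using N0[OF that] by (simp add: Y_def min_def)
    define C where "C = (\<Sum>k<N. X k \<omega> - Y k \<omega>)"
    have "(\<Sum>k<n. X k \<omega>) = S n \<omega> + C" if "N \<le> n" for n
      using that
    proof (induction n rule: dec_induct)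
      case base
      show ?case by (simp add: C_def S_def sum_subtractf)
    next
      case (step n)
      then show ?case using N[of n] by (simp add: S_def)
    qed
    then have ev: "eventually (\<lambda>n. S n \<omega> / real n + C / real n = (\<Sum>k<n. X k \<omega>) / real n) sequentially"
      by (intro eventually_sequentiallyI[of N]) (simp add: add_divide_distrib)
    have "(\<lambda>n. S n \<omega> / real n + C / real n) \<longlonglongrightarrow> \<mu> + 0"
      using elim(2) by (intro tendsto_add lim_const_over_n)
    from Lim_transform_eventually[OF this ev] show ?case by (simp add: \<mu>_def)
  qed
qed

end

section \<open>The strong law for increasing limits\<close>

lemma free_energy_cong:
  assumes "\<And>i. i < n \<Longrightarrow> d i = d' i"
  shows "free_energy \<delta> r n d = free_energy \<delta> r n d'"
proof -
  have "climb a r d n = climb a r d' n" "climb a r (\<lambda>k. - d k) n = climb a r (\<lambda>k. - d' k) n" for a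
    by (auto intro!: climb_cong assms)
  then show ?thesis by (simp add: free_energy_def)
qed

lemma borel_ennreal_atMost: "(borel :: ennreal measure) = sigma UNIV (range atMost)"
proof (rule borel_eq_sigmaI1[OF borel_Ioi])
  show "X \<in> sets (sigma UNIV (range atMost))" if Xr: "X \<in> range greaterThan" for X :: "ennreal set"
  proof -
    obtain x where X: "X = {x<..}" using Xr by blast
    have "space (sigma UNIV (range (atMost :: ennreal \<Rightarrow> _))) - {..x} \<in> sets (sigma UNIV (range atMost))"
      by (rule sets.compl_sets) auto
    moreover have "space (sigma UNIV (range (atMost :: ennreal \<Rightarrow> _))) - {..x} = X" unfolding X by auto
    ultimately show ?thesis by simp
  qed
qed auto

context prob_space
begin

text \<open>
  For an increasing sequence \<open>{SUP \<le> x}\<close> is a decreasing intersection, so the distribution function of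
  the supremum is determined by the others.
\<close>

lemma distr_SUP_eq:
  fixes F G :: "nat \<Rightarrow> 'a \<Rightarrow> ennreal"
  assumes [measurable]: "\<And>n. F n \<in> borel_measurable M" "\<And>n. G n \<in> borel_measurable M"
    and mono: "\<And>n \<omega>. F n \<omega> \<le> F (Suc n) \<omega>" "\<And>n \<omega>. G n \<omega> \<le> G (Suc n) \<omega>"
    and eq: "\<And>n. distr M borel (F n) = distr M borel (G n)"
  shows "distr M borel (\<lambda>\<omega>. SUP n. F n \<omega>) = distr M borel (\<lambda>\<omega>. SUP n. G n \<omega>)"
proof (rule measure_eqI_generator_eq[where E = "range (atMost :: ennreal \<Rightarrow> _)" and A = "\<lambda>_. {..top}" and \<Omega> = UNIV])
  have lim: "emeasure (distr M borel (\<lambda>\<omega>. SUP n. H n \<omega>)) {..x} = (INF n. emeasure (distr M borel (H n)) {..x})"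
    if [measurable]: "\<And>n. H n \<in> borel_measurable M" and inc: "\<And>n \<omega>. H n \<omega> \<le> H (Suc n) \<omega>"
    for H :: "nat \<Rightarrow> 'a \<Rightarrow> ennreal" and x
  proof -
    have "emeasure (distr M borel (\<lambda>\<omega>. SUP n. H n \<omega>)) {..x} = emeasure M (\<Inter>n. {\<omega>\<in>space M. H n \<omega> \<le> x})"
      by (subst emeasure_distr) (auto intro!: arg_cong[where f = "emeasure M"] simp: SUP_le_iff)
    also have "\<dots> = (INF n. emeasure M {\<omega>\<in>space M. H n \<omega> \<le> x})"
    proof (rule INF_emeasure_decseq[symmetric])
      show "decseq (\<lambda>n. {\<omega>\<in>space M. H n \<omega> \<le> x})"
        by (rule decseq_SucI) (use inc in \<open>blast intro: order_trans\<close>)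
    qed (auto simp: emeasure_eq_measure)
    also have "\<dots> = (INF n. emeasure (distr M borel (H n)) {..x})"
      by (intro INF_cong refl, subst emeasure_distr) (auto intro!: arg_cong[where f = "emeasure M"])
    finally show ?thesis .
  qed
  show "emeasure (distr M borel (\<lambda>\<omega>. SUP n. F n \<omega>)) X = emeasure (distr M borel (\<lambda>\<omega>. SUP n. G n \<omega>)) X"
    if Xr: "X \<in> range atMost" for X :: "ennreal set"
  proof -
    obtain x where X: "X = {..x}" using Xr by auto
    show ?thesis unfolding X lim[of F, OF assms(1) mono(1)] lim[of G, OF assms(2) mono(2)] eq ..
  qed
  show "emeasure (distr M borel (\<lambda>\<omega>. SUP n. F n \<omega>)) {..top} \<noteq> \<infinity>" for i :: nat
    by (subst emeasure_distr) (auto simp: emeasure_eq_measure)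
  show "Int_stable (range (atMost :: ennreal \<Rightarrow> _))" by (auto simp: Int_stable_def)
  show "(\<Union>i::nat. {..top::ennreal}) = UNIV" by auto
  show "sets (distr M borel (\<lambda>\<omega>. SUP n. F n \<omega>)) = sigma_sets UNIV (range atMost)"
    "sets (distr M borel (\<lambda>\<omega>. SUP n. G n \<omega>)) = sigma_sets UNIV (range atMost)"
    by (simp_all only: sets_distr borel_ennreal_atMost sets_measure_of subset_UNIV subset_Pow_Union Pow_UNIV)
qed auto

text \<open>
  The hypotheses of \<open>strong_law_nonneg\<close> pass to the suprema: the moments by monotone, the truncated
  correlations by dominated convergence.
\<close>

theorem strong_law_SUP:
  fixes F :: "nat \<Rightarrow> nat \<Rightarrow> 'a \<Rightarrow> ennreal"
  assumes meas[measurable]: "\<And>N k. F N k \<in> borel_measurable M"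
    and mono: "\<And>N k \<omega>. F N k \<omega> \<le> F (Suc N) k \<omega>"
    and ident: "\<And>N k. distr M borel (F N k) = distr M borel (F N 0)"
    and bound: "\<And>N. (\<integral>\<^sup>+\<omega>. F N 0 \<omega> \<partial>M) \<le> ennreal c"
    and uncorr: "\<And>N j k a b. j \<noteq> k \<Longrightarrow> 0 \<le> a \<Longrightarrow> 0 \<le> b \<Longrightarrow>
      expectation (\<lambda>\<omega>. min (enn2real (F N j \<omega>)) a * min (enn2real (F N k \<omega>)) b)
        = expectation (\<lambda>\<omega>. min (enn2real (F N j \<omega>)) a) * expectation (\<lambda>\<omega>. min (enn2real (F N k \<omega>)) b)"
  shows "AE \<omega> in M. \<forall>k. (SUP N. F N k \<omega>) < \<infinity>"
    and "AE \<omega> in M. (\<lambda>n. (\<Sum>k<n. enn2real (SUP N. F N k \<omega>)) / real n) \<longlonglongrightarrow> enn2real (SUP N. \<integral>\<^sup>+\<omega>. F N 0 \<omega> \<partial>M)"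
proof -
  define G where "G = (\<lambda>k \<omega>. SUP N. F N k \<omega>)"
  have [measurable]: "G k \<in> borel_measurable M" for k unfolding G_def by measurable
  have inc: "incseq (\<lambda>N. F N k \<omega>)" for k \<omega> by (rule incseq_SucI) (rule mono)
  have dG: "distr M borel (G k) = distr M borel (G 0)" for k
    unfolding G_def by (rule distr_SUP_eq) (use mono ident[of _ k] in auto)
  have EG: "(\<integral>\<^sup>+\<omega>. G k \<omega> \<partial>M) = (SUP N. \<integral>\<^sup>+\<omega>. F N 0 \<omega> \<partial>M)" for k
  proof -
    have "(\<integral>\<^sup>+\<omega>. G k \<omega> \<partial>M) = (\<integral>\<^sup>+x. x \<partial>distr M borel (G k))" by (subst nn_integral_distr) auto
    also have "\<dots> = (\<integral>\<^sup>+\<omega>. G 0 \<omega> \<partial>M)" unfolding dG[of k] by (subst nn_integral_distr) auto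
    also have "\<dots> = (SUP N. \<integral>\<^sup>+\<omega>. F N 0 \<omega> \<partial>M)"
      unfolding G_def by (rule nn_integral_monotone_convergence_SUP) (auto intro!: incseq_SucI le_funI mono)
    finally show ?thesis .
  qed
  have EG_le: "(\<integral>\<^sup>+\<omega>. G k \<omega> \<partial>M) \<le> ennreal c" for k unfolding EG[of k] by (rule SUP_least) (rule bound)
  have fin1: "AE \<omega> in M. G k \<omega> \<noteq> \<infinity>" for k
    by (rule nn_integral_PInf_AE) (use EG_le[of k] in \<open>auto simp: top_unique\<close>)
  then have fin: "AE \<omega> in M. \<forall>k. G k \<omega> \<noteq> \<infinity>" by (simp only: AE_all_countable) blast
  then show "AE \<omega> in M. \<forall>k. (SUP N. F N k \<omega>) < \<infinity>"
    by (simp only: G_def less_top infinity_ennreal_def)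
  define X where "X = (\<lambda>k \<omega>. enn2real (G k \<omega>))"
  have [measurable]: "X k \<in> borel_measurable M" for k unfolding X_def by measurable
  have lim: "AE \<omega> in M. (\<lambda>N. min (enn2real (F N k \<omega>)) a) \<longlonglongrightarrow> min (X k \<omega>) a" for k a
    using fin1[of k]
  proof eventually_elim
    case (elim \<omega>)
    have "(\<lambda>N. F N k \<omega>) \<longlonglongrightarrow> G k \<omega>" unfolding G_def by (rule LIMSEQ_SUP[OF inc])
    also have "G k \<omega> = ennreal (enn2real (G k \<omega>))" using elim by (simp add: less_top)
    finally have "(\<lambda>N. enn2real (F N k \<omega>)) \<longlonglongrightarrow> X k \<omega>" unfolding X_def
      by (rule tendsto_enn2real) simp
    then show ?case by (intro tendsto_min tendsto_const)
  qed
  have conv1: "(\<lambda>N. expectation (\<lambda>\<omega>. min (enn2real (F N k \<omega>)) a)) \<longlonglongrightarrow> expectation (\<lambda>\<omega>. min (X k \<omega>) a)"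
    if "0 \<le> a" for k a
    by (rule integral_dominated_convergence[where w = "\<lambda>_. a", OF _ _ _ lim]) (use that in \<open>auto simp: min_def\<close>)
  have conv2: "(\<lambda>N. expectation (\<lambda>\<omega>. min (enn2real (F N j \<omega>)) a * min (enn2real (F N k \<omega>)) b))
      \<longlonglongrightarrow> expectation (\<lambda>\<omega>. min (X j \<omega>) a * min (X k \<omega>) b)" if "0 \<le> a" "0 \<le> b" for j k a b
  proof (rule integral_dominated_convergence[where w = "\<lambda>_. a * b"])
    show "AE \<omega> in M. (\<lambda>N. min (enn2real (F N j \<omega>)) a * min (enn2real (F N k \<omega>)) b) \<longlonglongrightarrow> min (X j \<omega>) a * min (X k \<omega>) b"
      using lim[of j a] lim[of k b] by eventually_elim (rule tendsto_mult)
    show "AE \<omega> in M. norm (min (enn2real (F N j \<omega>)) a * min (enn2real (F N k \<omega>)) b) \<le> a * b" for N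
      using that by (intro AE_I2) (auto simp: abs_mult intro!: mult_mono)
  qed auto
  have int: "integrable M (X 0)" unfolding X_def
  proof (rule integrableI_bounded)
    have "(\<integral>\<^sup>+\<omega>. ennreal (norm (enn2real (G 0 \<omega>))) \<partial>M) = (\<integral>\<^sup>+\<omega>. G 0 \<omega> \<partial>M)"
      by (rule nn_integral_cong_AE) (use fin1[of 0] in \<open>eventually_elim, simp add: less_top\<close>)
    then show "(\<integral>\<^sup>+\<omega>. ennreal (norm (enn2real (G 0 \<omega>))) \<partial>M) < \<infinity>"
      using EG_le[of 0] by (simp add: order.strict_trans1)
  qed simp
  have "AE \<omega> in M. (\<lambda>n. (\<Sum>k<n. X k \<omega>) / real n) \<longlonglongrightarrow> expectation (X 0)"
  proof (rule strong_law_nonneg[where X = X])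
    show "integrable M (X 0)" by (rule int)
    show "distr M borel (X k) = distr M borel (X 0)" for k
    proof -
      have "distr M borel (X k) = distr (distr M borel (G k)) borel enn2real"
        by (subst distr_distr) (auto simp: X_def comp_def)
      also have "\<dots> = distr M borel (X 0)" unfolding dG[of k]
        by (subst distr_distr) (auto simp: X_def comp_def)
      finally show ?thesis .
    qed
    show "expectation (\<lambda>\<omega>. min (X j \<omega>) a * min (X k \<omega>) b)
        = expectation (\<lambda>\<omega>. min (X j \<omega>) a) * expectation (\<lambda>\<omega>. min (X k \<omega>) b)"
      if "j \<noteq> k" "0 \<le> a" "0 \<le> b" for j k a b
    proof (rule LIMSEQ_unique[OF conv2[OF that(2,3)]])
      show "(\<lambda>N. expectation (\<lambda>\<omega>. min (enn2real (F N j \<omega>)) a * min (enn2real (F N k \<omega>)) b))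
          \<longlonglongrightarrow> expectation (\<lambda>\<omega>. min (X j \<omega>) a) * expectation (\<lambda>\<omega>. min (X k \<omega>) b)"
        unfolding uncorr[OF that] by (intro tendsto_mult conv1 that)
    qed
  qed (auto simp: X_def)
  moreover have "expectation (X 0) = enn2real (SUP N. \<integral>\<^sup>+\<omega>. F N 0 \<omega> \<partial>M)"
  proof -
    have "expectation (X 0) = enn2real (\<integral>\<^sup>+\<omega>. ennreal (X 0 \<omega>) \<partial>M)"
      by (rule integral_eq_nn_integral) (auto simp: X_def)
    also have "(\<integral>\<^sup>+\<omega>. ennreal (X 0 \<omega>) \<partial>M) = (\<integral>\<^sup>+\<omega>. G 0 \<omega> \<partial>M)"
      by (rule nn_integral_cong_AE) (use fin1[of 0] in \<open>eventually_elim, simp add: X_def less_top\<close>)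
    finally show ?thesis unfolding EG .
  qed
  ultimately show "AE \<omega> in M. (\<lambda>n. (\<Sum>k<n. enn2real (SUP N. F N k \<omega>)) / real n) \<longlonglongrightarrow> enn2real (SUP N. \<integral>\<^sup>+\<omega>. F N 0 \<omega> \<partial>M)"
    by (simp add: X_def G_def)
qed

end

section \<open>Free energies of the blocks of a Wiener process\<close>

context wiener_process
begin

lemma grid_steps_measurable:
  "0 \<le> s \<Longrightarrow> 0 < \<delta> \<Longrightarrow> (\<lambda>\<omega>. steps (\<lambda>i. W (s + real i * \<delta>) \<omega>) k) \<in> borel_measurable M"
  unfolding steps_def by (intro borel_measurable_diff W_measurable) auto

lemma grid_steps_indep:
  assumes s: "0 \<le> s" and \<delta>: "0 < \<delta>"
  shows "indep_vars (\<lambda>_. borel) (\<lambda>k \<omega>. steps (\<lambda>i. W (s + real i * \<delta>) \<omega>) k) {..<n}"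
  unfolding steps_def
  by (rule W_indep[where \<tau> = "\<lambda>i. s + real i * \<delta>"]) (use s \<delta> in auto)

lemma grid_steps_distr:
  assumes s: "0 \<le> s" and \<delta>: "0 < \<delta>" and n: "0 < n"
  shows "distr M (PiM {..<n} (\<lambda>_. borel)) (\<lambda>\<omega>. \<lambda>k\<in>{..<n}. steps (\<lambda>i. W (s + real i * \<delta>) \<omega>) k) = gwalk \<delta> n"
proof -
  have d: "distr M borel (\<lambda>\<omega>. steps (\<lambda>i. W (s + real i * \<delta>) \<omega>) k) = gstep \<delta>" for k
  proof -
    have "distributed M lborel (\<lambda>\<omega>. W (s + real (Suc k) * \<delta>) \<omega> - W (s + real k * \<delta>) \<omega>)
        (\<lambda>x. ennreal (normal_density 0 (sqrt (s + real (Suc k) * \<delta> - (s + real k * \<delta>))) x))"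
      by (rule W_increment) (use s \<delta> in \<open>auto simp: algebra_simps\<close>)
    moreover have "s + real (Suc k) * \<delta> - (s + real k * \<delta>) = \<delta>" by (simp add: algebra_simps)
    ultimately have "distr M lborel (\<lambda>\<omega>. W (s + real (Suc k) * \<delta>) \<omega> - W (s + real k * \<delta>) \<omega>) = gstep \<delta>"
      unfolding gstep_def by (simp add: distributed_distr_eq_density)
    moreover have "distr M borel f = distr M lborel f" for f :: "'a \<Rightarrow> real" by (rule distr_cong) auto
    ultimately show ?thesis by (simp only: steps_def)
  qed
  have "distr M (PiM {..<n} (\<lambda>_. borel)) (\<lambda>\<omega>. \<lambda>k\<in>{..<n}. steps (\<lambda>i. W (s + real i * \<delta>) \<omega>) k)
      = PiM {..<n} (\<lambda>k. distr M borel (\<lambda>\<omega>. steps (\<lambda>i. W (s + real i * \<delta>) \<omega>) k))"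
    using n by (intro indep_vars_iff_distr_eq_PiM[THEN iffD1] grid_steps_indep grid_steps_measurable s \<delta>) auto
  then show ?thesis unfolding d gwalk_def .
qed

lemma level_energy_restrict:
  "level_energy \<rho> l N s w
     = free_energy (1 / 2 ^ N) \<rho> (l * 2 ^ N) (\<lambda>k\<in>{..<l * 2 ^ N}. steps (\<lambda>i. w (s + real i * (1 / 2 ^ N))) k)"
  unfolding level_energy_def by (rule free_energy_cong) simp

lemma free_energy_measurable_PiM: "free_energy \<delta> \<rho> n \<in> borel_measurable (PiM {..<n} (\<lambda>_. borel))"
  by (rule free_energy_measurable[where d = "\<lambda>x. x"]) (auto intro: measurable_component_singleton)

lemma level_energy_measurable:
  "0 \<le> s \<Longrightarrow> (\<lambda>\<omega>. level_energy \<rho> l N s (\<lambda>t. W t \<omega>)) \<in> borel_measurable M"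
  unfolding level_energy_def by (rule free_energy_measurable) (rule grid_steps_measurable, auto)

lemma level_energy_distr:
  assumes s: "0 \<le> s" and l: "0 < l"
  shows "distr M borel (\<lambda>\<omega>. level_energy \<rho> l N s (\<lambda>t. W t \<omega>))
      = distr (gwalk (1 / 2 ^ N) (l * 2 ^ N)) borel (free_energy (1 / 2 ^ N) \<rho> (l * 2 ^ N))"
proof -
  have 0: "0 < 1 / (2::real) ^ N" by simp
  have n: "0 < l * 2 ^ N" using l by simp
  have m: "(\<lambda>\<omega>. \<lambda>k\<in>{..<l * 2 ^ N}. steps (\<lambda>i. W (s + real i * (1 / 2 ^ N)) \<omega>) k) \<in> measurable M (PiM {..<l * 2 ^ N} (\<lambda>_. borel))"
    by (intro measurable_restrict grid_steps_measurable s 0)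
  show ?thesis
    unfolding grid_steps_distr[OF s 0 n, symmetric] level_energy_restrict distr_distr[OF free_energy_measurable_PiM m] comp_def ..
qed

lemma level_energy_expectation:
  assumes s: "0 \<le> s" and l: "0 < l"
  shows "(\<integral>\<^sup>+\<omega>. level_energy \<rho> l N s (\<lambda>t. W t \<omega>) \<partial>M)
      = (\<integral>\<^sup>+x. free_energy (1 / 2 ^ N) \<rho> (l * 2 ^ N) x \<partial>gwalk (1 / 2 ^ N) (l * 2 ^ N))"
proof -
  have m: "free_energy (1 / 2 ^ N) \<rho> (l * 2 ^ N) \<in> borel_measurable (gwalk (1 / 2 ^ N) (l * 2 ^ N))"
    by (rule free_energy_measurable[where d = "\<lambda>x. x"]) (rule gwalk_coordinate)
  have "(\<integral>\<^sup>+\<omega>. level_energy \<rho> l N s (\<lambda>t. W t \<omega>) \<partial>M)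
      = (\<integral>\<^sup>+x. x \<partial>distr M borel (\<lambda>\<omega>. level_energy \<rho> l N s (\<lambda>t. W t \<omega>)))"
    using level_energy_measurable[OF s] by (subst nn_integral_distr) auto
  also have "\<dots> = (\<integral>\<^sup>+x. free_energy (1 / 2 ^ N) \<rho> (l * 2 ^ N) x \<partial>gwalk (1 / 2 ^ N) (l * 2 ^ N))"
    unfolding level_energy_distr[OF s l] using m by (subst nn_integral_distr) auto
  finally show ?thesis .
qed

text \<open>
  On the common grid of mesh \<open>1 / 2 ^ N\<close> the blocks use disjoint sets of increments, which are independent.
\<close>

lemma level_energy_uncorrelated:
  fixes N off l L :: nat and \<rho> a b :: real
  assumes o: "off + l \<le> L" and jk: "j \<noteq> k" and ab: "0 \<le> a" "0 \<le> b"
  defines "F \<equiv> \<lambda>k \<omega>. enn2real (level_energy \<rho> l N (real (k * L + off)) (\<lambda>t. W t \<omega>))"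
  shows "expectation (\<lambda>\<omega>. min (F j \<omega>) a * min (F k \<omega>) b)
      = expectation (\<lambda>\<omega>. min (F j \<omega>) a) * expectation (\<lambda>\<omega>. min (F k \<omega>) b)"
proof -
  define \<delta> :: real where "\<delta> = 1 / 2 ^ N"
  define m :: nat where "m = 2 ^ N"
  have \<delta>: "0 < \<delta>" "real m * \<delta> = 1" by (auto simp: \<delta>_def m_def)
  define X where "X = (\<lambda>k \<omega>. steps (\<lambda>i. W (0 + real i * \<delta>) \<omega>) k)"
  define q where "q = (\<lambda>i. (i * L + off) * m)"
  define K where "K = (\<lambda>i. {q i..<q i + l * m})"
  define n where "n = q j + q k + l * m"
  define Y where "Y = (\<lambda>i x. min (enn2real (free_energy \<delta> \<rho> (l * m) (\<lambda>p. x (q i + p)))) (if i = j then a else b))"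
  have shift: "real (q i + p) * \<delta> = real (i * L + off) + real p * \<delta>" for i p
  proof -
    have "real (q i + p) * \<delta> = real (i * L + off) * (real m * \<delta>) + real p * \<delta>"
      unfolding q_def of_nat_add of_nat_mult by (simp only: distrib_right mult.assoc)
    then show ?thesis using \<delta>(2) by simp
  qed
  have F: "F i \<omega> = enn2real (free_energy \<delta> \<rho> (l * m) (\<lambda>p. restrict (\<lambda>i. X i \<omega>) (K i) (q i + p)))" for i \<omega>
    unfolding F_def level_energy_def \<delta>_def[symmetric] m_def[symmetric]
  proof (rule arg_cong[where f = enn2real], rule free_energy_cong)
    fix p assume "p < l * m"
    then have "q i + p \<in> K i" by (simp add: K_def)
    then show "steps (\<lambda>p. W (real (i * L + off) + real p * \<delta>) \<omega>) p = restrict (\<lambda>i. X i \<omega>) (K i) (q i + p)"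
      using shift[of i p] shift[of i "Suc p"] by (simp only: X_def steps_def restrict_apply' add_0 add_Suc_right)
  qed
  have disj: "K i \<inter> K i' = {}" if "i < i'" for i i'
  proof -
    have "i * L + off + l \<le> i' * L + off"
    proof -
      have "Suc i * L \<le> i' * L" using that by (intro mult_le_mono1) simp
      then show ?thesis using o by simp
    qed
    then have "(i * L + off + l) * m \<le> (i' * L + off) * m" by (rule mult_le_mono1)
    then have "q i + l * m \<le> q i'" by (simp add: q_def distrib_right)
    then show ?thesis by (auto simp: K_def)
  qed
  have "indep_vars (\<lambda>i. PiM (K i) (\<lambda>_. borel)) (\<lambda>i \<omega>. restrict (\<lambda>i. X i \<omega>) (K i)) {j, k}"
  proof (rule indep_vars_restrict)
    show "indep_vars (\<lambda>_. borel) X {..<n}" unfolding X_def by (rule grid_steps_indep) (use \<delta> in auto)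
    show "K i \<subseteq> {..<n}" if "i \<in> {j, k}" for i using that by (auto simp: K_def n_def)
    show "disjoint_family_on K {j, k}"
      unfolding disjoint_family_on_def using disj[of j k] disj[of k j] by (cases "j < k") auto
  qed
  then have "indep_vars (\<lambda>_. borel) (\<lambda>i \<omega>. Y i (restrict (\<lambda>i. X i \<omega>) (K i))) {j, k}"
  proof (rule indep_vars_compose2)
    fix i
    have "(\<lambda>x. free_energy \<delta> \<rho> (l * m) (\<lambda>p. x (q i + p))) \<in> borel_measurable (PiM (K i) (\<lambda>_. borel))"
      by (rule free_energy_measurable) (auto simp: K_def intro: measurable_component_singleton)
    then show "Y i \<in> borel_measurable (PiM (K i) (\<lambda>_. borel))" unfolding Y_def by measurable
  qed
  then have ind: "indep_vars (\<lambda>_. borel) (\<lambda>i \<omega>. min (F i \<omega>) (if i = j then a else b)) {j, k}"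
    unfolding Y_def F .
  have [measurable]: "F i \<in> borel_measurable M" for i
    unfolding F_def by (intro borel_measurable_enn2real level_energy_measurable) simp
  have F0: "0 \<le> F i \<omega>" for i \<omega> by (simp add: F_def)
  have "expectation (\<lambda>\<omega>. \<Prod>i\<in>{j, k}. min (F i \<omega>) (if i = j then a else b))
      = (\<Prod>i\<in>{j, k}. expectation (\<lambda>\<omega>. min (F i \<omega>) (if i = j then a else b)))"
  proof (rule indep_vars_lebesgue_integral[OF _ ind])
    show "integrable M (\<lambda>\<omega>. min (F i \<omega>) (if i = j then a else b))" for i
      by (rule integrable_const_bound[of _ "max a b"]) (use F0[of i] ab in \<open>auto simp: min_def max_def\<close>)
  qed simp
  then show ?thesis using jk by simp
qed

text \<open>
  Part 1 is used for the lower bound, where a fixed level suffices; parts 2 and 3 for the upper bound. The offset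
  \<open>off\<close> and the length \<open>l\<close> allow for the first and last unit of time in each block of length
  \<open>L\<close>.
\<close>

theorem level_energy_strong_law:
  assumes \<rho>: "0 < \<rho>" and l: "0 < l" and o: "off + l \<le> L"
  shows "AE \<omega> in M. (\<lambda>n. (\<Sum>k<n. enn2real (level_energy \<rho> l N (real (k * L + off)) (\<lambda>t. W t \<omega>))) / real n)
      \<longlonglongrightarrow> enn2real (\<integral>\<^sup>+x. free_energy (1 / 2 ^ N) \<rho> (l * 2 ^ N) x \<partial>gwalk (1 / 2 ^ N) (l * 2 ^ N))"
    and "AE \<omega> in M. \<forall>k. (SUP N. level_energy \<rho> l N (real (k * L + off)) (\<lambda>t. W t \<omega>)) < \<infinity>"
    and "\<exists>\<mu>\<le>real l * (pi\<^sup>2 / (6 * \<rho>\<^sup>2)). AE \<omega> in M.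
      (\<lambda>n. (\<Sum>k<n. enn2real (SUP N. level_energy \<rho> l N (real (k * L + off)) (\<lambda>t. W t \<omega>))) / real n) \<longlonglongrightarrow> \<mu>"
proof -
  define F where "F = (\<lambda>N k \<omega>. level_energy \<rho> l N (real (k * L + off)) (\<lambda>t. W t \<omega>))"
  define c where "c = real l * (pi\<^sup>2 / (6 * \<rho>\<^sup>2))"
  have c: "0 \<le> c" by (simp add: c_def)
  have meas: "F N k \<in> borel_measurable M" for N k unfolding F_def by (rule level_energy_measurable) simp
  have mono: "F N k \<omega> \<le> F (Suc N) k \<omega>" for N k \<omega>
  proof -
    have "free_energy (1 / 2 ^ N) \<rho> (l * 2 ^ N) (steps (\<lambda>i. W (real (k * L + off) + real (2 * i) * (1 / 2 ^ Suc N)) \<omega>))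
        \<le> free_energy (1 / 2 ^ N / 2) \<rho> (2 * (l * 2 ^ N)) (steps (\<lambda>i. W (real (k * L + off) + real i * (1 / 2 ^ Suc N)) \<omega>))"
      by (rule free_energy_refine) (use \<rho> in auto)
    moreover have "real (2 * i) * (1 / 2 ^ Suc N) = real i * (1 / 2 ^ N)" for i by simp
    moreover have "1 / 2 ^ N / 2 = 1 / (2::real) ^ Suc N" "2 * (l * 2 ^ N) = l * 2 ^ Suc N" by simp_all
    ultimately show ?thesis by (simp only: F_def level_energy_def)
  qed
  have ident: "distr M borel (F N k) = distr M borel (F N 0)" for N k
  proof -
    have "distr M borel (F N k) = distr (gwalk (1 / 2 ^ N) (l * 2 ^ N)) borel (free_energy (1 / 2 ^ N) \<rho> (l * 2 ^ N))" for k
      unfolding F_def by (rule level_energy_distr) (use l in auto)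
    from this[of k] this[of 0] show ?thesis by (rule trans[OF _ sym])
  qed
  have EF: "(\<integral>\<^sup>+\<omega>. F N 0 \<omega> \<partial>M) = (\<integral>\<^sup>+x. free_energy (1 / 2 ^ N) \<rho> (l * 2 ^ N) x \<partial>gwalk (1 / 2 ^ N) (l * 2 ^ N))" for N
    unfolding F_def by (rule level_energy_expectation) (use l in auto)
  have bound: "(\<integral>\<^sup>+\<omega>. F N 0 \<omega> \<partial>M) \<le> ennreal c" for N
  proof -
    have "(\<integral>\<^sup>+\<omega>. F N 0 \<omega> \<partial>M) \<le> ennreal (real (l * 2 ^ N) * (1 / 2 ^ N) * (pi\<^sup>2 / (6 * \<rho>\<^sup>2)))"
      unfolding EF by (rule free_energy_expectation_upper) (use \<rho> in auto)
    also have "real (l * 2 ^ N) * (1 / 2 ^ N) = real l" by simp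
    finally show ?thesis unfolding c_def .
  qed
  have uncorr: "expectation (\<lambda>\<omega>. min (enn2real (F N j \<omega>)) a * min (enn2real (F N k \<omega>)) b)
        = expectation (\<lambda>\<omega>. min (enn2real (F N j \<omega>)) a) * expectation (\<lambda>\<omega>. min (enn2real (F N k \<omega>)) b)"
    if "j \<noteq> k" "0 \<le> a" "0 \<le> b" for N j k a b
    unfolding F_def by (rule level_energy_uncorrelated[OF o that])
  have "AE \<omega> in M. (\<lambda>n. (\<Sum>k<n. enn2real (SUP _::nat. F N k \<omega>)) / real n) \<longlonglongrightarrow> enn2real (SUP _::nat. \<integral>\<^sup>+\<omega>. F N 0 \<omega> \<partial>M)"
    by (rule strong_law_SUP(2)[of "\<lambda>_. F N" c]) (use meas ident bound uncorr in auto)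
  then show "AE \<omega> in M. (\<lambda>n. (\<Sum>k<n. enn2real (level_energy \<rho> l N (real (k * L + off)) (\<lambda>t. W t \<omega>))) / real n)
      \<longlonglongrightarrow> enn2real (\<integral>\<^sup>+x. free_energy (1 / 2 ^ N) \<rho> (l * 2 ^ N) x \<partial>gwalk (1 / 2 ^ N) (l * 2 ^ N))"
    unfolding EF[symmetric] by (simp add: F_def)
  show "AE \<omega> in M. \<forall>k. (SUP N. level_energy \<rho> l N (real (k * L + off)) (\<lambda>t. W t \<omega>)) < \<infinity>"
    using strong_law_SUP(1)[of F c, OF meas mono ident bound uncorr] by (simp add: F_def)
  have "AE \<omega> in M. (\<lambda>n. (\<Sum>k<n. enn2real (SUP N. F N k \<omega>)) / real n) \<longlonglongrightarrow> enn2real (SUP N. \<integral>\<^sup>+\<omega>. F N 0 \<omega> \<partial>M)"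
    by (rule strong_law_SUP(2)[of F c, OF meas mono ident bound uncorr])
  moreover have "enn2real (SUP N. \<integral>\<^sup>+\<omega>. F N 0 \<omega> \<partial>M) \<le> c"
    by (rule enn2real_leI[OF c], rule SUP_least, rule bound)
  ultimately show "\<exists>\<mu>\<le>real l * (pi\<^sup>2 / (6 * \<rho>\<^sup>2)). AE \<omega> in M.
      (\<lambda>n. (\<Sum>k<n. enn2real (SUP N. level_energy \<rho> l N (real (k * L + off)) (\<lambda>t. W t \<omega>))) / real n) \<longlonglongrightarrow> \<mu>"
    unfolding c_def F_def by blast
qed

end

section \<open>From blocks to the whole time axis\<close>

lemma level_energy_le_block:
  assumes h: "h \<in> AC_on s (s + real l)" and r: "0 \<le> r"
    and near: "\<And>t. t \<in> {s..s + real l} \<Longrightarrow> \<bar>h t - w t\<bar> \<le> r / 2"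
  shows "level_energy r l N s w \<le> energy_on s (s + real l) h" and "level_energy r l N s w < \<infinity>"
proof -
  define \<delta> :: real where "\<delta> = 1 / 2 ^ N"
  define n :: nat where "n = l * 2 ^ N"
  have \<delta>: "0 < \<delta>" "real n * \<delta> = real l" by (auto simp: \<delta>_def n_def)
  define y where "y = (\<lambda>i. h (s + real i * \<delta>))"
  have "y \<in> tube r (\<lambda>i. w (s + real i * \<delta>)) n"
    unfolding tube_def
  proof (intro CollectI allI impI)
    fix k assume "k \<le> n"
    then have "real k * \<delta> \<le> real n * \<delta>" using \<delta>(1) by (intro mult_right_mono) auto
    then have "s + real k * \<delta> \<in> {s..s + real l}" using \<delta> by simp
    then show "\<bar>y k - w (s + real k * \<delta>)\<bar> \<le> r / 2" unfolding y_def by (rule near)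
  qed
  from free_energy_le[OF \<delta>(1) r this]
  have 1: "level_energy r l N s w \<le> ennreal (qenergy \<delta> n y)" by (simp only: level_energy_def \<delta>_def n_def)
  then show "level_energy r l N s w < \<infinity>" by (rule le_less_trans) simp
  have "ennreal (qenergy \<delta> n y) \<le> energy_on s (s + real n * \<delta>) h"
    unfolding qenergy_def y_def by (rule energy_on_grid_ge) (use h \<delta> in auto)
  then show "level_energy r l N s w \<le> energy_on s (s + real l) h" using 1 unfolding \<delta>(2) by (rule order_trans[rotated])
qed

text \<open>
  The restriction of \<open>h\<close> to a block, sampled on the grid, competes for the free energy of the block.
\<close>

lemma level_energy_sum_le:
  assumes h: "h \<in> strip T r w" and r: "0 \<le> r" and mT: "real (m * L) \<le> T"
  shows "ennreal (\<Sum>k<m. enn2real (level_energy r L N (real (k * L)) w)) \<le> energy T h"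
proof -
  have AC: "h \<in> AC_on 0 T" and near: "\<And>t. t \<in> {0..T} \<Longrightarrow> \<bar>h t - w t\<bar> \<le> r / 2"
    using h by (auto simp: strip_def AC_eq_AC_on)
  have blk: "level_energy r L N (real (k * L)) w \<le> energy_on (real (k * L)) (real (Suc k * L)) h"
    "level_energy r L N (real (k * L)) w < \<infinity>" if "k < m" for k
  proof -
    have "Suc k * L \<le> m * L" using that by (intro mult_le_mono1) simp
    then have "real (Suc k * L) \<le> real (m * L)" by (simp only: of_nat_le_iff)
    then have le: "real (Suc k * L) \<le> T" using mT by simp
    have e: "real (k * L) + real L = real (Suc k * L)" by simp
    have AC': "h \<in> AC_on (real (k * L)) (real (k * L) + real L)"
      unfolding e by (rule AC_on_subset[OF AC]) (use le in auto)
    have nb: "\<bar>h t - w t\<bar> \<le> r / 2" if "t \<in> {real (k * L)..real (k * L) + real L}" for t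
    proof (rule near)
      show "t \<in> {0..T}" using that le of_nat_0_le_iff[of "k * L", where 'a = real] unfolding e atLeastAtMost_iff by linarith
    qed
    show "level_energy r L N (real (k * L)) w \<le> energy_on (real (k * L)) (real (Suc k * L)) h"
      unfolding e[symmetric] by (rule level_energy_le_block(1)[OF AC' r]) (rule nb)
    show "level_energy r L N (real (k * L)) w < \<infinity>"
      by (rule level_energy_le_block(2)[OF AC' r]) (rule nb)
  qed
  have "(\<Sum>k<j. level_energy r L N (real (k * L)) w) \<le> energy_on 0 (real (j * L)) h" if "j \<le> m" for j
    using that
  proof (induction j)
    case (Suc j)
    have "Suc j * L \<le> m * L" using Suc.prems by (intro mult_le_mono1)
    then have "real (Suc j * L) \<le> real (m * L)" by (simp only: of_nat_le_iff)
    then have "h \<in> AC_on 0 (real (Suc j * L))" using mT by (intro AC_on_subset[OF AC]) auto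
    then have split: "energy_on 0 (real (Suc j * L)) h
        = energy_on 0 (real (j * L)) h + energy_on (real (j * L)) (real (Suc j * L)) h"
      by (rule energy_on_split) auto
    show ?case unfolding split sum.lessThan_Suc using Suc blk(1)[of j] by (intro add_mono) auto
  qed simp
  then have "(\<Sum>k<m. level_energy r L N (real (k * L)) w) \<le> energy_on 0 (real (m * L)) h" by simp
  also have "\<dots> \<le> energy_on 0 T h" by (rule energy_on_mono) (use mT in auto)
  finally have "(\<Sum>k<m. level_energy r L N (real (k * L)) w) \<le> energy T h" by (simp only: energy_eq_energy_on)
  moreover have "ennreal (\<Sum>k<m. enn2real (level_energy r L N (real (k * L)) w)) = (\<Sum>k<m. level_energy r L N (real (k * L)) w)"
  proof -
    have "(\<Sum>k<m. level_energy r L N (real (k * L)) w) = (\<Sum>k<m. ennreal (enn2real (level_energy r L N (real (k * L)) w)))"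
      by (rule sum.cong[OF refl]) (use blk(2) in \<open>simp del: of_nat_mult\<close>)
    then show ?thesis by (simp add: sum_ennreal del: of_nat_mult)
  qed
  ultimately show ?thesis by simp
qed

lemma floor_div_bounds:
  assumes "0 < L" "0 \<le> T"
  defines "m \<equiv> nat \<lfloor>T / L\<rfloor>"
  shows "real m * L \<le> T" "T < (real m + 1) * L"
proof -
  have mr: "real m = of_int \<lfloor>T / L\<rfloor>" using assms by (simp add: m_def)
  have "real m \<le> T / L" unfolding mr by (rule of_int_floor_le)
  then show "real m * L \<le> T" using assms(1) by (simp add: pos_le_divide_eq)
  have "T / L < real m + 1" unfolding mr by (rule floor_correct[THEN conjunct2, simplified])
  then show "T < (real m + 1) * L" using assms(1) by (simp add: pos_divide_less_eq)
qed

lemma filterlim_floor_div: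
  assumes "0 < (L::real)"
  shows "filterlim (\<lambda>T. nat \<lfloor>T / L\<rfloor>) sequentially at_top"
  unfolding filterlim_at_top
proof
  fix Z :: nat
  show "eventually (\<lambda>T. Z \<le> nat \<lfloor>T / L\<rfloor>) at_top"
    using eventually_ge_at_top[of "real Z * L"] eventually_ge_at_top[of 0]
  proof eventually_elim
    case (elim T)
    then have "real Z \<le> T / L" using assms by (simp add: pos_le_divide_eq)
    then show ?case by (simp add: le_nat_iff le_floor_iff)
  qed
qed

lemma eventually_energy_ge:
  fixes L :: nat
  assumes r: "0 \<le> r" and L: "0 < L" and \<theta>: "0 \<le> \<theta>" "\<theta> < \<theta>'"
    and lim: "(\<lambda>n. (\<Sum>k<n. enn2real (level_energy r L N (real (k * L)) w)) / real n) \<longlonglongrightarrow> \<mu>"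
    and \<mu>: "\<theta>' * real L < \<mu>"
  shows "eventually (\<lambda>T. ennreal (\<theta> * T) \<le> (INF h\<in>strip T r w. energy T h)) at_top"
proof -
  define S where "S = (\<lambda>n. \<Sum>k<n. enn2real (level_energy r L N (real (k * L)) w))"
  have L0: "0 < real L" using L by simp
  have "eventually (\<lambda>n. \<theta>' * real L < S n / real n) sequentially"
    unfolding S_def by (rule order_tendstoD(1)[OF lim \<mu>])
  then have "eventually (\<lambda>T. \<theta>' * real L < S (nat \<lfloor>T / real L\<rfloor>) / real (nat \<lfloor>T / real L\<rfloor>)) at_top"
    by (rule eventually_compose_filterlim[OF _ filterlim_floor_div[OF L0]])
  then show ?thesis
    using eventually_ge_at_top[of 0] eventually_ge_at_top[of "\<theta>' * real L / (\<theta>' - \<theta>)"]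
  proof eventually_elim
    case (elim T)
    define m where "m = nat \<lfloor>T / real L\<rfloor>"
    have m: "real m * real L \<le> T" "T < (real m + 1) * real L"
      using floor_div_bounds[OF L0 elim(2)] by (auto simp: m_def)
    have Sm: "\<theta>' * real L < S m / real m" using elim(1) by (simp only: m_def)
    have "0 < \<theta>' * real L" using \<theta> L0 by (intro mult_pos_pos) auto
    then have m0: "0 < real m" using Sm by (cases "m = 0") auto
    have "\<theta>' * real L * real m < S m" using Sm m0 by (simp add: pos_less_divide_eq)
    moreover have "\<theta>' * T \<le> \<theta>' * ((real m + 1) * real L)" using m(2) \<theta> by (intro mult_left_mono) auto
    moreover have "\<theta>' * real L \<le> (\<theta>' - \<theta>) * T" using elim(3) \<theta> by (simp add: pos_divide_le_eq mult.commute)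
    ultimately have "\<theta> * T \<le> S m" by (simp add: algebra_simps)
    show ?case
    proof (rule INF_greatest)
      fix h assume "h \<in> strip T r w"
      then have "ennreal (S m) \<le> energy T h"
        unfolding S_def by (rule level_energy_sum_le[OF _ r]) (use m in simp)
      then show "ennreal (\<theta> * T) \<le> energy T h" using ennreal_leI[OF \<open>\<theta> * T \<le> S m\<close>] by (rule order_trans[rotated])
    qed
  qed
qed

text \<open>
  The bound of \<open>strip_path_block\<close> for the \<open>k\<close>-th block, with suprema over the levels.
\<close>

definition block_cost :: "real \<Rightarrow> real \<Rightarrow> nat \<Rightarrow> (real \<Rightarrow> real) \<Rightarrow> nat \<Rightarrow> real" where
  "block_cost \<rho> \<eta> L w k = (1 + \<eta>)\<^sup>2 *
      (enn2real (SUP N. level_energy \<rho> L N (real (k * L + 0)) w)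
       + enn2real (SUP N. level_energy (\<rho> / 2) 1 N (real (k * L + 0)) w)
       + enn2real (SUP N. level_energy (\<rho> / 2) 1 N (real (k * L + (L - 1))) w))
     + (2 + \<eta>) * ((1 + 1 / \<eta>) * \<rho>\<^sup>2)"

text \<open>
  What the strong law provides along a typical path; \<open>real L + 8\<close> arises because a unit of time in the tube
  of half the width costs on average four times as much, at both ends.
\<close>

definition cheap_blocks :: "real \<Rightarrow> real \<Rightarrow> nat \<Rightarrow> (real \<Rightarrow> real) \<Rightarrow> bool" where
  "cheap_blocks \<rho> \<eta> L w \<longleftrightarrow>
     (\<forall>k. (SUP N. level_energy \<rho> L N (real (k * L + 0)) w) < \<infinity>) \<and>
     (\<forall>k. (SUP N. level_energy (\<rho> / 2) 1 N (real (k * L + 0)) w) < \<infinity>) \<and>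
     (\<forall>k. (SUP N. level_energy (\<rho> / 2) 1 N (real (k * L + (L - 1))) w) < \<infinity>) \<and>
     (\<exists>\<mu> \<le> (1 + \<eta>)\<^sup>2 * ((real L + 8) * (pi\<^sup>2 / (6 * \<rho>\<^sup>2))) + (2 + \<eta>) * ((1 + 1 / \<eta>) * \<rho>\<^sup>2).
        (\<lambda>n. (\<Sum>k<n. block_cost \<rho> \<eta> L w k) / real n) \<longlonglongrightarrow> \<mu>)"

lemma block_cost_nonneg: "0 < \<eta> \<Longrightarrow> 0 \<le> block_cost \<rho> \<eta> L w k"
  unfolding block_cost_def by (intro add_nonneg_nonneg mult_nonneg_nonneg) auto

lemma block_cost_strip_path:
  assumes c: "cheap_blocks \<rho> \<eta> L w" and w: "continuous_on {0..} w" and r: "0 < \<rho>" "\<rho> < R" and \<eta>: "0 < \<eta>" and L: "1 \<le> L"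
  shows "strip_path w (R / 2) (real (k * L)) (real (Suc k * L)) (w (real (k * L))) (w (real (Suc k * L))) (block_cost \<rho> \<eta> L w k)"
proof -
  have fin: "f N \<le> ennreal (enn2real (SUP N. f N))" if "(SUP N. f N) < \<infinity>" for f :: "nat \<Rightarrow> ennreal" and N
  proof -
    have "f N \<le> (SUP N. f N)" by (rule SUP_upper) simp
    then show ?thesis using that by simp
  qed
  have e: "real (k * L) + real L = real (Suc k * L)" by simp
  have o: "real (k * L) + real (L - 1) = real (k * L + (L - 1))" by (rule of_nat_add[symmetric])
  have cont: "continuous_on {real (k * L)..real (k * L) + real L} w"
    by (rule continuous_on_subset[OF w]) (auto intro: order_trans[OF of_nat_0_le_iff])
  have f: "(SUP N. level_energy \<rho> L N (real (k * L + 0)) w) < \<infinity>"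
    "(SUP N. level_energy (\<rho> / 2) 1 N (real (k * L + 0)) w) < \<infinity>"
    "(SUP N. level_energy (\<rho> / 2) 1 N (real (k * L + (L - 1))) w) < \<infinity>"
    using c unfolding cheap_blocks_def by blast+
  note f' = f[unfolded add_0_right o[symmetric]]
  show ?thesis
    unfolding block_cost_def e[symmetric] add_0_right o[symmetric]
  proof (rule strip_path_block[OF cont r \<eta> L])
    show "level_energy \<rho> L N (real (k * L)) w \<le> ennreal (enn2real (SUP N. level_energy \<rho> L N (real (k * L)) w))" for N
      by (rule fin[OF f'(1)])
    show "level_energy (\<rho> / 2) 1 N (real (k * L)) w \<le> ennreal (enn2real (SUP N. level_energy (\<rho> / 2) 1 N (real (k * L)) w))" for N
      by (rule fin[OF f'(2)])
    show "level_energy (\<rho> / 2) 1 N (real (k * L) + real (L - 1)) w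
        \<le> ennreal (enn2real (SUP N. level_energy (\<rho> / 2) 1 N (real (k * L) + real (L - 1)) w))" for N
      by (rule fin[OF f'(3)])
  qed (rule enn2real_nonneg)+
qed

text \<open>
  A sequence whose averages converge has single terms of order \<open>o(n)\<close>; two consecutive terms are needed for
  the incomplete block.
\<close>

lemma two_step_increment_tendsto:
  fixes S :: "nat \<Rightarrow> real"
  assumes lim: "(\<lambda>n. S n / real n) \<longlonglongrightarrow> \<mu>" and 0: "S 0 = 0"
  shows "(\<lambda>n. (S (Suc (Suc n)) - S n) / real (Suc n)) \<longlonglongrightarrow> 0"
proof -
  have "(\<lambda>n. S (Suc (Suc n)) / real (Suc (Suc n)) * (real (Suc (Suc n)) / real (Suc n)) - S n / real n * (real n / real (Suc n)))
      \<longlonglongrightarrow> \<mu> * 1 - \<mu> * 1"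
    by (intro tendsto_diff tendsto_mult lim LIMSEQ_n_over_Suc_n LIMSEQ_Suc[OF LIMSEQ_Suc[OF lim]] LIMSEQ_Suc[OF LIMSEQ_Suc_n_over_n])
  moreover have "S (Suc (Suc n)) / real (Suc (Suc n)) * (real (Suc (Suc n)) / real (Suc n)) - S n / real n * (real n / real (Suc n))
      = (S (Suc (Suc n)) - S n) / real (Suc n)" for n
    using 0 by (cases "n = 0") (simp_all add: diff_divide_distrib del: of_nat_Suc)
  ultimately show ?thesis by simp
qed

text \<open>
  The incomplete block at the end is treated in a strip of half the width, which is why the blocks of width
  \<open>\<rho> / 2\<close> have to be cheap, at any finite rate.
\<close>

lemma eventually_energy_le:
  assumes w: "continuous_on {0..} w" "w 0 = 0" and \<rho>: "0 < \<rho>" "\<rho> < R" and \<eta>: "0 < \<eta>" and L: "1 \<le> L"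
    and c: "cheap_blocks \<rho> \<eta> L w" and c': "cheap_blocks (\<rho> / 2) \<eta> L w"
    and \<theta>: "(1 + \<eta>)\<^sup>2 * ((real L + 8) * (pi\<^sup>2 / (6 * \<rho>\<^sup>2))) + (2 + \<eta>) * ((1 + 1 / \<eta>) * \<rho>\<^sup>2) < \<theta> * real L"
  shows "eventually (\<lambda>T. \<exists>h\<in>strip T R w. energy T h \<le> ennreal (\<theta> * T)) at_top"
proof -
  define e where "e = block_cost \<rho> \<eta> L w"
  define e' where "e' = block_cost (\<rho> / 2) \<eta> L w"
  define S where "S = (\<lambda>n. \<Sum>k<n. e k)"
  define S' where "S' = (\<lambda>n. \<Sum>k<n. e' k)"
  have L0: "0 < real L" using L by simp
  obtain \<mu> where \<mu>: "\<mu> < \<theta> * real L" "(\<lambda>n. S n / real n) \<longlonglongrightarrow> \<mu>"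
    using c \<theta> unfolding cheap_blocks_def S_def e_def by (blast intro: le_less_trans)
  obtain \<mu>' where \<mu>': "(\<lambda>n. S' n / real n) \<longlonglongrightarrow> \<mu>'"
    using c' unfolding cheap_blocks_def S'_def e'_def by blast
  have "(\<lambda>n. S (Suc n) / real (Suc n) + 2 * ((S' (Suc (Suc n)) - S' n) / real (Suc n)) + R\<^sup>2 / real (Suc n)) \<longlonglongrightarrow> \<mu> + 2 * 0 + 0"
    by (intro tendsto_add tendsto_mult tendsto_const LIMSEQ_Suc[OF \<mu>(2)] two_step_increment_tendsto[OF \<mu>'] LIMSEQ_Suc[OF lim_const_over_n])
      (simp add: S'_def)
  then have "eventually (\<lambda>n. S (Suc n) / real (Suc n) + 2 * ((S' (Suc (Suc n)) - S' n) / real (Suc n)) + R\<^sup>2 / real (Suc n) < \<theta> * real L) sequentially"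
    by (rule order_tendstoD(2)) (use \<mu>(1) in simp)
  then obtain n0 where n0: "\<And>n. n0 \<le> n \<Longrightarrow> S (Suc n) / real (Suc n) + 2 * ((S' (Suc (Suc n)) - S' n) / real (Suc n)) + R\<^sup>2 / real (Suc n) < \<theta> * real L"
    by (auto simp: eventually_sequentially)
  have "eventually (\<lambda>m. Suc n0 \<le> m) sequentially" by (rule eventually_ge_at_top)
  then have "eventually (\<lambda>T. Suc n0 \<le> nat \<lfloor>T / real L\<rfloor>) at_top"
    by (rule eventually_compose_filterlim[OF _ filterlim_floor_div[OF L0]])
  then show ?thesis
    using eventually_ge_at_top[of "real L"]
  proof eventually_elim
    case (elim T)
    define m where "m = nat \<lfloor>T / real L\<rfloor>"
    obtain n where n: "m = Suc n" "n0 \<le> n" using elim(1) by (cases m) (auto simp: m_def)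
    have T0: "0 \<le> T" using elim(2) L0 by simp
    have mT: "real m * real L \<le> T" using floor_div_bounds(1)[OF L0 T0] by (simp add: m_def)
    have p: "strip_path w (R / 2) (real (k * L)) (real (Suc k * L)) (w (real (k * L))) (w (real (Suc k * L))) (e k)" for k
      unfolding e_def by (rule block_cost_strip_path[OF c w(1) \<rho> \<eta> L])
    have p': "strip_path w (R / 4) (real (k * L)) (real (Suc k * L)) (w (real (k * L))) (w (real (Suc k * L))) (e' k)" for k
      using block_cost_strip_path[OF c' w(1) _ _ \<eta> L, of "R / 2" k] \<rho> unfolding e'_def by simp
    have "\<exists>h\<in>strip T R w. energy T h \<le> ennreal ((\<Sum>k<m. e k) + 2 * (e' (m - 1) + e' m) + R\<^sup>2)"
      unfolding m_def
      by (rule strip_path_total[where e = e and e' = e' and w = w and r = R and T = T and L = L, OF L _ w(2) elim(2)])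
        (use \<rho> p p' \<eta> in \<open>auto simp: e_def e'_def block_cost_nonneg simp del: of_nat_mult\<close>)
    moreover have "(\<Sum>k<m. e k) + 2 * (e' (m - 1) + e' m) + R\<^sup>2 \<le> \<theta> * T"
    proof -
      define X where "X = (\<Sum>k<m. e k) + 2 * (e' (m - 1) + e' m) + R\<^sup>2"
      have "X = S (Suc n) + 2 * (S' (Suc (Suc n)) - S' n) + R\<^sup>2"
        unfolding X_def S_def S'_def n(1) by simp
      then have "X / real (Suc n) = S (Suc n) / real (Suc n) + 2 * ((S' (Suc (Suc n)) - S' n) / real (Suc n)) + R\<^sup>2 / real (Suc n)"
        by (simp add: add_divide_distrib del: of_nat_Suc)
      then have "X / real (Suc n) < \<theta> * real L" using n0[OF n(2)] by simp
      then have "X < \<theta> * real L * real m" unfolding n(1) by (simp only: pos_divide_less_eq of_nat_0_less_iff zero_less_Suc)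
      also have "\<dots> = \<theta> * (real m * real L)" by simp
      also have "\<dots> \<le> \<theta> * T"
      proof (rule mult_left_mono[OF mT])
        have "0 \<le> (1 + \<eta>)\<^sup>2 * ((real L + 8) * (pi\<^sup>2 / (6 * \<rho>\<^sup>2))) + (2 + \<eta>) * ((1 + 1 / \<eta>) * \<rho>\<^sup>2)"
          using \<eta> by (intro add_nonneg_nonneg mult_nonneg_nonneg) auto
        then have "0 < \<theta> * real L" using \<theta> by linarith
        then show "0 \<le> \<theta>" using L0 by (simp add: zero_less_mult_iff)
      qed
      finally show ?thesis unfolding X_def by simp
    qed
    then have "ennreal ((\<Sum>k<m. e k) + 2 * (e' (m - 1) + e' m) + R\<^sup>2) \<le> ennreal (\<theta> * T)" by (rule ennreal_leI)
    ultimately obtain h where h: "h \<in> strip T R w" "energy T h \<le> ennreal ((\<Sum>k<m. e k) + 2 * (e' (m - 1) + e' m) + R\<^sup>2)"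
      and le: "ennreal ((\<Sum>k<m. e k) + 2 * (e' (m - 1) + e' m) + R\<^sup>2) \<le> ennreal (\<theta> * T)" by blast
    have "energy T h \<le> ennreal (\<theta> * T)" by (rule order_trans[OF h(2) le])
    then show ?case using h(1) by blast
  qed
qed

context wiener_process
begin

lemma cheap_blocks_AE:
  assumes \<rho>: "0 < \<rho>" and \<eta>: "0 < \<eta>" and L: "1 \<le> L"
  shows "AE \<omega> in M. cheap_blocks \<rho> \<eta> L (\<lambda>t. W t \<omega>)"
proof -
  have \<rho>2: "0 < \<rho> / 2" and o: "0 + L \<le> L" "0 + 1 \<le> L" "L - 1 + 1 \<le> L" and l: "0 < L" "0 < (1::nat)" using \<rho> L by auto
  define A where "A = (\<lambda>\<omega> k. enn2real (SUP N. level_energy \<rho> L N (real (k * L + 0)) (\<lambda>t. W t \<omega>)))"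
  define B where "B = (\<lambda>\<omega> k. enn2real (SUP N. level_energy (\<rho> / 2) 1 N (real (k * L + 0)) (\<lambda>t. W t \<omega>)))"
  define C where "C = (\<lambda>\<omega> k. enn2real (SUP N. level_energy (\<rho> / 2) 1 N (real (k * L + (L - 1))) (\<lambda>t. W t \<omega>)))"
  obtain a where a: "a \<le> real L * (pi\<^sup>2 / (6 * \<rho>\<^sup>2))" "AE \<omega> in M. (\<lambda>n. (\<Sum>k<n. A \<omega> k) / real n) \<longlonglongrightarrow> a"
    using level_energy_strong_law(3)[OF \<rho> l(1) o(1)] unfolding A_def by blast
  obtain b where b: "b \<le> real 1 * (pi\<^sup>2 / (6 * (\<rho> / 2)\<^sup>2))" "AE \<omega> in M. (\<lambda>n. (\<Sum>k<n. B \<omega> k) / real n) \<longlonglongrightarrow> b"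
    using level_energy_strong_law(3)[OF \<rho>2 l(2) o(2)] unfolding B_def by blast
  obtain c where c: "c \<le> real 1 * (pi\<^sup>2 / (6 * (\<rho> / 2)\<^sup>2))" "AE \<omega> in M. (\<lambda>n. (\<Sum>k<n. C \<omega> k) / real n) \<longlonglongrightarrow> c"
    using level_energy_strong_law(3)[OF \<rho>2 l(2) o(3)] unfolding C_def by blast
  define d where "d = (2 + \<eta>) * ((1 + 1 / \<eta>) * \<rho>\<^sup>2)"
  have four: "real 1 * (pi\<^sup>2 / (6 * (\<rho> / 2)\<^sup>2)) = 4 * (pi\<^sup>2 / (6 * \<rho>\<^sup>2))" by (simp add: power_divide)
  have bound: "(1 + \<eta>)\<^sup>2 * (a + b + c) + d \<le> (1 + \<eta>)\<^sup>2 * ((real L + 8) * (pi\<^sup>2 / (6 * \<rho>\<^sup>2))) + d"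
  proof (intro add_right_mono mult_left_mono)
    have "a + b + c \<le> real L * (pi\<^sup>2 / (6 * \<rho>\<^sup>2)) + 4 * (pi\<^sup>2 / (6 * \<rho>\<^sup>2)) + 4 * (pi\<^sup>2 / (6 * \<rho>\<^sup>2))"
      using a(1) b(1) c(1) unfolding four by linarith
    also have "\<dots> = (real L + 8) * (pi\<^sup>2 / (6 * \<rho>\<^sup>2))" by (simp only: distrib_right)
    finally show "a + b + c \<le> (real L + 8) * (pi\<^sup>2 / (6 * \<rho>\<^sup>2))" .
  qed simp
  show ?thesis
    using a(2) b(2) c(2) level_energy_strong_law(2)[OF \<rho> l(1) o(1)] level_energy_strong_law(2)[OF \<rho>2 l(2) o(2)]
      level_energy_strong_law(2)[OF \<rho>2 l(2) o(3)]
  proof eventually_elim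
    case (elim \<omega>)
    have "(\<lambda>n. (\<Sum>k<n. block_cost \<rho> \<eta> L (\<lambda>t. W t \<omega>) k) / real n) \<longlonglongrightarrow> (1 + \<eta>)\<^sup>2 * (a + b + c) + d"
    proof (rule Lim_transform_eventually)
      show "(\<lambda>n. (1 + \<eta>)\<^sup>2 * ((\<Sum>k<n. A \<omega> k) / real n + (\<Sum>k<n. B \<omega> k) / real n + (\<Sum>k<n. C \<omega> k) / real n) + d)
          \<longlonglongrightarrow> (1 + \<eta>)\<^sup>2 * (a + b + c) + d"
        by (intro tendsto_intros elim)
      show "eventually (\<lambda>n. (1 + \<eta>)\<^sup>2 * ((\<Sum>k<n. A \<omega> k) / real n + (\<Sum>k<n. B \<omega> k) / real n + (\<Sum>k<n. C \<omega> k) / real n) + d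
          = (\<Sum>k<n. block_cost \<rho> \<eta> L (\<lambda>t. W t \<omega>) k) / real n) sequentially"
      proof (rule eventually_sequentiallyI[of 1])
        fix n :: nat assume n: "1 \<le> n"
        have "(\<Sum>k<n. block_cost \<rho> \<eta> L (\<lambda>t. W t \<omega>) k) = (\<Sum>k<n. (1 + \<eta>)\<^sup>2 * (A \<omega> k + B \<omega> k + C \<omega> k) + d)"
          by (simp only: block_cost_def A_def B_def C_def d_def)
        also have "\<dots> = (1 + \<eta>)\<^sup>2 * ((\<Sum>k<n. A \<omega> k) + (\<Sum>k<n. B \<omega> k) + (\<Sum>k<n. C \<omega> k)) + real n * d"
          by (simp only: sum.distrib sum_distrib_left[symmetric] sum_constant card_lessThan)
        finally show "(1 + \<eta>)\<^sup>2 * ((\<Sum>k<n. A \<omega> k) / real n + (\<Sum>k<n. B \<omega> k) / real n + (\<Sum>k<n. C \<omega> k) / real n) + d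
          = (\<Sum>k<n. block_cost \<rho> \<eta> L (\<lambda>t. W t \<omega>) k) / real n"
          using n by (simp add: add_divide_distrib distrib_left)
      qed
    qed
    note avg = this
    show ?case
      unfolding cheap_blocks_def d_def[symmetric] by (intro conjI exI) (rule elim(4) elim(5) elim(6) bound avg)+
  qed
qed

end

theorem mainTheorem3:
  fixes M :: "'a measure" and W :: "real \<Rightarrow> 'a \<Rightarrow> real" and r :: real
  assumes "r > 0" and "wiener_process M W"
  shows "AE \<omega> in M.
    ((\<lambda>T. (INF h\<in>strip T r (\<lambda>t. W t \<omega>). energy T h) / ennreal T)
       \<longlongrightarrow> ennreal (pi\<^sup>2 / (6 * r\<^sup>2))) at_top \<and>
    ((\<lambda>T. energy T (taut_string T r (\<lambda>t. W t \<omega>)) / ennreal T)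
       \<longlongrightarrow> ennreal (pi\<^sup>2 / (6 * r\<^sup>2))) at_top"
proof -
  interpret wiener_process M W by (rule assms(2))
  define \<kappa> where "\<kappa> = pi\<^sup>2 / (6 * r\<^sup>2)"
  have \<kappa>: "0 < \<kappa>" using assms(1) by (simp add: \<kappa>_def)
  \<comment> \<open>A single sequence tending to 0 serves for the relative loss of width and for \<open>\<eta>\<close>.\<close>
  define x where "x = (\<lambda>q::nat. 1 / real (Suc (Suc q)))"
  define \<rho> where "\<rho> = (\<lambda>q. r * (1 - x q))"
  have x: "0 < x q" "x q < 1" for q by (auto simp: x_def)
  have \<rho>: "0 < \<rho> q" "\<rho> q < r" for q using x[of q] assms(1) by (auto simp: \<rho>_def)
  define E where "E = (\<lambda>L N. enn2real (\<integral>\<^sup>+d. free_energy (1 / 2 ^ N) r (L * 2 ^ N) d \<partial>gwalk (1 / 2 ^ N) (L * 2 ^ N)))"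
  have "AE \<omega> in M. \<forall>L N. (\<lambda>n. (\<Sum>k<n. enn2real (level_energy r (Suc L) N (real (k * Suc L)) (\<lambda>t. W t \<omega>))) / real n) \<longlonglongrightarrow> E (Suc L) N"
    unfolding AE_all_countable
  proof (intro allI)
    fix L N
    show "AE \<omega> in M. (\<lambda>n. (\<Sum>k<n. enn2real (level_energy r (Suc L) N (real (k * Suc L)) (\<lambda>t. W t \<omega>))) / real n) \<longlonglongrightarrow> E (Suc L) N"
      using level_energy_strong_law(1)[OF assms(1), of "Suc L" 0 "Suc L" N] by (simp add: E_def)
  qed
  moreover have "AE \<omega> in M. \<forall>q L. cheap_blocks (\<rho> q) (x q) (Suc L) (\<lambda>t. W t \<omega>)"
    unfolding AE_all_countable by (intro allI cheap_blocks_AE \<rho> x) simp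
  moreover have "AE \<omega> in M. \<forall>q L. cheap_blocks (\<rho> q / 2) (x q) (Suc L) (\<lambda>t. W t \<omega>)"
    unfolding AE_all_countable by (intro allI cheap_blocks_AE half_gt_zero \<rho> x) simp
  ultimately show ?thesis
    using W_start W_continuous
  proof eventually_elim
    case (elim \<omega>)
    define w where "w = (\<lambda>t. W t \<omega>)"
    define I where "I = (\<lambda>T. INF h\<in>strip T r w. energy T h)"
    have lower: "eventually (\<lambda>T. ennreal (\<theta> * T) \<le> I T) at_top" if "0 \<le> \<theta>" "\<theta> < \<kappa>" for \<theta>
    proof -
      define \<theta>' where "\<theta>' = (\<theta> + \<kappa>) / 2"
      have \<theta>': "0 \<le> \<theta>'" "\<theta> < \<theta>'" "\<theta>' < pi\<^sup>2 / (6 * r\<^sup>2)" using that by (auto simp: \<theta>'_def \<kappa>_def[symmetric])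
      obtain L j :: nat where L: "2 \<le> L" "ennreal (\<theta>' * real L) < (\<integral>\<^sup>+d. free_energy (1 / 2 ^ j) r (L * 2 ^ j) d \<partial>gwalk (1 / 2 ^ j) (L * 2 ^ j))"
        using free_energy_expectation_lower[OF assms(1) \<theta>'(1,3)] by blast
      have "(\<integral>\<^sup>+d. free_energy (1 / 2 ^ j) r (L * 2 ^ j) d \<partial>gwalk (1 / 2 ^ j) (L * 2 ^ j)) \<le> ennreal (real (L * 2 ^ j) * (1 / 2 ^ j) * (pi\<^sup>2 / (6 * r\<^sup>2)))"
        by (rule free_energy_expectation_upper) (use assms(1) in auto)
      then have "(\<integral>\<^sup>+d. free_energy (1 / 2 ^ j) r (L * 2 ^ j) d \<partial>gwalk (1 / 2 ^ j) (L * 2 ^ j)) < \<infinity>" by (rule le_less_trans) simp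
      then have "ennreal (E L j) = (\<integral>\<^sup>+d. free_energy (1 / 2 ^ j) r (L * 2 ^ j) d \<partial>gwalk (1 / 2 ^ j) (L * 2 ^ j))" by (simp add: E_def)
      then have EL: "\<theta>' * real L < E L j" using L(2) \<theta>'(1) by (metis ennreal_less_iff mult_nonneg_nonneg of_nat_0_le_iff)
      obtain l where l: "L = Suc l" using L(1) by (cases L) auto
      have "(\<lambda>n. (\<Sum>k<n. enn2real (level_energy r L j (real (k * L)) w)) / real n) \<longlonglongrightarrow> E L j"
        unfolding l w_def using elim(1) by blast
      from eventually_energy_ge[OF less_imp_le[OF assms(1)] _ that(1) \<theta>'(2) this EL] show ?thesis
        using L(1) by (simp add: I_def)
    qed
    have upper: "eventually (\<lambda>T. \<exists>h\<in>strip T r w. energy T h \<le> ennreal (\<theta> * T)) at_top" if "\<kappa> < \<theta>" for \<theta>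
    proof -
      have xl: "x \<longlonglongrightarrow> 0" unfolding x_def by (intro LIMSEQ_Suc lim_const_over_n)
      have "(\<lambda>q. (1 + x q)\<^sup>2 * (pi\<^sup>2 / (6 * (\<rho> q)\<^sup>2))) \<longlonglongrightarrow> (1 + 0)\<^sup>2 * (pi\<^sup>2 / (6 * (r * (1 - 0))\<^sup>2))"
        unfolding \<rho>_def by (intro tendsto_intros xl) (use assms(1) in simp)
      then have "eventually (\<lambda>q. (1 + x q)\<^sup>2 * (pi\<^sup>2 / (6 * (\<rho> q)\<^sup>2)) < \<theta>) sequentially"
        by (rule order_tendstoD(2)) (use that in \<open>simp add: \<kappa>_def\<close>)
      then obtain q where q: "(1 + x q)\<^sup>2 * (pi\<^sup>2 / (6 * (\<rho> q)\<^sup>2)) < \<theta>" by (auto simp: eventually_sequentially)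
      define a where "a = (1 + x q)\<^sup>2 * (pi\<^sup>2 / (6 * (\<rho> q)\<^sup>2))"
      define d where "d = (2 + x q) * ((1 + 1 / x q) * (\<rho> q)\<^sup>2)"
      \<comment> \<open>The costs \<open>8 * a + d\<close> of pinning do not depend on \<open>L\<close>.\<close>
      obtain L :: nat where "(8 * a + d) / (\<theta> - a) < real L" using reals_Archimedean2 by blast
      then have "(8 * a + d) / (\<theta> - a) < real (Suc L)" by simp
      then have L: "8 * a + d < real (Suc L) * (\<theta> - a)" using q by (simp only: a_def[symmetric] pos_divide_less_eq diff_gt_0_iff_gt)
      show ?thesis
      proof (rule eventually_energy_le[OF _ _ \<rho>(1)[of q] \<rho>(2) x(1)[of q]])
        show "continuous_on {0..} w" "w 0 = 0" using elim(4,5) by (auto simp: w_def)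
        show "1 \<le> Suc L" by simp
        show "cheap_blocks (\<rho> q) (x q) (Suc L) w" "cheap_blocks (\<rho> q / 2) (x q) (Suc L) w"
          using elim(2,3) unfolding w_def by blast+
        have "(1 + x q)\<^sup>2 * ((real (Suc L) + 8) * (pi\<^sup>2 / (6 * (\<rho> q)\<^sup>2))) = (real (Suc L) + 8) * a"
          unfolding a_def by simp
        moreover have "(real (Suc L) + 8) * a + d < \<theta> * real (Suc L)" using L by (simp add: algebra_simps)
        ultimately show "(1 + x q)\<^sup>2 * ((real (Suc L) + 8) * (pi\<^sup>2 / (6 * (\<rho> q)\<^sup>2)))
            + (2 + x q) * ((1 + 1 / x q) * (\<rho> q)\<^sup>2) < \<theta> * real (Suc L)"
          unfolding d_def by simp
      qed
    qed
    have div: "ennreal (\<theta> * T) / ennreal T = ennreal \<theta>" if "0 < T" "0 \<le> \<theta>" for \<theta> T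
      using that by (subst divide_ennreal) auto
    have inf: "((\<lambda>T. I T / ennreal T) \<longlongrightarrow> ennreal \<kappa>) at_top"
    proof (rule order_tendstoI)
      fix a assume a: "a < ennreal \<kappa>"
      define \<alpha> where "\<alpha> = enn2real a"
      have "a < \<infinity>" using a by (rule less_trans) simp
      then have \<alpha>: "a = ennreal \<alpha>" "0 \<le> \<alpha>" by (simp_all add: \<alpha>_def)
      then have ak: "\<alpha> < \<kappa>" using a by (simp add: ennreal_less_iff)
      define \<theta> where "\<theta> = (\<alpha> + \<kappa>) / 2"
      have \<theta>: "0 \<le> \<theta>" "\<alpha> < \<theta>" "\<theta> < \<kappa>" using ak \<alpha>(2) by (auto simp: \<theta>_def)
      show "eventually (\<lambda>T. a < I T / ennreal T) at_top"
        using lower[OF \<theta>(1,3)] eventually_gt_at_top[of 0]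
      proof eventually_elim
        case (elim T)
        have "a < ennreal \<theta>" unfolding \<alpha>(1) using \<alpha>(2) \<theta> by (simp add: ennreal_less_iff)
        also have "ennreal \<theta> = ennreal (\<theta> * T) / ennreal T" using div[OF elim(2) \<theta>(1)] by simp
        also have "\<dots> \<le> I T / ennreal T" using elim(1) by (rule divide_right_mono_ennreal)
        finally show ?case .
      qed
    next
      fix a assume a: "ennreal \<kappa> < a"
      obtain b where b: "ennreal \<kappa> < b" "b < a" using dense[OF a] by blast
      define \<theta> where "\<theta> = enn2real b"
      have "b < \<infinity>" using b(2) by (rule less_le_trans) simp
      then have \<theta>: "b = ennreal \<theta>" "0 \<le> \<theta>" by (simp_all add: \<theta>_def)
      then have k\<theta>: "\<kappa> < \<theta>" using b(1) \<kappa> by (simp add: ennreal_less_iff)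
      show "eventually (\<lambda>T. I T / ennreal T < a) at_top"
        using upper[OF k\<theta>] eventually_gt_at_top[of 0]
      proof eventually_elim
        case (elim T)
        have "I T \<le> ennreal (\<theta> * T)" unfolding I_def using elim(1) by (auto intro: INF_lower2)
        then have "I T / ennreal T \<le> ennreal (\<theta> * T) / ennreal T" by (rule divide_right_mono_ennreal)
        also have "\<dots> = b" using div[OF elim(2) \<theta>(2)] \<theta>(1) by simp
        finally show ?case using b(2) by (rule le_less_trans)
      qed
    qed
    have "eventually (\<lambda>T. I T / ennreal T = energy T (taut_string T r w) / ennreal T) at_top"
      using upper[of "\<kappa> + 1", OF less_add_one] eventually_gt_at_top[of 0]
    proof eventually_elim
      case (elim T)
      then obtain h where h: "h \<in> strip T r w" "energy T h \<le> ennreal ((\<kappa> + 1) * T)" by auto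
      then have "energy T h < \<infinity>" by (auto intro: le_less_trans)
      from energy_taut_string[OF elim(2) h(1) this] show ?case by (simp only: I_def)
    qed
    from Lim_transform_eventually[OF inf this] inf show ?case by (simp add: I_def w_def \<kappa>_def)
  qed
qed

end
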